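(* Let $\varepsilon>0$, let $\alpha_o>0$ and $\beta=\alpha_o$ be constants, and let $f_0\in H^{1.5}(\mathbb{R})$. Consider the initial value problem on $\mathbb{R}$ for the unknown $f=f(x_1,t)$ \begin{align*} 2f_t+\alpha_o\Lambda f_t={}&\frac{1}{\varepsilon}\Big\{f_{x_1}+\mathcal{H}f+(\alpha_o-\beta)\mathcal{H}f_{x_1x_1}\Big\}\\ &+\mathcal{H}\big((\Lambda f)^2\big)-[\![\mathcal{H},f]\!]\Lambda f+(\alpha_o-\beta)[\![\mathcal{H},f]\!]\Lambda^3 f, \end{align*} with initial data $f(x_1,0)=f_0(x_1)$ (the terms with factor $\alpha_o-\beta$ vanish since $\beta=\alpha_o$). Then there exist $T^*>0$ and at least one distributional solution $$f\in L^\infty(0,T^*;H^{1.5}(\mathbb{R}))$$ of this problem on $[0,T^* )$.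
   Context: Subscripts $t$ and $x_1$ denote partial derivatives in time and in the space variable $x_1\in\mathbb{R}$. The unknown is real-valued. The Fourier transform is $\hat f(k)=\frac{1}{\sqrt{2\pi}}\int_{\mathbb{R}}f(x_1)e^{-ikx_1}\,dx_1$. The Hilbert transform $\mathcal{H}$ and the operator $\Lambda$ (and its powers $\Lambda^s$) are the Fourier multipliers $\widehat{\mathcal{H}f}(k)=-i\,\mathrm{sgn}(k)\hat f(k)$, $\widehat{\Lambda f}(k)=|k|\hat f(k)$, $\widehat{\Lambda^s f}(k)=|k|^s\hat f(k)$. For an operator $\mathcal{T}$ and functions $f,g$, the commutator is $[\![\mathcal{T},f]\!]g=\mathcal{T}(fg)-f\,\mathcal{T}(g)$. The Sobolev spaces are $$H^s(\mathbb{R})=\Big\{h\in L^2(\mathbb{R}):\ \|h\|_{H^s}^2=\int_{\mathbb{R}}(1+|n|^{2s})|\hat h(n)|^2\,dn<\infty\Big\}.$$ The constants are the steepness parameter $\varepsilon$, the odd Reynolds number $\alpha_o$ and the Bond number $\beta$. Distributional solution (case $\beta=\alpha_o$): $f$ is a distributional solution on $[0,T)$ with initial data $f_0$ if and only if \begin{align*} &-\int_{\mathbb{R}}\big((2+\alpha_o\Lambda)\varphi\big)(x_1,0)\,f_0(x_1)\,dx_1-\int_0^T\!\!\int_{\mathbb{R}}\big((2+\alpha_o\Lambda)\varphi_t\big)(x_1,s)\,f(x_1,s)\,dx_1ds\\ &\quad=-\frac{1}{\varepsilon}\int_0^T\!\!\int_{\mathbb{R}}\Big(f(x_1,s)\varphi_{x_1}(x_1,s)+\mathcal{H}\varphi(x_1,s)\,f(x_1,s)\Big)dx_1ds\\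 &\qquad+\int_0^T\!\!\int_{\mathbb{R}}\Big\{\mathcal{H}\big((\Lambda f)^2\big)-[\![\mathcal{H},f]\!]\Lambda f\Big\}\varphi(x_1,s)\,dx_1ds \end{align*} for all $\varphi\in C_c^\infty([0,T)\times\mathbb{R})$; in the theorem $T=T^*$. The operators $\mathcal{H}$ and $\Lambda$ act in the variable $x_1$. *)

theory Defs
  imports "HOL-Analysis.Analysis"
begin

text \<open>
  Elements of function spaces are represented by functions; nothing below depends on the
  representative modulo Lebesgue-null sets.
\<close>

definition L2 :: "(real \<Rightarrow> 'a::{banach, second_countable_topology}) set" where
  "L2 = {h. h \<in> borel_measurable lebesgue \<and> integrable lebesgue (\<lambda>x. (norm (h x))\<^sup>2)}"

text \<open>
  The Fourier integral need not converge absolutely for a square integrable function.  The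
  transform on \<open>L2\<close> is the usual (Plancherel) extension, the \<open>L2\<close>-limit of the integrals over
  \<open>[-R, R]\<close>.  The distance is measured by a nonnegative integral, which is infinite (and not 0)
  if the difference is not square integrable.
\<close>

definition truncated_fourier :: "real \<Rightarrow> (real \<Rightarrow> real) \<Rightarrow> real \<Rightarrow> complex" where
  "truncated_fourier R h k =
     complex_of_real (1 / sqrt (2 * pi)) *
     (LINT x:{-R..R}|lebesgue. complex_of_real (h x) * exp (- (\<i> * complex_of_real (k * x))))"

definition is_fourier :: "(real \<Rightarrow> real) \<Rightarrow> (real \<Rightarrow> complex) \<Rightarrow> bool" where
  "is_fourier h F \<longleftrightarrow> F \<in> L2 \<and>
     ((\<lambda>R. \<integral>\<^sup>+k. ennreal ((cmod (F k - truncated_fourier R h k))\<^sup>2) \<partial>lebesgue) \<longlongrightarrow> 0) at_top"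

definition fourier :: "(real \<Rightarrow> real) \<Rightarrow> real \<Rightarrow> complex" where
  "fourier h = (SOME F. is_fourier h F)"

text \<open>
  The value is meaningful when \<open>h\<close> and \<open>\<lambda>k. m k * fourier h k\<close> are square integrable and
  \<open>m (- k) = cnj (m k)\<close>, so that the result is again real-valued.
\<close>

definition fourier_multiplier :: "(real \<Rightarrow> complex) \<Rightarrow> (real \<Rightarrow> real) \<Rightarrow> real \<Rightarrow> real" where
  "fourier_multiplier m h =
     (SOME g. g \<in> L2 \<and> (AE k in lebesgue. fourier g k = m k * fourier h k))"

definition Hilbert :: "(real \<Rightarrow> real) \<Rightarrow> real \<Rightarrow> real" where
  "Hilbert = fourier_multiplier (\<lambda>k. - \<i> * complex_of_real (sgn k))"

definition Lambda :: "(real \<Rightarrow> real) \<Rightarrow> real \<Rightarrow> real" where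
  "Lambda = fourier_multiplier (\<lambda>k. complex_of_real \<bar>k\<bar>)"

definition commutator ::
  "((real \<Rightarrow> real) \<Rightarrow> real \<Rightarrow> real) \<Rightarrow> (real \<Rightarrow> real) \<Rightarrow> (real \<Rightarrow> real) \<Rightarrow> real \<Rightarrow> real" where
  "commutator A f g = (\<lambda>x. A (\<lambda>y. f y * g y) x - f x * A g x)"

definition sobolev :: "real \<Rightarrow> (real \<Rightarrow> real) set" where
  "sobolev s = {h. h \<in> L2 \<and>
     integrable lebesgue (\<lambda>n. (1 + \<bar>n\<bar> powr (2 * s)) * (cmod (fourier h n))\<^sup>2)}"

definition sobolev_norm :: "real \<Rightarrow> (real \<Rightarrow> real) \<Rightarrow> real" where
  "sobolev_norm s h =
     sqrt (LINT n|lebesgue. (1 + \<bar>n\<bar> powr (2 * s)) * (cmod (fourier h n))\<^sup>2)"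

text \<open>
  The Bochner space \<open>L\<^sup>\<infinity>(0,T; H\<^sup>s)\<close>: almost everywhere limits of \<open>H\<^sup>s\<close>-valued simple functions
  (strong measurability) with essentially bounded norm.
\<close>

definition strongly_measurable_sobolev :: "real \<Rightarrow> real \<Rightarrow> (real \<Rightarrow> real \<Rightarrow> real) \<Rightarrow> bool" where
  "strongly_measurable_sobolev T s u \<longleftrightarrow>
     (\<exists>S :: nat \<Rightarrow> real \<Rightarrow> real \<Rightarrow> real.
        (\<forall>n. simple_function (lebesgue_on {0<..<T}) (S n)) \<and>
        (\<forall>n. \<forall>t\<in>{0<..<T}. S n t \<in> sobolev s) \<and>
        (AE t in lebesgue_on {0<..<T}.
           (\<lambda>n. sobolev_norm s (\<lambda>x. S n t x - u t x)) \<longlonglongrightarrow> 0))"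

definition Linfty_sobolev :: "real \<Rightarrow> real \<Rightarrow> (real \<Rightarrow> real \<Rightarrow> real) set" where
  "Linfty_sobolev T s =
     {u. (AE t in lebesgue_on {0<..<T}. u t \<in> sobolev s) \<and>
         strongly_measurable_sobolev T s u \<and>
         (\<exists>C. AE t in lebesgue_on {0<..<T}. sobolev_norm s (u t) \<le> C)}"

definition partial_x :: "(real \<Rightarrow> real \<Rightarrow> real) \<Rightarrow> real \<Rightarrow> real \<Rightarrow> real" where
  "partial_x u = (\<lambda>x t. deriv (\<lambda>y. u y t) x)"

definition partial_t :: "(real \<Rightarrow> real \<Rightarrow> real) \<Rightarrow> real \<Rightarrow> real \<Rightarrow> real" where
  "partial_t u = (\<lambda>x t. deriv (\<lambda>r. u x r) t)"

primrec Ck :: "nat \<Rightarrow> (real \<Rightarrow> real \<Rightarrow> real) \<Rightarrow> bool" where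
  "Ck 0 u \<longleftrightarrow> continuous_on UNIV (\<lambda>(x, t). u x t)"
| "Ck (Suc n) u \<longleftrightarrow>
     (\<forall>x t. (\<lambda>y. u y t) field_differentiable at x) \<and>
     (\<forall>x t. (\<lambda>r. u x r) field_differentiable at t) \<and>
     Ck n (partial_x u) \<and> Ck n (partial_t u)"

text \<open>
  Test functions on \<open>[0,T) \<times> \<real>\<close>, smooth up to \<open>t = 0\<close> and not required to vanish there, are the
  restrictions of smooth functions on the plane with compact support in \<open>{t < T}\<close>.
\<close>

definition test_function :: "real \<Rightarrow> (real \<Rightarrow> real \<Rightarrow> real) \<Rightarrow> bool" where
  "test_function T \<phi> \<longleftrightarrow> (\<forall>n. Ck n \<phi>) \<and>
     compact (closure {(x, t). \<phi> x t \<noteq> 0}) \<and>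
     closure {(x, t). \<phi> x t \<noteq> 0} \<subseteq> UNIV \<times> {..<T}"

text \<open>
  The weak formulation for Bond number equal to the odd Reynolds number \<open>\<alpha>\<close>.  All integrands are
  integrable if \<open>(\<lambda>t x. f x t) \<in> Linfty_sobolev T (3/2)\<close> and \<open>f0 \<in> L2\<close>.
\<close>

definition distributional_solution ::
  "real \<Rightarrow> real \<Rightarrow> real \<Rightarrow> (real \<Rightarrow> real) \<Rightarrow> (real \<Rightarrow> real \<Rightarrow> real) \<Rightarrow> bool" where
  "distributional_solution \<epsilon> \<alpha> T f0 f \<longleftrightarrow>
     (\<forall>\<phi>. test_function T \<phi> \<longrightarrow>
        - (LINT x|lebesgue. (2 * \<phi> x 0 + \<alpha> * Lambda (\<lambda>y. \<phi> y 0) x) * f0 x)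
        - (LINT s:{0<..<T}|lebesgue. LINT x|lebesgue.
             (2 * partial_t \<phi> x s + \<alpha> * Lambda (\<lambda>y. partial_t \<phi> y s) x) * f x s)
        = - (1 / \<epsilon>) * (LINT s:{0<..<T}|lebesgue. LINT x|lebesgue.
             f x s * partial_x \<phi> x s + Hilbert (\<lambda>y. \<phi> y s) x * f x s)
          + (LINT s:{0<..<T}|lebesgue. LINT x|lebesgue.
             (Hilbert (\<lambda>y. (Lambda (\<lambda>z. f z s) y)\<^sup>2) x
              - commutator Hilbert (\<lambda>y. f y s) (Lambda (\<lambda>y. f y s)) x) * \<phi> x s))"

end

theory Submission
  imports Defs "HOL-Probability.Probability"
begin

text \<open>
  Since \<open>f\<close> is real, it is determined by the profile \<open>A\<close> with \<open>fourier f = \<i> * A\<close> on the positive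
  frequencies, and there the equation becomes
  \<open>(2 + \<alpha> k) A\<^sub>t = (\<i>/\<epsilon>) (k - 1) A + c (B * B - 2 B \<star> B + 2 A \<star> B)\<close> with \<open>B = k A\<close>, where
  \<open>*\<close> is convolution and \<open>\<star>\<close> is correlation.  Tested with the weight \<open>1 + k\<^sup>2\<close>, the most singular
  cubic terms cancel by symmetry, which leaves a bound by the cube of the \<open>H\<^sup>3\<^sup>/\<^sup>2\<close>-norm; so
  the approximations (explicit Euler steps for the system truncated to \<open>k \<le> 2\<^sup>j\<close>) stay bounded in
  \<open>H\<^sup>3\<^sup>/\<^sup>2\<close> on a common time interval.  For the difference of two approximations
  the same symmetry leaves a factor given by the \<open>L\<^sup>1\<close>-norm of the difference, which is
  \<open>O(\<surd>j)\<close> times its \<open>H\<^sup>1\<^sup>/\<^sup>2\<close>-norm since the frequencies are truncated; on a short time interval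
  the Gronwall factor, at most a small exponential in \<open>j\<close>, is beaten by the consistency error
  \<open>O(2\<^sup>-\<^sup>j)\<close>.  Hence the approximations converge geometrically in \<open>H\<^sup>1\<^sup>/\<^sup>2\<close>, uniformly in time,
  which suffices for the weak formulation.
\<close>

section \<open>Square integrable functions\<close>

text \<open>The obstacle is a critical exponent: a function in H^(1/2) need not have an integrable
  transform, so the unweighted factor in the difference estimate is not controlled by the H^(1/2)
  norm, which prevents a direct contraction argument. Truncation at \<open>2 ^ j\<close> turns this
  failure into a Gronwall exponent at most linear in \<open>j\<close>. Its coefficient is
  proportional to \<open>T\<close>, so one choice of a small \<open>T\<close> limits the growth to
  about \<open>(5/4) ^ j\<close>, less than the gain \<open>2 ^ j\<close> in the squared norm.
  Convergence in H^(1/2) and the bound in H^(3/2) give convergence in H^1 by interpolation, and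
  there the quadratic terms are Lipschitz uniformly in the frequency; this is why the weaker
  convergence suffices. Working on positive frequencies makes the cancellation an identity between
  polynomials in two frequencies: tested convolutions and correlations become one trilinear form and
  differ only in the slot of the test function. Explicit steps lose powers of the frequency cutoff
  in stability, which is harmless because the step size may depend on \<open>j\<close>.\<close>

definition sqi :: "'a measure \<Rightarrow> ('a \<Rightarrow> complex) \<Rightarrow> bool" where
  "sqi M f \<longleftrightarrow> f \<in> borel_measurable M \<and> integrable M (\<lambda>x. (cmod (f x))\<^sup>2)"

text \<open>Bochner integrals default to 0, so \<open>L2n\<close> carries information only together
  with \<open>sqi\<close>; many results below therefore come in pairs, membership and norm.\<close>

definition L2n :: "'a measure \<Rightarrow> ('a \<Rightarrow> complex) \<Rightarrow> real" where
  "L2n M f = sqrt (LINT x|M. (cmod (f x))\<^sup>2)"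

lemma sqi_measurable [measurable_dest]: "sqi M f \<Longrightarrow> f \<in> borel_measurable M"
  by (simp add: sqi_def)

lemma sqi_integrable: "sqi M f \<Longrightarrow> integrable M (\<lambda>x. (cmod (f x))\<^sup>2)"
  by (simp add: sqi_def)

lemma L2n_nonneg [simp]: "0 \<le> L2n M f"
  by (simp add: L2n_def)

lemma L2n_sq: "(L2n M f)\<^sup>2 = (LINT x|M. (cmod (f x))\<^sup>2)"
  by (simp add: L2n_def)

lemma L2n_cong: "(\<And>x. x \<in> space M \<Longrightarrow> cmod (f x) = cmod (g x)) \<Longrightarrow> L2n M f = L2n M g"
  unfolding L2n_def by (intro arg_cong[where f=sqrt] Bochner_Integration.integral_cong) auto

lemma L2n_cong_AE:
  "f \<in> borel_measurable M \<Longrightarrow> g \<in> borel_measurable M \<Longrightarrow> AE x in M. cmod (f x) = cmod (g x) \<Longrightarrow> L2n M f = L2n M g"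
  unfolding L2n_def by (intro arg_cong[where f=sqrt] integral_cong_AE) auto

lemma sqi_bound:
  assumes "sqi M g" "f \<in> borel_measurable M" "AE x in M. cmod (f x) \<le> cmod (g x)"
  shows "sqi M f"
  unfolding sqi_def
proof
  show "integrable M (\<lambda>x. (cmod (f x))\<^sup>2)"
    by (rule Bochner_Integration.integrable_bound[OF sqi_integrable[OF assms(1)]])
       (use assms in \<open>auto intro: power_mono\<close>)
qed (use assms in auto)

lemma L2n_mono:
  assumes "sqi M g" "f \<in> borel_measurable M" "AE x in M. cmod (f x) \<le> cmod (g x)"
  shows "L2n M f \<le> L2n M g"
  unfolding L2n_def
  by (intro real_sqrt_le_mono integral_mono_AE sqi_integrable sqi_bound[OF assms] assms)
     (use assms in \<open>auto intro: power_mono\<close>)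

lemma sqi_cmult: "sqi M f \<Longrightarrow> sqi M (\<lambda>x. c * f x)"
  unfolding sqi_def by (auto simp: norm_mult power_mult_distrib)

lemma L2n_cmult: "L2n M (\<lambda>x. c * f x) = cmod c * L2n M f"
  unfolding L2n_def by (simp add: norm_mult power_mult_distrib real_sqrt_mult)

lemma borel_measurable_cnj [measurable (raw)]:
  "f \<in> borel_measurable M \<Longrightarrow> (\<lambda>x. cnj (f x)) \<in> borel_measurable M"
  by (rule borel_measurable_continuous_on[OF _ , of cnj]) (auto intro: continuous_intros)

lemma sqi_cnj: "sqi M f \<Longrightarrow> sqi M (\<lambda>x. cnj (f x))"
  unfolding sqi_def by auto

lemma sqi_zero [simp]: "sqi M (\<lambda>x. 0)"
  unfolding sqi_def by auto

lemma sqi_add: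
  assumes "sqi M f" "sqi M g" shows "sqi M (\<lambda>x. f x + g x)"
  unfolding sqi_def
proof
  note [measurable] = assms[THEN sqi_measurable]
  show "(\<lambda>x. f x + g x) \<in> borel_measurable M" by measurable
  have "integrable M (\<lambda>x. 2 * (cmod (f x))\<^sup>2 + 2 * (cmod (g x))\<^sup>2)"
    using assms by (auto simp: sqi_def)
  then show "integrable M (\<lambda>x. (cmod (f x + g x))\<^sup>2)"
  proof (rule Bochner_Integration.integrable_bound)
    show "AE x in M. norm ((cmod (f x + g x))\<^sup>2) \<le> norm (2 * (cmod (f x))\<^sup>2 + 2 * (cmod (g x))\<^sup>2)"
    proof (rule AE_I2)
      fix x
      have "(cmod (f x + g x))\<^sup>2 \<le> (cmod (f x) + cmod (g x))\<^sup>2"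
        by (intro power_mono norm_triangle_ineq) auto
      also have "\<dots> \<le> 2 * (cmod (f x))\<^sup>2 + 2 * (cmod (g x))\<^sup>2"
        using sum_squares_bound[of "cmod (f x)" "cmod (g x)"] by (simp add: power2_sum)
      finally show "norm ((cmod (f x + g x))\<^sup>2) \<le> norm (2 * (cmod (f x))\<^sup>2 + 2 * (cmod (g x))\<^sup>2)"
        by simp
    qed
  qed measurable
qed

lemma sqi_uminus: "sqi M f \<Longrightarrow> sqi M (\<lambda>x. - f x)"
  using sqi_cmult[of M f "-1"] by simp

lemma sqi_diff: "sqi M f \<Longrightarrow> sqi M g \<Longrightarrow> sqi M (\<lambda>x. f x - g x)"
  using sqi_add[of M f "\<lambda>x. - g x"] sqi_uminus[of M g] by simp

lemma sqi_mult_bounded: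
  assumes "sqi M f" "m \<in> borel_measurable M" "\<And>x. cmod (m x) \<le> K"
  shows "sqi M (\<lambda>x. m x * f x)"
proof (rule sqi_bound[OF sqi_cmult[OF assms(1), of "of_real \<bar>K\<bar>"]])
  have "cmod (m x) \<le> \<bar>K\<bar>" for x
    using assms(3)[of x] by linarith
  then show "AE x in M. cmod (m x * f x) \<le> cmod (of_real \<bar>K\<bar> * f x)"
    by (auto simp: norm_mult intro!: mult_right_mono)
qed (use assms sqi_measurable in auto)

lemma nn_integral_sqi:
  assumes "sqi M f"
  shows "(\<integral>\<^sup>+x. ennreal ((cmod (f x))\<^sup>2) \<partial>M) = ennreal ((L2n M f)\<^sup>2)"
  unfolding L2n_sq by (rule nn_integral_eq_integral) (use assms in \<open>auto simp: sqi_def\<close>)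

text \<open>Fatou's lemma and Young's inequality control only the nonnegative integral of the
  square. A finite bound for it yields both integrability and the norm bound.\<close>

lemma sqi_nn_integral:
  assumes "f \<in> borel_measurable M" "(\<integral>\<^sup>+x. ennreal ((cmod (f x))\<^sup>2) \<partial>M) \<le> ennreal (C\<^sup>2)" "0 \<le> C"
  shows "sqi M f" "L2n M f \<le> C"
proof -
  show s: "sqi M f"
    unfolding sqi_def
  proof
    show "integrable M (\<lambda>x. (cmod (f x))\<^sup>2)"
      using assms(1,2) by (intro integrableI_nonneg) (auto simp: less_top[symmetric] top_unique)
  qed fact
  have "ennreal ((L2n M f)\<^sup>2) \<le> ennreal (C\<^sup>2)"
    using assms(2) nn_integral_sqi[OF s] by simp
  then show "L2n M f \<le> C"
    using assms(3) by (auto intro: power2_le_imp_le)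
qed

lemma Cauchy_Schwarz_integral:
  fixes f g :: "'a \<Rightarrow> real"
  assumes [measurable]: "f \<in> borel_measurable M" "g \<in> borel_measurable M"
    and f: "integrable M (\<lambda>x. (f x)\<^sup>2)" and g: "integrable M (\<lambda>x. (g x)\<^sup>2)"
  shows "integrable M (\<lambda>x. f x * g x)"
    and "(LINT x|M. \<bar>f x * g x\<bar>) \<le> sqrt (LINT x|M. (f x)\<^sup>2) * sqrt (LINT x|M. (g x)\<^sup>2)"
proof -
  show i: "integrable M (\<lambda>x. f x * g x)"
  proof (rule Bochner_Integration.integrable_bound[OF Bochner_Integration.integrable_add[OF f g]])
    show "AE x in M. norm (f x * g x) \<le> norm ((f x)\<^sup>2 + (g x)\<^sup>2)"
    proof (rule AE_I2)
      fix x
      have "\<bar>f x\<bar> * \<bar>g x\<bar> \<le> (f x)\<^sup>2 + (g x)\<^sup>2"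
        using sum_squares_bound[of "\<bar>f x\<bar>" "\<bar>g x\<bar>"] mult_nonneg_nonneg[of "\<bar>f x\<bar>" "\<bar>g x\<bar>"]
        unfolding power2_abs by linarith
      then show "norm (f x * g x) \<le> norm ((f x)\<^sup>2 + (g x)\<^sup>2)"
        by (simp add: abs_mult)
    qed
  qed measurable
  have "(\<integral>\<^sup>+x. ennreal \<bar>f x\<bar> * ennreal \<bar>g x\<bar> \<partial>M)\<^sup>2
      \<le> (\<integral>\<^sup>+x. ennreal \<bar>f x\<bar> ^ 2 \<partial>M) * (\<integral>\<^sup>+x. ennreal \<bar>g x\<bar> ^ 2 \<partial>M)"
    by (rule Cauchy_Schwarz_nn_integral) auto
  also have "(\<integral>\<^sup>+x. ennreal \<bar>f x\<bar> * ennreal \<bar>g x\<bar> \<partial>M) = ennreal (LINT x|M. \<bar>f x * g x\<bar>)"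
    unfolding ennreal_mult[symmetric, OF abs_ge_zero abs_ge_zero] abs_mult[symmetric]
    by (rule nn_integral_eq_integral) (use i in auto)
  also have "(\<integral>\<^sup>+x. ennreal \<bar>f x\<bar> ^ 2 \<partial>M) = ennreal (LINT x|M. (f x)\<^sup>2)"
    by (subst nn_integral_eq_integral[symmetric, OF f]) (auto simp: ennreal_power)
  also have "(\<integral>\<^sup>+x. ennreal \<bar>g x\<bar> ^ 2 \<partial>M) = ennreal (LINT x|M. (g x)\<^sup>2)"
    by (subst nn_integral_eq_integral[symmetric, OF g]) (auto simp: ennreal_power)
  finally have "ennreal ((LINT x|M. \<bar>f x * g x\<bar>)\<^sup>2) \<le> ennreal ((LINT x|M. (f x)\<^sup>2) * (LINT x|M. (g x)\<^sup>2))"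
    by (simp add: ennreal_power ennreal_mult)
  then have "(LINT x|M. \<bar>f x * g x\<bar>)\<^sup>2 \<le> (LINT x|M. (f x)\<^sup>2) * (LINT x|M. (g x)\<^sup>2)"
    by (subst (asm) ennreal_le_iff) (auto intro!: mult_nonneg_nonneg)
  then show "(LINT x|M. \<bar>f x * g x\<bar>) \<le> sqrt (LINT x|M. (f x)\<^sup>2) * sqrt (LINT x|M. (g x)\<^sup>2)"
    unfolding real_sqrt_mult[symmetric] by (rule real_le_rsqrt)
qed

lemma sqi_mult_integrable:
  assumes "sqi M f" "sqi M g"
  shows "integrable M (\<lambda>x. f x * g x)"
    and "(LINT x|M. cmod (f x) * cmod (g x)) \<le> L2n M f * L2n M g"
    and "cmod (LINT x|M. f x * g x) \<le> L2n M f * L2n M g"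
proof -
  note [measurable] = assms[THEN sqi_measurable]
  have *: "integrable M (\<lambda>x. cmod (f x) * cmod (g x))"
    using Cauchy_Schwarz_integral(1)[of "\<lambda>x. cmod (f x)" M "\<lambda>x. cmod (g x)"] assms
    by (auto simp: sqi_def)
  show i: "integrable M (\<lambda>x. f x * g x)"
    by (rule Bochner_Integration.integrable_bound[OF *]) (auto simp: norm_mult)
  show b: "(LINT x|M. cmod (f x) * cmod (g x)) \<le> L2n M f * L2n M g"
    using Cauchy_Schwarz_integral(2)[of "\<lambda>x. cmod (f x)" M "\<lambda>x. cmod (g x)"] assms
    by (auto simp: sqi_def L2n_def)
  have "cmod (LINT x|M. f x * g x) \<le> (LINT x|M. cmod (f x) * cmod (g x))"
    using integral_norm_bound[of M "\<lambda>x. f x * g x"] by (simp add: norm_mult)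
  with b show "cmod (LINT x|M. f x * g x) \<le> L2n M f * L2n M g" by simp
qed

lemma L2n_triangle:
  assumes "sqi M f" "sqi M g"
  shows "L2n M (\<lambda>x. f x + g x) \<le> L2n M f + L2n M g"
proof -
  note [measurable] = assms[THEN sqi_measurable]
  have fg: "integrable M (\<lambda>x. cmod (f x) * cmod (g x))"
    using integrable_norm[OF sqi_mult_integrable(1)[OF assms]] by (simp add: norm_mult)
  have "(L2n M (\<lambda>x. f x + g x))\<^sup>2 \<le> (LINT x|M. (cmod (f x))\<^sup>2 + (cmod (g x))\<^sup>2 + 2 * (cmod (f x) * cmod (g x)))"
    unfolding L2n_sq
  proof (rule integral_mono)
    show "(cmod (f x + g x))\<^sup>2 \<le> (cmod (f x))\<^sup>2 + (cmod (g x))\<^sup>2 + 2 * (cmod (f x) * cmod (g x))" for x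
      using power_mono[OF norm_triangle_ineq[of "f x" "g x"] norm_ge_zero, of 2]
      by (simp add: power2_sum)
  qed (use assms fg sqi_add[OF assms] in \<open>auto simp: sqi_def\<close>)
  also have "\<dots> = (L2n M f)\<^sup>2 + (L2n M g)\<^sup>2 + 2 * (LINT x|M. cmod (f x) * cmod (g x))"
    unfolding L2n_sq using assms fg by (simp add: sqi_def)
  also have "\<dots> \<le> (L2n M f + L2n M g)\<^sup>2"
    using sqi_mult_integrable(2)[OF assms] by (simp add: power2_sum)
  finally show ?thesis by (rule power2_le_imp_le) simp
qed

lemma L2n_uminus: "L2n M (\<lambda>x. - f x) = L2n M f"
  by (simp add: L2n_def)

lemma L2n_minus_commute: "L2n M (\<lambda>x. f x - g x) = L2n M (\<lambda>x. g x - f x)"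
  by (simp add: L2n_def norm_minus_commute)

lemma L2n_triangle_diff:
  assumes "sqi M f" "sqi M g"
  shows "L2n M (\<lambda>x. f x - g x) \<le> L2n M f + L2n M g"
  using L2n_triangle[OF assms(1) sqi_uminus[OF assms(2)]] by (simp add: L2n_uminus)

lemma L2n_triangle3:
  assumes "sqi M f" "sqi M g" "sqi M h"
  shows "L2n M (\<lambda>x. f x - h x) \<le> L2n M (\<lambda>x. f x - g x) + L2n M (\<lambda>x. g x - h x)"
  using L2n_triangle[OF sqi_diff[OF assms(1,2)] sqi_diff[OF assms(2,3)]] by simp

lemma L2n_abs_diff:
  assumes "sqi M f" "sqi M g"
  shows "\<bar>L2n M f - L2n M g\<bar> \<le> L2n M (\<lambda>x. f x - g x)"
  using L2n_triangle[OF sqi_diff[OF assms] assms(2)]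
    L2n_triangle[OF sqi_diff[OF assms(2,1)] assms(1)] L2n_minus_commute[of M f g]
  by simp

lemma L2n_tendsto:
  assumes "\<And>n. sqi M (f n)" "sqi M g" "((\<lambda>n. L2n M (\<lambda>x. f n x - g x)) \<longlongrightarrow> 0) F"
  shows "((\<lambda>n. L2n M (f n)) \<longlongrightarrow> L2n M g) F"
  unfolding tendsto_iff dist_real_def
proof (intro allI impI)
  fix e :: real assume "0 < e"
  then have "eventually (\<lambda>n. dist (L2n M (\<lambda>x. f n x - g x)) 0 < e) F"
    using assms(3) by (auto simp: tendsto_iff)
  then show "eventually (\<lambda>n. \<bar>L2n M (f n) - L2n M g\<bar> < e) F"
  proof (rule eventually_mono)
    fix n assume "dist (L2n M (\<lambda>x. f n x - g x)) 0 < e"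
    then show "\<bar>L2n M (f n) - L2n M g\<bar> < e"
      using L2n_abs_diff[OF assms(1)[of n] assms(2)] by simp
  qed
qed

lemma L2n_eq_0:
  assumes "sqi M f" "L2n M f = 0"
  shows "AE x in M. f x = 0"
proof -
  have "(LINT x|M. (cmod (f x))\<^sup>2) = 0"
    using assms(2) by (simp add: L2n_def)
  then have "AE x in M. (cmod (f x))\<^sup>2 = 0"
    using assms(1) by (subst (asm) integral_nonneg_eq_0_iff_AE) (auto simp: sqi_def)
  then show ?thesis by auto
qed

lemma L2n_unique:
  assumes "\<And>n. sqi M (f n)" "sqi M g" "sqi M h" "F \<noteq> bot"
    "((\<lambda>n. L2n M (\<lambda>x. f n x - g x)) \<longlongrightarrow> 0) F" "((\<lambda>n. L2n M (\<lambda>x. f n x - h x)) \<longlongrightarrow> 0) F"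
  shows "AE x in M. g x = h x"
proof -
  have "((\<lambda>n. L2n M (\<lambda>x. f n x - g x) + L2n M (\<lambda>x. f n x - h x)) \<longlongrightarrow> 0) F"
    using tendsto_add[OF assms(5,6)] by simp
  moreover have "L2n M (\<lambda>x. g x - h x) \<le> L2n M (\<lambda>x. f n x - g x) + L2n M (\<lambda>x. f n x - h x)" for n
    using L2n_triangle3[OF assms(2) assms(1) assms(3), of n] L2n_minus_commute[of M g "f n"] by simp
  ultimately have "L2n M (\<lambda>x. g x - h x) \<le> 0"
    using tendsto_lowerbound[OF _ _ assms(4)] by (metis (mono_tags, lifting) always_eventually)
  then have "L2n M (\<lambda>x. g x - h x) = 0" by (simp add: order_antisym)
  from L2n_eq_0[OF sqi_diff[OF assms(2,3)] this] show ?thesis by auto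
qed

text \<open>Bilinearity: the integrand differs from its limit by
  \<open>(f n x - f' x) * g n x + f' x * (g n x - g' x)\<close>, and the norms of \<open>g n\<close>
  converge.\<close>

lemma inner_tendsto:
  assumes "\<And>n. sqi M (f n)" "sqi M f'" "\<And>n. sqi M (g n)" "sqi M g'"
    "((\<lambda>n. L2n M (\<lambda>x. f n x - f' x)) \<longlongrightarrow> 0) F" "((\<lambda>n. L2n M (\<lambda>x. g n x - g' x)) \<longlongrightarrow> 0) F"
  shows "((\<lambda>n. LINT x|M. f n x * g n x) \<longlongrightarrow> (LINT x|M. f' x * g' x)) F"
proof -
  have b: "cmod ((LINT x|M. f n x * g n x) - (LINT x|M. f' x * g' x))
      \<le> L2n M (\<lambda>x. f n x - f' x) * L2n M (g n) + L2n M f' * L2n M (\<lambda>x. g n x - g' x)" for n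
  proof -
    have "(LINT x|M. f n x * g n x) - (LINT x|M. f' x * g' x)
        = (LINT x|M. (f n x - f' x) * g n x) + (LINT x|M. f' x * (g n x - g' x))"
      unfolding left_diff_distrib right_diff_distrib
        Bochner_Integration.integral_diff[OF sqi_mult_integrable(1)[OF assms(1,3)] sqi_mult_integrable(1)[OF assms(2,3)]]
        Bochner_Integration.integral_diff[OF sqi_mult_integrable(1)[OF assms(2,3)] sqi_mult_integrable(1)[OF assms(2,4)]]
      by simp
    also have "cmod \<dots> \<le> cmod (LINT x|M. (f n x - f' x) * g n x) + cmod (LINT x|M. f' x * (g n x - g' x))"
      by (rule norm_triangle_ineq)
    also have "\<dots> \<le> L2n M (\<lambda>x. f n x - f' x) * L2n M (g n) + L2n M f' * L2n M (\<lambda>x. g n x - g' x)"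
      by (rule add_mono[OF sqi_mult_integrable(3)[OF sqi_diff[OF assms(1,2)] assms(3)]
            sqi_mult_integrable(3)[OF assms(2) sqi_diff[OF assms(3,4)]]])
    finally show ?thesis .
  qed
  have "((\<lambda>n. L2n M (\<lambda>x. f n x - f' x) * L2n M (g n) + L2n M f' * L2n M (\<lambda>x. g n x - g' x)) \<longlongrightarrow>
      0 * L2n M g' + L2n M f' * 0) F"
    by (rule tendsto_add[OF tendsto_mult[OF assms(5) L2n_tendsto[OF assms(3,4,6)]]
          tendsto_mult[OF tendsto_const assms(6)]])
  then have "((\<lambda>n. L2n M (\<lambda>x. f n x - f' x) * L2n M (g n) + L2n M f' * L2n M (\<lambda>x. g n x - g' x)) \<longlongrightarrow> 0) F"
    by simp
  then have "((\<lambda>n. (LINT x|M. f n x * g n x) - (LINT x|M. f' x * g' x)) \<longlongrightarrow> 0) F"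
    by (rule Lim_null_comparison[OF always_eventually[OF allI[OF b]]])
  then show ?thesis by (rule LIM_zero_cancel)
qed

section \<open>Lower semicontinuity and completeness of L2\<close>

lemma L2_Fatou:
  assumes "\<And>n. sqi M (f n)" "g \<in> borel_measurable M" "AE x in M. (\<lambda>n. f n x) \<longlonglongrightarrow> g x"
    "0 \<le> C" "eventually (\<lambda>n. L2n M (f n) \<le> C) sequentially"
  shows "sqi M g" "L2n M g \<le> C"
proof -
  note [measurable] = assms(2) assms(1)[THEN sqi_measurable]
  have "(\<integral>\<^sup>+x. ennreal ((cmod (g x))\<^sup>2) \<partial>M) = (\<integral>\<^sup>+x. liminf (\<lambda>n. ennreal ((cmod (f n x))\<^sup>2)) \<partial>M)"
  proof (rule nn_integral_cong_AE)
    show "AE x in M. ennreal ((cmod (g x))\<^sup>2) = liminf (\<lambda>n. ennreal ((cmod (f n x))\<^sup>2))"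
      using assms(3)
    proof eventually_elim
      case (elim x)
      then have "(\<lambda>n. ennreal ((cmod (f n x))\<^sup>2)) \<longlonglongrightarrow> ennreal ((cmod (g x))\<^sup>2)"
        by (intro tendsto_intros)
      then show ?case by (rule lim_imp_Liminf[OF sequentially_bot, symmetric])
    qed
  qed
  also have "\<dots> \<le> liminf (\<lambda>n. \<integral>\<^sup>+x. ennreal ((cmod (f n x))\<^sup>2) \<partial>M)"
    by (rule nn_integral_liminf) measurable
  also have "\<dots> \<le> ennreal (C\<^sup>2)"
  proof (rule order_trans[OF Liminf_le_Limsup])
    show "limsup (\<lambda>n. \<integral>\<^sup>+x. ennreal ((cmod (f n x))\<^sup>2) \<partial>M) \<le> ennreal (C\<^sup>2)"
    proof (rule Limsup_bounded)
      show "\<forall>\<^sub>F n in sequentially. (\<integral>\<^sup>+x. ennreal ((cmod (f n x))\<^sup>2) \<partial>M) \<le> ennreal (C\<^sup>2)"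
        using assms(5)
        by eventually_elim (auto simp: nn_integral_sqi[OF assms(1)] intro!: ennreal_leI power_mono)
    qed
  qed simp
  finally have *: "(\<integral>\<^sup>+x. ennreal ((cmod (g x))\<^sup>2) \<partial>M) \<le> ennreal (C\<^sup>2)" .
  show "sqi M g" "L2n M g \<le> C"
    using sqi_nn_integral[OF assms(2) * assms(4)] by auto
qed

lemma L2n_sum_triangle:
  assumes "\<And>n. sqi M (u n)"
  shows "sqi M (\<lambda>x. \<Sum>i<n. u i x)" "L2n M (\<lambda>x. \<Sum>i<(n::nat). u i x) \<le> (\<Sum>i<n. L2n M (u i))"
proof (induction n)
  case 0
  { case 1 then show ?case by simp }
  { case 2 then show ?case by (simp add: L2n_def) }
next
  case (Suc n)
  { case 1 then show ?case using sqi_add[OF Suc(1) assms[of n]] by simp }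
  { case 2 then show ?case using L2n_triangle[OF Suc(1) assms[of n]] Suc(2) by simp }
qed

text \<open>The moduli of the increments have summable norms, so their partial sums are bounded in
  L2 and finite almost everywhere. Taking the pointwise \<open>lim\<close> as the limit, rather than
  an abstract L2 limit, keeps it measurable when the sequence depends on a further
  parameter.\<close>

lemma L2_fast_Cauchy:
  assumes u: "\<And>n. sqi M (u n)" and b: "\<And>n. L2n M (\<lambda>x. u (Suc n) x - u n x) \<le> C * q ^ n"
    and q: "0 < q" "q < 1"
  shows "AE x in M. (\<lambda>n. u n x) \<longlonglongrightarrow> lim (\<lambda>n. u n x)"
    and "sqi M (\<lambda>x. lim (\<lambda>n. u n x))"
    and "L2n M (\<lambda>x. u n x - lim (\<lambda>n. u n x)) \<le> C / (1 - q) * q ^ n"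
proof -
  note [measurable] = u[THEN sqi_measurable]
  have C: "0 \<le> C" using order_trans[OF L2n_nonneg b[of 0]] by simp
  define D where "D n x = complex_of_real (cmod (u (Suc n) x - u n x))" for n x
  have D: "sqi M (D n)" for n
    by (rule sqi_bound[OF sqi_diff[OF u[of "Suc n"] u[of n]]]) (auto simp: D_def[abs_def])
  note [measurable] = D[THEN sqi_measurable]
  have Dn: "L2n M (D n) \<le> C * q ^ n" for n
    using b[of n] by (simp add: D_def L2n_def)
  have geo: "(\<Sum>i<n. C * q ^ i) \<le> C / (1 - q)" for n
  proof -
    have "(\<Sum>i<n. C * q ^ i) \<le> (\<Sum>i. C * q ^ i)"
      by (rule sum_le_suminf) (use q C in \<open>auto intro!: summable_mult summable_geometric\<close>)
    also have "\<dots> = C / (1 - q)"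
      using q by (simp add: suminf_mult suminf_geometric summable_geometric)
    finally show ?thesis .
  qed
  define S where "S n x = (\<Sum>i<n. D i x)" for n x
  have S: "sqi M (S n)" "L2n M (S n) \<le> C / (1 - q)" for n
    using L2n_sum_triangle[of M D n, OF D] sum_mono[of "{..<n}" "\<lambda>i. L2n M (D i)" "\<lambda>i. C * q ^ i"] Dn geo[of n]
    unfolding S_def by force+
  note [measurable] = S(1)[THEN sqi_measurable]
  have Sr: "cmod (S n x) = (\<Sum>i<n. cmod (u (Suc i) x - u i x))" for n x
  proof -
    have "S n x = complex_of_real (\<Sum>i<n. cmod (u (Suc i) x - u i x))"
      by (simp add: S_def D_def)
    then show ?thesis by (simp only: norm_of_real abs_of_nonneg sum_nonneg norm_ge_zero)
  qed
  have mono: "incseq (\<lambda>n. cmod (S n x))" for x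
    unfolding Sr by (intro incseq_SucI) simp
  have "(\<integral>\<^sup>+x. (SUP n. ennreal ((cmod (S n x))\<^sup>2)) \<partial>M) = (SUP n. \<integral>\<^sup>+x. ennreal ((cmod (S n x))\<^sup>2) \<partial>M)"
    by (rule nn_integral_monotone_convergence_SUP)
       (use mono in \<open>auto simp: incseq_def le_fun_def intro!: ennreal_leI power_mono\<close>)
  also have "\<dots> \<le> ennreal ((C / (1 - q))\<^sup>2)"
    by (rule SUP_least) (auto simp: nn_integral_sqi[OF S(1)] intro!: ennreal_leI power_mono S(2))
  finally have "(\<integral>\<^sup>+x. (SUP n. ennreal ((cmod (S n x))\<^sup>2)) \<partial>M) \<noteq> \<infinity>"
    by (auto simp: top_unique)
  then have "AE x in M. (SUP n. ennreal ((cmod (S n x))\<^sup>2)) \<noteq> \<infinity>"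
    by (intro nn_integral_PInf_AE) auto
  then show conv: "AE x in M. (\<lambda>n. u n x) \<longlonglongrightarrow> lim (\<lambda>n. u n x)"
  proof eventually_elim
    case (elim x)
    then obtain r where r: "0 \<le> r" "(SUP n. ennreal ((cmod (S n x))\<^sup>2)) = ennreal r"
      by (metis ennreal_cases infinity_ennreal_def)
    have "(cmod (S n x))\<^sup>2 \<le> r" for n
      using SUP_upper[of n UNIV "\<lambda>n. ennreal ((cmod (S n x))\<^sup>2)"] r by simp
    then have *: "cmod (S n x) \<le> sqrt r" for n
      by (simp add: real_le_rsqrt)
    have "summable (\<lambda>i. cmod (u (Suc i) x - u i x))"
      by (rule bounded_imp_summable[of _ "sqrt r"])
         (use *[of "Suc _"] in \<open>auto simp: Sr lessThan_Suc_atMost\<close>)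
    then have "summable (\<lambda>i. u (Suc i) x - u i x)"
      by (rule summable_norm_cancel)
    then have "convergent (\<lambda>n. \<Sum>i<n. u (Suc i) x - u i x)"
      by (simp add: summable_iff_convergent)
    then have "convergent (\<lambda>n. u n x - u 0 x)"
      unfolding sum_lessThan_telescope[of "\<lambda>i. u i x"] .
    then have "convergent (\<lambda>n. u n x)"
      by (simp only: convergent_diff_const_right_iff)
    then show ?case by (simp add: convergent_LIMSEQ_iff)
  qed
  have diff: "L2n M (\<lambda>x. u n x - u (n + m) x) \<le> C / (1 - q) * q ^ n" for n m
  proof -
    have "L2n M (\<lambda>x. u n x - u (n + m) x) = L2n M (\<lambda>x. \<Sum>i<m. u (Suc (n + i)) x - u (n + i) x)"
      using sum_lessThan_telescope[of "\<lambda>i. u (n + i) _" m]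
      by (intro L2n_cong) (simp add: norm_minus_commute)
    also have "\<dots> \<le> (\<Sum>i<m. L2n M (\<lambda>x. u (Suc (n + i)) x - u (n + i) x))"
      by (rule L2n_sum_triangle(2)) (intro sqi_diff u)
    also have "\<dots> \<le> (\<Sum>i<m. C * q ^ (n + i))"
      by (intro sum_mono b)
    also have "\<dots> = q ^ n * (\<Sum>i<m. C * q ^ i)"
      by (simp add: sum_distrib_left power_add mult_ac)
    also have "\<dots> \<le> q ^ n * (C / (1 - q))"
      using q by (intro mult_left_mono geo) auto
    finally show ?thesis by (simp add: mult_ac)
  qed
  have *: "sqi M (\<lambda>x. u n x - lim (\<lambda>n. u n x))" "L2n M (\<lambda>x. u n x - lim (\<lambda>n. u n x)) \<le> C / (1 - q) * q ^ n" for n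
  proof -
    \<comment> \<open>The differences tend to the error as \<open>m\<close> tends to infinity; Fatou
      then passes the bound \<open>diff\<close>, which is uniform in \<open>m\<close>, on to the
      error.\<close>
    have a: "AE x in M. (\<lambda>m. u n x - u (n + m) x) \<longlonglongrightarrow> u n x - lim (\<lambda>n. u n x)"
      using conv
    proof eventually_elim
      case (elim x)
      have "(\<lambda>m. u (m + n) x) \<longlonglongrightarrow> lim (\<lambda>n. u n x)"
        using elim by (rule LIMSEQ_ignore_initial_segment)
      then show ?case
        by (intro tendsto_intros) (simp add: add.commute)
    qed
    have nn: "0 \<le> C / (1 - q) * q ^ n" using C q by simp
    have m: "(\<lambda>x. u n x - lim (\<lambda>n. u n x)) \<in> borel_measurable M"
      by (intro borel_measurable_diff borel_measurable_lim_metric sqi_measurable[OF u])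
    have e: "\<forall>\<^sub>F m in sequentially. L2n M (\<lambda>x. u n x - u (n + m) x) \<le> C / (1 - q) * q ^ n"
      using diff by (intro always_eventually allI)
    note F = L2_Fatou[where f="\<lambda>m x. u n x - u (n + m) x", OF sqi_diff[OF u u] m a nn e]
    show "sqi M (\<lambda>x. u n x - lim (\<lambda>n. u n x))" by (rule F(1))
    show "L2n M (\<lambda>x. u n x - lim (\<lambda>n. u n x)) \<le> C / (1 - q) * q ^ n" by (rule F(2))
  qed
  show "L2n M (\<lambda>x. u n x - lim (\<lambda>n. u n x)) \<le> C / (1 - q) * q ^ n" by (rule *)
  show "sqi M (\<lambda>x. lim (\<lambda>n. u n x))"
    using sqi_diff[OF u[of 0] *(1)[of 0]] by simp
qed

text \<open>Completeness together with a subsequence converging almost everywhere: the subsequence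
  serves to identify the L2 limit with a pointwise limit known by other means.\<close>

lemma L2_Cauchy:
  assumes u: "\<And>n. sqi M (u n)"
    and c: "\<And>e. 0 < e \<Longrightarrow> \<exists>N. \<forall>m\<ge>N. \<forall>n\<ge>N. L2n M (\<lambda>x. u m x - u n x) < e"
  obtains v r where "sqi M v" "(\<lambda>n. L2n M (\<lambda>x. u n x - v x)) \<longlonglongrightarrow> 0"
    "strict_mono (r :: nat \<Rightarrow> nat)" "AE x in M. (\<lambda>n. u (r n) x) \<longlonglongrightarrow> v x"
proof -
  have "\<forall>k::nat. \<exists>N. \<forall>m\<ge>N. \<forall>n\<ge>N. L2n M (\<lambda>x. u m x - u n x) < (1/2)^k"
    using c by simp
  then obtain N where N: "\<And>k m n. N k \<le> m \<Longrightarrow> N k \<le> n \<Longrightarrow> L2n M (\<lambda>x. u m x - u n x) < (1/2)^k"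
    by metis
  \<comment> \<open>Summing the thresholds makes \<open>r n\<close> at least \<open>N n\<close> and
    monotone; the added \<open>n\<close> makes it strictly increasing.\<close>
  define r where "r n = (\<Sum>k\<le>n. N k) + n" for n
  have r: "strict_mono r"
    by (rule strict_mono_Suc_iff[THEN iffD2]) (simp add: r_def)
  have rN: "N n \<le> r n" for n
    unfolding r_def by (rule trans_le_add1, rule member_le_sum) auto
  have rS: "r n \<le> r (Suc n)" for n using r by (simp add: strict_mono_Suc_iff less_imp_le)
  have b: "L2n M (\<lambda>x. u (r (Suc n)) x - u (r n) x) \<le> 1 * (1/2)^n" for n
    using N[of n "r (Suc n)" "r n"] rN[of n] rS[of n] by simp
  define v where "v x = lim (\<lambda>n. u (r n) x)" for x
  have fc: "AE x in M. (\<lambda>n. u (r n) x) \<longlonglongrightarrow> v x" "sqi M v" "L2n M (\<lambda>x. u (r n) x - v x) \<le> 1 / (1 - 1/2) * (1/2)^n" for n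
    using L2_fast_Cauchy[of M "\<lambda>n. u (r n)" 1 "1/2", OF u b] unfolding v_def by auto
  have "(\<lambda>n. L2n M (\<lambda>x. u n x - v x)) \<longlonglongrightarrow> 0"
  proof (rule LIMSEQ_I)
    fix e :: real assume e: "0 < e"
    then obtain K where K: "\<forall>m\<ge>K. \<forall>n\<ge>K. L2n M (\<lambda>x. u m x - u n x) < e / 2"
      using c[of "e/2"] by auto
    have "(\<lambda>n. 2 * (1/2)^n :: real) \<longlonglongrightarrow> 2 * 0"
      by (intro tendsto_intros) auto
    from order_tendstoD(2)[OF this, of "e/2"] e
    have "eventually (\<lambda>n. 2 * (1/2)^n < e/2) sequentially"
      by simp
    then obtain L where L: "\<And>n. n \<ge> L \<Longrightarrow> 2 * (1/2)^n < e/2"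
      by (auto simp: eventually_sequentially)
    show "\<exists>no. \<forall>n\<ge>no. norm (L2n M (\<lambda>x. u n x - v x) - 0) < e"
    proof (intro exI allI impI)
      fix n assume n: "n \<ge> K"
      define k where "k = max K L"
      have "K \<le> k" by (simp add: k_def)
      also have "k \<le> r k" by (rule strict_mono_imp_increasing[OF r])
      finally have "K \<le> r k" .
      have "L2n M (\<lambda>x. u n x - v x) \<le> L2n M (\<lambda>x. u n x - u (r k) x) + L2n M (\<lambda>x. u (r k) x - v x)"
        by (rule L2n_triangle3) (auto intro: u fc)
      also have "\<dots> < e/2 + e/2"
      proof (rule add_strict_mono)
        show "L2n M (\<lambda>x. u n x - u (r k) x) < e / 2"
          using K n \<open>K \<le> r k\<close> by blast
        have "L \<le> k" by (simp add: k_def)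
        show "L2n M (\<lambda>x. u (r k) x - v x) < e / 2"
          using fc(3)[of k] L[OF \<open>L \<le> k\<close>] by simp
      qed
      finally show "norm (L2n M (\<lambda>x. u n x - v x) - 0) < e" by simp
    qed
  qed
  then show thesis by (rule that[OF fc(2) _ r fc(1)])
qed

section \<open>The Fourier transform on square integrable functions\<close>

definition ft :: "(real \<Rightarrow> complex) \<Rightarrow> real \<Rightarrow> complex" where
  "ft g k = complex_of_real (1 / sqrt (2 * pi)) * (LINT x|lborel. g x * exp (- (\<i> * complex_of_real (k * x))))"

lemma cmod_exp_ii [simp]: "cmod (exp (- (\<i> * complex_of_real t))) = 1"
  using norm_exp_i_times[of "-t"] by simp

lemma ft_integrable:
  assumes "integrable lborel g"
  shows "integrable lborel (\<lambda>x. g x * exp (- (\<i> * complex_of_real (k * x))))"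
  by (rule Bochner_Integration.integrable_bound[OF integrable_norm[OF assms]])
     (use borel_measurable_integrable[OF assms] in \<open>auto simp: norm_mult\<close>)

lemma ft_bound:
  assumes "integrable lborel g"
  shows "cmod (ft g k) \<le> 1 / sqrt (2 * pi) * (LINT x|lborel. cmod (g x))"
proof -
  have "cmod (LINT x|lborel. g x * exp (- (\<i> * complex_of_real (k * x))))
      \<le> (LINT x|lborel. cmod (g x * exp (- (\<i> * complex_of_real (k * x)))))"
    by (rule integral_norm_bound)
  then show ?thesis
    unfolding ft_def norm_mult cmod_exp_ii mult_1_right norm_of_real
    by (intro mult_mono) auto
qed

lemma ft_diff:
  assumes "integrable lborel f" "integrable lborel g"
  shows "ft (\<lambda>x. f x - g x) k = ft f k - ft g k"
  unfolding ft_def left_diff_distrib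
    Bochner_Integration.integral_diff[OF ft_integrable[OF assms(1)] ft_integrable[OF assms(2)]]
  by (rule right_diff_distrib)

lemma borel_measurable_ft [measurable]:
  assumes [measurable]: "g \<in> borel_measurable lborel"
  shows "ft g \<in> borel_measurable lborel"
  unfolding ft_def[abs_def] by measurable

text \<open>Fubini for the kernel, which is symmetric in \<open>k\<close> and \<open>x\<close>. With
  a modulated Gaussian as second factor this formula already contains Fourier inversion in the
  summed form used below.\<close>

lemma ft_mult:
  assumes f: "integrable lborel f" and g: "integrable lborel g"
  shows "(LINT k|lborel. ft f k * g k) = (LINT x|lborel. f x * ft g x)"
proof -
  note [measurable] = borel_measurable_integrable[OF f] borel_measurable_integrable[OF g]
  have "integrable (lborel \<Otimes>\<^sub>M lborel) (\<lambda>(k, x). g k * f x)"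
  proof (rule lborel_pair.Fubini_integrable)
    show "(\<lambda>(k, x). g k * f x) \<in> borel_measurable (lborel \<Otimes>\<^sub>M lborel)" by measurable
    show "integrable lborel (\<lambda>k. LINT x|lborel. norm (case (k, x) of (k, x) \<Rightarrow> g k * f x))"
      using g by (auto simp: norm_mult)
    show "AE k in lborel. integrable lborel (\<lambda>x. case (k, x) of (k, x) \<Rightarrow> g k * f x)"
      using f by auto
  qed
  then have i: "integrable (lborel \<Otimes>\<^sub>M lborel) (\<lambda>(k, x). g k * (f x * exp (- (\<i> * complex_of_real (k * x)))))"
    by (rule Bochner_Integration.integrable_bound) (auto simp: norm_mult)
  have "(LINT k|lborel. ft f k * g k) =
      complex_of_real (1 / sqrt (2 * pi)) * (LINT k|lborel. LINT x|lborel. g k * (f x * exp (- (\<i> * complex_of_real (k * x)))))"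
  proof -
    have "ft f k * g k = complex_of_real (1 / sqrt (2 * pi)) * (LINT x|lborel. g k * (f x * exp (- (\<i> * complex_of_real (k * x)))))" for k
      unfolding ft_def integral_mult_right_zero by (simp only: mult_ac)
    then show ?thesis by (simp only: integral_mult_right_zero)
  qed
  also have "(LINT k|lborel. LINT x|lborel. g k * (f x * exp (- (\<i> * complex_of_real (k * x)))))
      = (LINT x|lborel. LINT k|lborel. g k * (f x * exp (- (\<i> * complex_of_real (k * x)))))"
    using lborel_pair.Fubini_integral[of "\<lambda>k x. g k * (f x * exp (- (\<i> * complex_of_real (k * x))))"] i by simp
  also have "\<dots> = (LINT x|lborel. f x * (LINT k|lborel. g k * exp (- (\<i> * complex_of_real (x * k)))))"
  proof (rule Bochner_Integration.integral_cong[OF refl])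
    fix x
    have "(LINT k|lborel. g k * (f x * exp (- (\<i> * complex_of_real (k * x)))))
        = (LINT k|lborel. f x * (g k * exp (- (\<i> * complex_of_real (x * k)))))"
      by (intro Bochner_Integration.integral_cong refl) (simp add: mult_ac)
    then show "(LINT k|lborel. g k * (f x * exp (- (\<i> * complex_of_real (k * x)))))
        = f x * (LINT k|lborel. g k * exp (- (\<i> * complex_of_real (x * k))))"
      by simp
  qed
  also have "complex_of_real (1 / sqrt (2 * pi)) * \<dots> = (LINT x|lborel. f x * ft g x)"
  proof -
    have "f x * ft g x = complex_of_real (1 / sqrt (2 * pi)) * (f x * (LINT k|lborel. g k * exp (- (\<i> * complex_of_real (x * k)))))" for x
      unfolding ft_def by (simp only: mult_ac)
    then show ?thesis by (simp only: integral_mult_right_zero)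
  qed
  finally show ?thesis .
qed

section \<open>Gaussian summation and Plancherel's identity\<close>

definition gauss :: "real \<Rightarrow> real" where "gauss z = std_normal_density z"

lemma gauss_eq: "gauss z = 1 / sqrt (2 * pi) * exp (- z\<^sup>2 / 2)"
  by (simp add: gauss_def std_normal_density_def)

lemma integrable_gauss: "integrable lborel gauss" "(LINT x|lborel. gauss x) = 1"
  unfolding gauss_def[abs_def] using integrable_normal_density[of 0 1] integral_normal_density[of 0 1] by auto

text \<open>After scaling the variable by \<open>n\<close> the integral is the characteristic
  function of the standard normal distribution.\<close>

lemma ft_gauss: "ft (\<lambda>k. complex_of_real (exp (- (k / n)\<^sup>2 / 2))) y = complex_of_real (n * exp (- (n * y)\<^sup>2 / 2))"
  if n: "0 < n" for n :: real
proof -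
  have 1: "(LINT x|lborel. exp (\<i> * complex_of_real (t * x)) * complex_of_real (exp (- x\<^sup>2 / 2)))
      = complex_of_real (sqrt (2 * pi) * exp (- t\<^sup>2 / 2))" for t
  proof -
    have "char std_normal_distribution t = (LINT x|lborel. std_normal_density x *\<^sub>R exp (\<i> * complex_of_real (t * x)))"
      unfolding char_def by (subst integral_density) auto
    also have "\<dots> = (LINT x|lborel. complex_of_real (1 / sqrt (2 * pi)) *
         (exp (\<i> * complex_of_real (t * x)) * complex_of_real (exp (- x\<^sup>2 / 2))))"
      by (intro Bochner_Integration.integral_cong refl)
         (simp add: std_normal_density_def scaleR_conv_of_real)
    also have "\<dots> = complex_of_real (1 / sqrt (2 * pi)) *
         (LINT x|lborel. exp (\<i> * complex_of_real (t * x)) * complex_of_real (exp (- x\<^sup>2 / 2)))"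
      by simp
    finally show ?thesis
      by (simp add: char_std_normal_distribution field_simps)
  qed
  have "ft (\<lambda>k. complex_of_real (exp (- (k / n)\<^sup>2 / 2))) y
     = complex_of_real (1 / sqrt (2 * pi)) * (n *\<^sub>R
        (LINT x|lborel. exp (\<i> * complex_of_real ((- n * y) * x)) * complex_of_real (exp (- x\<^sup>2 / 2))))"
    unfolding ft_def
    by (subst lborel_integral_real_affine[where c=n and t=0])
       (use n in \<open>auto simp: mult_ac power_mult_distrib intro!: Bochner_Integration.integral_cong\<close>)
  also have "\<dots> = complex_of_real (n * exp (- (n * y)\<^sup>2 / 2))"
    unfolding 1 by (simp add: scaleR_conv_of_real field_simps)
  finally show ?thesis .
qed

lemma integrable_compact_bounded:
  fixes f :: "real \<Rightarrow> 'a::{banach, second_countable_topology}"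
  assumes "f \<in> borel_measurable lborel" "\<And>x. norm (f x) \<le> K" "\<And>x. \<bar>x\<bar> > R \<Longrightarrow> f x = 0"
  shows "integrable lborel f"
proof (rule Bochner_Integration.integrable_bound)
  show "integrable lborel (\<lambda>x. K * indicat_real {-R..R} x)"
    by (intro integrable_mult_right integrable_real_indicator) (auto simp: emeasure_lborel_Icc_eq)
  have K: "0 \<le> K" using order_trans[OF norm_ge_zero assms(2)[of 0]] by simp
  show "AE x in lborel. norm (f x) \<le> norm (K * indicat_real {-R..R} x)"
    using assms(2,3) K by (intro AE_I2) (auto simp: indicator_def abs_le_iff not_less)
qed (use assms in auto)

lemma sqi_compact_bounded:
  fixes f :: "real \<Rightarrow> complex"
  assumes "f \<in> borel_measurable lborel" "\<And>x. cmod (f x) \<le> K" "\<And>x. \<bar>x\<bar> > R \<Longrightarrow> f x = 0"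
  shows "sqi lborel f"
  unfolding sqi_def
proof
  show "integrable lborel (\<lambda>x. (cmod (f x))\<^sup>2)"
    by (rule integrable_compact_bounded[where K="K\<^sup>2" and R=R])
       (use assms in \<open>auto intro: power_mono\<close>)
qed fact

text \<open>A summability factor that increases to 1 with \<open>n\<close>; \<open>Suc n\<close>
  keeps the width nonzero.\<close>

definition gker :: "nat \<Rightarrow> real \<Rightarrow> complex" where
  "gker n k = complex_of_real (exp (- (k / real (Suc n))\<^sup>2 / 2))"

lemma gker_measurable [measurable]: "gker n \<in> borel_measurable lborel"
  unfolding gker_def[abs_def] by measurable

lemma integrable_gker: "integrable lborel (gker n)"
proof -
  have "integrable lborel (\<lambda>x. gauss (0 + (1 / real (Suc n)) * x))"
    by (rule lborel_integrable_real_affine) (use integrable_gauss in auto)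
  then have "integrable lborel (\<lambda>x. complex_of_real (sqrt (2 * pi) * gauss (x / real (Suc n))))"
    by simp
  then show ?thesis by (simp add: gauss_eq gker_def[abs_def])
qed

lemma ft_gker_shift:
  "ft (\<lambda>k. gker n k * exp (- (\<i> * complex_of_real (k * (- x))))) y
    = complex_of_real (sqrt (2 * pi)) * complex_of_real (real (Suc n) * gauss (real (Suc n) * (y - x)))"
proof -
  have "gker n k * exp (- (\<i> * complex_of_real (k * (- x)))) * exp (- (\<i> * complex_of_real (y * k)))
      = gker n k * exp (- (\<i> * complex_of_real ((y - x) * k)))" for k
    unfolding mult.assoc exp_add[symmetric]
    by (intro arg_cong2[where f="(*)"] arg_cong[where f=exp] refl) (simp add: algebra_simps)
  then have "ft (\<lambda>k. gker n k * exp (- (\<i> * complex_of_real (k * (- x))))) y = ft (gker n) (y - x)"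
    unfolding ft_def by (simp only:)
  also have "\<dots> = complex_of_real (real (Suc n) * exp (- (real (Suc n) * (y - x))\<^sup>2 / 2))"
    unfolding gker_def by (rule ft_gauss) simp
  finally show ?thesis by (simp add: gauss_eq)
qed

text \<open>Damping the transform by \<open>gker n\<close> amounts to averaging \<open>g\<close>
  against a Gaussian of width \<open>1 / real (Suc n)\<close>. The integral over frequencies is
  moved onto \<open>g\<close> by \<open>ft_mult\<close>, applied to the damped exponential
  \<open>e\<close>, whose transform is an explicit translated Gaussian.\<close>

lemma ft_gker_cnj:
  assumes gi: "integrable lborel g"
  shows "integrable lborel (\<lambda>k. gker n k * cnj (ft g k))"
    and "ft (\<lambda>k. gker n k * cnj (ft g k)) x
      = cnj (LINT z|lborel. g (x - z / real (Suc n)) * complex_of_real (gauss z))"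
proof -
  note [measurable] = borel_measurable_integrable[OF gi]
  show "integrable lborel (\<lambda>k. gker n k * cnj (ft g k))"
  proof (rule Bochner_Integration.integrable_bound[OF integrable_mult_right[OF integrable_gker,
            of "complex_of_real (1 / sqrt (2 * pi) * (LINT x|lborel. cmod (g x)))" n]])
    show "AE k in lborel. norm (gker n k * cnj (ft g k)) \<le> norm (complex_of_real (1 / sqrt (2 * pi) * (LINT x|lborel. cmod (g x))) * gker n k)"
    proof (rule AE_I2)
      fix k
      have "cmod (ft g k) * cmod (gker n k) \<le> \<bar>1 / sqrt (2 * pi) * (LINT x|lborel. cmod (g x))\<bar> * cmod (gker n k)"
        using ft_bound[OF gi, of k] by (intro mult_right_mono norm_ge_zero) linarith
      then show "norm (gker n k * cnj (ft g k)) \<le> norm (complex_of_real (1 / sqrt (2 * pi) * (LINT x|lborel. cmod (g x))) * gker n k)"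
        unfolding norm_mult complex_mod_cnj norm_of_real by (simp only: mult.commute)
    qed
  qed measurable
  define e where "e k = gker n k * exp (- (\<i> * complex_of_real (k * (- x))))" for k
  have ei: "integrable lborel e"
    unfolding e_def[abs_def] using ft_integrable[OF integrable_gker[of n], of "-x"] by (simp add: mult_ac)
  have fte: "ft e y = complex_of_real (sqrt (2 * pi)) * complex_of_real (real (Suc n) * gauss (real (Suc n) * (y - x)))" for y
    unfolding e_def by (rule ft_gker_shift)
  have "gker n k * cnj (ft g k) * exp (- (\<i> * complex_of_real (x * k))) = cnj (ft g k * e k)" for k
    by (simp add: e_def gker_def exp_cnj mult_ac)
  then have "ft (\<lambda>k. gker n k * cnj (ft g k)) x
      = complex_of_real (1 / sqrt (2 * pi)) * cnj (LINT k|lborel. ft g k * e k)"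
    unfolding ft_def[of "\<lambda>k. gker n k * cnj (ft g k)"] by (simp only: Bochner_Integration.integral_cnj)
  also have "(LINT k|lborel. ft g k * e k) = (LINT y|lborel. g y * ft e y)"
    by (rule ft_mult[OF gi ei])
  also have "\<dots> = complex_of_real (sqrt (2 * pi)) * (LINT y|lborel. g y * complex_of_real (real (Suc n) * gauss (real (Suc n) * (y - x))))"
    unfolding fte integral_mult_right_zero[symmetric] by (simp only: mult_ac)
  also have "(LINT y|lborel. g y * complex_of_real (real (Suc n) * gauss (real (Suc n) * (y - x))))
      = \<bar>- 1 / real (Suc n)\<bar> *\<^sub>R (LINT z|lborel. g (x + (- 1 / real (Suc n)) * z) *
          complex_of_real (real (Suc n) * gauss (real (Suc n) * (x + (- 1 / real (Suc n)) * z - x))))"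
    by (rule lborel_integral_real_affine) simp
  also have "\<dots> = (LINT z|lborel. g (x - z / real (Suc n)) * complex_of_real (gauss z))"
  proof -
    have "\<bar>- 1 / real (Suc n)\<bar> *\<^sub>R (g (x + (- 1 / real (Suc n)) * z) *
          complex_of_real (real (Suc n) * gauss (real (Suc n) * (x + (- 1 / real (Suc n)) * z - x))))
        = g (x - z / real (Suc n)) * complex_of_real (gauss z)" for z
      by (simp add: scaleR_conv_of_real gauss_eq del: of_nat_Suc)
    then show ?thesis unfolding integral_scaleR_right[symmetric] by (simp only:)
  qed
  finally show "ft (\<lambda>k. gker n k * cnj (ft g k)) x
      = cnj (LINT z|lborel. g (x - z / real (Suc n)) * complex_of_real (gauss z))" by simp
qed

lemma approx_identity_bound:
  assumes [measurable]: "g \<in> borel_measurable lborel" and K: "\<And>x. cmod (g x) \<le> K"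
  shows "cmod (LINT z|lborel. g (x - z / real (Suc n)) * complex_of_real (gauss z)) \<le> K"
proof -
  note [measurable] = borel_measurable_integrable[OF integrable_gauss(1)]
  have Ki: "integrable lborel (\<lambda>z. K * gauss z)" using integrable_gauss by simp
  have b: "norm (g (x - z / real (Suc n)) * complex_of_real (gauss z)) \<le> K * gauss z" for z
    using K by (auto simp: norm_mult gauss_def intro!: mult_right_mono)
  have "cmod (LINT z|lborel. g (x - z / real (Suc n)) * complex_of_real (gauss z)) \<le> (LINT z|lborel. K * gauss z)"
  proof (rule Bochner_Integration.integral_norm_bound_integral[OF _ Ki b])
    show "integrable lborel (\<lambda>z. g (x - z / real (Suc n)) * complex_of_real (gauss z))"
      by (rule Bochner_Integration.integrable_bound[OF Ki _ AE_I2[OF order_trans[OF b]]]) auto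
  qed
  also have "\<dots> = K" using integrable_gauss by simp
  finally show ?thesis .
qed

lemma approx_identity_continuous:
  assumes c: "continuous_on UNIV g" and K: "\<And>x. cmod (g x) \<le> K"
  shows "(\<lambda>n. LINT z|lborel. g (x - z / real (Suc n)) * complex_of_real (gauss z)) \<longlonglongrightarrow> g x"
proof -
  have [measurable]: "g \<in> borel_measurable lborel"
    using c by (simp add: borel_measurable_continuous_onI)
  note [measurable] = borel_measurable_integrable[OF integrable_gauss(1)]
  have "(\<lambda>n. LINT z|lborel. g (x - z / real (Suc n)) * complex_of_real (gauss z)) \<longlonglongrightarrow> (LINT z|lborel. g x * complex_of_real (gauss z))"
  proof (rule integral_dominated_convergence)
    show "integrable lborel (\<lambda>z. K * gauss z)" using integrable_gauss by simp
    show "AE z in lborel. (\<lambda>n. g (x - z / real (Suc n)) * complex_of_real (gauss z)) \<longlonglongrightarrow> g x * complex_of_real (gauss z)"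
    proof (rule AE_I2)
      fix z
      have "(\<lambda>n. x - z / real (Suc n)) \<longlonglongrightarrow> x - 0"
        by (intro tendsto_intros LIMSEQ_Suc[OF lim_const_over_n])
      then have "(\<lambda>n. g (x - z / real (Suc n))) \<longlonglongrightarrow> g x"
        using c by (intro isCont_tendsto_compose[of x g]) (auto simp: continuous_on_eq_continuous_at)
      then show "(\<lambda>n. g (x - z / real (Suc n)) * complex_of_real (gauss z)) \<longlonglongrightarrow> g x * complex_of_real (gauss z)"
        by (intro tendsto_intros)
    qed
    show "AE z in lborel. norm (g (x - z / real (Suc n)) * complex_of_real (gauss z)) \<le> K * gauss z" for n
      using K by (intro AE_I2) (auto simp: norm_mult gauss_def intro!: mult_right_mono)
  qed measurable
  then show ?thesis using integrable_gauss by simp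
qed

text \<open>Pairing \<open>ft g\<close> with its damped conjugate gives two expressions for one
  number. As the damping disappears, one increases to the square integral of \<open>ft g\<close> by
  monotone convergence, the other tends to that of \<open>g\<close> by the approximate identity.
  Square integrability of \<open>ft g\<close> comes out of the same argument.\<close>

lemma Plancherel_continuous:
  assumes c: "continuous_on UNIV g" and R: "\<And>x. \<bar>x\<bar> > R \<Longrightarrow> g x = 0"
  shows "sqi lborel (ft g)" "L2n lborel (ft g) = L2n lborel g"
proof -
  have [measurable]: "g \<in> borel_measurable lborel"
    using c by (simp add: borel_measurable_continuous_onI)
  obtain K where K: "\<And>x. cmod (g x) \<le> K"
  proof -
    have "compact (g ` {-R..R})"
      by (intro compact_continuous_image continuous_on_subset[OF c]) auto
    then obtain B where B: "\<And>x. x \<in> {-R..R} \<Longrightarrow> cmod (g x) \<le> B"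
      by (meson bounded_iff compact_imp_bounded image_eqI)
    have "cmod (g x) \<le> \<bar>B\<bar>" for x
      using B[of x] R[of x] by (cases "\<bar>x\<bar> \<le> R") (auto simp: abs_le_iff)
    then show thesis using that by blast
  qed
  have gi: "integrable lborel g" by (rule integrable_compact_bounded[OF _ K R]) auto
  have ftb: "cmod (ft g k) \<le> 1 / sqrt (2 * pi) * (LINT x|lborel. cmod (g x))" for k
    by (rule ft_bound[OF gi])
  note [measurable] = borel_measurable_integrable[OF integrable_gauss(1)]
  have key: "(LINT k|lborel. ft g k * (gker n k * cnj (ft g k)))
      = (LINT x|lborel. g x * cnj (LINT z|lborel. g (x - z / real (Suc n)) * complex_of_real (gauss z)))" for n
    unfolding ft_mult[OF gi ft_gker_cnj(1)[OF gi]] ft_gker_cnj(2)[OF gi] ..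
  have conv: "(\<lambda>n. LINT x|lborel. g x * cnj (LINT z|lborel. g (x - z / real (Suc n)) * complex_of_real (gauss z)))
     \<longlonglongrightarrow> (LINT x|lborel. g x * cnj (g x))"
  proof (rule integral_dominated_convergence)
    show "AE x in lborel. (\<lambda>n. g x * cnj (LINT z|lborel. g (x - z / real (Suc n)) * complex_of_real (gauss z))) \<longlonglongrightarrow> g x * cnj (g x)"
      by (intro AE_I2 tendsto_intros approx_identity_continuous[OF c K])
    show "integrable lborel (\<lambda>x. cmod (g x) * K)" using gi by auto
    show "AE x in lborel. norm (g x * cnj (LINT z|lborel. g (x - z / real (Suc n)) * complex_of_real (gauss z))) \<le> cmod (g x) * K" for n
      unfolding norm_mult complex_mod_cnj
      by (intro AE_I2 mult_left_mono approx_identity_bound K) auto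
  qed measurable
  define J where "J n = (LINT k|lborel. exp (- (k / real (Suc n))\<^sup>2 / 2) * (cmod (ft g k))\<^sup>2)" for n
  have eq: "ft g k * (gker n k * cnj (ft g k)) = complex_of_real (exp (- (k / real (Suc n))\<^sup>2 / 2) * (cmod (ft g k))\<^sup>2)" for k n
    unfolding gker_def of_real_mult complex_norm_square by (simp only: mult_ac)
  have Ji: "integrable lborel (\<lambda>k. exp (- (k / real (Suc n))\<^sup>2 / 2) * (cmod (ft g k))\<^sup>2)" for n
  proof -
    have "integrable lborel (\<lambda>k. ft g k * (gker n k * cnj (ft g k)))"
    proof (rule Bochner_Integration.integrable_bound[OF integrable_mult_right[OF ft_gker_cnj(1)[OF gi],
            of "complex_of_real (1 / sqrt (2 * pi) * (LINT x|lborel. cmod (g x)))" n]])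
      show "AE k in lborel. norm (ft g k * (gker n k * cnj (ft g k))) \<le>
          norm (complex_of_real (1 / sqrt (2 * pi) * (LINT x|lborel. cmod (g x))) * (gker n k * cnj (ft g k)))"
        unfolding norm_mult[of "ft g _"] norm_mult[of "complex_of_real _"] norm_of_real
        by (intro AE_I2 mult_right_mono norm_ge_zero order_trans[OF ftb abs_ge_self])
    qed measurable
    then show ?thesis unfolding eq complex_of_real_integrable_eq .
  qed
  have "complex_of_real (J n) = (LINT k|lborel. ft g k * (gker n k * cnj (ft g k)))" for n
    unfolding J_def eq integral_complex_of_real ..
  then have "(\<lambda>n. complex_of_real (J n)) \<longlonglongrightarrow> (LINT x|lborel. g x * cnj (g x))"
    using conv key by simp
  also have "(LINT x|lborel. g x * cnj (g x)) = complex_of_real ((L2n lborel g)\<^sup>2)"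
    unfolding L2n_sq integral_complex_of_real[symmetric] complex_norm_square ..
  finally have J: "J \<longlonglongrightarrow> (L2n lborel g)\<^sup>2" by (simp only: tendsto_of_real_iff)
  have lim: "(\<lambda>n. exp (- (k / real (Suc n))\<^sup>2 / 2) * (cmod (ft g k))\<^sup>2) \<longlonglongrightarrow> (cmod (ft g k))\<^sup>2" for k
  proof -
    have "(\<lambda>n. exp (- (k / real (Suc n))\<^sup>2 / 2) * (cmod (ft g k))\<^sup>2) \<longlonglongrightarrow> exp (- 0\<^sup>2 / 2) * (cmod (ft g k))\<^sup>2"
      by (intro tendsto_intros LIMSEQ_Suc[OF lim_const_over_n]) auto
    then show ?thesis by simp
  qed
  have m: "mono (\<lambda>n. exp (- (k / real (Suc n))\<^sup>2 / 2) * (cmod (ft g k))\<^sup>2)" for k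
  proof (intro monoI mult_right_mono)
    fix m n :: nat assume "m \<le> n"
    then have "(k / real (Suc n))\<^sup>2 \<le> (k / real (Suc m))\<^sup>2"
      unfolding power_divide by (intro divide_left_mono power_mono) auto
    then show "exp (- (k / real (Suc m))\<^sup>2 / 2) \<le> exp (- (k / real (Suc n))\<^sup>2 / 2)" by simp
  qed simp
  have hb: "has_bochner_integral lborel (\<lambda>k. (cmod (ft g k))\<^sup>2) ((L2n lborel g)\<^sup>2)"
    by (rule has_bochner_integral_monotone_convergence[OF Ji])
       (use lim m J in \<open>auto simp: J_def[abs_def]\<close>)
  then show "sqi lborel (ft g)"
    by (auto simp: sqi_def has_bochner_integral_iff)
  have "(L2n lborel (ft g))\<^sup>2 = (L2n lborel g)\<^sup>2"
    using hb by (simp only: L2n_sq has_bochner_integral_iff)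
  then show "L2n lborel (ft g) = L2n lborel g"
    by (simp add: power2_eq_iff_nonneg)
qed

lemma L2n_compact_integral:
  assumes "sqi lborel f" "\<And>x. \<bar>x\<bar> > R \<Longrightarrow> f x = 0"
  shows "integrable lborel f" "(LINT x|lborel. cmod (f x)) \<le> sqrt (2 * \<bar>R\<bar>) * L2n lborel f"
proof -
  note [measurable] = sqi_measurable[OF assms(1)]
  have i: "sqi lborel (indicator {-\<bar>R\<bar>..\<bar>R\<bar>} :: real \<Rightarrow> complex)"
    by (rule sqi_compact_bounded[where K=1 and R="\<bar>R\<bar>"]) (auto simp: indicator_def)
  have n: "L2n lborel (indicator {-\<bar>R\<bar>..\<bar>R\<bar>} :: real \<Rightarrow> complex) = sqrt (2 * \<bar>R\<bar>)"
  proof -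
    have "(cmod (indicator {-\<bar>R\<bar>..\<bar>R\<bar>} x))\<^sup>2 = indicat_real {-\<bar>R\<bar>..\<bar>R\<bar>} x" for x
      by (auto simp: indicator_def)
    then show ?thesis by (simp add: L2n_def)
  qed
  have eq: "indicator {-\<bar>R\<bar>..\<bar>R\<bar>} x * f x = f x" for x
  proof (cases "f x = 0")
    case False
    then have "\<bar>x\<bar> \<le> R" using assms(2)[of x] by force
    then have "x \<in> {-\<bar>R\<bar>..\<bar>R\<bar>}" by auto
    then show ?thesis by simp
  qed simp
  have eq': "cmod (indicator {-\<bar>R\<bar>..\<bar>R\<bar>} x) * cmod (f x) = cmod (f x)" for x
    unfolding norm_mult[symmetric] eq ..
  show "integrable lborel f"
    using sqi_mult_integrable(1)[OF i assms(1)] unfolding eq .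
  show "(LINT x|lborel. cmod (f x)) \<le> sqrt (2 * \<bar>R\<bar>) * L2n lborel f"
    using sqi_mult_integrable(2)[OF i assms(1)] unfolding eq' n .
qed

text \<open>With all supports in one interval, L2 convergence implies L1 convergence, so the
  transforms converge at every point; this identifies their L2 limit with \<open>ft f\<close>. The
  isometry is assumed for differences as well, in place of a linear structure on the class of
  approximants.\<close>

lemma Plancherel_closure:
  assumes g: "\<And>n. sqi lborel (g n)" "\<And>n x. \<bar>x\<bar> > R \<Longrightarrow> g n x = 0"
    and f: "sqi lborel f" "\<And>x. \<bar>x\<bar> > R \<Longrightarrow> f x = 0"
    and lim: "(\<lambda>n. L2n lborel (\<lambda>x. g n x - f x)) \<longlonglongrightarrow> 0"
    and iso: "\<And>n. sqi lborel (ft (g n))" "\<And>n. L2n lborel (ft (g n)) = L2n lborel (g n)"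
      "\<And>m n. L2n lborel (ft (\<lambda>x. g m x - g n x)) = L2n lborel (\<lambda>x. g m x - g n x)"
  shows "sqi lborel (ft f)" "L2n lborel (ft f) = L2n lborel f"
proof -
  have gi: "integrable lborel (g n)" for n
    by (rule L2n_compact_integral(1)[OF g(1)[of n] g(2)])
  have fi: "integrable lborel f"
    by (rule L2n_compact_integral(1)[OF f])
  note [measurable] = borel_measurable_integrable[OF gi] borel_measurable_integrable[OF fi]
  have pt: "(\<lambda>n. ft (g n) k) \<longlonglongrightarrow> ft f k" for k
  proof -
    have *: "cmod (ft (g n) k - ft f k) \<le> 1 / sqrt (2 * pi) * (sqrt (2 * \<bar>R\<bar>) * L2n lborel (\<lambda>x. g n x - f x))" for n
    proof -
      have "cmod (ft (g n) k - ft f k) = cmod (ft (\<lambda>x. g n x - f x) k)"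
        by (simp add: ft_diff[OF gi fi])
      also have "\<dots> \<le> 1 / sqrt (2 * pi) * (LINT x|lborel. cmod (g n x - f x))"
        by (rule ft_bound[OF Bochner_Integration.integrable_diff[OF gi fi]])
      also have "\<dots> \<le> 1 / sqrt (2 * pi) * (sqrt (2 * \<bar>R\<bar>) * L2n lborel (\<lambda>x. g n x - f x))"
      proof (rule mult_left_mono)
        show "(LINT x|lborel. cmod (g n x - f x)) \<le> sqrt (2 * \<bar>R\<bar>) * L2n lborel (\<lambda>x. g n x - f x)"
          by (rule L2n_compact_integral(2)[OF sqi_diff[OF g(1) f(1)]]) (simp add: g(2) f(2))
      qed simp
      finally show ?thesis .
    qed
    have "(\<lambda>n. 1 / sqrt (2 * pi) * (sqrt (2 * \<bar>R\<bar>) * L2n lborel (\<lambda>x. g n x - f x))) \<longlonglongrightarrow> 0"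
      by (rule tendsto_mult_right_zero[OF tendsto_mult_right_zero[OF lim]])
    from Lim_null_comparison[OF always_eventually[OF allI[OF *]] this]
    have "(\<lambda>n. ft (g n) k - ft f k) \<longlonglongrightarrow> 0" .
    then show ?thesis by (rule LIM_zero_cancel)
  qed
  have cau: "\<exists>N. \<forall>m\<ge>N. \<forall>n\<ge>N. L2n lborel (\<lambda>k. ft (g m) k - ft (g n) k) < e" if "0 < e" for e
  proof -
    have "eventually (\<lambda>n. L2n lborel (\<lambda>x. g n x - f x) < e / 2) sequentially"
      by (rule order_tendstoD(2)[OF lim]) (use that in simp)
    then obtain N where N: "\<And>n. n \<ge> N \<Longrightarrow> L2n lborel (\<lambda>x. g n x - f x) < e / 2"
      by (auto simp: eventually_sequentially)
    show ?thesis
    proof (intro exI allI impI)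
      fix m n assume "N \<le> m" "N \<le> n"
      have "L2n lborel (\<lambda>k. ft (g m) k - ft (g n) k) = L2n lborel (ft (\<lambda>x. g m x - g n x))"
        by (intro L2n_cong) (simp add: ft_diff[OF gi gi])
      also have "\<dots> = L2n lborel (\<lambda>x. g m x - g n x)" by (rule iso)
      also have "\<dots> \<le> L2n lborel (\<lambda>x. g m x - f x) + L2n lborel (\<lambda>x. f x - g n x)"
        by (rule L2n_triangle3[OF g(1) f(1) g(1)])
      also have "\<dots> < e / 2 + e / 2"
        using N[OF \<open>N \<le> m\<close>] N[OF \<open>N \<le> n\<close>] L2n_minus_commute[of lborel f "g n"] by simp
      finally show "L2n lborel (\<lambda>k. ft (g m) k - ft (g n) k) < e" by simp
    qed
  qed
  obtain v r where v: "sqi lborel v" "(\<lambda>n. L2n lborel (\<lambda>x. ft (g n) x - v x)) \<longlonglongrightarrow> 0"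
    "strict_mono (r :: nat \<Rightarrow> nat)" "AE x in lborel. (\<lambda>n. ft (g (r n)) x) \<longlonglongrightarrow> v x"
    by (rule L2_Cauchy[OF iso(1) cau])
  have ae: "AE x in lborel. cmod (ft f x) = cmod (v x)"
    using v(4)
  proof eventually_elim
    case (elim x)
    have "(\<lambda>n. ft (g (r n)) x) \<longlonglongrightarrow> ft f x"
      using LIMSEQ_subseq_LIMSEQ[OF pt v(3)] by (simp add: o_def)
    from LIMSEQ_unique[OF elim this] show ?case by simp
  qed
  have vm: "v \<in> borel_measurable lborel" using v(1) by (rule sqi_measurable)
  show "sqi lborel (ft f)"
    by (rule sqi_bound[OF v(1)]) (use ae in auto)
  have "(\<lambda>n. L2n lborel (ft (g n))) \<longlonglongrightarrow> L2n lborel v"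
    by (rule L2n_tendsto[OF iso(1) v(1,2)])
  moreover have "(\<lambda>n. L2n lborel (ft (g n))) \<longlonglongrightarrow> L2n lborel f"
    unfolding iso(2) by (rule L2n_tendsto[OF g(1) f(1) lim])
  ultimately have "L2n lborel v = L2n lborel f" by (rule LIMSEQ_unique)
  moreover have "L2n lborel (ft f) = L2n lborel v"
    by (rule L2n_cong_AE[OF _ vm ae]) simp
  ultimately show "L2n lborel (ft f) = L2n lborel f" by simp
qed

lemma L2_dominated:
  assumes f: "\<And>n. f n \<in> borel_measurable M" and g: "g \<in> borel_measurable M"
    and w: "integrable M (\<lambda>x. (w x)\<^sup>2)"
    and bd: "\<And>n. AE x in M. cmod (f n x - g x) \<le> w x" and lim: "AE x in M. (\<lambda>n. f n x) \<longlonglongrightarrow> g x"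
  shows "(\<lambda>n. L2n M (\<lambda>x. f n x - g x)) \<longlonglongrightarrow> 0"
proof -
  note [measurable] = f g
  have "(\<lambda>n. LINT x|M. (cmod (f n x - g x))\<^sup>2) \<longlonglongrightarrow> (LINT x|M. 0)"
  proof (rule integral_dominated_convergence[OF _ _ w])
    show "AE x in M. (\<lambda>n. (cmod (f n x - g x))\<^sup>2) \<longlonglongrightarrow> 0"
      using lim
    proof eventually_elim
      case (elim x)
      have "(\<lambda>n. (cmod (f n x - g x))\<^sup>2) \<longlonglongrightarrow> (cmod (g x - g x))\<^sup>2"
        by (intro tendsto_intros elim)
      then show ?case by simp
    qed
    show "AE x in M. norm ((cmod (f n x - g x))\<^sup>2) \<le> (w x)\<^sup>2" for n
      using bd[of n] by eventually_elim (simp add: power_mono)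
  qed measurable
  then have "(\<lambda>n. sqrt (LINT x|M. (cmod (f n x - g x))\<^sup>2)) \<longlonglongrightarrow> sqrt 0"
    by (intro tendsto_real_sqrt) simp
  then show ?thesis by (simp add: L2n_def)
qed

lemma AE_lborel_uminus:
  assumes "AE x in lborel. P (x::real)"
  shows "AE x in lborel. P (- x)"
proof -
  have "AE x in distr lborel borel uminus. P (x::real)"
    using assms by (subst lborel_distr_uminus)
  then show ?thesis
    by (rule AE_distrD[rotated]) simp
qed

lemma integral_lborel_uminus:
  fixes f :: "real \<Rightarrow> 'a::{banach, second_countable_topology}"
  shows "(LINT x|lborel. f (- x)) = (LINT x|lborel. f x)"
  using lborel_integral_real_affine[of "-1" f 0] by simp

lemma integrable_lborel_uminus:
  fixes f :: "real \<Rightarrow> 'a::{banach, second_countable_topology}"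
  assumes "integrable lborel f" shows "integrable lborel (\<lambda>x. f (- x))"
  using lborel_integrable_real_affine[OF assms, of "-1" 0] by simp

lemma sqi_uminus_arg: "sqi lborel (f :: real \<Rightarrow> complex) \<Longrightarrow> sqi lborel (\<lambda>x. f (- x))"
  unfolding sqi_def using integrable_lborel_uminus[of "\<lambda>x. (cmod (f x))\<^sup>2"] by auto

lemma L2n_uminus_arg: "L2n lborel (\<lambda>x::real. f (- x)) = L2n lborel f"
  unfolding L2n_def using integral_lborel_uminus[of "\<lambda>x. (cmod (f x))\<^sup>2"] by simp

text \<open>A measurable function is an almost everywhere limit of continuous functions. Clipping
  their values and cutting off their supports makes the errors dominated by a multiple of an
  indicator, hence small in L2, and leaves the limit unchanged.\<close>

lemma Plancherel_bounded:
  assumes g: "g \<in> borel_measurable lborel" "\<And>x. cmod (g x) \<le> K" "\<And>x. \<bar>x\<bar> > R \<Longrightarrow> g x = 0"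
  shows "sqi lborel (ft g)" "L2n lborel (ft g) = L2n lborel g"
proof -
  have "g \<in> borel_measurable lebesgue" using g(1) by (rule measurable_completion)
  then have "g measurable_on UNIV"
    by (intro lebesgue_measurable_imp_measurable_on) auto
  then obtain N h where N: "negligible N" and h: "\<And>n. continuous_on UNIV (h n)"
    and hl: "\<And>x. x \<notin> N \<Longrightarrow> (\<lambda>n. h n x) \<longlonglongrightarrow> g x"
    unfolding measurable_on_def by auto
  have K: "0 \<le> K" using order_trans[OF norm_ge_zero g(2)[of 0]] .
  \<comment> \<open>The added 1 keeps the clipping level positive even if \<open>K = 0\<close>, so
    that \<open>clip\<close> is continuous; values of modulus at most \<open>K\<close> are
    unaffected.\<close>
  define L where "L = K + 1"
  have L: "0 < L" "K \<le> L" using K by (auto simp: L_def)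
  define clip where "clip z = complex_of_real (L / max L (cmod z)) * z" for z
  have clip_c: "continuous_on UNIV clip"
    unfolding clip_def[abs_def] using L by (intro continuous_intros) auto
  have clip_b: "cmod (clip z) \<le> L" for z
  proof -
    have "L * cmod z \<le> L * max L (cmod z)" using L by (intro mult_left_mono) auto
    then show ?thesis using L by (auto simp: clip_def norm_mult norm_divide field_simps max_def)
  qed
  have clip_id: "clip z = z" if "cmod z \<le> K" for z
  proof -
    from that have "max L (cmod z) = L" using L by simp
    then show ?thesis using L by (simp add: clip_def)
  qed
  define cut where "cut x = complex_of_real (max 0 (min 1 (R + 1 - \<bar>x\<bar>)))" for x
  have cut_c: "continuous_on UNIV cut"
    unfolding cut_def[abs_def] by (intro continuous_intros)
  have cut_b: "cmod (cut x) \<le> 1" for x by (auto simp: cut_def)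
  define f where "f n x = cut x * clip (h n x)" for n x
  have fc: "continuous_on UNIV (f n)" for n
    unfolding f_def[abs_def]
    by (intro continuous_on_mult cut_c continuous_on_compose2[OF clip_c h]) auto
  have f0: "\<bar>x\<bar> > R + 1 \<Longrightarrow> f n x = 0" for n x by (auto simp: f_def cut_def)
  have fb: "cmod (f n x) \<le> L" for n x
  proof -
    have "cmod (cut x) * cmod (clip (h n x)) \<le> 1 * L"
      by (intro mult_mono cut_b clip_b) auto
    then show ?thesis by (simp add: f_def norm_mult)
  qed
  have fm: "f n \<in> borel_measurable lborel" for n
    using fc by (simp add: borel_measurable_continuous_onI)
  have fs: "sqi lborel (f n)" for n
    by (rule sqi_compact_bounded[OF fm fb f0])
  have g0: "\<bar>x\<bar> > R + 1 \<Longrightarrow> g x = 0" for x using g(3)[of x] by auto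
  have gs: "sqi lborel g"
    by (rule sqi_compact_bounded[OF g])
  have lim: "(\<lambda>n. L2n lborel (\<lambda>x. f n x - g x)) \<longlonglongrightarrow> 0"
  proof (rule L2_dominated[OF fm g(1), where w="\<lambda>x. (2 * L) * indicat_real {-(R+1)..R+1} x"])
    have "((2 * L) * indicat_real {-(R+1)..R+1} x)\<^sup>2 = (2 * L)\<^sup>2 * indicat_real {-(R+1)..R+1} x" for x
      by (auto simp: indicator_def)
    then show "integrable lborel (\<lambda>x. ((2 * L) * indicat_real {-(R+1)..R+1} x)\<^sup>2)"
      by (simp add: emeasure_lborel_Icc_eq)
    show "AE x in lborel. cmod (f n x - g x) \<le> (2 * L) * indicat_real {-(R+1)..R+1} x" for n
    proof (rule AE_I2)
      fix x
      show "cmod (f n x - g x) \<le> (2 * L) * indicat_real {-(R+1)..R+1} x"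
      proof (cases "\<bar>x\<bar> > R + 1")
        case True
        then show ?thesis using f0[of x n] g0[of x] L by simp
      next
        case False
        have "cmod (f n x - g x) \<le> L + L"
          using norm_triangle_ineq4[of "f n x" "g x"] fb[of n x] g(2)[of x] L by linarith
        moreover have "x \<in> {-(R+1)..R+1}" using False by auto
        ultimately show ?thesis by simp
      qed
    qed
    have "AE x in lebesgue. x \<notin> N"
      using N by (simp add: negligible_iff_null_sets AE_not_in)
    then have "AE x in lborel. x \<notin> N"
      by (simp add: AE_completion_iff)
    then show "AE x in lborel. (\<lambda>n. f n x) \<longlonglongrightarrow> g x"
    proof eventually_elim
      case (elim x)
      have "isCont clip (g x)"
        using clip_c by (auto simp: continuous_on_eq_continuous_at)
      from isCont_tendsto_compose[OF this hl[OF elim]]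
      have "(\<lambda>n. clip (h n x)) \<longlonglongrightarrow> g x"
        unfolding clip_id[OF g(2)] .
      then have *: "(\<lambda>n. f n x) \<longlonglongrightarrow> cut x * g x"
        unfolding f_def by (intro tendsto_mult tendsto_const)
      have "cut x * g x = g x"
        using g(3)[of x] by (cases "\<bar>x\<bar> > R") (auto simp: cut_def)
      with * show ?case by simp
    qed
  qed
  have d0: "\<bar>x\<bar> > R + 1 \<Longrightarrow> f m x - f n x = 0" for m n x
    using f0[of x m] f0[of x n] by simp
  note iso = Plancherel_continuous[OF fc f0]
  note isod = Plancherel_continuous(2)[OF continuous_on_diff[OF fc fc] d0]
  show "sqi lborel (ft g)" "L2n lborel (ft g) = L2n lborel g"
    by (rule Plancherel_closure[OF fs f0 gs g0 lim iso isod]; assumption)+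
qed

text \<open>Unbounded values are cut off: the approximants keep \<open>g\<close> where its modulus
  is at most \<open>n\<close> and vanish elsewhere, so the errors are dominated by \<open>g\<close>
  itself.\<close>

lemma Plancherel_compact:
  assumes g: "sqi lborel g" "\<And>x. \<bar>x\<bar> > R \<Longrightarrow> g x = 0"
  shows "sqi lborel (ft g)" "L2n lborel (ft g) = L2n lborel g"
proof -
  note [measurable] = sqi_measurable[OF g(1)]
  define f where "f n x = (if cmod (g x) \<le> real n then g x else 0)" for n x
  have fm [measurable]: "f n \<in> borel_measurable lborel" for n
    unfolding f_def[abs_def] by measurable
  have fb: "cmod (f n x) \<le> real n" for n x by (auto simp: f_def)
  have f0: "\<bar>x\<bar> > R \<Longrightarrow> f n x = 0" for n x using g(2)[of x] by (auto simp: f_def)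
  have fs: "sqi lborel (f n)" for n
    by (rule sqi_compact_bounded[OF fm fb f0])
  have lim: "(\<lambda>n. L2n lborel (\<lambda>x. f n x - g x)) \<longlonglongrightarrow> 0"
  proof (rule L2_dominated[OF fm sqi_measurable[OF g(1)] sqi_integrable[OF g(1)]])
    show "AE x in lborel. cmod (f n x - g x) \<le> cmod (g x)" for n
      by (auto simp: f_def)
    have "(\<lambda>n. f n x) \<longlonglongrightarrow> g x" for x
    proof (rule tendsto_eventually)
      obtain n0 :: nat where "cmod (g x) \<le> real n0" using real_arch_simple by blast
      then have "f n x = g x" if "n \<ge> n0" for n
        using that by (auto simp: f_def)
      then show "\<forall>\<^sub>F n in sequentially. f n x = g x"
        unfolding eventually_sequentially by blast
    qed
    then show "AE x in lborel. (\<lambda>n. f n x) \<longlonglongrightarrow> g x" by simp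
  qed
  have db: "cmod (f m x - f n x) \<le> real m + real n" for m n x
    using norm_triangle_ineq4[of "f m x" "f n x"] fb[of m x] fb[of n x] by linarith
  have d0: "\<bar>x\<bar> > R \<Longrightarrow> f m x - f n x = 0" for m n x
    using f0[of x m] f0[of x n] by simp
  note iso = Plancherel_bounded[OF fm fb f0]
  note isod = Plancherel_bounded(2)[OF borel_measurable_diff[OF fm fm] db d0]
  show "sqi lborel (ft g)" "L2n lborel (ft g) = L2n lborel g"
    by (rule Plancherel_closure[OF fs f0 g lim iso isod]; assumption)+
qed

section \<open>Extension of the transform to L2\<close>

definition trunc :: "real \<Rightarrow> (real \<Rightarrow> complex) \<Rightarrow> real \<Rightarrow> complex" where
  "trunc R h x = indicator {-R..R} x * h x"

lemma trunc_sqi: "sqi lborel h \<Longrightarrow> sqi lborel (trunc R h)"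
  unfolding trunc_def[abs_def]
  by (rule sqi_mult_bounded[where K=1]) (auto simp: indicator_def)

lemma trunc_0: "\<bar>x\<bar> > \<bar>R\<bar> \<Longrightarrow> trunc R h x = 0"
  by (auto simp: trunc_def indicator_def)

lemma trunc_integrable: "sqi lborel h \<Longrightarrow> integrable lborel (trunc R h)"
  by (rule L2n_compact_integral(1)[OF trunc_sqi trunc_0])

lemma trunc_tendsto: "((\<lambda>R. trunc R h x) \<longlongrightarrow> h x) at_top"
proof (rule tendsto_eventually)
  show "\<forall>\<^sub>F R in at_top. trunc R h x = h x"
    using eventually_ge_at_top[of "\<bar>x\<bar>"]
    by eventually_elim (auto simp: trunc_def indicator_def)
qed

lemma trunc_L2: "sqi lborel h \<Longrightarrow> ((\<lambda>R. L2n lborel (\<lambda>x. trunc R h x - h x)) \<longlongrightarrow> 0) at_top"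
proof (rule tendsto_at_topI_sequentially)
  fix X :: "nat \<Rightarrow> real" assume h: "sqi lborel h" and X: "filterlim X at_top sequentially"
  show "(\<lambda>n. L2n lborel (\<lambda>x. trunc (X n) h x - h x)) \<longlonglongrightarrow> 0"
  proof (rule L2_dominated[OF sqi_measurable[OF trunc_sqi[OF h]] sqi_measurable[OF h] sqi_integrable[OF h]])
    show "AE x in lborel. cmod (trunc (X n) h x - h x) \<le> cmod (h x)" for n
      by (auto simp: trunc_def indicator_def)
    show "AE x in lborel. (\<lambda>n. trunc (X n) h x) \<longlonglongrightarrow> h x"
      by (intro AE_I2 filterlim_compose[OF trunc_tendsto X])
  qed
qed

lemma ft_trunc:
  assumes "sqi lborel h"
  shows "sqi lborel (ft (trunc R h))" "L2n lborel (ft (trunc R h)) = L2n lborel (trunc R h)"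
  using Plancherel_compact[OF trunc_sqi[OF assms] trunc_0] by auto

lemma ft_trunc_diff:
  assumes h: "sqi lborel h"
  shows "L2n lborel (\<lambda>k. ft (trunc R h) k - ft (trunc S h) k)
    \<le> L2n lborel (\<lambda>x. trunc R h x - h x) + L2n lborel (\<lambda>x. trunc S h x - h x)"
proof -
  have z: "\<bar>x\<bar> > max \<bar>R\<bar> \<bar>S\<bar> \<Longrightarrow> trunc R h x - trunc S h x = 0" for x
    using trunc_0[of R x h] trunc_0[of S x h] by simp
  have "L2n lborel (\<lambda>k. ft (trunc R h) k - ft (trunc S h) k) = L2n lborel (ft (\<lambda>x. trunc R h x - trunc S h x))"
    by (intro L2n_cong) (simp add: ft_diff[OF trunc_integrable[OF h] trunc_integrable[OF h]])
  also have "\<dots> = L2n lborel (\<lambda>x. trunc R h x - trunc S h x)"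
    by (rule Plancherel_compact(2)[OF sqi_diff[OF trunc_sqi[OF h] trunc_sqi[OF h]] z])
  also have "\<dots> \<le> L2n lborel (\<lambda>x. trunc R h x - h x) + L2n lborel (\<lambda>x. h x - trunc S h x)"
    by (rule L2n_triangle3[OF trunc_sqi[OF h] h trunc_sqi[OF h]])
  finally show ?thesis
    unfolding L2n_minus_commute[of lborel h "trunc S h"] .
qed

text \<open>The Borel, complex-valued counterpart of \<open>is_fourier\<close>. For square
  integrable differences the \<open>L2n\<close> distance and the nonnegative integral carry the same
  information, which \<open>is_fourier_iff\<close> makes precise.\<close>

definition is_FT :: "(real \<Rightarrow> complex) \<Rightarrow> (real \<Rightarrow> complex) \<Rightarrow> bool" where
  "is_FT h F \<longleftrightarrow> sqi lborel F \<and> ((\<lambda>R. L2n lborel (\<lambda>k. ft (trunc R h) k - F k)) \<longlongrightarrow> 0) at_top"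

definition FT :: "(real \<Rightarrow> complex) \<Rightarrow> real \<Rightarrow> complex" where
  "FT h = (SOME F. is_FT h F)"

lemma is_FT_ex:
  assumes h: "sqi lborel h" shows "\<exists>F. is_FT h F"
proof -
  let ?t = "\<lambda>R. L2n lborel (\<lambda>x. trunc R h x - h x)"
  have tl: "(\<lambda>n. ?t (real n)) \<longlonglongrightarrow> 0"
    by (rule filterlim_compose[OF trunc_L2[OF h] filterlim_real_sequentially])
  have cau: "\<exists>N. \<forall>m\<ge>N. \<forall>n\<ge>N. L2n lborel (\<lambda>k. ft (trunc (real m) h) k - ft (trunc (real n) h) k) < e" if "0 < e" for e
  proof -
    have "eventually (\<lambda>n. ?t (real n) < e / 2) sequentially"
      by (rule order_tendstoD(2)[OF tl]) (use that in simp)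
    then obtain N where N: "\<And>n. n \<ge> N \<Longrightarrow> ?t (real n) < e / 2"
      by (auto simp: eventually_sequentially)
    show ?thesis
    proof (intro exI allI impI)
      fix m n assume "N \<le> m" "N \<le> n"
      show "L2n lborel (\<lambda>k. ft (trunc (real m) h) k - ft (trunc (real n) h) k) < e"
        using ft_trunc_diff[OF h, of "real m" "real n"] N[OF \<open>N \<le> m\<close>] N[OF \<open>N \<le> n\<close>] by linarith
    qed
  qed
  obtain v r where v: "sqi lborel v" "(\<lambda>n. L2n lborel (\<lambda>x. ft (trunc (real n) h) x - v x)) \<longlonglongrightarrow> 0"
    "strict_mono (r :: nat \<Rightarrow> nat)" "AE x in lborel. (\<lambda>n. ft (trunc (real (r n)) h) x) \<longlonglongrightarrow> v x"
    by (rule L2_Cauchy[OF ft_trunc(1)[OF h] cau])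
  \<comment> \<open>The limit \<open>v\<close> was formed along integer cutoffs; letting the integer
    cutoff tend to infinity in the triangle inequality controls every real cutoff
    \<open>R\<close>.\<close>
  have "L2n lborel (\<lambda>k. ft (trunc R h) k - v k) \<le> ?t R" for R
  proof (rule LIMSEQ_le_const)
    show "(\<lambda>n. ?t R + ?t (real n) + L2n lborel (\<lambda>x. ft (trunc (real n) h) x - v x)) \<longlonglongrightarrow> ?t R"
      using tendsto_add[OF tendsto_add[OF tendsto_const[of "?t R"] tl] v(2)] by simp
    have "L2n lborel (\<lambda>k. ft (trunc R h) k - v k) \<le> ?t R + ?t (real n) + L2n lborel (\<lambda>x. ft (trunc (real n) h) x - v x)" for n
      using L2n_triangle3[OF ft_trunc(1)[OF h] ft_trunc(1)[OF h] v(1), of R "real n"] ft_trunc_diff[OF h, of R "real n"]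
      by linarith
    then show "\<exists>N. \<forall>n\<ge>N. L2n lborel (\<lambda>k. ft (trunc R h) k - v k) \<le> ?t R + ?t (real n) + L2n lborel (\<lambda>x. ft (trunc (real n) h) x - v x)"
      by blast
  qed
  then have "((\<lambda>R. L2n lborel (\<lambda>k. ft (trunc R h) k - v k)) \<longlongrightarrow> 0) at_top"
    by (intro tendsto_sandwich[OF always_eventually[OF allI[OF L2n_nonneg]] always_eventually[OF allI] tendsto_const trunc_L2[OF h]])
  with v(1) show ?thesis unfolding is_FT_def by blast
qed

lemma FT_is_FT: "sqi lborel h \<Longrightarrow> is_FT h (FT h)"
  unfolding FT_def by (rule someI_ex[OF is_FT_ex])

lemma FT_sqi: "sqi lborel h \<Longrightarrow> sqi lborel (FT h)"
  using FT_is_FT by (simp add: is_FT_def)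

lemma FT_lim: "sqi lborel h \<Longrightarrow> ((\<lambda>R. L2n lborel (\<lambda>k. ft (trunc R h) k - FT h k)) \<longlongrightarrow> 0) at_top"
  using FT_is_FT by (simp add: is_FT_def)

lemma is_FT_unique:
  assumes h: "sqi lborel h" and F: "is_FT h F" "is_FT h G"
  shows "AE k in lborel. F k = G k"
proof (rule L2n_unique[of lborel "\<lambda>R. ft (trunc R h)" F G at_top])
  show "\<And>R. sqi lborel (ft (trunc R h))" by (rule ft_trunc(1)[OF h])
qed (use F in \<open>auto simp: is_FT_def\<close>)

lemma FT_unique: "sqi lborel h \<Longrightarrow> is_FT h F \<Longrightarrow> AE k in lborel. FT h k = F k"
  by (rule is_FT_unique[OF _ FT_is_FT])

lemma FT_norm: assumes h: "sqi lborel h" shows "L2n lborel (FT h) = L2n lborel h"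
proof -
  have "((\<lambda>R. L2n lborel (ft (trunc R h))) \<longlongrightarrow> L2n lborel (FT h)) at_top"
    by (rule L2n_tendsto[OF ft_trunc(1)[OF h] FT_sqi[OF h] FT_lim[OF h]])
  moreover have "((\<lambda>R. L2n lborel (ft (trunc R h))) \<longlongrightarrow> L2n lborel h) at_top"
    unfolding ft_trunc(2)[OF h] by (rule L2n_tendsto[OF trunc_sqi[OF h] h trunc_L2[OF h]])
  ultimately show ?thesis by (rule tendsto_unique[OF trivial_limit_at_top_linorder])
qed

lemma ft_lincomb:
  assumes "integrable lborel f" "integrable lborel g"
  shows "ft (\<lambda>x. a * f x + b * g x) k = a * ft f k + b * ft g k"
proof -
  have "(\<lambda>x. (a * f x + b * g x) * exp (- (\<i> * complex_of_real (k * x))))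
      = (\<lambda>x. a * (f x * exp (- (\<i> * complex_of_real (k * x)))) + b * (g x * exp (- (\<i> * complex_of_real (k * x)))))"
    by (simp add: algebra_simps)
  then show ?thesis
    unfolding ft_def
    by (simp only: Bochner_Integration.integral_add[OF integrable_mult_right[OF ft_integrable[OF assms(1)]]
        integrable_mult_right[OF ft_integrable[OF assms(2)]]] integral_mult_right_zero)
       (simp add: algebra_simps)
qed

lemma FT_lincomb:
  assumes f: "sqi lborel f" and g: "sqi lborel g"
  shows "AE k in lborel. FT (\<lambda>x. a * f x + b * g x) k = a * FT f k + b * FT g k"
proof (rule FT_unique)
  show s: "sqi lborel (\<lambda>x. a * f x + b * g x)"
    by (intro sqi_add sqi_cmult f g)
  show "is_FT (\<lambda>x. a * f x + b * g x) (\<lambda>k. a * FT f k + b * FT g k)"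
    unfolding is_FT_def
  proof
    show "sqi lborel (\<lambda>k. a * FT f k + b * FT g k)"
      by (intro sqi_add sqi_cmult FT_sqi f g)
    let ?b = "\<lambda>R. cmod a * L2n lborel (\<lambda>k. ft (trunc R f) k - FT f k) + cmod b * L2n lborel (\<lambda>k. ft (trunc R g) k - FT g k)"
    have "(?b \<longlongrightarrow> cmod a * 0 + cmod b * 0) at_top"
      by (intro tendsto_add tendsto_mult tendsto_const FT_lim f g)
    then have lim: "(?b \<longlongrightarrow> 0) at_top" by simp
    have b: "L2n lborel (\<lambda>k. ft (trunc R (\<lambda>x. a * f x + b * g x)) k - (a * FT f k + b * FT g k)) \<le> ?b R" for R
    proof -
      have "trunc R (\<lambda>x. a * f x + b * g x) = (\<lambda>x. a * trunc R f x + b * trunc R g x)"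
        by (auto simp: trunc_def algebra_simps)
      then have "ft (trunc R (\<lambda>x. a * f x + b * g x)) k - (a * FT f k + b * FT g k)
          = a * (ft (trunc R f) k - FT f k) + b * (ft (trunc R g) k - FT g k)" for k
        by (simp add: ft_lincomb[OF trunc_integrable[OF f] trunc_integrable[OF g]] algebra_simps)
      then have "L2n lborel (\<lambda>k. ft (trunc R (\<lambda>x. a * f x + b * g x)) k - (a * FT f k + b * FT g k))
          = L2n lborel (\<lambda>k. a * (ft (trunc R f) k - FT f k) + b * (ft (trunc R g) k - FT g k))"
        by simp
      also have "\<dots> \<le> L2n lborel (\<lambda>k. a * (ft (trunc R f) k - FT f k)) + L2n lborel (\<lambda>k. b * (ft (trunc R g) k - FT g k))"
        by (rule L2n_triangle) (intro sqi_cmult sqi_diff ft_trunc FT_sqi f g)+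
      finally show ?thesis by (simp add: L2n_cmult)
    qed
    show "((\<lambda>R. L2n lborel (\<lambda>k. ft (trunc R (\<lambda>x. a * f x + b * g x)) k - (a * FT f k + b * FT g k))) \<longlongrightarrow> 0) at_top"
      by (rule tendsto_sandwich[OF always_eventually[OF allI[OF L2n_nonneg]] always_eventually[OF allI[OF b]] tendsto_const lim])
  qed
qed

text \<open>The truncated integrals converge at every point by dominated convergence, while a
  subsequence converges almost everywhere to the L2 limit.\<close>

lemma FT_ft:
  assumes h: "sqi lborel h" "integrable lborel h"
  shows "AE k in lborel. FT h k = ft h k"
proof -
  have pt: "(\<lambda>n. ft (trunc (X n) h) k) \<longlonglongrightarrow> ft h k" if X: "filterlim X at_top sequentially" for X k
    unfolding ft_def
  proof (intro tendsto_mult tendsto_const integral_dominated_convergence)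
    show "integrable lborel (\<lambda>x. cmod (h x))" using h by simp
    show "AE x in lborel. (\<lambda>n. trunc (X n) h x * exp (- (\<i> * complex_of_real (k * x)))) \<longlonglongrightarrow> h x * exp (- (\<i> * complex_of_real (k * x)))"
      by (intro AE_I2 tendsto_mult tendsto_const filterlim_compose[OF trunc_tendsto X])
    show "AE x in lborel. norm (trunc (X n) h x * exp (- (\<i> * complex_of_real (k * x)))) \<le> cmod (h x)" for n
      by (intro AE_I2) (auto simp: norm_mult trunc_def indicator_def)
  qed (use sqi_measurable[OF h(1)] sqi_measurable[OF trunc_sqi[OF h(1)]] in measurable)
  have l: "(\<lambda>n. L2n lborel (\<lambda>k. ft (trunc (real n) h) k - FT h k)) \<longlonglongrightarrow> 0"
    by (rule filterlim_compose[OF FT_lim[OF h(1)] filterlim_real_sequentially])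
  have cau: "\<exists>N. \<forall>m\<ge>N. \<forall>n\<ge>N. L2n lborel (\<lambda>k. ft (trunc (real m) h) k - ft (trunc (real n) h) k) < e" if "0 < e" for e
  proof -
    have "eventually (\<lambda>n. L2n lborel (\<lambda>k. ft (trunc (real n) h) k - FT h k) < e / 2) sequentially"
      by (rule order_tendstoD(2)[OF l]) (use that in simp)
    then obtain N where N: "\<And>n. n \<ge> N \<Longrightarrow> L2n lborel (\<lambda>k. ft (trunc (real n) h) k - FT h k) < e / 2"
      by (auto simp: eventually_sequentially)
    show ?thesis
    proof (intro exI allI impI)
      fix m n assume mn: "N \<le> m" "N \<le> n"
      show "L2n lborel (\<lambda>k. ft (trunc (real m) h) k - ft (trunc (real n) h) k) < e"
        using L2n_triangle3[OF ft_trunc(1)[OF h(1)] FT_sqi[OF h(1)] ft_trunc(1)[OF h(1)], of "real m" "real n"]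
          N[OF mn(1)] N[OF mn(2)] L2n_minus_commute[of lborel "FT h" "ft (trunc (real n) h)"] by linarith
    qed
  qed
  obtain v r where v: "sqi lborel v" "(\<lambda>n. L2n lborel (\<lambda>x. ft (trunc (real n) h) x - v x)) \<longlonglongrightarrow> 0"
    "strict_mono (r :: nat \<Rightarrow> nat)" "AE x in lborel. (\<lambda>n. ft (trunc (real (r n)) h) x) \<longlonglongrightarrow> v x"
    by (rule L2_Cauchy[OF ft_trunc(1)[OF h(1)] cau])
  have X: "filterlim (\<lambda>n. real (r n)) at_top sequentially"
    by (rule filterlim_compose[OF filterlim_real_sequentially filterlim_subseq[OF v(3)]])
  have "AE k in lborel. FT h k = v k"
    by (rule L2n_unique[OF ft_trunc(1)[OF h(1)] FT_sqi[OF h(1)] v(1) sequentially_bot l v(2)])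
  then show ?thesis
    using v(4)
  proof eventually_elim
    case (elim k)
    from LIMSEQ_unique[OF elim(2) pt[OF X]] elim(1) show ?case by simp
  qed
qed

section \<open>Parseval's identity, symmetries and inversion\<close>

lemma L2n_add_sq:
  assumes f: "sqi M f" and g: "sqi M g"
  shows "(L2n M (\<lambda>x. f x + g x))\<^sup>2 = (L2n M f)\<^sup>2 + (L2n M g)\<^sup>2 + 2 * Re (LINT x|M. f x * cnj (g x))"
proof -
  note i = sqi_mult_integrable(1)[OF f sqi_cnj[OF g]]
  have "(cmod (f x + g x))\<^sup>2 = (cmod (f x))\<^sup>2 + (cmod (g x))\<^sup>2 + 2 * Re (f x * cnj (g x))" for x
    unfolding cmod_power2 by (simp add: power2_eq_square algebra_simps)
  then have "(L2n M (\<lambda>x. f x + g x))\<^sup>2 = (LINT x|M. (cmod (f x))\<^sup>2 + (cmod (g x))\<^sup>2 + 2 * Re (f x * cnj (g x)))"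
    unfolding L2n_sq by presburger
  also have "\<dots> = (LINT x|M. (cmod (f x))\<^sup>2) + (LINT x|M. (cmod (g x))\<^sup>2) + (LINT x|M. 2 * Re (f x * cnj (g x)))"
    using sqi_integrable[OF f] sqi_integrable[OF g] integrable_Re[OF i]
    by (simp only: Bochner_Integration.integral_add Bochner_Integration.integrable_add integrable_mult_right)
  also have "(LINT x|M. 2 * Re (f x * cnj (g x))) = 2 * Re (LINT x|M. f x * cnj (g x))"
    unfolding integral_mult_right_zero integral_Re[OF i] ..
  finally show ?thesis unfolding L2n_sq .
qed

text \<open>Polarization of the isometry: \<open>b = 1\<close> recovers the real part and
  \<open>b = \<i>\<close> the imaginary part.\<close>

lemma Parseval:
  assumes f: "sqi lborel f" and g: "sqi lborel g"
  shows "(LINT k|lborel. FT f k * cnj (FT g k)) = (LINT x|lborel. f x * cnj (g x))"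
proof -
  have *: "Re (LINT k|lborel. FT f k * cnj (b * FT g k)) = Re (LINT x|lborel. f x * cnj (b * g x))" if "cmod b = 1" for b
  proof -
    have "L2n lborel (\<lambda>k. FT f k + b * FT g k) = L2n lborel (FT (\<lambda>x. 1 * f x + b * g x))"
    proof (rule L2n_cong_AE)
      show "AE k in lborel. cmod (FT f k + b * FT g k) = cmod (FT (\<lambda>x. 1 * f x + b * g x) k)"
        using FT_lincomb[OF f g, of 1 b] by eventually_elim simp
    qed (use sqi_measurable[OF FT_sqi[OF f]] sqi_measurable[OF FT_sqi[OF g]]
          sqi_measurable[OF FT_sqi[OF sqi_add[OF sqi_cmult[OF f] sqi_cmult[OF g]]]] in measurable)
    also have "\<dots> = L2n lborel (\<lambda>x. f x + b * g x)"
      using FT_norm[OF sqi_add[OF sqi_cmult[OF f, of 1] sqi_cmult[OF g, of b]]] by simp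
    finally show ?thesis
      using L2n_add_sq[OF FT_sqi[OF f] sqi_cmult[OF FT_sqi[OF g], of b]]
        L2n_add_sq[OF f sqi_cmult[OF g, of b]] FT_norm[OF f] FT_norm[OF g]
      by (simp only: L2n_cmult that)
  qed
  have "Re (LINT k|lborel. FT f k * cnj (FT g k)) = Re (LINT x|lborel. f x * cnj (g x))"
    using *[of 1] by simp
  moreover have "Im (LINT k|lborel. FT f k * cnj (FT g k)) = Im (LINT x|lborel. f x * cnj (g x))"
  proof -
    have "Re (LINT x|lborel. F x * cnj (\<i> * G x)) = Im (LINT x|lborel. F x * cnj (G x))" for F G :: "real \<Rightarrow> complex"
    proof -
      have "F x * cnj (\<i> * G x) = - \<i> * (F x * cnj (G x))" for x by simp
      then have "(LINT x|lborel. F x * cnj (\<i> * G x)) = - \<i> * (LINT x|lborel. F x * cnj (G x))"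
        by (simp only: integral_mult_right_zero)
      then show ?thesis by simp
    qed
    then show ?thesis using *[of \<i>] by simp
  qed
  ultimately show ?thesis by (simp add: complex_eq_iff)
qed

lemma FT_mult:
  assumes f: "sqi lborel f" and g: "sqi lborel g"
  shows "(LINT k|lborel. FT f k * g k) = (LINT x|lborel. f x * FT g x)"
proof -
  have "((\<lambda>R. LINT k|lborel. ft (trunc R f) k * trunc R g k) \<longlongrightarrow> (LINT k|lborel. FT f k * g k)) at_top"
    by (rule inner_tendsto[OF ft_trunc(1)[OF f] FT_sqi[OF f] trunc_sqi[OF g] g FT_lim[OF f] trunc_L2[OF g]])
  moreover have "((\<lambda>R. LINT k|lborel. trunc R f k * ft (trunc R g) k) \<longlongrightarrow> (LINT k|lborel. f k * FT g k)) at_top"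
    by (rule inner_tendsto[OF trunc_sqi[OF f] f ft_trunc(1)[OF g] FT_sqi[OF g] trunc_L2[OF f] FT_lim[OF g]])
  moreover have "(LINT k|lborel. ft (trunc R f) k * trunc R g k) = (LINT k|lborel. trunc R f k * ft (trunc R g) k)" for R
    by (rule ft_mult[OF trunc_integrable[OF f] trunc_integrable[OF g]])
  ultimately show ?thesis
    by (simp only: tendsto_unique[OF trivial_limit_at_top_linorder])
qed

lemma FT_reflect:
  assumes h: "sqi lborel h"
  shows "AE k in lborel. FT (\<lambda>x. h (- x)) k = FT h (- k)"
proof (rule FT_unique[OF sqi_uminus_arg[OF h]])
  have "ft (trunc R (\<lambda>x. h (- x))) k = ft (trunc R h) (- k)" for R k
  proof -
    have "(LINT x|lborel. trunc R (\<lambda>x. h (- x)) x * exp (- (\<i> * complex_of_real (k * x))))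
        = (LINT x|lborel. trunc R (\<lambda>x. h (- x)) (- x) * exp (- (\<i> * complex_of_real (k * (- x)))))"
      by (rule integral_lborel_uminus[symmetric])
    also have "\<dots> = (LINT x|lborel. trunc R h x * exp (- (\<i> * complex_of_real (- k * x))))"
      by (intro Bochner_Integration.integral_cong refl) (auto simp: trunc_def indicator_def)
    finally show ?thesis by (simp add: ft_def)
  qed
  then show "is_FT (\<lambda>x. h (- x)) (\<lambda>k. FT h (- k))"
    unfolding is_FT_def using FT_lim[OF h] sqi_uminus_arg[OF FT_sqi[OF h]]
      L2n_uminus_arg[of "\<lambda>k. ft (trunc _ h) k - FT h k"] by simp
qed

lemma FT_cnj:
  assumes h: "sqi lborel h"
  shows "AE k in lborel. FT (\<lambda>x. cnj (h x)) k = cnj (FT h (- k))"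
proof (rule FT_unique[OF sqi_cnj[OF h]])
  have ft: "ft (trunc R (\<lambda>x. cnj (h x))) k = cnj (ft (trunc R h) (- k))" for R k
  proof -
    have "trunc R (\<lambda>x. cnj (h x)) x * exp (- (\<i> * complex_of_real (k * x)))
        = cnj (trunc R h x * exp (- (\<i> * complex_of_real (- k * x))))" for x
      by (auto simp: trunc_def indicator_def exp_cnj)
    then show ?thesis
      unfolding ft_def by (simp only: Bochner_Integration.integral_cnj) simp
  qed
  have "L2n lborel (\<lambda>k. cnj (ft (trunc R h) (- k)) - cnj (FT h (- k))) = L2n lborel (\<lambda>k. ft (trunc R h) k - FT h k)" for R
  proof -
    have "L2n lborel (\<lambda>k. cnj (ft (trunc R h) (- k)) - cnj (FT h (- k))) = L2n lborel (\<lambda>k. ft (trunc R h) (- k) - FT h (- k))"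
      by (rule L2n_cong) (simp flip: complex_cnj_diff)
    also have "\<dots> = L2n lborel (\<lambda>k. ft (trunc R h) k - FT h k)"
      by (rule L2n_uminus_arg[of "\<lambda>k. ft (trunc R h) k - FT h k"])
    finally show ?thesis .
  qed
  then show "is_FT (\<lambda>x. cnj (h x)) (\<lambda>k. cnj (FT h (- k)))"
    unfolding is_FT_def ft using FT_lim[OF h] sqi_cnj[OF sqi_uminus_arg[OF FT_sqi[OF h]]] by simp
qed

text \<open>Tested against \<open>\<phi>\<close>, the outer transform moves to \<open>\<phi>\<close>
  by \<open>FT_mult\<close>, and Parseval removes the remaining pair of transforms. Testing with the
  conjugate of the difference \<open>D\<close> itself then shows that \<open>D\<close>
  vanishes.\<close>

lemma FT_FT:
  assumes g: "sqi lborel g"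
  shows "AE x in lborel. FT (FT g) x = g (- x)"
proof -
  have key: "(LINT x|lborel. FT (FT g) x * \<phi> x) = (LINT x|lborel. g (- x) * \<phi> x)" if p: "sqi lborel \<phi>" for \<phi>
  proof -
    \<comment> \<open>Conjugation and reflection are chosen so that the transform of
      \<open>\<phi>\<close> is the conjugate of that of \<open>\<psi>\<close>, which gives the
      pairing the form required by Parseval.\<close>
    define \<psi> where "\<psi> x = cnj (\<phi> (- x))" for x
    have ps: "sqi lborel \<psi>" unfolding \<psi>_def[abs_def] by (intro sqi_cnj sqi_uminus_arg p)
    have ae: "AE k in lborel. FT \<phi> k = cnj (FT \<psi> k)"
    proof -
      have "AE k in lborel. FT (\<lambda>x. cnj (\<psi> x)) (- k) = cnj (FT \<psi> (- (- k)))"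
        by (rule AE_lborel_uminus[OF FT_cnj[OF ps]])
      moreover have "AE k in lborel. FT (\<lambda>x. \<phi> (- x)) (- k) = FT \<phi> (- (- k))"
        by (rule AE_lborel_uminus[OF FT_reflect[OF p]])
      ultimately show ?thesis
        by eventually_elim (simp add: \<psi>_def)
    qed
    have "(LINT x|lborel. FT (FT g) x * \<phi> x) = (LINT k|lborel. FT g k * FT \<phi> k)"
      by (rule FT_mult[OF FT_sqi[OF g] p])
    also have "\<dots> = (LINT k|lborel. FT g k * cnj (FT \<psi> k))"
      by (rule integral_cong_AE)
         (use ae sqi_measurable[OF FT_sqi[OF g]] sqi_measurable[OF FT_sqi[OF p]] sqi_measurable[OF FT_sqi[OF ps]] in auto)
    also have "\<dots> = (LINT x|lborel. g x * cnj (\<psi> x))"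
      by (rule Parseval[OF g ps])
    also have "\<dots> = (LINT x|lborel. g (- x) * cnj (\<psi> (- x)))"
      by (rule integral_lborel_uminus[symmetric])
    finally show ?thesis by (simp add: \<psi>_def)
  qed
  define D where "D x = FT (FT g) x - g (- x)" for x
  have D: "sqi lborel D"
    unfolding D_def[abs_def] by (intro sqi_diff FT_sqi sqi_uminus_arg g)
  note i1 = sqi_mult_integrable(1)[OF FT_sqi[OF FT_sqi[OF g]] sqi_cnj[OF D]]
  note i2 = sqi_mult_integrable(1)[OF sqi_uminus_arg[OF g] sqi_cnj[OF D]]
  have "(LINT x|lborel. D x * cnj (D x)) = (LINT x|lborel. FT (FT g) x * cnj (D x) - g (- x) * cnj (D x))"
    by (intro Bochner_Integration.integral_cong refl) (simp add: D_def algebra_simps)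
  also have "\<dots> = 0"
    unfolding Bochner_Integration.integral_diff[OF i1 i2] using key[OF sqi_cnj[OF D]] by simp
  finally have "complex_of_real ((L2n lborel D)\<^sup>2) = 0"
    unfolding L2n_sq integral_complex_of_real[symmetric] complex_norm_square .
  then have "L2n lborel D = 0" by simp
  from L2n_eq_0[OF D this] show ?thesis by (auto simp: D_def)
qed

section \<open>Transforms of products\<close>

lemma L2_subseq:
  assumes u: "\<And>n. sqi M (u n)" and v: "sqi M v" and l: "(\<lambda>n. L2n M (\<lambda>x. u n x - v x)) \<longlonglongrightarrow> 0"
  obtains r where "strict_mono (r :: nat \<Rightarrow> nat)" "AE x in M. (\<lambda>n. u (r n) x) \<longlonglongrightarrow> v x"
proof -
  have cau: "\<exists>N. \<forall>m\<ge>N. \<forall>n\<ge>N. L2n M (\<lambda>x. u m x - u n x) < e" if "0 < e" for e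
  proof -
    have "eventually (\<lambda>n. L2n M (\<lambda>x. u n x - v x) < e / 2) sequentially"
      by (rule order_tendstoD(2)[OF l]) (use that in simp)
    then obtain N where N: "\<And>n. n \<ge> N \<Longrightarrow> L2n M (\<lambda>x. u n x - v x) < e / 2"
      by (auto simp: eventually_sequentially)
    show ?thesis
    proof (intro exI allI impI)
      fix m n assume mn: "N \<le> m" "N \<le> n"
      show "L2n M (\<lambda>x. u m x - u n x) < e"
        using L2n_triangle3[OF u v u, of m n] N[OF mn(1)] N[OF mn(2)] L2n_minus_commute[of M v "u n"] by linarith
    qed
  qed
  obtain w r where w: "sqi M w" "(\<lambda>n. L2n M (\<lambda>x. u n x - w x)) \<longlonglongrightarrow> 0"
    "strict_mono (r :: nat \<Rightarrow> nat)" "AE x in M. (\<lambda>n. u (r n) x) \<longlonglongrightarrow> w x"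
    by (rule L2_Cauchy[OF u cau])
  have "AE x in M. v x = w x"
    by (rule L2n_unique[OF u v w(1) sequentially_bot l w(2)])
  then have "AE x in M. (\<lambda>n. u (r n) x) \<longlonglongrightarrow> v x"
    using w(4) by eventually_elim simp
  with w(3) show thesis by (rule that)
qed

lemma AE_lborel_shift:
  assumes "AE x in lborel. P (x::real)"
  shows "AE x in lborel. P (t + x)"
proof -
  have "AE x in distr lborel borel ((+) t). P x"
    using assms by (subst lborel_distr_plus)
  then show ?thesis
    by (rule AE_distrD[rotated]) simp
qed

lemma sqi_shift: "sqi lborel (f :: real \<Rightarrow> complex) \<Longrightarrow> sqi lborel (\<lambda>x. f (t + x))"
  unfolding sqi_def using lborel_integrable_real_affine[of "\<lambda>x. (cmod (f x))\<^sup>2" 1 t] by auto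

lemma L2n_shift: "L2n lborel (\<lambda>x::real. f (t + x)) = L2n lborel f"
  unfolding L2n_def using lborel_integral_real_affine[of 1 "\<lambda>x. (cmod (f x))\<^sup>2" t] by simp

lemma FT_modulate:
  assumes h: "sqi lborel h"
  shows "sqi lborel (\<lambda>x. h x * exp (\<i> * complex_of_real (t * x)))"
    and "AE k in lborel. FT (\<lambda>x. h x * exp (\<i> * complex_of_real (t * x))) k = FT h (- t + k)"
proof -
  have e: "cmod (exp (\<i> * complex_of_real (t * x))) \<le> 1" for x
    using norm_exp_i_times[of "t * x"] by simp
  show s: "sqi lborel (\<lambda>x. h x * exp (\<i> * complex_of_real (t * x)))"
  proof -
    have m: "(\<lambda>x. exp (\<i> * complex_of_real (t * x))) \<in> borel_measurable lborel" by measurable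
    show ?thesis using sqi_mult_bounded[OF h m e] by (subst mult.commute)
  qed
  have ft: "ft (trunc R (\<lambda>x. h x * exp (\<i> * complex_of_real (t * x)))) k = ft (trunc R h) (- t + k)" for R k
  proof -
    have "exp (\<i> * complex_of_real (t * x)) * exp (- (\<i> * complex_of_real (k * x))) = exp (- (\<i> * complex_of_real ((- t + k) * x)))" for x
      unfolding exp_add[symmetric] by (intro arg_cong[where f=exp]) (simp add: algebra_simps)
    then have "trunc R (\<lambda>x. h x * exp (\<i> * complex_of_real (t * x))) x * exp (- (\<i> * complex_of_real (k * x)))
        = trunc R h x * exp (- (\<i> * complex_of_real ((- t + k) * x)))" for x
      unfolding trunc_def by (simp only: mult.assoc)
    then show ?thesis by (simp only: ft_def)
  qed
  have "L2n lborel (\<lambda>k. ft (trunc R h) (- t + k) - FT h (- t + k)) = L2n lborel (\<lambda>k. ft (trunc R h) k - FT h k)" for R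
    by (rule L2n_shift[of "\<lambda>k. ft (trunc R h) k - FT h k"])
  then have "is_FT (\<lambda>x. h x * exp (\<i> * complex_of_real (t * x))) (\<lambda>k. FT h (- t + k))"
    unfolding is_FT_def ft using FT_lim[OF h] sqi_shift[OF FT_sqi[OF h], of "- t"] by simp
  then show "AE k in lborel. FT (\<lambda>x. h x * exp (\<i> * complex_of_real (t * x))) k = FT h (- t + k)"
    by (rule FT_unique[OF s])
qed

text \<open>Parseval applied to \<open>f\<close> and the conjugate of \<open>g\<close> modulated
  with frequency \<open>k\<close>; modulation translates the transform. The product is integrable,
  so the formula holds for every \<open>k\<close> and not only almost everywhere.\<close>

lemma ft_prod:
  assumes f: "sqi lborel f" and g: "sqi lborel g"
  shows "ft (\<lambda>x. f x * g x) k = complex_of_real (1 / sqrt (2 * pi)) * (LINT l|lborel. FT f l * FT g (k - l))"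
proof -
  define \<psi> where "\<psi> x = cnj (g x) * exp (\<i> * complex_of_real (k * x))" for x
  have ps: "sqi lborel \<psi>" unfolding \<psi>_def[abs_def] by (rule FT_modulate(1)[OF sqi_cnj[OF g]])
  have "AE l in lborel. FT (\<lambda>x. cnj (g x)) (- k + l) = cnj (FT g (- (- k + l)))"
    by (rule AE_lborel_shift[OF FT_cnj[OF g]])
  then have ae: "AE l in lborel. FT f l * cnj (FT \<psi> l) = FT f l * FT g (k - l)"
    using FT_modulate(2)[OF sqi_cnj[OF g], of k] unfolding \<psi>_def[symmetric, abs_def]
    by eventually_elim simp
  have gm: "(\<lambda>l. FT g (k - l)) \<in> borel_measurable lborel"
    by (rule measurable_compose[OF _ sqi_measurable[OF FT_sqi[OF g]]]) simp
  have "f x * g x * exp (- (\<i> * complex_of_real (k * x))) = f x * cnj (\<psi> x)" for x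
    by (simp add: \<psi>_def exp_cnj)
  then have "ft (\<lambda>x. f x * g x) k = complex_of_real (1 / sqrt (2 * pi)) * (LINT x|lborel. f x * cnj (\<psi> x))"
    by (simp only: ft_def)
  also have "(LINT x|lborel. f x * cnj (\<psi> x)) = (LINT l|lborel. FT f l * cnj (FT \<psi> l))"
    by (rule Parseval[OF f ps, symmetric])
  also have "\<dots> = (LINT l|lborel. FT f l * FT g (k - l))"
    by (rule integral_cong_AE[OF _ _ ae])
       (use gm sqi_measurable[OF FT_sqi[OF f]] sqi_measurable[OF FT_sqi[OF ps]] in auto)
  finally show ?thesis .
qed

lemma conv_integrable:
  fixes F G :: "real \<Rightarrow> complex"
  assumes F: "sqi lborel F" and G: "sqi lborel G"
  shows "integrable lborel (\<lambda>l. F l * G (k - l))"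
proof -
  have "sqi lborel (\<lambda>l. G (k - l))"
    using sqi_uminus_arg[OF sqi_shift[OF G, of k]] by simp
  from sqi_mult_integrable(1)[OF F this] show ?thesis .
qed

text \<open>The factors are approximated by functions with compactly supported transforms, which are bounded.\<close>

lemma sqi_prod:
  assumes f: "sqi lborel f" and g: "sqi lborel g"
    and c: "sqi lborel (\<lambda>k. complex_of_real (LINT l|lborel. cmod (FT f l) * cmod (FT g (k - l))))"
  shows "sqi lborel (\<lambda>x. f x * g x)"
    and "AE k in lborel. FT (\<lambda>x. f x * g x) k = complex_of_real (1 / sqrt (2 * pi)) * (LINT l|lborel. FT f l * FT g (k - l))"
proof -
  have approx: "\<exists>h. (\<forall>n. sqi lborel (h n)) \<and> (\<forall>n. \<exists>K. AE x in lborel. cmod (h n x) \<le> K)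
      \<and> (\<lambda>n. L2n lborel (\<lambda>x. h n x - f x)) \<longlonglongrightarrow> 0
      \<and> (\<forall>n. AE k in lborel. FT (h n) k = trunc (real n) (FT f) k)" if f: "sqi lborel f" for f
  proof -
    define h where "h n x = FT (trunc (real n) (FT f)) (- x)" for n :: nat and x
    have tn: "sqi lborel (trunc (real n) (FT f))" for n :: nat by (rule trunc_sqi[OF FT_sqi[OF f]])
    have hs: "sqi lborel (h n)" for n
      unfolding h_def[abs_def] by (rule sqi_uminus_arg[OF FT_sqi[OF tn]])
    have hb: "\<exists>K. AE x in lborel. cmod (h n x) \<le> K" for n
    proof
      show "AE x in lborel. cmod (h n x) \<le> 1 / sqrt (2 * pi) * (LINT k|lborel. cmod (trunc (real n) (FT f) k))"
        using AE_lborel_uminus[OF FT_ft[OF tn trunc_integrable[OF FT_sqi[OF f]], of n]]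
      proof eventually_elim
        case (elim x)
        show ?case
          using ft_bound[OF trunc_integrable[OF FT_sqi[OF f], of "real n"], of "-x"] unfolding h_def elim .
      qed
    qed
    have hF: "AE k in lborel. FT (h n) k = trunc (real n) (FT f) k" for n
    proof -
      have "AE k in lborel. FT (h n) k = FT (FT (trunc (real n) (FT f))) (- k)"
        unfolding h_def[abs_def] by (rule FT_reflect[OF FT_sqi[OF tn]])
      moreover have "AE k in lborel. FT (FT (trunc (real n) (FT f))) (- k) = trunc (real n) (FT f) (- (- k))"
        by (rule AE_lborel_uminus[OF FT_FT[OF tn]])
      ultimately show ?thesis by eventually_elim simp
    qed
    have e: "L2n lborel (\<lambda>x. h n x - f x) = L2n lborel (\<lambda>k. trunc (real n) (FT f) k - FT f k)" for n
    proof -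
      have "L2n lborel (\<lambda>x. h n x - f x) = L2n lborel (FT (\<lambda>x. h n x - f x))"
        by (rule FT_norm[OF sqi_diff[OF hs f], symmetric])
      also have "\<dots> = L2n lborel (\<lambda>k. trunc (real n) (FT f) k - FT f k)"
      proof (rule L2n_cong_AE)
        show "AE k in lborel. cmod (FT (\<lambda>x. h n x - f x) k) = cmod (trunc (real n) (FT f) k - FT f k)"
          using FT_lincomb[OF hs[of n] f, of 1 "-1"] hF[of n]
          by eventually_elim simp
      qed (rule sqi_measurable[OF FT_sqi[OF sqi_diff[OF hs f]]] sqi_measurable[OF sqi_diff[OF tn FT_sqi[OF f]]])+
      finally show ?thesis .
    qed
    have "(\<lambda>n. L2n lborel (\<lambda>x. h n x - f x)) \<longlonglongrightarrow> 0"
      unfolding e by (rule filterlim_compose[OF trunc_L2[OF FT_sqi[OF f]] filterlim_real_sequentially])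
    with hs hb hF show ?thesis by blast
  qed
  obtain u where u: "\<And>n. sqi lborel (u n)" "\<And>n. \<exists>K. AE x in lborel. cmod (u n x) \<le> K"
    "(\<lambda>n. L2n lborel (\<lambda>x. u n x - f x)) \<longlonglongrightarrow> 0" "\<And>n. AE k in lborel. FT (u n) k = trunc (real n) (FT f) k"
    using approx[OF f] by blast
  obtain v where v: "\<And>n. sqi lborel (v n)" "\<And>n. \<exists>K. AE x in lborel. cmod (v n x) \<le> K"
    "(\<lambda>n. L2n lborel (\<lambda>x. v n x - g x)) \<longlonglongrightarrow> 0" "\<And>n. AE k in lborel. FT (v n) k = trunc (real n) (FT g) k"
    using approx[OF g] by blast
  have uv: "sqi lborel (\<lambda>x. u n x * v n x)" for n
  proof -
    obtain K where "AE x in lborel. cmod (u n x) \<le> K" using u(2) by blast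
    then have "AE x in lborel. cmod (u n x * v n x) \<le> cmod (complex_of_real \<bar>K\<bar> * v n x)"
      by eventually_elim (auto simp: norm_mult intro!: mult_right_mono)
    then show ?thesis
      by (rule sqi_bound[OF sqi_cmult[OF v(1)] borel_measurable_times[OF sqi_measurable[OF u(1)] sqi_measurable[OF v(1)]]])
  qed
  define C where "C = L2n lborel (\<lambda>k. complex_of_real (1 / sqrt (2 * pi)) * complex_of_real (LINT l|lborel. cmod (FT f l) * cmod (FT g (k - l))))"
  have cs: "sqi lborel (\<lambda>k. complex_of_real (1 / sqrt (2 * pi)) * complex_of_real (LINT l|lborel. cmod (FT f l) * cmod (FT g (k - l))))"
    by (rule sqi_cmult[OF c])
  \<comment> \<open>Truncating the transforms can only decrease the absolute convolution, which is
    assumed to lie in L2. The products are therefore bounded in L2 uniformly in \<open>n\<close>, as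
    Fatou requires.\<close>
  have uvb: "L2n lborel (\<lambda>x. u n x * v n x) \<le> C" for n
  proof -
    have "L2n lborel (FT (\<lambda>x. u n x * v n x)) \<le> C"
      unfolding C_def
    proof (rule L2n_mono[OF cs sqi_measurable[OF FT_sqi[OF uv]]])
      show "AE k in lborel. cmod (FT (\<lambda>x. u n x * v n x) k)
          \<le> cmod (complex_of_real (1 / sqrt (2 * pi)) * complex_of_real (LINT l|lborel. cmod (FT f l) * cmod (FT g (k - l))))"
        using FT_ft[OF uv[of n] sqi_mult_integrable(1)[OF u(1)[of n] v(1)[of n]]]
      proof eventually_elim
        case (elim k)
        have i: "integrable lborel (\<lambda>l. cmod (FT f l) * cmod (FT g (k - l)))"
          using integrable_norm[OF conv_integrable[OF FT_sqi[OF f] FT_sqi[OF g], of k]] by (simp add: norm_mult)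
        have "AE l in lborel. FT (v n) (- (- k + l)) = trunc (real n) (FT g) (- (- k + l))"
          by (rule AE_lborel_shift[OF AE_lborel_uminus[OF v(4)]])
        then have "AE l in lborel. norm (FT (u n) l * FT (v n) (k - l)) \<le> cmod (FT f l) * cmod (FT g (k - l))"
          using u(4)[of n] by eventually_elim (auto simp: norm_mult trunc_def indicator_def)
        then have "cmod (LINT l|lborel. FT (u n) l * FT (v n) (k - l)) \<le> (LINT l|lborel. cmod (FT f l) * cmod (FT g (k - l)))"
          by (intro order_trans[OF integral_norm_bound] integral_mono_AE i integrable_norm
              conv_integrable[OF FT_sqi[OF u(1)] FT_sqi[OF v(1)]])
        then have "1 / sqrt (2 * pi) * cmod (LINT l|lborel. FT (u n) l * FT (v n) (k - l))
            \<le> 1 / sqrt (2 * pi) * \<bar>LINT l|lborel. cmod (FT f l) * cmod (FT g (k - l))\<bar>"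
          by (intro mult_left_mono) auto
        then show ?case
          unfolding elim ft_prod[OF u(1) v(1)] norm_mult norm_of_real by simp
      qed
    qed
    then show ?thesis unfolding FT_norm[OF uv] .
  qed
  \<comment> \<open>A common subsequence is extracted: for the approximants of \<open>f\<close>, and
    inside it for those of \<open>g\<close>.\<close>
  obtain r where r: "strict_mono (r :: nat \<Rightarrow> nat)" "AE x in lborel. (\<lambda>n. u (r n) x) \<longlonglongrightarrow> f x"
    by (rule L2_subseq[OF u(1) f u(3)])
  have "(\<lambda>n. L2n lborel (\<lambda>x. v (r n) x - g x)) \<longlonglongrightarrow> 0"
    using LIMSEQ_subseq_LIMSEQ[OF v(3) r(1)] by (simp add: o_def)
  then obtain q where q: "strict_mono (q :: nat \<Rightarrow> nat)" "AE x in lborel. (\<lambda>n. v (r (q n)) x) \<longlonglongrightarrow> g x"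
    by (rule L2_subseq[of lborel "\<lambda>n. v (r n)" g, OF v(1) g])
  have ae: "AE x in lborel. (\<lambda>n. u (r (q n)) x * v (r (q n)) x) \<longlonglongrightarrow> f x * g x"
    using r(2) q(2)
  proof eventually_elim
    case (elim x)
    have "(\<lambda>n. u (r (q n)) x) \<longlonglongrightarrow> f x"
      using LIMSEQ_subseq_LIMSEQ[OF elim(1) q(1)] by (simp add: o_def)
    then show ?case using elim(2) by (rule tendsto_mult)
  qed
  have m: "(\<lambda>x. f x * g x) \<in> borel_measurable lborel"
    using sqi_measurable[OF f] sqi_measurable[OF g] by measurable
  have C0: "0 \<le> C" by (simp add: C_def)
  show fg: "sqi lborel (\<lambda>x. f x * g x)"
    by (rule L2_Fatou(1)[where f="\<lambda>n x. u (r (q n)) x * v (r (q n)) x", OF uv m ae C0 always_eventually[OF allI[OF uvb]]])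
  show "AE k in lborel. FT (\<lambda>x. f x * g x) k = complex_of_real (1 / sqrt (2 * pi)) * (LINT l|lborel. FT f l * FT g (k - l))"
    using FT_ft[OF fg sqi_mult_integrable(1)[OF f g]] by (simp only: ft_prod[OF f g])
qed

abbreviation cr :: "(real \<Rightarrow> real) \<Rightarrow> real \<Rightarrow> complex" where
  "cr h \<equiv> \<lambda>x. complex_of_real (h x)"

section \<open>Fourier multipliers\<close>

lemma L2_lborel:
  assumes h: "h \<in> borel_measurable lborel"
  shows "(h :: real \<Rightarrow> 'a::{banach,second_countable_topology}) \<in> L2 \<longleftrightarrow> integrable lborel (\<lambda>x. (norm (h x))\<^sup>2)"
  unfolding L2_def using h by (auto simp: integrable_completion measurable_completion)

lemma L2_cong_AE:
  fixes h h' :: "real \<Rightarrow> 'a::{banach,second_countable_topology}"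
  assumes "h \<in> L2" "h' \<in> borel_measurable lebesgue" "AE x in lebesgue. h x = h' x"
  shows "h' \<in> L2"
proof -
  have "integrable lebesgue (\<lambda>x. (norm (h x))\<^sup>2) \<longleftrightarrow> integrable lebesgue (\<lambda>x. (norm (h' x))\<^sup>2)"
    using assms by (intro integrable_cong_AE) (auto simp: L2_def)
  then show ?thesis using assms by (auto simp: L2_def)
qed

lemma L2_Borel_version:
  assumes h: "h \<in> L2"
  obtains h' :: "real \<Rightarrow> real" where "h' \<in> borel_measurable lborel" "AE x in lborel. h x = h' x" "sqi lborel (cr h')"
proof -
  have "h \<in> borel_measurable lebesgue" using h by (simp add: L2_def)
  then obtain h' where h': "h' \<in> borel_measurable lborel" "AE x in lborel. h x = h' x"
    using completion_ex_borel_measurable_real by blast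
  have "h' \<in> L2"
    by (rule L2_cong_AE[OF h measurable_completion[OF h'(1)] AE_completion[OF h'(2)]])
  then have "sqi lborel (cr h')"
    using h'(1) by (simp add: sqi_def L2_lborel)
  with h' show thesis by (rule that)
qed

lemma complex_Borel_version:
  assumes F: "F \<in> borel_measurable lebesgue"
  obtains F' :: "real \<Rightarrow> complex" where "F' \<in> borel_measurable lborel" "AE x in lborel. F x = F' x"
proof -
  have "(\<lambda>x. Re (F x)) \<in> borel_measurable lebesgue" "(\<lambda>x. Im (F x)) \<in> borel_measurable lebesgue"
    using F by measurable
  then obtain a b where ab: "a \<in> borel_measurable lborel" "AE x in lborel. Re (F x) = a x"
    "b \<in> borel_measurable lborel" "AE x in lborel. Im (F x) = b x"
    using completion_ex_borel_measurable_real[of "\<lambda>x. Re (F x)" lborel]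
      completion_ex_borel_measurable_real[of "\<lambda>x. Im (F x)" lborel] by blast
  have "(\<lambda>x. Complex (a x) (b x)) \<in> borel_measurable lborel"
    unfolding Complex_eq using ab(1,3) by measurable
  moreover have "AE x in lborel. F x = Complex (a x) (b x)"
    using ab(2,4) by eventually_elim (simp add: complex_eq_iff)
  ultimately show thesis by (rule that)
qed

lemma truncated_fourier_ft:
  assumes h: "h \<in> borel_measurable lebesgue" and h': "h' \<in> borel_measurable lborel" "AE x in lborel. h x = h' x"
  shows "truncated_fourier R h k = ft (trunc R (cr h')) k"
proof -
  let ?e = "\<lambda>x. exp (- (\<i> * complex_of_real (k * x)))"
  have m: "(\<lambda>x. trunc R (cr h') x * ?e x) \<in> borel_measurable lborel"
    unfolding trunc_def using h'(1) by measurable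
  have e: "?e \<in> borel_measurable lebesgue"
    by (rule measurable_completion) measurable
  have i: "indicat_real {-R..R} \<in> borel_measurable lebesgue"
    by (rule measurable_completion) measurable
  have "(LINT x:{-R..R}|lebesgue. complex_of_real (h x) * ?e x) = (LINT x|lebesgue. trunc R (cr h') x * ?e x)"
    unfolding set_lebesgue_integral_def
  proof (rule integral_cong_AE)
    show "AE x in lebesgue. indicat_real {-R..R} x *\<^sub>R (complex_of_real (h x) * ?e x) = trunc R (cr h') x * ?e x"
      using AE_completion[OF h'(2)] by eventually_elim (auto simp: trunc_def indicator_def)
    show "(\<lambda>x. indicat_real {-R..R} x *\<^sub>R (complex_of_real (h x) * ?e x)) \<in> borel_measurable lebesgue"
      using h e i by measurable
  qed (rule measurable_completion[OF m])
  also have "\<dots> = (LINT x|lborel. trunc R (cr h') x * ?e x)"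
    by (rule integral_completion[OF m])
  finally show ?thesis by (simp add: truncated_fourier_def ft_def)
qed

text \<open>Neither side changes under modification on null sets, and integrals over the completed
  measure agree with Borel ones. If \<open>F'\<close> is not square integrable, both sides fail;
  otherwise the nonnegative integral is the square of the \<open>L2n\<close> distance.\<close>

lemma is_fourier_iff:
  assumes h: "h \<in> borel_measurable lebesgue" and h': "h' \<in> borel_measurable lborel" "AE x in lborel. h x = h' x"
    and s: "sqi lborel (cr h')"
    and F: "F \<in> borel_measurable lebesgue" and F': "F' \<in> borel_measurable lborel" "AE x in lborel. F x = F' x"
  shows "is_fourier h F \<longleftrightarrow> is_FT (cr h') F'"
proof -
  have L: "F \<in> L2 \<longleftrightarrow> sqi lborel F'"
  proof -
    have "F \<in> L2 \<longleftrightarrow> F' \<in> L2"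
      using L2_cong_AE[of F F'] L2_cong_AE[of F' F] AE_completion[OF F'(2)] F measurable_completion[OF F'(1)]
      by (auto simp: eq_commute)
    then show ?thesis using L2_lborel[OF F'(1)] F'(1) by (simp add: sqi_def)
  qed
  show ?thesis
  proof (cases "sqi lborel F'")
    case True
    have "(\<integral>\<^sup>+k. ennreal ((cmod (F k - truncated_fourier R h k))\<^sup>2) \<partial>lebesgue)
        = ennreal ((L2n lborel (\<lambda>k. ft (trunc R (cr h')) k - F' k))\<^sup>2)" for R
    proof -
      have "(\<integral>\<^sup>+k. ennreal ((cmod (F k - truncated_fourier R h k))\<^sup>2) \<partial>lebesgue)
          = (\<integral>\<^sup>+k. ennreal ((cmod (F k - truncated_fourier R h k))\<^sup>2) \<partial>lborel)"
        by (rule nn_integral_completion)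
      also have "\<dots> = (\<integral>\<^sup>+k. ennreal ((cmod (ft (trunc R (cr h')) k - F' k))\<^sup>2) \<partial>lborel)"
        by (rule nn_integral_cong_AE)
           (use F'(2) in eventually_elim, simp add: truncated_fourier_ft[OF h h'] norm_minus_commute)
      also have "\<dots> = ennreal ((L2n lborel (\<lambda>k. ft (trunc R (cr h')) k - F' k))\<^sup>2)"
        by (rule nn_integral_sqi[OF sqi_diff[OF ft_trunc(1)[OF s] True]])
      finally show ?thesis .
    qed
    then have "is_fourier h F \<longleftrightarrow> F \<in> L2 \<and> ((\<lambda>R. ennreal ((L2n lborel (\<lambda>k. ft (trunc R (cr h')) k - F' k))\<^sup>2)) \<longlongrightarrow> ennreal 0) at_top"
      by (simp add: is_fourier_def)
    also have "\<dots> \<longleftrightarrow> F \<in> L2 \<and> ((\<lambda>R. (L2n lborel (\<lambda>k. ft (trunc R (cr h')) k - F' k))\<^sup>2) \<longlongrightarrow> 0) at_top"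
      by (subst tendsto_ennreal_iff) auto
    also have "\<dots> \<longleftrightarrow> F \<in> L2 \<and> ((\<lambda>R. L2n lborel (\<lambda>k. ft (trunc R (cr h')) k - F' k)) \<longlongrightarrow> 0) at_top"
    proof -
      have "((\<lambda>R. (f R)\<^sup>2) \<longlongrightarrow> 0) at_top \<longleftrightarrow> (f \<longlongrightarrow> 0) at_top" if "\<And>R. 0 \<le> f R" for f :: "real \<Rightarrow> real"
      proof
        assume "((\<lambda>R. (f R)\<^sup>2) \<longlongrightarrow> 0) at_top"
        then have "((\<lambda>R. sqrt ((f R)\<^sup>2)) \<longlongrightarrow> sqrt 0) at_top" by (rule tendsto_real_sqrt)
        then show "(f \<longlongrightarrow> 0) at_top" using that by simp
      next
        assume "(f \<longlongrightarrow> 0) at_top"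
        then have "((\<lambda>R. (f R)\<^sup>2) \<longlongrightarrow> 0\<^sup>2) at_top" by (rule tendsto_power)
        then show "((\<lambda>R. (f R)\<^sup>2) \<longlongrightarrow> 0) at_top" by simp
      qed
      then show ?thesis by simp
    qed
    finally show ?thesis using True L by (simp add: is_FT_def)
  next
    case False
    then show ?thesis using L by (auto simp: is_fourier_def is_FT_def)
  qed
qed

text \<open>\<open>fourier\<close> and \<open>FT\<close> are both choices among representatives, so
  almost everywhere equality is the strongest relation that can be asserted.\<close>

lemma fourier_FT:
  assumes h: "h \<in> L2" and h': "h' \<in> borel_measurable lborel" "AE x in lborel. h x = h' x" "sqi lborel (cr h')"
  shows "AE k in lborel. fourier h k = FT (cr h') k" "fourier h \<in> L2"
proof -
  have hm: "h \<in> borel_measurable lebesgue" using h by (simp add: L2_def)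
  have Fm: "FT (cr h') \<in> borel_measurable lborel" by (rule sqi_measurable[OF FT_sqi[OF h'(3)]])
  have "is_fourier h (FT (cr h'))"
    using is_fourier_iff[OF hm h' measurable_completion[OF Fm] Fm] FT_is_FT[OF h'(3)] by simp
  then have f: "is_fourier h (fourier h)"
    unfolding fourier_def by (rule someI[of "is_fourier h"])
  then show "fourier h \<in> L2" by (simp add: is_fourier_def)
  then have fm: "fourier h \<in> borel_measurable lebesgue" by (simp add: L2_def)
  obtain F' where F': "F' \<in> borel_measurable lborel" "AE x in lborel. fourier h x = F' x"
    by (rule complex_Borel_version[OF fm])
  have "is_FT (cr h') F'"
    using is_fourier_iff[OF hm h' fm F'] f by simp
  from FT_unique[OF h'(3) this] F'(2)
  show "AE k in lborel. fourier h k = FT (cr h') k" by eventually_elim simp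
qed

text \<open>\<open>sqi\<close> makes \<open>F\<close> Borel measurable, while \<open>fourier h\<close> need only be Lebesgue measurable.\<close>

definition fhat :: "(real \<Rightarrow> real) \<Rightarrow> (real \<Rightarrow> complex) \<Rightarrow> bool" where
  "fhat h F \<longleftrightarrow> h \<in> L2 \<and> sqi lborel F \<and> (AE k in lborel. fourier h k = F k)"

lemma fhat_FT:
  assumes "h \<in> borel_measurable lborel" "sqi lborel (cr h)"
  shows "fhat h (FT (cr h))"
proof -
  have "h \<in> L2" using assms by (simp add: L2_lborel sqi_def)
  then show ?thesis
    using fourier_FT[of h h] assms FT_sqi by (simp add: fhat_def)
qed

lemma fhat_Borel:
  assumes "fhat h F"
  obtains h' where "h' \<in> borel_measurable lborel" "AE x in lborel. h x = h' x" "sqi lborel (cr h')"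
    "AE k in lborel. FT (cr h') k = F k"
proof -
  have h: "h \<in> L2" and F: "AE k in lborel. fourier h k = F k" using assms by (auto simp: fhat_def)
  obtain h' where h': "h' \<in> borel_measurable lborel" "AE x in lborel. h x = h' x" "sqi lborel (cr h')"
    by (rule L2_Borel_version[OF h])
  have "AE k in lborel. FT (cr h') k = F k"
    using fourier_FT(1)[OF h h'] F by eventually_elim simp
  with h' show thesis by (rule that)
qed

lemma fhatI:
  assumes "h \<in> borel_measurable lebesgue" "h' \<in> borel_measurable lborel" "AE x in lborel. h x = h' x" "sqi lborel (cr h')"
    "sqi lborel F" "AE k in lborel. FT (cr h') k = F k"
  shows "fhat h F"
proof -
  have "h' \<in> L2" using assms(2,4) by (simp add: L2_lborel sqi_def)
  moreover have "AE x in lebesgue. h' x = h x"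
    using AE_completion[OF assms(3)] by eventually_elim simp
  ultimately have h: "h \<in> L2" by (rule L2_cong_AE[OF _ assms(1)])
  show ?thesis unfolding fhat_def
    using h assms(5) fourier_FT(1)[OF h assms(2,3,4)] assms(6) by auto
qed

lemma fhat_ex: "h \<in> L2 \<Longrightarrow> \<exists>F. fhat h F"
proof -
  assume h: "h \<in> L2"
  obtain h' where h': "h' \<in> borel_measurable lborel" "AE x in lborel. h x = h' x" "sqi lborel (cr h')"
    by (rule L2_Borel_version[OF h])
  show ?thesis
    using h fourier_FT(1)[OF h h'] FT_sqi[OF h'(3)] unfolding fhat_def by blast
qed

lemma fhat_L2: "fhat h F \<Longrightarrow> h \<in> L2" by (simp add: fhat_def)
lemma fhat_measurable: "fhat h F \<Longrightarrow> h \<in> borel_measurable lebesgue" by (simp add: fhat_def L2_def)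
lemma fhat_sqi: "fhat h F \<Longrightarrow> sqi lborel F" by (simp add: fhat_def)

lemma fhat_cong_AE:
  assumes "fhat h F" "sqi lborel G" "AE k in lborel. F k = G k"
  shows "fhat h G"
  using assms unfolding fhat_def by auto

lemma fhat_Parseval:
  assumes f: "fhat f F" and g: "fhat g G"
  shows "integrable lebesgue (\<lambda>x. f x * g x)"
    and "(LINT x|lebesgue. f x * g x) = Re (LINT k|lborel. F k * cnj (G k))"
proof -
  obtain f' where f': "f' \<in> borel_measurable lborel" "AE x in lborel. f x = f' x" "sqi lborel (cr f')"
    "AE k in lborel. FT (cr f') k = F k" by (rule fhat_Borel[OF f])
  obtain g' where g': "g' \<in> borel_measurable lborel" "AE x in lborel. g x = g' x" "sqi lborel (cr g')"
    "AE k in lborel. FT (cr g') k = G k" by (rule fhat_Borel[OF g])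
  have m: "(\<lambda>x. f' x * g' x) \<in> borel_measurable lborel" using f'(1) g'(1) by measurable
  have i: "integrable lborel (\<lambda>x. f' x * g' x)"
    using sqi_mult_integrable(1)[OF f'(3) g'(3)] unfolding of_real_mult[symmetric] complex_of_real_integrable_eq .
  have ae: "AE x in lebesgue. f' x * g' x = f x * g x"
    using AE_completion[OF f'(2)] AE_completion[OF g'(2)] by eventually_elim simp
  have fm: "(\<lambda>x. f x * g x) \<in> borel_measurable lebesgue"
    using fhat_measurable[OF f] fhat_measurable[OF g] by measurable
  have mc: "(\<lambda>x. f' x * g' x) \<in> borel_measurable lebesgue" by (rule measurable_completion[OF m])
  show "integrable lebesgue (\<lambda>x. f x * g x)"
    using integrable_cong_AE[OF mc fm ae] i integrable_completion[OF m] by simp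
  have "(LINT x|lebesgue. f x * g x) = (LINT x|lborel. f' x * g' x)"
    using integral_cong_AE[OF mc fm ae] integral_completion[OF m] by simp
  also have "\<dots> = Re (LINT x|lborel. cr f' x * cnj (cr g' x))"
    by (simp flip: of_real_mult)
  also have "(LINT x|lborel. cr f' x * cnj (cr g' x)) = (LINT k|lborel. FT (cr f') k * cnj (FT (cr g') k))"
    by (rule Parseval[OF f'(3) g'(3), symmetric])
  also have "\<dots> = (LINT k|lborel. F k * cnj (G k))"
  proof (rule integral_cong_AE)
    show "AE k in lborel. FT (cr f') k * cnj (FT (cr g') k) = F k * cnj (G k)"
      using f'(4) g'(4) by eventually_elim simp
  qed (use sqi_measurable[OF FT_sqi[OF f'(3)]] sqi_measurable[OF FT_sqi[OF g'(3)]]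
        sqi_measurable[OF fhat_sqi[OF f]] sqi_measurable[OF fhat_sqi[OF g]] in measurable)
  finally show "(LINT x|lebesgue. f x * g x) = Re (LINT k|lborel. F k * cnj (G k))" .
qed

lemma fhat_hermitian:
  assumes "fhat h F"
  shows "AE k in lborel. F (- k) = cnj (F k)"
proof -
  obtain h' where h': "h' \<in> borel_measurable lborel" "AE x in lborel. h x = h' x" "sqi lborel (cr h')"
    "AE k in lborel. FT (cr h') k = F k" by (rule fhat_Borel[OF assms])
  show ?thesis
    using AE_lborel_uminus[OF h'(4)] h'(4) FT_cnj[OF h'(3)]
    by eventually_elim simp
qed

text \<open>Transform followed by reflection inverts the transform. Hermitian symmetry of
  \<open>F\<close> makes the inverse transform equal to its conjugate almost everywhere, so its real
  part is the desired function.\<close>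

lemma fhat_surj:
  assumes F: "sqi lborel F" "AE k in lborel. F (- k) = cnj (F k)"
  obtains h where "h \<in> borel_measurable lborel" "fhat h F"
proof -
  define H where "H x = FT F (- x)" for x
  have Hs: "sqi lborel H" unfolding H_def[abs_def] by (rule sqi_uminus_arg[OF FT_sqi[OF F(1)]])
  have Hm [measurable]: "H \<in> borel_measurable lborel" by (rule sqi_measurable[OF Hs])
  have FH: "AE k in lborel. FT H k = F k"
    using FT_reflect[OF FT_sqi[OF F(1)]] AE_lborel_uminus[OF FT_FT[OF F(1)]]
    unfolding H_def[abs_def] by eventually_elim simp
  have Fm: "F \<in> borel_measurable lborel" by (rule sqi_measurable[OF F(1)])
  have eq: "AE x in lborel. FT (\<lambda>k. cnj (F (- k))) x = FT F x"
  proof -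
    have c: "sqi lborel (\<lambda>k. cnj (F (- k)))" by (intro sqi_cnj sqi_uminus_arg F)
    have ae: "AE k in lborel. cmod (cnj (F (- k)) - F k) = cmod 0"
      using F(2) by eventually_elim simp
    have z: "L2n lborel (\<lambda>k. cnj (F (- k)) - F k) = L2n lborel (\<lambda>k::real. 0)"
      by (rule L2n_cong_AE[OF sqi_measurable[OF sqi_diff[OF c F(1)]] borel_measurable_const ae])
    have "L2n lborel (FT (\<lambda>k. cnj (F (- k)) - F k)) = 0"
      unfolding FT_norm[OF sqi_diff[OF c F(1)]] z by (simp add: L2n_def)
    from L2n_eq_0[OF FT_sqi[OF sqi_diff[OF c F(1)]] this]
      FT_lincomb[OF c F(1), of 1 "-1"]
    show ?thesis by eventually_elim simp
  qed
  have real: "AE x in lborel. H x = cnj (H x)"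
  proof -
    have "AE x in lborel. FT (\<lambda>k. cnj (F (- k))) x = cnj (FT (\<lambda>k. F (- k)) (- x))"
      by (rule FT_cnj[OF sqi_uminus_arg[OF F(1)]])
    moreover have "AE x in lborel. FT (\<lambda>k. F (- k)) (- x) = FT F (- (- x))"
      by (rule AE_lborel_uminus[OF FT_reflect[OF F(1)]])
    ultimately have "AE x in lborel. FT F x = cnj (FT F x)"
      using eq by eventually_elim simp
    from AE_lborel_uminus[OF this] show ?thesis unfolding H_def .
  qed
  define h where "h x = Re (H x)" for x
  have hm: "h \<in> borel_measurable lborel" unfolding h_def[abs_def] by measurable
  have hH: "AE x in lborel. H x = complex_of_real (h x)"
    using real by eventually_elim (simp add: h_def complex_eq_iff)
  have hs: "sqi lborel (cr h)"
  proof (rule sqi_bound[OF Hs])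
    show "AE x in lborel. cmod (cr h x) \<le> cmod (H x)" using hH by eventually_elim simp
  qed (use hm in measurable)
  have "AE k in lborel. FT (cr h) k = FT H k"
  proof -
    have "L2n lborel (\<lambda>x. cr h x - H x) = L2n lborel (\<lambda>x::real. 0)"
      by (intro L2n_cong_AE[OF sqi_measurable[OF sqi_diff[OF hs Hs]] borel_measurable_const]) (use hH in auto)
    then have "L2n lborel (FT (\<lambda>x. cr h x - H x)) = 0"
      unfolding FT_norm[OF sqi_diff[OF hs Hs]] by (simp add: L2n_def)
    from L2n_eq_0[OF FT_sqi[OF sqi_diff[OF hs Hs]] this] FT_lincomb[OF hs Hs, of 1 "-1"]
    show ?thesis by eventually_elim simp
  qed
  then have "AE k in lborel. FT (cr h) k = F k" using FH by eventually_elim simp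
  then have "fhat h F"
    by (intro fhatI[OF measurable_completion[OF hm] hm _ hs F(1)]) auto
  with hm show thesis by (rule that)
qed

section \<open>Linear combinations, multipliers and products\<close>

lemma fhat_lincomb:
  assumes f: "fhat f F" and g: "fhat g G"
  shows "fhat (\<lambda>x. a * f x + b * g x) (\<lambda>k. complex_of_real a * F k + complex_of_real b * G k)"
proof -
  obtain f' where f': "f' \<in> borel_measurable lborel" "AE x in lborel. f x = f' x" "sqi lborel (cr f')"
    "AE k in lborel. FT (cr f') k = F k" by (rule fhat_Borel[OF f])
  obtain g' where g': "g' \<in> borel_measurable lborel" "AE x in lborel. g x = g' x" "sqi lborel (cr g')"
    "AE k in lborel. FT (cr g') k = G k" by (rule fhat_Borel[OF g])
  have e: "cr (\<lambda>x. a * f' x + b * g' x) = (\<lambda>x. complex_of_real a * cr f' x + complex_of_real b * cr g' x)" by simp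
  show ?thesis
  proof (rule fhatI)
    show "(\<lambda>x. a * f x + b * g x) \<in> borel_measurable lebesgue"
      using fhat_measurable[OF f] fhat_measurable[OF g] by measurable
    show "(\<lambda>x. a * f' x + b * g' x) \<in> borel_measurable lborel" using f' g' by measurable
    show "AE x in lborel. a * f x + b * g x = a * f' x + b * g' x"
      using f'(2) g'(2) by eventually_elim simp
    show "sqi lborel (cr (\<lambda>x. a * f' x + b * g' x))"
      unfolding e by (intro sqi_add sqi_cmult f' g')
    show "sqi lborel (\<lambda>k. complex_of_real a * F k + complex_of_real b * G k)"
      by (intro sqi_add sqi_cmult fhat_sqi[OF f] fhat_sqi[OF g])
    show "AE k in lborel. FT (cr (\<lambda>x. a * f' x + b * g' x)) k = complex_of_real a * F k + complex_of_real b * G k"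
      unfolding e using FT_lincomb[OF f'(3) g'(3), of "complex_of_real a" "complex_of_real b"] f'(4) g'(4)
      by eventually_elim simp
  qed
qed

text \<open>\<open>fourier_multiplier\<close> is a choice, meaningful only if a candidate exists.
  The symmetry of \<open>m\<close> and that of the transform of a real function make
  \<open>m k * F k\<close> hermitian, so \<open>fhat_surj\<close> supplies the candidate.\<close>

lemma fhat_multiplier:
  assumes h: "fhat h F" and m: "m \<in> borel_measurable lborel" "\<And>k. m (- k) = cnj (m k)"
    and s: "sqi lborel (\<lambda>k. m k * F k)"
  shows "fhat (fourier_multiplier m h) (\<lambda>k. m k * F k)"
proof -
  have "AE k in lborel. m (- k) * F (- k) = cnj (m k * F k)"
    using fhat_hermitian[OF h] by eventually_elim (simp add: m(2))
  then obtain g where g: "fhat g (\<lambda>k. m k * F k)"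
    using fhat_surj[OF s] by blast
  have hF: "AE k in lebesgue. fourier h k = F k"
    using h by (auto simp: fhat_def intro: AE_completion)
  have gF: "AE k in lebesgue. fourier g k = m k * F k"
    using g by (auto simp: fhat_def intro: AE_completion)
  have "\<exists>g. g \<in> L2 \<and> (AE k in lebesgue. fourier g k = m k * fourier h k)"
    by (rule exI[of _ g]) (use g hF gF in \<open>auto simp: fhat_def\<close>)
  from someI_ex[OF this]
  have *: "fourier_multiplier m h \<in> L2" "AE k in lebesgue. fourier (fourier_multiplier m h) k = m k * fourier h k"
    unfolding fourier_multiplier_def by auto
  have "AE k in lebesgue. fourier (fourier_multiplier m h) k = m k * F k"
    using *(2) hF by eventually_elim simp
  then have "AE k in lborel. fourier (fourier_multiplier m h) k = m k * F k"
    by (simp add: AE_completion_iff)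
  with *(1) s show ?thesis by (simp add: fhat_def)
qed

lemma fhat_Hilbert:
  assumes h: "fhat h F"
  shows "fhat (Hilbert h) (\<lambda>k. - \<i> * complex_of_real (sgn k) * F k)"
  unfolding Hilbert_def
proof (rule fhat_multiplier[OF h])
  show "sqi lborel (\<lambda>k. - \<i> * complex_of_real (sgn k) * F k)"
    by (rule sqi_mult_bounded[OF fhat_sqi[OF h], where K=1]) (auto simp: norm_mult sgn_real_def)
qed (auto simp: sgn_minus)

lemma fhat_Lambda:
  assumes h: "fhat h F" and s: "sqi lborel (\<lambda>k. complex_of_real \<bar>k\<bar> * F k)"
  shows "fhat (Lambda h) (\<lambda>k. complex_of_real \<bar>k\<bar> * F k)"
  unfolding Lambda_def by (rule fhat_multiplier[OF h _ _ s]) auto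

lemma fhat_prod:
  assumes f: "fhat f F" and g: "fhat g G"
    and c: "sqi lborel (\<lambda>k. complex_of_real (LINT l|lborel. cmod (F l) * cmod (G (k - l))))"
  shows "fhat (\<lambda>x. f x * g x) (\<lambda>k. complex_of_real (1 / sqrt (2 * pi)) * (LINT l|lborel. F l * G (k - l)))"
proof -
  obtain f' where f': "f' \<in> borel_measurable lborel" "AE x in lborel. f x = f' x" "sqi lborel (cr f')"
    "AE k in lborel. FT (cr f') k = F k" by (rule fhat_Borel[OF f])
  obtain g' where g': "g' \<in> borel_measurable lborel" "AE x in lborel. g x = g' x" "sqi lborel (cr g')"
    "AE k in lborel. FT (cr g') k = G k" by (rule fhat_Borel[OF g])
  note Fs = fhat_sqi[OF f] and Gs = fhat_sqi[OF g]
  note FTs = FT_sqi[OF f'(3)] and GTs = FT_sqi[OF g'(3)]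
  note [measurable] = sqi_measurable[OF Fs] sqi_measurable[OF Gs] sqi_measurable[OF FTs] sqi_measurable[OF GTs]
  have ae: "AE l in lborel. FT (cr f') l = F l \<and> FT (cr g') (k - l) = G (k - l)" for k
    using f'(4) AE_lborel_shift[OF AE_lborel_uminus[OF g'(4)], of "-k"] by eventually_elim simp
  have 1: "(LINT l|lborel. cmod (FT (cr f') l) * cmod (FT (cr g') (k - l))) = (LINT l|lborel. cmod (F l) * cmod (G (k - l)))" for k
    by (rule integral_cong_AE) (use ae[of k] in auto)
  have 2: "(LINT l|lborel. FT (cr f') l * FT (cr g') (k - l)) = (LINT l|lborel. F l * G (k - l))" for k
    by (rule integral_cong_AE) (use ae[of k] in auto)
  have e: "cr (\<lambda>x. f' x * g' x) = (\<lambda>x. cr f' x * cr g' x)" by simp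
  note p = sqi_prod[OF f'(3) g'(3), unfolded 1 2, OF c]
  have m: "(\<lambda>k. complex_of_real (1 / sqrt (2 * pi)) * (LINT l|lborel. F l * G (k - l))) \<in> borel_measurable lborel"
    by measurable
  show ?thesis
  proof (rule fhatI)
    show "(\<lambda>x. f x * g x) \<in> borel_measurable lebesgue"
      using fhat_measurable[OF f] fhat_measurable[OF g] by measurable
    show "(\<lambda>x. f' x * g' x) \<in> borel_measurable lborel" using f'(1) g'(1) by measurable
    show "AE x in lborel. f x * g x = f' x * g' x"
      using f'(2) g'(2) by eventually_elim simp
    show "sqi lborel (cr (\<lambda>x. f' x * g' x))" unfolding e by (rule p(1))
    show "AE k in lborel. FT (cr (\<lambda>x. f' x * g' x)) k = complex_of_real (1 / sqrt (2 * pi)) * (LINT l|lborel. F l * G (k - l))"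
      unfolding e by (rule p(2))
    show "sqi lborel (\<lambda>k. complex_of_real (1 / sqrt (2 * pi)) * (LINT l|lborel. F l * G (k - l)))"
      by (rule sqi_bound[OF FT_sqi[OF p(1)] m]) (use p(2) in auto)
  qed
qed

section \<open>Quadratic terms on positive frequencies\<close>

text \<open>Bounded profiles supported in \<open>(0, N]\<close>: on this class every integral of the
  energy method converges absolutely, and the truncated velocity maps the class to itself.\<close>

definition bcs :: "real \<Rightarrow> (real \<Rightarrow> complex) \<Rightarrow> bool" where
  "bcs N A \<longleftrightarrow> A \<in> borel_measurable lborel \<and> (\<exists>K. \<forall>k. cmod (A k) \<le> K) \<and> (\<forall>k. A k \<noteq> 0 \<longrightarrow> 0 < k \<and> k \<le> N)"

lemma bcs_measurable: "bcs N A \<Longrightarrow> A \<in> borel_measurable lborel"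
  by (simp add: bcs_def)

lemma bcs_bound: "bcs N A \<Longrightarrow> \<exists>K\<ge>0. \<forall>k. cmod (A k) \<le> K"
  unfolding bcs_def by (meson norm_ge_zero order_trans)

lemma bcs_0: "bcs N A \<Longrightarrow> \<not> (0 < k \<and> k \<le> N) \<Longrightarrow> A k = 0"
  unfolding bcs_def by blast

lemma bcs_out: "bcs N A \<Longrightarrow> \<bar>k\<bar> > \<bar>N\<bar> \<Longrightarrow> A k = 0"
  by (rule bcs_0) auto

lemma bcs_sqi: assumes "bcs N A" shows "sqi lborel A"
proof -
  obtain K where K: "\<And>k. cmod (A k) \<le> K" using bcs_bound[OF assms] by blast
  show ?thesis
    by (rule sqi_compact_bounded[OF bcs_measurable[OF assms] K bcs_out[OF assms]])
qed

lemma bcs_integrable: "bcs N A \<Longrightarrow> integrable lborel A"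
  by (rule L2n_compact_integral(1)[OF bcs_sqi bcs_out])

lemma bcs_mult:
  assumes A: "bcs N A" and m: "m \<in> borel_measurable lborel" "\<And>k. 0 < k \<Longrightarrow> k \<le> N \<Longrightarrow> cmod (m k) \<le> K"
  shows "bcs N (\<lambda>k. m k * A k)"
  unfolding bcs_def
proof (intro conjI)
  show "(\<lambda>k. m k * A k) \<in> borel_measurable lborel"
    using m(1) bcs_measurable[OF A] by (rule borel_measurable_times)
  obtain B where B: "0 \<le> B" "\<And>k. cmod (A k) \<le> B" using bcs_bound[OF A] by blast
  have "cmod (m k * A k) \<le> \<bar>K\<bar> * B" for k
  proof (cases "0 < k \<and> k \<le> N")
    case True
    then show ?thesis unfolding norm_mult using m(2)[of k] B by (intro mult_mono) auto
  next
    case False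
    then show ?thesis using bcs_0[OF A False] B(1) by simp
  qed
  then show "\<exists>K. \<forall>k. cmod (m k * A k) \<le> K" by blast
  show "\<forall>k. m k * A k \<noteq> 0 \<longrightarrow> 0 < k \<and> k \<le> N" using bcs_0[OF A] by auto
qed

lemma bcs_mult_cont:
  assumes A: "bcs N A" and m: "continuous_on UNIV m"
  shows "bcs N (\<lambda>k. m k * A k)"
proof -
  have "compact (m ` {0..N})"
    by (intro compact_continuous_image continuous_on_subset[OF m]) auto
  then obtain B where B: "\<And>x. x \<in> {0..N} \<Longrightarrow> cmod (m x) \<le> B"
    by (meson bounded_iff compact_imp_bounded image_eqI)
  show ?thesis
    by (rule bcs_mult[OF A, of m B]) (use m B in \<open>auto simp: borel_measurable_continuous_onI\<close>)
qed

lemma bcs_add: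
  assumes "bcs N A" "bcs N B" shows "bcs N (\<lambda>k. A k + B k)"
  unfolding bcs_def
proof (intro conjI)
  show "(\<lambda>k. A k + B k) \<in> borel_measurable lborel"
    using bcs_measurable[OF assms(1)] bcs_measurable[OF assms(2)] by (rule borel_measurable_add)
  obtain K where K: "\<And>k. cmod (A k) \<le> K" using bcs_bound[OF assms(1)] by blast
  obtain L where L: "\<And>k. cmod (B k) \<le> L" using bcs_bound[OF assms(2)] by blast
  have "cmod (A k + B k) \<le> K + L" for k
    using norm_triangle_ineq[of "A k" "B k"] K[of k] L[of k] by linarith
  then show "\<exists>K. \<forall>k. cmod (A k + B k) \<le> K" by blast
  show "\<forall>k. A k + B k \<noteq> 0 \<longrightarrow> 0 < k \<and> k \<le> N"
    using bcs_0[OF assms(1)] bcs_0[OF assms(2)] by fastforce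
qed

lemma bcs_cmult: "bcs N A \<Longrightarrow> bcs N (\<lambda>k. c * A k)"
  by (rule bcs_mult[of N A "\<lambda>k. c" "cmod c"]) auto

lemma bcs_diff: "bcs N A \<Longrightarrow> bcs N B \<Longrightarrow> bcs N (\<lambda>k. A k - B k)"
  using bcs_add[of N A "\<lambda>k. - B k"] bcs_cmult[of N B "-1"] by simp

lemma bcs_mono: "bcs N A \<Longrightarrow> N \<le> N' \<Longrightarrow> bcs N' A"
  unfolding bcs_def by fastforce

lemma box_integrable:
  fixes f :: "real \<times> real \<Rightarrow> 'a::{banach, second_countable_topology}"
  assumes m: "f \<in> borel_measurable (lborel \<Otimes>\<^sub>M lborel)" and b: "\<And>p. norm (f p) \<le> K"
    and z: "\<And>x y. \<bar>x\<bar> > R \<or> \<bar>y\<bar> > R \<Longrightarrow> f (x, y) = 0"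
  shows "integrable (lborel \<Otimes>\<^sub>M lborel) f"
proof (rule Bochner_Integration.integrable_bound[OF _ m])
  have "emeasure (lborel \<Otimes>\<^sub>M lborel) ({-R..R} \<times> {-R..R}) = emeasure lborel {-R..R} * emeasure lborel {-R..R}"
    by (rule lborel.emeasure_pair_measure_Times) auto
  also have "\<dots> < \<infinity>" by (simp add: emeasure_lborel_Icc_eq ennreal_mult_less_top)
  finally show "integrable (lborel \<Otimes>\<^sub>M lborel) (\<lambda>p. K * indicat_real ({-R..R} \<times> {-R..R}) p)"
    by (intro integrable_mult_right integrable_real_indicator) auto
  have K: "0 \<le> K" using order_trans[OF norm_ge_zero b] .
  show "AE p in (lborel \<Otimes>\<^sub>M lborel). norm (f p) \<le> norm (K * indicat_real ({-R..R} \<times> {-R..R}) p)"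
  proof (rule AE_I2)
    fix p :: "real \<times> real"
    obtain x y where p: "p = (x, y)" by (cases p)
    show "norm (f p) \<le> norm (K * indicat_real ({-R..R} \<times> {-R..R}) p)"
    proof (cases "\<bar>x\<bar> > R \<or> \<bar>y\<bar> > R")
      case True then show ?thesis using z[OF True] p by simp
    next
      case False
      then have "p \<in> {-R..R} \<times> {-R..R}" using p by auto
      then show ?thesis using b[of p] K by simp
    qed
  qed
qed

section \<open>Trilinear forms\<close>

definition convol :: "(real \<Rightarrow> complex) \<Rightarrow> (real \<Rightarrow> complex) \<Rightarrow> real \<Rightarrow> complex" where
  "convol U V k = (LINT l|lborel. U l * V (k - l))"

text \<open>The interaction of the frequencies \<open>k + m\<close> and \<open>- m\<close>: at a
  negative frequency a hermitian transform is the conjugate of its value at the opposite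
  one.\<close>

definition correl :: "(real \<Rightarrow> complex) \<Rightarrow> (real \<Rightarrow> complex) \<Rightarrow> real \<Rightarrow> complex" where
  "correl U V k = (LINT m|lborel. U (k + m) * cnj (V m))"

text \<open>The first slot carries the sum frequency, the largest of the three. Convolution and
  correlation terms then differ only in the slot occupied by the test function, so that
  cancellations can be read off from one polynomial factor.\<close>

definition tri :: "(real \<Rightarrow> complex) \<Rightarrow> (real \<Rightarrow> complex) \<Rightarrow> (real \<Rightarrow> complex) \<Rightarrow> real \<times> real \<Rightarrow> complex" where
  "tri Z U V p = cnj (Z (fst p + snd p)) * U (fst p) * V (snd p)"

definition Tri :: "(real \<Rightarrow> complex) \<Rightarrow> (real \<Rightarrow> complex) \<Rightarrow> (real \<Rightarrow> complex) \<Rightarrow> real" where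
  "Tri Z U V = (LINT p|(lborel \<Otimes>\<^sub>M lborel). Re (tri Z U V p))"

lemma borel_measurable_convol [measurable]:
  assumes [measurable]: "U \<in> borel_measurable lborel" "V \<in> borel_measurable lborel"
  shows "convol U V \<in> borel_measurable lborel"
  unfolding convol_def[abs_def] by measurable

lemma borel_measurable_correl [measurable]:
  assumes [measurable]: "U \<in> borel_measurable lborel" "V \<in> borel_measurable lborel"
  shows "correl U V \<in> borel_measurable lborel"
  unfolding correl_def[abs_def] by measurable

lemma tri_measurable:
  assumes [measurable]: "Z \<in> borel_measurable lborel" "U \<in> borel_measurable lborel" "V \<in> borel_measurable lborel"
  shows "tri Z U V \<in> borel_measurable (lborel \<Otimes>\<^sub>M lborel)"
  unfolding tri_def[abs_def] by measurable

lemma tri_integrable: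
  assumes Z: "bcs N Z" and U: "bcs N U" and V: "bcs N V"
  shows "integrable (lborel \<Otimes>\<^sub>M lborel) (tri Z U V)"
proof -
  obtain K where K: "0 \<le> K" "\<And>k. cmod (Z k) \<le> K" using bcs_bound[OF Z] by blast
  obtain L where L: "0 \<le> L" "\<And>k. cmod (U k) \<le> L" using bcs_bound[OF U] by blast
  obtain M where M: "0 \<le> M" "\<And>k. cmod (V k) \<le> M" using bcs_bound[OF V] by blast
  show ?thesis
  proof (rule box_integrable[OF tri_measurable])
    show "norm (tri Z U V p) \<le> K * L * M" for p
      unfolding tri_def norm_mult complex_mod_cnj using K L M by (intro mult_mono) auto
    show "\<bar>x\<bar> > \<bar>N\<bar> \<or> \<bar>y\<bar> > \<bar>N\<bar> \<Longrightarrow> tri Z U V (x, y) = 0" for x y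
      using bcs_out[OF U, of x] bcs_out[OF V, of y] by (auto simp: tri_def)
  qed (use bcs_measurable[OF Z] bcs_measurable[OF U] bcs_measurable[OF V] in auto)
qed

lemma Re_tri_integrable:
  assumes "bcs N Z" "bcs N U" "bcs N V"
  shows "integrable (lborel \<Otimes>\<^sub>M lborel) (\<lambda>p. Re (tri Z U V p))"
  by (rule integrable_Re[OF tri_integrable[OF assms]])

lemma Tri_Re:
  assumes "bcs N Z" "bcs N U" "bcs N V"
  shows "Tri Z U V = Re (LINT p|(lborel \<Otimes>\<^sub>M lborel). tri Z U V p)"
  unfolding Tri_def by (rule integral_Re[OF tri_integrable[OF assms]])

lemma Tri_swap:
  assumes "bcs N Z" "bcs N U" "bcs N V"
  shows "Tri Z U V = Tri Z V U"
proof -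
  have "Tri Z U V = (LINT p|(lborel \<Otimes>\<^sub>M lborel). (case p of (x, y) \<Rightarrow> Re (tri Z U V (y, x))))"
    unfolding Tri_def
    by (rule lborel_pair.integral_product_swap[symmetric])
       (rule borel_measurable_integrable[OF Re_tri_integrable[OF assms]])
  also have "\<dots> = Tri Z V U"
    unfolding Tri_def by (intro Bochner_Integration.integral_cong refl) (auto simp: tri_def add.commute mult_ac)
  finally show ?thesis .
qed

lemma convol_pair:
  assumes Z: "bcs N Z" and U: "bcs N U" and V: "bcs N V"
  shows "Re (LINT k|lborel. cnj (Z k) * convol U V k) = Tri Z U V"
proof -
  note [measurable] = bcs_measurable[OF Z] bcs_measurable[OF U] bcs_measurable[OF V]
  obtain K where K: "0 \<le> K" "\<And>k. cmod (Z k) \<le> K" using bcs_bound[OF Z] by blast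
  obtain L where L: "0 \<le> L" "\<And>k. cmod (U k) \<le> L" using bcs_bound[OF U] by blast
  obtain M where M: "0 \<le> M" "\<And>k. cmod (V k) \<le> M" using bcs_bound[OF V] by blast
  have i: "integrable (lborel \<Otimes>\<^sub>M lborel) (\<lambda>(k, l). cnj (Z k) * (U l * V (k - l)))"
  proof (rule box_integrable)
    show "norm (case p of (k, l) \<Rightarrow> cnj (Z k) * (U l * V (k - l))) \<le> K * (L * M)" for p
      unfolding norm_mult complex_mod_cnj case_prod_beta using K L M by (intro mult_mono) auto
    show "\<bar>x\<bar> > \<bar>N\<bar> \<or> \<bar>y\<bar> > \<bar>N\<bar> \<Longrightarrow> (case (x, y) of (k, l) \<Rightarrow> cnj (Z k) * (U l * V (k - l))) = 0" for x y
      using bcs_out[OF Z, of x] bcs_out[OF U, of y] by auto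
  qed measurable
  have "(LINT k|lborel. cnj (Z k) * convol U V k) = (LINT k|lborel. LINT l|lborel. cnj (Z k) * (U l * V (k - l)))"
    unfolding convol_def by simp
  also have "\<dots> = (LINT l|lborel. LINT k|lborel. cnj (Z k) * (U l * V (k - l)))"
    using lborel_pair.Fubini_integral[of "\<lambda>k l. cnj (Z k) * (U l * V (k - l))"] i by simp
  also have "\<dots> = (LINT l|lborel. LINT m|lborel. tri Z U V (l, m))"
  proof (rule Bochner_Integration.integral_cong[OF refl])
    fix l
    have "(LINT k|lborel. cnj (Z k) * (U l * V (k - l))) = (LINT m|lborel. cnj (Z (l + 1 * m)) * (U l * V (l + 1 * m - l)))"
      using lborel_integral_real_affine[of 1 "\<lambda>k. cnj (Z k) * (U l * V (k - l))" l] by simp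
    then show "(LINT k|lborel. cnj (Z k) * (U l * V (k - l))) = (LINT m|lborel. tri Z U V (l, m))"
      by (simp add: tri_def mult.assoc)
  qed
  also have "\<dots> = (LINT p|(lborel \<Otimes>\<^sub>M lborel). tri Z U V p)"
    by (rule lborel_pair.integral_fst'[OF tri_integrable[OF assms]])
  finally show ?thesis unfolding Tri_Re[OF assms] by simp
qed

text \<open>In a correlation the sum frequency belongs to \<open>U\<close>, so the test function
  moves from the first to the second slot; the conjugation that appears does not affect real
  parts.\<close>

lemma correl_pair:
  assumes Z: "bcs N Z" and U: "bcs N U" and V: "bcs N V"
  shows "Re (LINT k|lborel. cnj (Z k) * correl U V k) = Tri U Z V"
proof -
  have "cnj (Z k) * (U (k + m) * cnj (V m)) = cnj (tri U Z V (k, m))" for k m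
    by (simp add: tri_def mult_ac)
  then have "(LINT k|lborel. cnj (Z k) * correl U V k) = (LINT k|lborel. cnj (LINT m|lborel. tri U Z V (k, m)))"
    unfolding correl_def integral_mult_right_zero[symmetric] Bochner_Integration.integral_cnj[symmetric] by (simp only:)
  also have "\<dots> = cnj (LINT k|lborel. LINT m|lborel. tri U Z V (k, m))"
    by (rule Bochner_Integration.integral_cnj)
  also have "(LINT k|lborel. LINT m|lborel. tri U Z V (k, m)) = (LINT p|(lborel \<Otimes>\<^sub>M lborel). tri U Z V p)"
    by (rule lborel_pair.integral_fst'[OF tri_integrable[OF U Z V]])
  finally show ?thesis unfolding Tri_Re[OF U Z V] by simp
qed

text \<open>Cauchy-Schwarz in the first frequency for a fixed second one, then integration in the
  second. Two factors enter with L2 norms and one with its L1 norm, the form in which the energy and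
  the difference estimate use it.\<close>

lemma tri_norm_bound:
  assumes P: "bcs N P" and Q: "bcs N Q" and R: "bcs N R"
  shows "integrable (lborel \<Otimes>\<^sub>M lborel) (\<lambda>p. cmod (P (fst p + snd p)) * cmod (Q (fst p)) * cmod (R (snd p)))"
    and "(LINT p|(lborel \<Otimes>\<^sub>M lborel). cmod (P (fst p + snd p)) * cmod (Q (fst p)) * cmod (R (snd p)))
      \<le> L2n lborel P * L2n lborel Q * (LINT m|lborel. cmod (R m))"
proof -
  show i: "integrable (lborel \<Otimes>\<^sub>M lborel) (\<lambda>p. cmod (P (fst p + snd p)) * cmod (Q (fst p)) * cmod (R (snd p)))"
    using integrable_norm[OF tri_integrable[OF P Q R]] by (simp add: tri_def norm_mult)
  have i': "integrable (lborel \<Otimes>\<^sub>M lborel) (\<lambda>(l, m). cmod (P (l + m)) * cmod (Q l) * cmod (R m))"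
    using i by (simp add: case_prod_beta')
  have inner: "(LINT l|lborel. cmod (P (l + m)) * cmod (Q l) * cmod (R m)) \<le> (L2n lborel P * L2n lborel Q) * cmod (R m)" for m
  proof -
    have s: "sqi lborel (\<lambda>l. P (l + m))" using sqi_shift[OF bcs_sqi[OF P], of m] by (simp add: add.commute)
    have n: "L2n lborel (\<lambda>l. P (l + m)) = L2n lborel P" using L2n_shift[of P m] by (simp add: add.commute)
    have "(LINT l|lborel. cmod (P (l + m)) * cmod (Q l)) \<le> L2n lborel P * L2n lborel Q"
      using sqi_mult_integrable(2)[OF s bcs_sqi[OF Q]] unfolding n .
    then show ?thesis
      unfolding integral_mult_left_zero by (rule mult_right_mono) simp
  qed
  have "(LINT p|(lborel \<Otimes>\<^sub>M lborel). cmod (P (fst p + snd p)) * cmod (Q (fst p)) * cmod (R (snd p)))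
      = (LINT m|lborel. LINT l|lborel. cmod (P (l + m)) * cmod (Q l) * cmod (R m))"
    using lborel_pair.integral_snd[OF i'] by (simp add: case_prod_beta')
  also have "\<dots> \<le> (LINT m|lborel. (L2n lborel P * L2n lborel Q) * cmod (R m))"
  proof (rule integral_mono[OF _ _ inner])
    show "integrable lborel (\<lambda>m. LINT l|lborel. cmod (P (l + m)) * cmod (Q l) * cmod (R m))"
      using lborel_pair.integrable_snd[OF i'] by simp
    show "integrable lborel (\<lambda>m. (L2n lborel P * L2n lborel Q) * cmod (R m))"
      using integrable_norm[OF bcs_integrable[OF R]] by simp
  qed
  finally show "(LINT p|(lborel \<Otimes>\<^sub>M lborel). cmod (P (fst p + snd p)) * cmod (Q (fst p)) * cmod (R (snd p)))
      \<le> L2n lborel P * L2n lborel Q * (LINT m|lborel. cmod (R m))" by simp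
qed

text \<open>Weights: \<open>nX\<close> and \<open>nW\<close> are the \<open>H\<^sup>3\<^sup>/\<^sup>2\<close> and \<open>H\<^sup>1\<^sup>/\<^sup>2\<close> norms of the positive frequencies.\<close>

definition s3 :: "real \<Rightarrow> complex" where "s3 k = complex_of_real (sqrt ((1 + \<bar>k\<bar>) ^ 3))"
definition s1 :: "real \<Rightarrow> complex" where "s1 k = complex_of_real (sqrt (1 + \<bar>k\<bar>))"

definition nX :: "(real \<Rightarrow> complex) \<Rightarrow> real" where "nX A = L2n lborel (\<lambda>k. s3 k * A k)"
definition nW :: "(real \<Rightarrow> complex) \<Rightarrow> real" where "nW A = L2n lborel (\<lambda>k. s1 k * A k)"
definition n1 :: "(real \<Rightarrow> complex) \<Rightarrow> real" where "n1 A = (LINT k|lborel. cmod (A k))"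
definition KM :: "(real \<Rightarrow> complex) \<Rightarrow> real \<Rightarrow> complex" where "KM A k = complex_of_real k * A k"

lemma nX_nonneg [simp]: "0 \<le> nX A" and nW_nonneg [simp]: "0 \<le> nW A" and n1_nonneg [simp]: "0 \<le> n1 A"
  by (auto simp: nX_def nW_def n1_def)

lemma s3_cont: "continuous_on UNIV s3" and s1_cont: "continuous_on UNIV s1"
  unfolding s3_def[abs_def] s1_def[abs_def] by (intro continuous_intros)+

lemma s3_measurable [measurable]: "s3 \<in> borel_measurable borel" and s1_measurable [measurable]: "s1 \<in> borel_measurable borel"
  by (rule borel_measurable_continuous_onI[OF s3_cont] borel_measurable_continuous_onI[OF s1_cont])+

lemma cmod_s3: "cmod (s3 k) = sqrt ((1 + \<bar>k\<bar>) ^ 3)" and cmod_s1: "cmod (s1 k) = sqrt (1 + \<bar>k\<bar>)"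
  by (auto simp: s3_def s1_def)

lemma bcs_s3: "bcs N A \<Longrightarrow> bcs N (\<lambda>k. s3 k * A k)" and bcs_s1: "bcs N A \<Longrightarrow> bcs N (\<lambda>k. s1 k * A k)"
  by (rule bcs_mult_cont, assumption, rule s3_cont s1_cont)+

lemma KM_bcs: "bcs N A \<Longrightarrow> bcs N (KM A)"
  unfolding KM_def[abs_def] by (rule bcs_mult_cont) (auto intro!: continuous_intros)

text \<open>If \<open>M\<close> is the larger of \<open>l\<close> and \<open>m\<close>, then
  \<open>1 + l + m \<le> 2 * (1 + M)\<close>, so half of the six powers in the squared inequality
  move to \<open>M\<close> at the cost of a factor 8, enlarged to 9 to have the root 3. The sum on
  the right serves both cases.\<close>

lemma weight3:
  fixes l m :: real
  assumes "0 < l" "0 < m"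
  shows "(1 + l + m) ^ 3 \<le> 3 * (cmod (s3 (l + m)) * (cmod (s3 l) + cmod (s3 m)))"
proof -
  have w: "(1 + l + m) ^ 3 \<le> 3 * (cmod (s3 (l + m)) * cmod (s3 M))" if M: "1 + l + m \<le> 2 * (1 + M)" "0 \<le> M" for M
  proof -
    have "((1 + l + m) ^ 3)\<^sup>2 = (1 + l + m) ^ 3 * (1 + l + m) ^ 3" by (simp add: power2_eq_square)
    also have "\<dots> \<le> (1 + l + m) ^ 3 * (2 * (1 + M)) ^ 3"
      using assms M by (intro mult_left_mono power_mono) auto
    also have "\<dots> \<le> (1 + l + m) ^ 3 * (9 * (1 + M) ^ 3)"
    proof (rule mult_left_mono)
      have "(2 * (1 + M)) ^ 3 = 8 * (1 + M) ^ 3" unfolding power_mult_distrib by simp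
      moreover have "0 \<le> (1 + M) ^ 3" using M by simp
      ultimately show "(2 * (1 + M)) ^ 3 \<le> 9 * (1 + M) ^ 3" by linarith
    qed (use assms in simp)
    also have "\<dots> = (3 * (cmod (s3 (l + m)) * cmod (s3 M)))\<^sup>2"
      using assms M by (simp add: cmod_s3 power_mult_distrib add.assoc)
    finally show ?thesis by (rule power2_le_imp_le) simp
  qed
  show ?thesis
  proof (cases "l \<le> m")
    case True
    have "(1 + l + m) ^ 3 \<le> 3 * (cmod (s3 (l + m)) * cmod (s3 m))" by (rule w) (use True assms in auto)
    also have "\<dots> \<le> 3 * (cmod (s3 (l + m)) * (cmod (s3 l) + cmod (s3 m)))" by (intro mult_left_mono) auto
    finally show ?thesis .
  next
    case False
    have "(1 + l + m) ^ 3 \<le> 3 * (cmod (s3 (l + m)) * cmod (s3 l))" by (rule w) (use False assms in auto)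
    also have "\<dots> \<le> 3 * (cmod (s3 (l + m)) * (cmod (s3 l) + cmod (s3 m)))" by (intro mult_left_mono) auto
    finally show ?thesis .
  qed
qed

text \<open>The distribution of the two derivatives in the difference estimate: weight 3/2 goes to
  the sum of the two profiles and weight 1/2 to their difference, in the two placements of
  frequencies that occur.\<close>

lemma weight31:
  fixes l m :: real
  assumes "0 < l" "0 < m"
  shows "(1 + m)\<^sup>2 \<le> cmod (s3 m) * cmod (s1 (l + m))"
    and "(1 + l + m) * (1 + m) \<le> cmod (s3 (l + m)) * cmod (s1 m)"
proof -
  have "((1 + m)\<^sup>2)\<^sup>2 = (1 + m) ^ 3 * (1 + m)" by (simp add: power2_eq_square power3_eq_cube)
  also have "\<dots> \<le> (1 + m) ^ 3 * (1 + (l + m))" using assms by (intro mult_left_mono) auto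
  also have "\<dots> = (cmod (s3 m) * cmod (s1 (l + m)))\<^sup>2"
    using assms by (simp add: cmod_s3 cmod_s1 power_mult_distrib)
  finally show "(1 + m)\<^sup>2 \<le> cmod (s3 m) * cmod (s1 (l + m))" by (rule power2_le_imp_le) simp
  have "((1 + l + m) * (1 + m))\<^sup>2 = (1 + l + m)\<^sup>2 * (1 + m) * (1 + m)" by (simp add: power2_eq_square)
  also have "\<dots> \<le> (1 + l + m)\<^sup>2 * (1 + l + m) * (1 + m)" using assms by (intro mult_right_mono mult_left_mono) auto
  also have "\<dots> = (1 + l + m) ^ 3 * (1 + m)" by (simp add: power2_eq_square power3_eq_cube)
  also have "\<dots> = (cmod (s3 (l + m)) * cmod (s1 m))\<^sup>2"
    using assms by (simp add: cmod_s3 cmod_s1 power_mult_distrib add.assoc)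
  finally show "(1 + l + m) * (1 + m) \<le> cmod (s3 (l + m)) * cmod (s1 m)" by (rule power2_le_imp_le) simp
qed

lemma tri_norm_bound':
  assumes P: "bcs N P" and Q: "bcs N Q" and R: "bcs N R"
  shows "(LINT p|(lborel \<Otimes>\<^sub>M lborel). cmod (P (fst p + snd p)) * cmod (Q (fst p)) * cmod (R (snd p)))
      \<le> L2n lborel P * L2n lborel R * n1 Q"
proof -
  have "(LINT p|(lborel \<Otimes>\<^sub>M lborel). cmod (P (fst p + snd p)) * cmod (Q (fst p)) * cmod (R (snd p)))
      = (LINT p|(lborel \<Otimes>\<^sub>M lborel). (case p of (x, y) \<Rightarrow>
          (\<lambda>p. cmod (P (fst p + snd p)) * cmod (Q (fst p)) * cmod (R (snd p))) (y, x)))"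
    by (rule lborel_pair.integral_product_swap[symmetric])
       (rule borel_measurable_integrable[OF tri_norm_bound(1)[OF assms]])
  also have "\<dots> = (LINT p|(lborel \<Otimes>\<^sub>M lborel). cmod (P (fst p + snd p)) * cmod (R (fst p)) * cmod (Q (snd p)))"
    by (intro Bochner_Integration.integral_cong refl) (auto simp: add.commute mult_ac)
  also have "\<dots> \<le> L2n lborel P * L2n lborel R * n1 Q"
    unfolding n1_def by (rule tri_norm_bound(2)[OF P R Q])
  finally show ?thesis .
qed

lemma convol_bound:
  assumes U: "sqi lborel U" and V: "sqi lborel V"
  shows "cmod (convol U V k) \<le> L2n lborel U * L2n lborel V"
proof -
  have s: "sqi lborel (\<lambda>l. V (k - l))"
    using sqi_uminus_arg[OF sqi_shift[OF V, of k]] by simp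
  have n: "L2n lborel (\<lambda>l. V (k - l)) = L2n lborel V"
    using L2n_uminus_arg[of "\<lambda>l. V (k + l)"] L2n_shift[of V k] by simp
  show ?thesis unfolding convol_def using sqi_mult_integrable(3)[OF U s] unfolding n .
qed

lemma correl_integrable:
  fixes U V :: "real \<Rightarrow> complex"
  assumes U: "sqi lborel U" and V: "sqi lborel V"
  shows "integrable lborel (\<lambda>m. U (k + m) * cnj (V m))"
  by (rule sqi_mult_integrable(1)[OF sqi_shift[OF U] sqi_cnj[OF V]])

lemma correl_bound:
  assumes U: "sqi lborel U" and V: "sqi lborel V"
  shows "cmod (correl U V k) \<le> L2n lborel U * L2n lborel V"
proof -
  have n: "L2n lborel (\<lambda>m. cnj (V m)) = L2n lborel V" by (simp add: L2n_def)
  show ?thesis unfolding correl_def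
    using sqi_mult_integrable(3)[OF sqi_shift[OF U] sqi_cnj[OF V], of k] unfolding n L2n_shift .
qed

section \<open>The H^(3/2) class of profiles and the quadratic map\<close>

definition Xc :: "(real \<Rightarrow> complex) \<Rightarrow> bool" where
  "Xc A \<longleftrightarrow> A \<in> borel_measurable lborel \<and> sqi lborel (\<lambda>k. s3 k * A k) \<and> (\<forall>k\<le>0. A k = 0)"

lemma Xc_measurable: "Xc A \<Longrightarrow> A \<in> borel_measurable lborel" by (simp add: Xc_def)

lemma bcs_Xc: "bcs N A \<Longrightarrow> Xc A"
  unfolding Xc_def using bcs_measurable[of N A] bcs_sqi[OF bcs_s3] bcs_0[of N A] by auto

lemma one_le_s3: "1 \<le> cmod (s3 k)"
  unfolding cmod_s3 by (simp add: one_le_power)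

lemma le_s3: "1 + \<bar>k\<bar> \<le> cmod (s3 k)"
proof -
  have "(1 + \<bar>k\<bar>)\<^sup>2 \<le> (1 + \<bar>k\<bar>) ^ 3" by (rule power_increasing) auto
  then show ?thesis unfolding cmod_s3 by (rule real_le_rsqrt)
qed

lemma s1_le_s3: "cmod (s1 k) \<le> cmod (s3 k)"
  unfolding cmod_s3 cmod_s1 by (rule real_sqrt_le_mono) (rule self_le_power, auto)

lemma one_le_s1: "1 \<le> cmod (s1 k)"
  unfolding cmod_s1 by simp

lemma Xc_sqi:
  assumes A: "Xc A" and m: "m \<in> borel_measurable lborel" "\<And>k. cmod (m k) \<le> cmod (s3 k)"
  shows "sqi lborel (\<lambda>k. m k * A k)" "L2n lborel (\<lambda>k. m k * A k) \<le> nX A"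
proof -
  have s: "sqi lborel (\<lambda>k. s3 k * A k)" using A by (simp add: Xc_def)
  have mm: "(\<lambda>k. m k * A k) \<in> borel_measurable lborel"
    using m(1) Xc_measurable[OF A] by (rule borel_measurable_times)
  have ae: "AE k in lborel. cmod (m k * A k) \<le> cmod (s3 k * A k)"
    using m(2) by (auto simp: norm_mult intro!: mult_right_mono)
  show "sqi lborel (\<lambda>k. m k * A k)" by (rule sqi_bound[OF s mm ae])
  show "L2n lborel (\<lambda>k. m k * A k) \<le> nX A" unfolding nX_def by (rule L2n_mono[OF s mm ae])
qed

lemma Xc_KM:
  assumes A: "Xc A" shows "sqi lborel (KM A)" "L2n lborel (KM A) \<le> nX A"
proof -
  have "cmod (complex_of_real k) \<le> cmod (s3 k)" for k using le_s3[of k] by simp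
  from Xc_sqi[OF A _ this] show "sqi lborel (KM A)" "L2n lborel (KM A) \<le> nX A"
    unfolding KM_def[abs_def] by auto
qed

lemma Xc_self:
  assumes A: "Xc A" shows "sqi lborel A" "L2n lborel A \<le> nX A"
proof -
  have "cmod 1 \<le> cmod (s3 k)" for k using one_le_s3[of k] by simp
  from Xc_sqi[OF A _ this] show "sqi lborel A" "L2n lborel A \<le> nX A" by auto
qed

lemma Xc_s1:
  assumes A: "Xc A" shows "sqi lborel (\<lambda>k. s1 k * A k)" "nW A \<le> nX A"
proof -
  have "s1 \<in> borel_measurable lborel" by simp
  from Xc_sqi[OF A this s1_le_s3] show "sqi lborel (\<lambda>k. s1 k * A k)" "nW A \<le> nX A"
    unfolding nW_def by auto
qed

lemma Xc_diff: "Xc A \<Longrightarrow> Xc B \<Longrightarrow> Xc (\<lambda>k. A k - B k)"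
  unfolding Xc_def using sqi_diff[of lborel "\<lambda>k. s3 k * A k" "\<lambda>k. s3 k * B k"]
  by (auto simp: right_diff_distrib)

lemma nX_triangle: "Xc A \<Longrightarrow> Xc B \<Longrightarrow> nX (\<lambda>k. A k + B k) \<le> nX A + nX B"
  unfolding nX_def distrib_left by (rule L2n_triangle) (auto simp: Xc_def)

lemma nX_triangle_diff: "Xc A \<Longrightarrow> Xc B \<Longrightarrow> nX (\<lambda>k. A k - B k) \<le> nX A + nX B"
  unfolding nX_def right_diff_distrib by (rule L2n_triangle_diff) (auto simp: Xc_def)

definition c0 :: real where "c0 = 1 / sqrt (2 * pi)"

lemma c0: "0 \<le> c0" "c0 \<le> 1"
proof -
  have "1 \<le> sqrt (2 * pi)" using pi_ge_two by (intro real_le_rsqrt) auto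
  then show "0 \<le> c0" "c0 \<le> 1" by (auto simp: c0_def divide_simps)
qed

text \<open>The quadratic terms on positive frequencies, divided by \<open>\<i>\<close>;
  \<open>NL_symbol\<close> derives the coefficients. The convolution collects pairs of positive
  frequencies, the correlations pairs of opposite sign.\<close>

definition NL :: "(real \<Rightarrow> complex) \<Rightarrow> real \<Rightarrow> complex" where
  "NL A k = complex_of_real c0 * (convol (KM A) (KM A) k - 2 * correl (KM A) (KM A) k + 2 * correl A (KM A) k)"

lemma KM_measurable: "A \<in> borel_measurable lborel \<Longrightarrow> KM A \<in> borel_measurable lborel"
  unfolding KM_def[abs_def] by (rule borel_measurable_times) auto

lemma NL_measurable:
  assumes [measurable]: "A \<in> borel_measurable lborel" shows "NL A \<in> borel_measurable lborel"
proof -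
  note [measurable] = KM_measurable[OF assms]
  show ?thesis unfolding NL_def[abs_def] by measurable
qed

lemma norm_combination:
  assumes "cmod a \<le> X" "cmod b \<le> X" "cmod c \<le> X"
  shows "cmod (complex_of_real c0 * (a - 2 * b + 2 * c)) \<le> 5 * X"
proof -
  have X: "0 \<le> X" using order_trans[OF norm_ge_zero assms(1)] .
  have "cmod (a - 2 * b + 2 * c) \<le> cmod (a - 2 * b) + cmod (2 * c)" by (rule norm_triangle_ineq)
  also have "\<dots> \<le> cmod a + cmod (2 * b) + cmod (2 * c)"
    by (intro add_right_mono norm_triangle_ineq4)
  also have "\<dots> \<le> 5 * X" using assms by (simp add: norm_mult)
  finally have "c0 * cmod (a - 2 * b + 2 * c) \<le> 1 * (5 * X)"
    using c0 X by (intro mult_mono) auto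
  then show ?thesis using c0 by (simp add: norm_mult)
qed

text \<open>Convolutions and correlations of square integrable functions are bounded. The quadratic
  terms are thus controlled uniformly in frequency and are paired with integrable test
  profiles.\<close>

lemma NL_bound:
  assumes A: "Xc A" shows "cmod (NL A k) \<le> 5 * (nX A)\<^sup>2"
proof -
  note K = Xc_KM[OF A] and S = Xc_self[OF A]
  have KK: "L2n lborel (KM A) * L2n lborel (KM A) \<le> (nX A)\<^sup>2"
    unfolding power2_eq_square by (intro mult_mono K) auto
  have SK: "L2n lborel A * L2n lborel (KM A) \<le> (nX A)\<^sup>2"
    unfolding power2_eq_square by (intro mult_mono K S) auto
  show ?thesis unfolding NL_def
    by (rule norm_combination[OF order_trans[OF convol_bound[OF K(1) K(1)] KK]
          order_trans[OF correl_bound[OF K(1) K(1)] KK] order_trans[OF correl_bound[OF S(1) K(1)] SK]])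
qed

lemma convol_diff:
  assumes "sqi lborel U" "sqi lborel V"
  shows "convol U U k - convol V V k = convol (\<lambda>k. U k - V k) U k + convol V (\<lambda>k. U k - V k) k"
proof -
  note i = conv_integrable[OF assms(1,1), of k] conv_integrable[OF assms(2,1), of k] conv_integrable[OF assms(2,2), of k]
  show ?thesis unfolding convol_def left_diff_distrib right_diff_distrib
    by (simp only: Bochner_Integration.integral_diff[OF i(1,2)] Bochner_Integration.integral_diff[OF i(2,3)]) simp
qed

lemma correl_diff:
  assumes "sqi lborel U" "sqi lborel U'" "sqi lborel V" "sqi lborel V'"
  shows "correl U V k - correl U' V' k = correl (\<lambda>k. U k - U' k) V k + correl U' (\<lambda>k. V k - V' k) k"
proof -
  note i = correl_integrable[OF assms(1,3), of k] correl_integrable[OF assms(2,3), of k] correl_integrable[OF assms(2,4), of k]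
  show ?thesis unfolding correl_def complex_cnj_diff left_diff_distrib right_diff_distrib
    by (simp only: Bochner_Integration.integral_diff[OF i(1,2)] Bochner_Integration.integral_diff[OF i(2,3)] diff_add_cancel add_diff_eq)
qed

text \<open>The H^1 norm, halfway between \<open>nW\<close> and \<open>nX\<close>; of the three it
  is the weakest that controls \<open>KM u\<close> in L2.\<close>

definition n2 :: "(real \<Rightarrow> complex) \<Rightarrow> real" where
  "n2 u = L2n lborel (\<lambda>k. complex_of_real (1 + \<bar>k\<bar>) * u k)"

lemma Xc_n2:
  assumes u: "Xc u"
  shows "sqi lborel (\<lambda>k. complex_of_real (1 + \<bar>k\<bar>) * u k)" "L2n lborel u \<le> n2 u" "L2n lborel (KM u) \<le> n2 u"
proof -
  have "cmod (complex_of_real (1 + \<bar>k\<bar>)) \<le> cmod (s3 k)" for k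
    using le_s3[of k] by (simp only: norm_of_real)
  from Xc_sqi(1)[OF u _ this] show s: "sqi lborel (\<lambda>k. complex_of_real (1 + \<bar>k\<bar>) * u k)" by simp
  have 1: "cmod (u k) \<le> cmod (complex_of_real (1 + \<bar>k\<bar>) * u k)" for k
    unfolding norm_mult norm_of_real by (rule mult_le_cancel_right1[THEN iffD2]) auto
  have 2: "cmod (KM u k) \<le> cmod (complex_of_real (1 + \<bar>k\<bar>) * u k)" for k
    unfolding norm_mult norm_of_real KM_def by (intro mult_right_mono) auto
  show "L2n lborel u \<le> n2 u" unfolding n2_def
    by (rule L2n_mono[OF s Xc_measurable[OF u] AE_I2[OF 1]])
  show "L2n lborel (KM u) \<le> n2 u" unfolding n2_def
    by (rule L2n_mono[OF s KM_measurable[OF Xc_measurable[OF u]] AE_I2[OF 2]])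
qed

text \<open>Cauchy-Schwarz, since \<open>cmod (s1 k) * cmod (s3 k)\<close> is the square of
  \<open>1 + \<bar>k\<bar>\<close>. This converts convergence in H^(1/2) with a bound in H^(3/2)
  into convergence in H^1, where the quadratic terms are continuous.\<close>

lemma n2_interpolation:
  assumes u: "Xc u" shows "(n2 u)\<^sup>2 \<le> nW u * nX u"
proof -
  have s: "sqi lborel (\<lambda>k. s1 k * u k)" "sqi lborel (\<lambda>k. s3 k * u k)"
    using Xc_s1(1)[OF u] u by (auto simp: Xc_def)
  have "(cmod (complex_of_real (1 + \<bar>k\<bar>) * u k))\<^sup>2 = cmod (s1 k * u k) * cmod (s3 k * u k)" for k
  proof -
    have "cmod (s1 k) * cmod (s3 k) = (1 + \<bar>k\<bar>)\<^sup>2"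
      unfolding cmod_s1 cmod_s3 real_sqrt_mult[symmetric]
      by (rule real_sqrt_unique) (auto simp: power2_eq_square power3_eq_cube)
    moreover have "(cmod (complex_of_real (1 + \<bar>k\<bar>) * u k))\<^sup>2 = (1 + \<bar>k\<bar>)\<^sup>2 * (cmod (u k))\<^sup>2"
      unfolding norm_mult power_mult_distrib norm_of_real by simp
    ultimately show ?thesis by (simp add: norm_mult power2_eq_square mult_ac)
  qed
  then have "(n2 u)\<^sup>2 = (LINT k|lborel. cmod (s1 k * u k) * cmod (s3 k * u k))"
    unfolding n2_def L2n_sq by presburger
  also have "\<dots> \<le> nW u * nX u" unfolding nW_def nX_def
    by (rule sqi_mult_integrable(2)[OF s])
  finally show ?thesis .
qed

lemma NL_diff:
  assumes A: "Xc A" and B: "Xc B"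
  shows "cmod (NL A k - NL B k) \<le> 5 * (n2 (\<lambda>k. A k - B k) * (nX A + nX B))"
proof -
  note d = Xc_n2[OF Xc_diff[OF A B]]
  note KA = Xc_KM[OF A] and KB = Xc_KM[OF B] and SA = Xc_self[OF A] and SB = Xc_self[OF B]
  note ds = Xc_self(1)[OF Xc_diff[OF A B]] and dK = Xc_KM(1)[OF Xc_diff[OF A B]]
  have KD: "(\<lambda>k. KM A k - KM B k) = KM (\<lambda>k. A k - B k)"
    by (auto simp: KM_def algebra_simps)
  have n2: "0 \<le> n2 (\<lambda>k. A k - B k)" by (simp add: n2_def)
  let ?n = "n2 (\<lambda>k. A k - B k)"
  have 1: "cmod (convol (KM A) (KM A) k - convol (KM B) (KM B) k) \<le> ?n * (nX A + nX B)"
    unfolding convol_diff[OF KA(1) KB(1)] KD distrib_left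
  proof (rule norm_triangle_mono)
    show "cmod (convol (KM (\<lambda>k. A k - B k)) (KM A) k) \<le> ?n * nX A"
      by (rule order_trans[OF convol_bound[OF dK KA(1)]]) (intro mult_mono d KA n2 L2n_nonneg)
    show "cmod (convol (KM B) (KM (\<lambda>k. A k - B k)) k) \<le> ?n * nX B"
      by (rule order_trans[OF convol_bound[OF KB(1) dK]], subst mult.commute) (intro mult_mono d KB n2 L2n_nonneg)
  qed
  have 2: "cmod (correl (KM A) (KM A) k - correl (KM B) (KM B) k) \<le> ?n * (nX A + nX B)"
    unfolding correl_diff[OF KA(1) KB(1) KA(1) KB(1)] KD distrib_left
  proof (rule norm_triangle_mono)
    show "cmod (correl (KM (\<lambda>k. A k - B k)) (KM A) k) \<le> ?n * nX A"
      by (rule order_trans[OF correl_bound[OF dK KA(1)]]) (intro mult_mono d KA n2 L2n_nonneg)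
    show "cmod (correl (KM B) (KM (\<lambda>k. A k - B k)) k) \<le> ?n * nX B"
      by (rule order_trans[OF correl_bound[OF KB(1) dK]], subst mult.commute) (intro mult_mono d KB n2 L2n_nonneg)
  qed
  have 3: "cmod (correl A (KM A) k - correl B (KM B) k) \<le> ?n * (nX A + nX B)"
    unfolding correl_diff[OF SA(1) SB(1) KA(1) KB(1)] KD distrib_left
  proof (rule norm_triangle_mono)
    show "cmod (correl (\<lambda>k. A k - B k) (KM A) k) \<le> ?n * nX A"
      by (rule order_trans[OF correl_bound[OF ds KA(1)]]) (intro mult_mono d KA n2 L2n_nonneg)
    show "cmod (correl B (KM (\<lambda>k. A k - B k)) k) \<le> ?n * nX B"
      by (rule order_trans[OF correl_bound[OF SB(1) dK]], subst mult.commute) (intro mult_mono d SB n2 L2n_nonneg)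
  qed
  have "NL A k - NL B k = complex_of_real c0 * ((convol (KM A) (KM A) k - convol (KM B) (KM B) k)
     - 2 * (correl (KM A) (KM A) k - correl (KM B) (KM B) k) + 2 * (correl A (KM A) k - correl B (KM B) k))"
    by (simp add: NL_def algebra_simps)
  then show ?thesis using norm_combination[OF 1 2 3] by simp
qed

section \<open>Energy and difference estimates\<close>

lemma bcs_pair_integrable:
  assumes Z: "bcs N Z" and F: "F \<in> borel_measurable lborel" "\<And>k. cmod (F k) \<le> C"
  shows "integrable lborel (\<lambda>k. cnj (Z k) * F k)"
proof (rule Bochner_Integration.integrable_bound[OF integrable_mult_right[OF bcs_integrable[OF Z], of "complex_of_real C"]])
  show "AE k in lborel. norm (cnj (Z k) * F k) \<le> norm (complex_of_real C * Z k)"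
  proof (rule AE_I2)
    fix k
    have "cmod (F k) * cmod (Z k) \<le> \<bar>C\<bar> * cmod (Z k)"
      using F(2)[of k] by (intro mult_right_mono) auto
    then show "norm (cnj (Z k) * F k) \<le> norm (complex_of_real C * Z k)"
      by (simp add: norm_mult mult.commute)
  qed
qed (use F(1) bcs_measurable[OF Z] in measurable)

lemma NL_pair:
  assumes Z: "bcs N Z" and A: "bcs N A"
  shows "integrable lborel (\<lambda>k. cnj (Z k) * NL A k)"
    and "Re (LINT k|lborel. cnj (Z k) * NL A k) = c0 * (Tri Z (KM A) (KM A) - 2 * Tri (KM A) Z (KM A) + 2 * Tri A Z (KM A))"
proof -
  note X = bcs_Xc[OF A]
  note K = KM_bcs[OF A] and Am = bcs_measurable[OF A] and Km = KM_measurable[OF bcs_measurable[OF A]]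
  show "integrable lborel (\<lambda>k. cnj (Z k) * NL A k)"
    by (rule bcs_pair_integrable[OF Z NL_measurable[OF Am] NL_bound[OF X]])
  have i1: "integrable lborel (\<lambda>k. cnj (Z k) * convol (KM A) (KM A) k)"
    by (rule bcs_pair_integrable[OF Z borel_measurable_convol[OF Km Km] convol_bound[OF bcs_sqi[OF K] bcs_sqi[OF K]]])
  have i2: "integrable lborel (\<lambda>k. cnj (Z k) * correl (KM A) (KM A) k)"
    by (rule bcs_pair_integrable[OF Z borel_measurable_correl[OF Km Km] correl_bound[OF bcs_sqi[OF K] bcs_sqi[OF K]]])
  have i3: "integrable lborel (\<lambda>k. cnj (Z k) * correl A (KM A) k)"
    by (rule bcs_pair_integrable[OF Z borel_measurable_correl[OF Am Km] correl_bound[OF bcs_sqi[OF A] bcs_sqi[OF K]]])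
  have "cnj (Z k) * NL A k = complex_of_real c0 * (cnj (Z k) * convol (KM A) (KM A) k
      - 2 * (cnj (Z k) * correl (KM A) (KM A) k) + 2 * (cnj (Z k) * correl A (KM A) k))" for k
    by (simp add: NL_def algebra_simps)
  then have "(LINT k|lborel. cnj (Z k) * NL A k) = complex_of_real c0 * ((LINT k|lborel. cnj (Z k) * convol (KM A) (KM A) k)
      - 2 * (LINT k|lborel. cnj (Z k) * correl (KM A) (KM A) k) + 2 * (LINT k|lborel. cnj (Z k) * correl A (KM A) k))"
    using i1 i2 i3 by simp
  then show "Re (LINT k|lborel. cnj (Z k) * NL A k) = c0 * (Tri Z (KM A) (KM A) - 2 * Tri (KM A) Z (KM A) + 2 * Tri A Z (KM A))"
    unfolding convol_pair[OF Z K K, symmetric] correl_pair[OF Z K K, symmetric] correl_pair[OF Z A K, symmetric]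
    by simp
qed

lemma abs_Re_le: "\<bar>Re z * r\<bar> \<le> cmod z * \<bar>r\<bar>"
  unfolding abs_mult by (intro mult_right_mono abs_Re_le_cmod) auto

text \<open>The cubic energy estimate: after symmetrization in the two frequencies the terms of order
  five in the frequencies cancel.\<close>

lemma energy_estimate:
  assumes A: "bcs N A"
  shows "\<bar>Re (LINT k|lborel. cnj (complex_of_real (1 + k\<^sup>2) * A k) * NL A k)\<bar> \<le> 6 * (nX A)\<^sup>2 * n1 A"
proof -
  define Z where "Z k = complex_of_real (1 + k\<^sup>2) * A k" for k
  have Z: "bcs N Z" unfolding Z_def[abs_def]
    by (rule bcs_mult_cont[OF A]) (intro continuous_intros)
  note K = KM_bcs[OF A] and S = bcs_s3[OF A]
  let ?M = "lborel \<Otimes>\<^sub>M (lborel :: real measure)"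
  let ?g = "\<lambda>p. Re (tri Z (KM A) (KM A) p) - Re (tri (KM A) Z (KM A) p) - Re (tri (KM A) (KM A) Z p)
      + Re (tri A Z (KM A) p) + Re (tri A (KM A) Z p)"
  let ?b1 = "\<lambda>p. cmod ((\<lambda>k. s3 k * A k) (fst p + snd p)) * cmod ((\<lambda>k. s3 k * A k) (fst p)) * cmod (A (snd p))"
  let ?b2 = "\<lambda>p. cmod ((\<lambda>k. s3 k * A k) (fst p + snd p)) * cmod (A (fst p)) * cmod ((\<lambda>k. s3 k * A k) (snd p))"
  note i = Re_tri_integrable[OF Z K K] Re_tri_integrable[OF K Z K] Re_tri_integrable[OF K K Z]
    Re_tri_integrable[OF A Z K] Re_tri_integrable[OF A K Z]
  \<comment> \<open>Each doubled correlation term is replaced by its two orderings in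
    \<open>l\<close> and \<open>m\<close>; only the symmetrized integrand shows the
    cancellation.\<close>
  have "Tri Z (KM A) (KM A) - 2 * Tri (KM A) Z (KM A) + 2 * Tri A Z (KM A)
      = Tri Z (KM A) (KM A) - Tri (KM A) Z (KM A) - Tri (KM A) (KM A) Z + Tri A Z (KM A) + Tri A (KM A) Z"
    using Tri_swap[OF K Z K] Tri_swap[OF A Z K] by simp
  also have "\<dots> = (LINT p|?M. ?g p)"
    unfolding Tri_def using i by simp
  finally have eq: "Re (LINT k|lborel. cnj (Z k) * NL A k) = c0 * (LINT p|?M. ?g p)"
    using NL_pair(2)[OF Z A] by simp
  have pt: "\<bar>?g p\<bar> \<le> 3 * (?b1 p + ?b2 p)" for p
  proof -
    obtain l m where p: "p = (l, m)" by (cases p)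
    show ?thesis
    proof (cases "0 < l \<and> 0 < m")
      case False
      then have "A l = 0 \<or> A m = 0" using bcs_0[OF A] by auto
      then show ?thesis by (auto simp: p tri_def KM_def Z_def)
    next
      case True
      define P where "P = cnj (A (l + m)) * A l * A m"
      define a where "a = 1 + l + m"
      \<comment> \<open>The quartic term \<open>l * m * (l + m)\<^sup>2\<close> enters with a plus
        sign from the convolution and, as \<open>(l + m) * (m * l\<^sup>2 + l * m\<^sup>2)\<close>,
        with a minus sign from the two orderings of the first correlation. What remains has degree
        three.\<close>
      define q where "q = l * m - (l + m)\<^sup>2 + (l + m) + l * m * (l + m)"
      have g: "?g p = Re P * q"
        unfolding p tri_def KM_def Z_def P_def q_def fst_conv snd_conv
        by (simp add: algebra_simps power2_eq_square power3_eq_cube)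
      have q: "\<bar>q\<bar> \<le> a ^ 3"
      proof -
        have lm: "0 \<le> l * m" "0 \<le> l + m" "l * m \<le> (l + m)\<^sup>2" "l * m * (l + m) \<le> (l + m) ^ 3"
          using True by (auto simp: power2_eq_square power3_eq_cube algebra_simps)
        have "0 \<le> l * m * (l + m)" using lm by simp
        moreover have "a ^ 3 = 1 + 3 * (l + m) + 3 * (l + m)\<^sup>2 + (l + m) ^ 3"
          by (simp add: a_def power2_eq_square power3_eq_cube algebra_simps)
        moreover have "0 \<le> (l + m)\<^sup>2" "0 \<le> (l + m) ^ 3" using lm by auto
        moreover have "\<bar>x - y + z + t\<bar> \<le> 1 + 3 * z + 3 * y + v"
          if "0 \<le> x" "0 \<le> z" "x \<le> y" "t \<le> v" "0 \<le> t" "0 \<le> y" "0 \<le> v" for x y z t v :: real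
          using that by linarith
        ultimately show ?thesis using lm unfolding q_def by presburger
      qed
      have "\<bar>?g p\<bar> \<le> cmod P * \<bar>q\<bar>" unfolding g by (rule abs_Re_le)
      also have "\<dots> \<le> cmod P * (3 * (cmod (s3 (l + m)) * (cmod (s3 l) + cmod (s3 m))))"
        using q weight3[of l m] True unfolding a_def by (intro mult_left_mono) auto
      also have "\<dots> = 3 * (?b1 p + ?b2 p)"
        by (simp add: P_def p norm_mult algebra_simps)
      finally show ?thesis .
    qed
  qed
  have "\<bar>LINT p|?M. ?g p\<bar> \<le> (LINT p|?M. \<bar>?g p\<bar>)"
    using integral_norm_bound[of ?M ?g] by simp
  also have "\<dots> \<le> (LINT p|?M. 3 * (?b1 p + ?b2 p))"
  proof (rule integral_mono[OF _ _ pt])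
    show "integrable ?M (\<lambda>p. \<bar>?g p\<bar>)" using i by simp
    show "integrable ?M (\<lambda>p. 3 * (?b1 p + ?b2 p))"
      by (intro integrable_mult_right Bochner_Integration.integrable_add tri_norm_bound(1)[OF S S A] tri_norm_bound(1)[OF S A S])
  qed
  also have "\<dots> = 3 * ((LINT p|?M. ?b1 p) + (LINT p|?M. ?b2 p))"
    by (simp only: integral_mult_right_zero Bochner_Integration.integral_add[OF tri_norm_bound(1)[OF S S A] tri_norm_bound(1)[OF S A S]])
  also have "\<dots> \<le> 3 * (nX A * nX A * n1 A + nX A * nX A * n1 A)"
    unfolding nX_def
    by (intro mult_left_mono add_mono tri_norm_bound(2)[OF S S A, folded n1_def] tri_norm_bound'[OF S A S]) simp
  finally have b: "\<bar>LINT p|?M. ?g p\<bar> \<le> 6 * (nX A)\<^sup>2 * n1 A" by (simp add: power2_eq_square mult_ac)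
  have "c0 * \<bar>LINT p|?M. ?g p\<bar> \<le> 1 * (6 * (nX A)\<^sup>2 * n1 A)"
    using c0 b by (intro mult_mono) auto
  then show ?thesis unfolding Z_def[symmetric] eq abs_mult using c0 by simp
qed

text \<open>In terms of the sum \<open>s\<close> and the difference \<open>w\<close>, every tested
  quadratic form polarizes into terms linear in \<open>s\<close> and quadratic in \<open>w\<close>.
  After collecting, the polynomial factors put no weight on \<open>w\<close> at the frequency
  \<open>l\<close>: that factor enters through its L1 norm, the other \<open>w\<close> through
  H^(1/2).\<close>

lemma difference_estimate:
  assumes D: "bcs N D" and A: "bcs N A"
  defines "w \<equiv> \<lambda>k. D k - A k" and "s \<equiv> \<lambda>k. D k + A k"
  shows "\<bar>Re (LINT k|lborel. cnj (w k) * (NL D k - NL A k))\<bar> \<le> 2 * nW w * nX s * n1 w"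
proof -
  have w: "bcs N w" unfolding w_def by (rule bcs_diff[OF D A])
  have s: "bcs N s" unfolding s_def by (rule bcs_add[OF D A])
  note KD = KM_bcs[OF D] and KA = KM_bcs[OF A] and Kw = KM_bcs[OF w] and Ks = KM_bcs[OF s]
  note sw = bcs_s1[OF w] and ss = bcs_s3[OF s]
  let ?M = "lborel \<Otimes>\<^sub>M (lborel :: real measure)"
  have Dd: "D k = (s k + w k) / 2" and Ad: "A k = (s k - w k) / 2" for k by (auto simp: s_def w_def)
  have 1: "Tri w (KM D) (KM D) - Tri w (KM A) (KM A) = Tri w (KM w) (KM s)"
  proof -
    have "Tri w (KM D) (KM D) - Tri w (KM A) (KM A) = (LINT p|?M. Re (tri w (KM D) (KM D) p) - Re (tri w (KM A) (KM A) p))"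
      unfolding Tri_def using Re_tri_integrable[OF w KD KD] Re_tri_integrable[OF w KA KA] by simp
    also have "\<dots> = (LINT p|?M. (Re (tri w (KM w) (KM s) p) + Re (tri w (KM s) (KM w) p)) / 2)"
      by (intro Bochner_Integration.integral_cong refl) (simp add: tri_def KM_def Dd Ad field_simps)
    also have "\<dots> = (Tri w (KM w) (KM s) + Tri w (KM s) (KM w)) / 2"
      unfolding Tri_def using Re_tri_integrable[OF w Kw Ks] Re_tri_integrable[OF w Ks Kw] by simp
    finally show ?thesis using Tri_swap[OF w Ks Kw] by simp
  qed
  have 2: "2 * Tri (KM D) w (KM D) - 2 * Tri (KM A) w (KM A) = Tri (KM w) w (KM s) + Tri (KM s) w (KM w)"
  proof -
    have "2 * Tri (KM D) w (KM D) - 2 * Tri (KM A) w (KM A) = (LINT p|?M. 2 * Re (tri (KM D) w (KM D) p) - 2 * Re (tri (KM A) w (KM A) p))"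
      unfolding Tri_def using Re_tri_integrable[OF KD w KD] Re_tri_integrable[OF KA w KA] by simp
    also have "\<dots> = (LINT p|?M. Re (tri (KM w) w (KM s) p) + Re (tri (KM s) w (KM w) p))"
      by (intro Bochner_Integration.integral_cong refl) (simp add: tri_def KM_def Dd Ad field_simps)
    finally show ?thesis unfolding Tri_def using Re_tri_integrable[OF Kw w Ks] Re_tri_integrable[OF Ks w Kw] by simp
  qed
  have 3: "2 * Tri D w (KM D) - 2 * Tri A w (KM A) = Tri w w (KM s) + Tri s w (KM w)"
  proof -
    have "2 * Tri D w (KM D) - 2 * Tri A w (KM A) = (LINT p|?M. 2 * Re (tri D w (KM D) p) - 2 * Re (tri A w (KM A) p))"
      unfolding Tri_def using Re_tri_integrable[OF D w KD] Re_tri_integrable[OF A w KA] by simp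
    also have "\<dots> = (LINT p|?M. Re (tri w w (KM s) p) + Re (tri s w (KM w) p))"
      by (intro Bochner_Integration.integral_cong refl) (simp add: tri_def KM_def Dd Ad field_simps)
    finally show ?thesis unfolding Tri_def using Re_tri_integrable[OF w w Ks] Re_tri_integrable[OF s w Kw] by simp
  qed
  let ?g = "\<lambda>p. Re (tri w (KM w) (KM s) p) - Re (tri (KM w) w (KM s) p) - Re (tri (KM s) w (KM w) p)
      + Re (tri w w (KM s) p) + Re (tri s w (KM w) p)"
  let ?b1 = "\<lambda>p. cmod ((\<lambda>k. s1 k * w k) (fst p + snd p)) * cmod (w (fst p)) * cmod ((\<lambda>k. s3 k * s k) (snd p))"
  let ?b2 = "\<lambda>p. cmod ((\<lambda>k. s3 k * s k) (fst p + snd p)) * cmod (w (fst p)) * cmod ((\<lambda>k. s1 k * w k) (snd p))"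
  note i = Re_tri_integrable[OF w Kw Ks] Re_tri_integrable[OF Kw w Ks] Re_tri_integrable[OF Ks w Kw]
    Re_tri_integrable[OF w w Ks] Re_tri_integrable[OF s w Kw]
  have eq: "Re (LINT k|lborel. cnj (w k) * (NL D k - NL A k)) = c0 * (LINT p|?M. ?g p)"
  proof -
    have "Re (LINT k|lborel. cnj (w k) * (NL D k - NL A k))
        = Re (LINT k|lborel. cnj (w k) * NL D k) - Re (LINT k|lborel. cnj (w k) * NL A k)"
      unfolding right_diff_distrib by (simp add: Bochner_Integration.integral_diff[OF NL_pair(1)[OF w D] NL_pair(1)[OF w A]])
    also have "\<dots> = c0 * ((Tri w (KM D) (KM D) - Tri w (KM A) (KM A)) - (2 * Tri (KM D) w (KM D) - 2 * Tri (KM A) w (KM A))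
        + (2 * Tri D w (KM D) - 2 * Tri A w (KM A)))"
      unfolding NL_pair(2)[OF w D] NL_pair(2)[OF w A] by (simp add: algebra_simps)
    also have "\<dots> = c0 * (LINT p|?M. ?g p)"
      unfolding 1 2 3 unfolding Tri_def using i by (simp add: algebra_simps)
    finally show ?thesis .
  qed
  have pt: "\<bar>?g p\<bar> \<le> ?b1 p + ?b2 p" for p
  proof -
    obtain l m where p: "p = (l, m)" by (cases p)
    show ?thesis
    proof (cases "0 < l \<and> 0 < m")
      case False
      then have "w l = 0 \<or> (w m = 0 \<and> s m = 0)" using bcs_0[OF w] bcs_0[OF s] by auto
      then show ?thesis by (auto simp: p tri_def KM_def)
    next
      case True
      define P where "P = cnj (w (l + m)) * w l * s m"
      define Q where "Q = cnj (s (l + m)) * w l * w m"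
      \<comment> \<open>The factors \<open>l * m\<close> and \<open>(l + m) * m\<close> combine to
        \<open>- m\<^sup>2\<close>. To leading order two derivatives thus fall on \<open>s\<close>
        in the first term, while in the second one falls on \<open>s\<close> and one on
        \<open>w\<close>.\<close>
      have g: "?g p = Re P * (m - m\<^sup>2) + Re Q * (m - (l + m) * m)"
        unfolding p tri_def KM_def P_def Q_def fst_conv snd_conv
        by (simp add: algebra_simps power2_eq_square)
      have q1: "\<bar>m - m\<^sup>2\<bar> \<le> (1 + m)\<^sup>2" using True by (auto simp: power2_eq_square abs_le_iff algebra_simps)
      have q2: "\<bar>m - (l + m) * m\<bar> \<le> (1 + l + m) * (1 + m)"
      proof -
        have "0 \<le> (l + m) * m" using True by simp
        moreover have "(1 + l + m) * (1 + m) = 1 + l + 2 * m + (l + m) * m" by (simp add: algebra_simps)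
        ultimately show ?thesis using True by linarith
      qed
      have "\<bar>?g p\<bar> \<le> cmod P * \<bar>m - m\<^sup>2\<bar> + cmod Q * \<bar>m - (l + m) * m\<bar>"
        unfolding g using abs_triangle_ineq[of "Re P * (m - m\<^sup>2)" "Re Q * (m - (l + m) * m)"]
          abs_Re_le[of P "m - m\<^sup>2"] abs_Re_le[of Q "m - (l + m) * m"] by linarith
      also have "\<dots> \<le> cmod P * (cmod (s3 m) * cmod (s1 (l + m))) + cmod Q * (cmod (s3 (l + m)) * cmod (s1 m))"
        using True by (intro add_mono mult_left_mono order_trans[OF q1 weight31(1)] order_trans[OF q2 weight31(2)]) auto
      also have "\<dots> = ?b1 p + ?b2 p"
        by (simp add: P_def Q_def p norm_mult algebra_simps)
      finally show ?thesis .
    qed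
  qed
  have "\<bar>LINT p|?M. ?g p\<bar> \<le> (LINT p|?M. \<bar>?g p\<bar>)"
    using integral_norm_bound[of ?M ?g] by simp
  also have "\<dots> \<le> (LINT p|?M. ?b1 p + ?b2 p)"
  proof (rule integral_mono[OF _ _ pt])
    show "integrable ?M (\<lambda>p. \<bar>?g p\<bar>)" using i by simp
    show "integrable ?M (\<lambda>p. ?b1 p + ?b2 p)"
      by (intro Bochner_Integration.integrable_add tri_norm_bound(1)[OF sw w ss] tri_norm_bound(1)[OF ss w sw])
  qed
  also have "\<dots> = (LINT p|?M. ?b1 p) + (LINT p|?M. ?b2 p)"
    by (rule Bochner_Integration.integral_add[OF tri_norm_bound(1)[OF sw w ss] tri_norm_bound(1)[OF ss w sw]])
  also have "\<dots> \<le> nW w * nX s * n1 w + nX s * nW w * n1 w"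
    unfolding nX_def nW_def
    by (intro add_mono tri_norm_bound'[OF sw w ss] tri_norm_bound'[OF ss w sw])
  finally have b: "\<bar>LINT p|?M. ?g p\<bar> \<le> 2 * nW w * nX s * n1 w" by (simp add: mult_ac)
  have "c0 * \<bar>LINT p|?M. ?g p\<bar> \<le> 1 * (2 * nW w * nX s * n1 w)"
    using c0 b by (intro mult_mono) auto
  then show ?thesis unfolding eq abs_mult using c0 by simp
qed

text \<open>Cauchy-Schwarz after inserting the weight and its inverse; \<open>F\<close> is an
  antiderivative of the inverse square of the weight.\<close>

lemma n1_weight_bound:
  assumes A: "bcs N A" and z: "\<And>k. k \<le> M \<Longrightarrow> A k = 0" and M: "0 \<le> M" "M \<le> N"
    and s: "s \<in> borel_measurable lborel" "\<And>k. 0 < cmod (s k)" and sA: "sqi lborel (\<lambda>k. s k * A k)"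
    and F: "\<And>k. M \<le> k \<Longrightarrow> k \<le> N \<Longrightarrow> (F has_real_derivative 1 / (cmod (s k))\<^sup>2) (at k)"
  shows "n1 A \<le> sqrt (F N - F M) * L2n lborel (\<lambda>k. s k * A k)"
proof -
  define g where "g k = complex_of_real (1 / cmod (s k) * indicat_real {M..N} k)" for k
  have gm: "g \<in> borel_measurable lborel" unfolding g_def[abs_def] using s(1) by measurable
  have hb: "has_bochner_integral lborel (\<lambda>k. 1 / (cmod (s k))\<^sup>2 * indicat_real {M..N} k) (F N - F M)"
  proof (rule has_bochner_integral_FTC_Icc_nonneg[OF _ F _ M(2)])
    show "(\<lambda>k. 1 / (cmod (s k))\<^sup>2) \<in> borel_measurable borel"
      using measurable_compose[OF s(1) borel_measurable_norm] by simp
  qed auto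
  have g2: "(cmod (g k))\<^sup>2 = 1 / (cmod (s k))\<^sup>2 * indicat_real {M..N} k" for k
    by (auto simp: g_def indicator_def norm_divide power_divide)
  have gs: "sqi lborel g" unfolding sqi_def g2 using gm hb by (auto simp: has_bochner_integral_iff)
  have gn: "L2n lborel g = sqrt (F N - F M)"
    unfolding L2n_def g2 using hb by (simp add: has_bochner_integral_iff)
  have "cmod (g k) * cmod (s k * A k) = cmod (A k)" for k
  proof (cases "A k = 0")
    case False
    then have "k \<in> {M..N}" using z[of k] bcs_0[OF A, of k] by force
    then show ?thesis using s(2)[of k] by (simp add: g_def norm_mult norm_divide)
  qed simp
  then show ?thesis
    using sqi_mult_integrable(2)[OF gs sA] unfolding n1_def gn by simp
qed

text \<open>For the weight 3/2 the antiderivative is a multiple of the inverse square of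
  \<open>1 + k\<close>, whose root is the gain \<open>1 / (1 + M)\<close>. With \<open>M\<close> the
  coarser of two frequency cutoffs this becomes the consistency error between two levels.\<close>

lemma n1_le_nX_tail:
  assumes A: "bcs N A" and z: "\<And>k. k \<le> M \<Longrightarrow> A k = 0" and M: "0 \<le> M" "M \<le> N"
  shows "n1 A \<le> nX A / (1 + M)"
proof -
  have d: "((\<lambda>k. - (inverse (1 + k))\<^sup>2 / 2) has_real_derivative 1 / (cmod (s3 k))\<^sup>2) (at k)" if "M \<le> k" "k \<le> N" for k
  proof -
    have "1 / cmod (s3 k) ^ 2 = inverse (1 + k) ^ 3" using that M by (simp add: cmod_s3 inverse_eq_divide power_divide)
    moreover have "((\<lambda>k. - (inverse (1 + k))\<^sup>2 / 2) has_real_derivative inverse (1 + k) ^ 3) (at k)"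
      using that M by (auto intro!: derivative_eq_intros simp: power2_eq_square power3_eq_cube)
    ultimately show ?thesis by simp
  qed
  have s0: "0 < cmod (s3 k)" for k using one_le_s3[of k] by linarith
  have "n1 A \<le> sqrt (- (inverse (1 + N))\<^sup>2 / 2 - - (inverse (1 + M))\<^sup>2 / 2) * nX A"
    unfolding nX_def by (rule n1_weight_bound[OF A z M _ s0 bcs_sqi[OF bcs_s3[OF A]] d]) auto
  also have "\<dots> \<le> (1 / (1 + M)) * nX A"
  proof (rule mult_right_mono)
    have "- (inverse (1 + N))\<^sup>2 / 2 - - (inverse (1 + M))\<^sup>2 / 2 \<le> (inverse (1 + M))\<^sup>2"
      using zero_le_power2[of "inverse (1 + N)"] zero_le_power2[of "inverse (1 + M)"] by linarith
    then show "sqrt (- (inverse (1 + N))\<^sup>2 / 2 - - (inverse (1 + M))\<^sup>2 / 2) \<le> 1 / (1 + M)"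
      using M by (intro real_le_lsqrt) (auto simp: inverse_eq_divide)
  qed simp
  finally show ?thesis by simp
qed

lemma n1_le_nX:
  assumes A: "bcs N A" and N: "0 \<le> N"
  shows "n1 A \<le> nX A"
proof -
  have "A k = 0" if "k \<le> 0" for k by (rule bcs_0[OF A]) (use that in simp)
  from n1_le_nX_tail[OF A this order_refl N] show ?thesis by simp
qed

text \<open>For the weight 1/2 the antiderivative is a logarithm. This is the borderline failure of
  H^(1/2) to control the L1 norm of the transform, and the origin of the growing Gronwall
  constant.\<close>

lemma n1_le_nW:
  assumes A: "bcs N A" and N: "0 \<le> N"
  shows "n1 A \<le> sqrt (ln (1 + N)) * nW A"
proof -
  have d: "((\<lambda>k. ln (1 + k)) has_real_derivative 1 / (cmod (s1 k))\<^sup>2) (at k)" if "0 \<le> k" "k \<le> N" for k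
  proof -
    have "cmod (s1 k) ^ 2 = 1 + k" using that by (simp add: cmod_s1)
    then show ?thesis using that by (auto intro!: derivative_eq_intros)
  qed
  have z: "A k = 0" if "k \<le> 0" for k by (rule bcs_0[OF A]) (use that in simp)
  have s0: "0 < cmod (s1 k)" for k using one_le_s1[of k] by linarith
  have "n1 A \<le> sqrt (ln (1 + N) - ln (1 + 0)) * nW A"
    unfolding nW_def by (rule n1_weight_bound[OF A z order_refl N _ s0 bcs_sqi[OF bcs_s1[OF A]] d]) auto
  then show ?thesis by simp
qed

section \<open>Truncated Euler iterates\<close>

definition ip :: "(real \<Rightarrow> real) \<Rightarrow> (real \<Rightarrow> complex) \<Rightarrow> (real \<Rightarrow> complex) \<Rightarrow> real" where
  "ip \<omega> A B = (LINT k|lborel. \<omega> k * Re (cnj (A k) * B k))"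

lemma ip_integrable:
  assumes A: "bcs N A" and B: "bcs N B" and w: "continuous_on UNIV \<omega>"
  shows "integrable lborel (\<lambda>k. \<omega> k * Re (cnj (A k) * B k))"
proof -
  have "continuous_on UNIV (\<lambda>k. complex_of_real (\<omega> k))" using w by (intro continuous_intros)
  from bcs_sqi[OF bcs_mult_cont[OF A this]]
  have "integrable lborel (\<lambda>k. cnj (complex_of_real (\<omega> k) * A k) * B k)"
    by (rule sqi_mult_integrable(1)[OF sqi_cnj bcs_sqi[OF B]])
  from integrable_Re[OF this] show ?thesis by (simp add: algebra_simps)
qed

lemma ip_add_sq:
  assumes A: "bcs N A" and B: "bcs N B" and w: "continuous_on UNIV \<omega>"
  shows "ip \<omega> (\<lambda>k. A k + complex_of_real h * B k) (\<lambda>k. A k + complex_of_real h * B k)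
    = ip \<omega> A A + 2 * h * ip \<omega> A B + h\<^sup>2 * ip \<omega> B B"
proof -
  have "\<omega> k * Re (cnj (A k + complex_of_real h * B k) * (A k + complex_of_real h * B k))
      = \<omega> k * Re (cnj (A k) * A k) + (2 * h) * (\<omega> k * Re (cnj (A k) * B k)) + h\<^sup>2 * (\<omega> k * Re (cnj (B k) * B k))" for k
    by (simp add: power2_eq_square algebra_simps)
  then show ?thesis
    unfolding ip_def using ip_integrable[OF A A w] ip_integrable[OF A B w] ip_integrable[OF B B w] by simp
qed

lemma ip_diff_right:
  assumes A: "bcs N A" and B: "bcs N B" and C: "bcs N C" and w: "continuous_on UNIV \<omega>"
  shows "ip \<omega> (\<lambda>k. B k - complex_of_real h * C k) A = ip \<omega> B A - h * ip \<omega> C A"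
proof -
  have "\<omega> k * Re (cnj (B k - complex_of_real h * C k) * A k)
      = \<omega> k * Re (cnj (B k) * A k) - h * (\<omega> k * Re (cnj (C k) * A k))" for k
    by (simp add: algebra_simps)
  then show ?thesis
    unfolding ip_def using ip_integrable[OF B A w] ip_integrable[OF C A w] by simp
qed

lemma ip_self: "ip \<omega> A A = (LINT k|lborel. \<omega> k * (cmod (A k))\<^sup>2)"
proof -
  have "Re (cnj (A k) * A k) = (cmod (A k))\<^sup>2" for k
    unfolding cmod_power2 by (simp add: power2_eq_square)
  then show ?thesis by (simp add: ip_def)
qed

lemma ip_self_integrable:
  assumes A: "bcs N A" and w: "continuous_on UNIV \<omega>"
  shows "integrable lborel (\<lambda>k. \<omega> k * (cmod (A k))\<^sup>2)"
proof -
  have "Re (cnj (A k) * A k) = (cmod (A k))\<^sup>2" for k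
    unfolding cmod_power2 by (simp add: power2_eq_square)
  then show ?thesis using ip_integrable[OF A A w] by simp
qed

lemma ip_nonneg: "(\<And>k. 0 \<le> \<omega> k) \<Longrightarrow> 0 \<le> ip \<omega> A A"
  unfolding ip_self by (intro Bochner_Integration.integral_nonneg) auto

lemma ip_AMGM:
  assumes A: "bcs N A" and B: "bcs N B" and w: "continuous_on UNIV \<omega>" "\<And>k. 0 \<le> \<omega> k"
  shows "2 * \<bar>ip \<omega> A B\<bar> \<le> ip \<omega> A A + ip \<omega> B B"
proof -
  have pt: "\<bar>\<omega> k * Re (cnj (A k) * B k)\<bar> \<le> (\<omega> k * (cmod (A k))\<^sup>2 + \<omega> k * (cmod (B k))\<^sup>2) / 2" for k
  proof -
    have "\<bar>Re (cnj (A k) * B k)\<bar> \<le> cmod (A k) * cmod (B k)"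
      using abs_Re_le_cmod[of "cnj (A k) * B k"] by (simp add: norm_mult)
    also have "\<dots> \<le> ((cmod (A k))\<^sup>2 + (cmod (B k))\<^sup>2) / 2"
      using sum_squares_bound[of "cmod (A k)" "cmod (B k)"] by simp
    finally have "\<omega> k * \<bar>Re (cnj (A k) * B k)\<bar> \<le> \<omega> k * (((cmod (A k))\<^sup>2 + (cmod (B k))\<^sup>2) / 2)"
      using w(2)[of k] by (intro mult_left_mono)
    then show ?thesis
      unfolding abs_mult[of "\<omega> k"] abs_of_nonneg[OF w(2)] by (simp only: times_divide_eq_right distrib_left)
  qed
  have "\<bar>ip \<omega> A B\<bar> \<le> (LINT k|lborel. \<bar>\<omega> k * Re (cnj (A k) * B k)\<bar>)"
    unfolding ip_def using integral_norm_bound[of lborel "\<lambda>k. \<omega> k * Re (cnj (A k) * B k)"] by simp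
  also have "\<dots> \<le> (LINT k|lborel. (\<omega> k * (cmod (A k))\<^sup>2 + \<omega> k * (cmod (B k))\<^sup>2) / 2)"
  proof (rule integral_mono[OF _ _ pt])
    show "integrable lborel (\<lambda>k. \<bar>\<omega> k * Re (cnj (A k) * B k)\<bar>)" using ip_integrable[OF A B w(1)] by simp
    show "integrable lborel (\<lambda>k. (\<omega> k * (cmod (A k))\<^sup>2 + \<omega> k * (cmod (B k))\<^sup>2) / 2)"
      using ip_self_integrable[OF A w(1)] ip_self_integrable[OF B w(1)] by simp
  qed
  also have "\<dots> = (ip \<omega> A A + ip \<omega> B B) / 2"
    unfolding ip_self using ip_self_integrable[OF A w(1)] ip_self_integrable[OF B w(1)] by simp
  finally show ?thesis by simp
qed

lemma ip_diff_sq: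
  assumes A: "bcs N A" and B: "bcs N B" and w: "continuous_on UNIV \<omega>" "\<And>k. 0 \<le> \<omega> k"
  shows "ip \<omega> (\<lambda>k. A k - B k) (\<lambda>k. A k - B k) \<le> 2 * ip \<omega> A A + 2 * ip \<omega> B B"
  using ip_add_sq[OF A B w(1), of "-1"] ip_AMGM[OF A B w] by simp

lemma ip_mono_weight:
  assumes A: "bcs N A" and w: "continuous_on UNIV \<omega>" "continuous_on UNIV \<omega>'" and le: "\<And>k. \<omega> k \<le> \<omega>' k"
  shows "ip \<omega> A A \<le> ip \<omega>' A A"
  unfolding ip_self
  by (rule integral_mono[OF ip_self_integrable[OF A w(1)] ip_self_integrable[OF A w(2)]])
     (intro mult_right_mono le zero_le_power2)

lemma nX_sq: "(nX A)\<^sup>2 = ip (\<lambda>k. (1 + \<bar>k\<bar>) ^ 3) A A"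
  unfolding nX_def L2n_sq ip_self norm_mult power_mult_distrib cmod_s3 by simp

lemma nW_sq: "(nW A)\<^sup>2 = ip (\<lambda>k. 1 + \<bar>k\<bar>) A A"
  unfolding nW_def L2n_sq ip_self norm_mult power_mult_distrib cmod_s1 by simp

lemma ip_cmult_weight: "ip (\<lambda>k. c * \<omega> k) A B = c * ip \<omega> A B"
  unfolding ip_def mult.assoc by simp

text \<open>If the transform of \<open>f\<close> is \<open>\<i> * A\<close> on the positive half-line, the equation reads
  \<open>wt * A\<^sub>t = RR A\<close>; \<open>QQ N\<close> is the resulting velocity truncated to frequencies up to \<open>N\<close> and
  \<open>eul N h b n\<close> the \<open>n\<close>-th Euler iterate with step \<open>h\<close> and initial datum \<open>b\<close>.\<close>

locale evol =
  fixes \<epsilon> \<alpha> :: real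
  assumes eps: "0 < \<epsilon>" and alpha: "0 < \<alpha>"
begin

definition wt :: "real \<Rightarrow> real" where "wt k = 2 + \<alpha> * \<bar>k\<bar>"
text \<open>The factor \<open>wt\<close> cancels the division in \<open>QQ\<close>, so pairing with
  the velocity leaves the weight \<open>1 + k\<^sup>2\<close> of the cubic estimate; the resulting
  energy is comparable with the square of \<open>nX\<close>.\<close>

definition wE :: "real \<Rightarrow> real" where "wE k = wt k * (1 + k\<^sup>2)"
text \<open>\<open>mu\<close> and \<open>nu\<close> are the constants of the equivalence between
  \<open>wt k\<close> and \<open>1 + \<bar>k\<bar>\<close>; positivity of \<open>mu\<close> rests on
  \<open>0 < \<alpha>\<close>.\<close>

definition mu :: real where "mu = min 2 \<alpha>"
definition nu :: real where "nu = max 2 \<alpha>"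

definition RR :: "(real \<Rightarrow> complex) \<Rightarrow> real \<Rightarrow> complex" where
  "RR A k = (if 0 < k then \<i> * complex_of_real ((k - 1) / \<epsilon>) * A k + NL A k else 0)"

definition QQ :: "real \<Rightarrow> (real \<Rightarrow> complex) \<Rightarrow> real \<Rightarrow> complex" where
  "QQ N A k = (if 0 < k \<and> k \<le> N then RR A k / complex_of_real (wt k) else 0)"

text \<open>A bound for the squared energy norm of the velocity at cutoff \<open>N\<close> when
  \<open>nX\<close> is at most \<open>x\<close>. Its growth in \<open>N\<close> is the stiffness of
  explicit steps and dictates the step size.\<close>

definition CR :: "real \<Rightarrow> real \<Rightarrow> real" where
  "CR N x = (1 + N) / \<epsilon>\<^sup>2 * x\<^sup>2 + 25 * x ^ 4 * (1 + N) ^ 3"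

lemma wt_ge: "2 \<le> wt k" using alpha by (simp add: wt_def)
lemma wt_pos: "0 < wt k" using wt_ge[of k] by linarith
lemma wt_cont: "continuous_on UNIV wt" unfolding wt_def[abs_def] by (intro continuous_intros)
lemma wE_cont: "continuous_on UNIV wE" unfolding wE_def[abs_def] by (intro continuous_intros wt_cont)
lemma wt_nonneg: "0 \<le> wt k" using wt_pos[of k] by linarith
lemma mu: "0 < mu" "mu \<le> 2" "mu \<le> \<alpha>" using alpha by (auto simp: mu_def)
lemma nu: "0 < nu" "2 \<le> nu" "\<alpha> \<le> nu" using alpha by (auto simp: nu_def)

lemma wt_lower: "mu * (1 + \<bar>k\<bar>) \<le> wt k"
  using mu mult_right_mono[OF mu(3), of "\<bar>k\<bar>"] by (simp add: wt_def algebra_simps)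

lemma wt_upper: "wt k \<le> nu * (1 + \<bar>k\<bar>)"
  using nu mult_right_mono[OF nu(3), of "\<bar>k\<bar>"] by (simp add: wt_def algebra_simps)

lemma wE_lower: "mu / 2 * (1 + \<bar>k\<bar>) ^ 3 \<le> wE k"
proof -
  have "(1 + \<bar>k\<bar>)\<^sup>2 \<le> 2 * (1 + k\<^sup>2)"
    using sum_squares_bound[of 1 "\<bar>k\<bar>"] by (simp add: power2_sum)
  then have "(mu * (1 + \<bar>k\<bar>)) * (1 + \<bar>k\<bar>)\<^sup>2 \<le> wt k * (2 * (1 + k\<^sup>2))"
    using wt_lower[of k] wt_nonneg[of k] by (intro mult_mono) auto
  then show ?thesis by (simp add: wE_def power2_eq_square power3_eq_cube algebra_simps)
qed

lemma wE_upper: "wE k \<le> nu * (1 + \<bar>k\<bar>) ^ 3"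
proof -
  have "1 + k\<^sup>2 \<le> (1 + \<bar>k\<bar>)\<^sup>2" by (simp add: power2_sum)
  then have "wt k * (1 + k\<^sup>2) \<le> (nu * (1 + \<bar>k\<bar>)) * (1 + \<bar>k\<bar>)\<^sup>2"
    using wt_upper[of k] nu by (intro mult_mono) auto
  then show ?thesis by (simp add: wE_def power2_eq_square power3_eq_cube mult_ac)
qed

lemma wt_le_wE: "wt k \<le> wE k"
  using mult_left_mono[of 1 "1 + k\<^sup>2" "wt k"] wt_nonneg[of k] by (simp add: wE_def)

lemma cont3: "continuous_on UNIV (\<lambda>k::real. c * (1 + \<bar>k\<bar>) ^ 3)" "continuous_on UNIV (\<lambda>k::real. c * (1 + \<bar>k\<bar>))" for c :: real
  by (intro continuous_intros)+

lemma nX_le_E: "bcs N A \<Longrightarrow> mu / 2 * (nX A)\<^sup>2 \<le> ip wE A A"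
  unfolding nX_sq ip_cmult_weight[symmetric] by (rule ip_mono_weight[OF _ cont3(1) wE_cont wE_lower])

lemma E_le_nX: "bcs N A \<Longrightarrow> ip wE A A \<le> nu * (nX A)\<^sup>2"
  unfolding nX_sq ip_cmult_weight[symmetric] by (rule ip_mono_weight[OF _ wE_cont cont3(1) wE_upper])

lemma nW_le_e: "bcs N A \<Longrightarrow> mu * (nW A)\<^sup>2 \<le> ip wt A A"
  unfolding nW_sq ip_cmult_weight[symmetric] by (rule ip_mono_weight[OF _ cont3(2) wt_cont wt_lower])

lemma e_le_nW: "bcs N A \<Longrightarrow> ip wt A A \<le> nu * (nW A)\<^sup>2"
  unfolding nW_sq ip_cmult_weight[symmetric] by (rule ip_mono_weight[OF _ wt_cont cont3(2) wt_upper])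

lemma e_le_E: "bcs N A \<Longrightarrow> ip wt A A \<le> ip wE A A"
  by (rule ip_mono_weight[OF _ wt_cont wE_cont wt_le_wE])

lemma RR_measurable:
  assumes "A \<in> borel_measurable lborel" shows "RR A \<in> borel_measurable lborel"
proof -
  have [measurable]: "A \<in> borel_measurable borel" "NL A \<in> borel_measurable borel"
    using assms NL_measurable[OF assms] by auto
  have "RR A \<in> borel_measurable borel" unfolding RR_def[abs_def] by measurable
  then show ?thesis by simp
qed

lemma RR_bound: "Xc A \<Longrightarrow> cmod (RR A k) \<le> (1 + \<bar>k\<bar>) / \<epsilon> * cmod (A k) + 5 * (nX A)\<^sup>2"
proof -
  assume A: "Xc A"
  show ?thesis
  proof (cases "0 < k")
    case True
    have "cmod (RR A k) \<le> cmod (\<i> * complex_of_real ((k - 1) / \<epsilon>) * A k) + cmod (NL A k)"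
      unfolding RR_def using True by (simp add: norm_triangle_ineq)
    moreover have "cmod (\<i> * complex_of_real ((k - 1) / \<epsilon>) * A k) \<le> (1 + \<bar>k\<bar>) / \<epsilon> * cmod (A k)"
      unfolding norm_mult norm_of_real using eps True
      by (intro mult_right_mono) (auto simp: abs_divide intro!: divide_right_mono)
    ultimately show ?thesis using NL_bound[OF A, of k] by linarith
  next
    case False
    have "0 \<le> (1 + \<bar>k\<bar>) / \<epsilon> * cmod (A k)" using eps by simp
    then show ?thesis using False by (simp add: RR_def)
  qed
qed

lemma QQ_bcs:
  assumes A: "bcs N A" shows "bcs N (QQ N A)"
  unfolding bcs_def
proof (intro conjI)
  have [measurable]: "RR A \<in> borel_measurable borel" using RR_measurable[OF bcs_measurable[OF A]] by simp
  have [measurable]: "wt \<in> borel_measurable borel" by (rule borel_measurable_continuous_onI[OF wt_cont])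
  have "QQ N A \<in> borel_measurable borel" unfolding QQ_def[abs_def] by measurable
  then show "QQ N A \<in> borel_measurable lborel" by simp
  obtain K where K: "0 \<le> K" "\<And>k. cmod (A k) \<le> K" using bcs_bound[OF A] by blast
  have "cmod (QQ N A k) \<le> (1 + \<bar>N\<bar>) / \<epsilon> * K + 5 * (nX A)\<^sup>2" for k
  proof (cases "0 < k \<and> k \<le> N")
    case True
    have "cmod (QQ N A k) \<le> cmod (RR A k)"
    proof -
      have "cmod (QQ N A k) = cmod (RR A k) / wt k"
        using True wt_pos[of k] by (simp add: QQ_def norm_divide)
      also have "\<dots> \<le> cmod (RR A k) / 1"
        using wt_ge[of k] by (intro divide_left_mono) auto
      finally show ?thesis by simp
    qed
    also have "\<dots> \<le> (1 + \<bar>k\<bar>) / \<epsilon> * cmod (A k) + 5 * (nX A)\<^sup>2" by (rule RR_bound[OF bcs_Xc[OF A]])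
    also have "\<dots> \<le> (1 + \<bar>N\<bar>) / \<epsilon> * K + 5 * (nX A)\<^sup>2"
      using True eps K by (intro add_right_mono mult_mono divide_right_mono) auto
    finally show ?thesis .
  next
    case False
    then have "QQ N A k = 0" unfolding QQ_def by (rule if_not_P)
    then show ?thesis using K eps by simp
  qed
  then show "\<exists>K. \<forall>k. cmod (QQ N A k) \<le> K" by blast
qed (auto simp: QQ_def split: if_splits)

text \<open>The linear part of the velocity is an imaginary multiple of \<open>A\<close> and drops
  out of the real part; the rest is the cubic energy estimate, with the L1 norm bounded by
  \<open>nX\<close>.\<close>

lemma E_deriv:
  assumes A: "bcs N A" and N: "0 \<le> N"
  shows "\<bar>ip wE A (QQ N A)\<bar> \<le> 6 * (nX A) ^ 3"
proof -
  have pt: "wE k * Re (cnj (A k) * QQ N A k) = Re (cnj (complex_of_real (1 + k\<^sup>2) * A k) * NL A k)" for k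
  proof (cases "0 < k \<and> k \<le> N")
    case True
    have w: "wt k \<noteq> 0" using wt_pos[of k] by simp
    have "QQ N A k = complex_of_real (1 / wt k) * RR A k" using True by (simp add: QQ_def)
    moreover have "Re (cnj b * (complex_of_real r * z)) = r * Re (cnj b * z)" for b r z
      by (simp add: algebra_simps)
    ultimately have "wE k * Re (cnj (A k) * QQ N A k) = (wE k / wt k) * Re (cnj (A k) * RR A k)"
      by (simp only:) simp
    also have "wE k / wt k = 1 + k\<^sup>2" using w by (simp add: wE_def)
    also have "Re (cnj (A k) * RR A k) = Re (cnj (A k) * NL A k)"
      using True by (simp add: RR_def algebra_simps)
    finally show ?thesis by (simp add: algebra_simps)
  next
    case False
    then show ?thesis using bcs_0[OF A False] by simp
  qed
  have "integrable lborel (\<lambda>k. cnj (complex_of_real (1 + k\<^sup>2) * A k) * NL A k)"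
    by (rule NL_pair(1)[OF bcs_mult_cont[OF A] A]) (intro continuous_intros)
  then have "ip wE A (QQ N A) = Re (LINT k|lborel. cnj (complex_of_real (1 + k\<^sup>2) * A k) * NL A k)"
    unfolding ip_def pt by (rule integral_Re)
  then have "\<bar>ip wE A (QQ N A)\<bar> \<le> 6 * (nX A)\<^sup>2 * n1 A"
    using energy_estimate[OF A] by simp
  also have "\<dots> \<le> 6 * (nX A)\<^sup>2 * nX A"
    by (intro mult_left_mono n1_le_nX[OF A N]) auto
  finally show ?thesis by (simp add: power2_eq_square power3_eq_cube mult_ac)
qed

lemma CR_nonneg: "0 \<le> N \<Longrightarrow> 0 \<le> CR N x"
  unfolding CR_def using eps by (intro add_nonneg_nonneg mult_nonneg_nonneg) auto

lemma CR_mono: "0 \<le> N \<Longrightarrow> N \<le> N' \<Longrightarrow> CR N x \<le> CR N' x"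
  unfolding CR_def using eps
  by (intro add_mono mult_right_mono mult_left_mono divide_right_mono power_mono) auto

lemma E_QQ:
  assumes A: "bcs N A" and N: "0 \<le> N" and x: "nX A \<le> x"
  shows "ip wE (QQ N A) (QQ N A) \<le> CR N x"
proof -
  have pt: "wE k * (cmod (QQ N A k))\<^sup>2 \<le> (1 + N) / \<epsilon>\<^sup>2 * (cmod (s3 k * A k))\<^sup>2 + 25 * x ^ 4 * (1 + N)\<^sup>2 * indicat_real {0..N} k" for k
  proof (cases "0 < k \<and> k \<le> N")
    case True
    have x4: "(5 * (nX A)\<^sup>2)\<^sup>2 \<le> 25 * x ^ 4"
    proof -
      have "(nX A) ^ 4 \<le> x ^ 4" using x by (intro power_mono) auto
      then show ?thesis by (simp add: power_mult_distrib flip: power_mult)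
    qed
    have "(cmod (RR A k))\<^sup>2 \<le> ((1 + \<bar>k\<bar>) / \<epsilon> * cmod (A k) + 5 * (nX A)\<^sup>2)\<^sup>2"
      by (rule power_mono[OF RR_bound[OF bcs_Xc[OF A]] norm_ge_zero])
    also have "\<dots> \<le> 2 * ((1 + \<bar>k\<bar>) / \<epsilon> * cmod (A k))\<^sup>2 + 2 * (5 * (nX A)\<^sup>2)\<^sup>2"
      using sum_squares_bound[of "(1 + \<bar>k\<bar>) / \<epsilon> * cmod (A k)" "5 * (nX A)\<^sup>2"] by (simp only: power2_sum)
    also have "\<dots> \<le> 2 * ((1 + k)\<^sup>2 / \<epsilon>\<^sup>2 * (cmod (A k))\<^sup>2) + 2 * (25 * x ^ 4)"
      using True x4 by (simp add: power_mult_distrib power_divide)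
    finally have r: "(cmod (RR A k))\<^sup>2 / 2 \<le> (1 + k)\<^sup>2 / \<epsilon>\<^sup>2 * (cmod (A k))\<^sup>2 + 25 * x ^ 4" by linarith
    have "wE k * (cmod (QQ N A k))\<^sup>2 = (1 + k\<^sup>2) * ((cmod (RR A k))\<^sup>2 / wt k)"
      using True wt_pos[of k] by (simp add: QQ_def wE_def norm_divide power_divide power2_eq_square)
    also have "\<dots> \<le> (1 + k\<^sup>2) * ((cmod (RR A k))\<^sup>2 / 2)"
      using wt_ge[of k] by (intro mult_left_mono divide_left_mono) auto
    also have "\<dots> \<le> (1 + k\<^sup>2) * ((1 + k)\<^sup>2 / \<epsilon>\<^sup>2 * (cmod (A k))\<^sup>2 + 25 * x ^ 4)"
      by (rule mult_left_mono[OF r]) simp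
    also have "\<dots> \<le> (1 + k)\<^sup>2 * ((1 + k)\<^sup>2 / \<epsilon>\<^sup>2 * (cmod (A k))\<^sup>2 + 25 * x ^ 4)"
      using True eps by (intro mult_right_mono) (auto simp: power2_sum)
    also have "\<dots> = (1 + k) * ((1 + k) ^ 3 * (cmod (A k))\<^sup>2 / \<epsilon>\<^sup>2) + (1 + k)\<^sup>2 * (25 * x ^ 4)"
    proof -
      have "u * (u / e * c + y) = v * (z * c / e) + u * y" if "u * u = v * z" for u v z e c y :: real
      proof -
        have "u * (u / e * c + y) = (u * u) * c / e + u * y" by (simp add: distrib_left)
        then show ?thesis unfolding that by simp
      qed
      then show ?thesis by (simp flip: power_add power_Suc)
    qed
    also have "\<dots> \<le> (1 + N) * ((1 + k) ^ 3 * (cmod (A k))\<^sup>2 / \<epsilon>\<^sup>2) + (1 + N)\<^sup>2 * (25 * x ^ 4)"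
      using True by (intro add_mono mult_right_mono power_mono) auto
    also have "\<dots> = (1 + N) / \<epsilon>\<^sup>2 * (cmod (s3 k * A k))\<^sup>2 + 25 * x ^ 4 * (1 + N)\<^sup>2 * indicat_real {0..N} k"
      using True by (simp add: norm_mult power_mult_distrib cmod_s3 mult_ac)
    finally show ?thesis .
  next
    case False
    then have "QQ N A k = 0" unfolding QQ_def by (rule if_not_P)
    moreover have "0 \<le> (1 + N) / \<epsilon>\<^sup>2 * (cmod (s3 k * A k))\<^sup>2 + 25 * x ^ 4 * (1 + N)\<^sup>2 * indicat_real {0..N} k"
      using N by (intro add_nonneg_nonneg mult_nonneg_nonneg) auto
    ultimately show ?thesis by simp
  qed
  have i1: "integrable lborel (\<lambda>k. (1 + N) / \<epsilon>\<^sup>2 * (cmod (s3 k * A k))\<^sup>2)"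
    by (intro integrable_mult_right sqi_integrable[OF bcs_sqi[OF bcs_s3[OF A]]])
  have i2: "integrable lborel (\<lambda>k. 25 * x ^ 4 * (1 + N)\<^sup>2 * indicat_real {0..N} k)"
    by (intro integrable_mult_right integrable_real_indicator) (auto simp: emeasure_lborel_Icc_eq)
  have "ip wE (QQ N A) (QQ N A) \<le> (LINT k|lborel. (1 + N) / \<epsilon>\<^sup>2 * (cmod (s3 k * A k))\<^sup>2 + 25 * x ^ 4 * (1 + N)\<^sup>2 * indicat_real {0..N} k)"
    unfolding ip_self
    by (rule integral_mono[OF ip_self_integrable[OF QQ_bcs[OF A] wE_cont] Bochner_Integration.integrable_add[OF i1 i2] pt])
  also have "\<dots> = (1 + N) / \<epsilon>\<^sup>2 * (nX A)\<^sup>2 + 25 * x ^ 4 * (1 + N)\<^sup>2 * N"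
    unfolding Bochner_Integration.integral_add[OF i1 i2] integral_mult_right_zero nX_def L2n_sq using N by simp
  also have "\<dots> \<le> CR N x"
  proof -
    have "(nX A)\<^sup>2 \<le> x\<^sup>2" using x by (intro power_mono) auto
    moreover have "(1 + N)\<^sup>2 * N \<le> (1 + N) ^ 3" using N by (simp add: power2_eq_square power3_eq_cube mult_left_mono)
    ultimately show ?thesis unfolding CR_def mult.assoc[of "25 * x ^ 4"]
      using N by (intro add_mono mult_left_mono) auto
  qed
  finally show ?thesis .
qed

section \<open>Energy bound for the iterates and difference of velocities\<close>

primrec eul :: "real \<Rightarrow> real \<Rightarrow> (real \<Rightarrow> complex) \<Rightarrow> nat \<Rightarrow> real \<Rightarrow> complex" where
  "eul N h a 0 = a"
| "eul N h a (Suc n) = (\<lambda>k. eul N h a n k + complex_of_real h * QQ N (eul N h a n) k)"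

lemma eul_bcs: "bcs N a \<Longrightarrow> bcs N (eul N h a n)"
  by (induction n) (auto intro!: bcs_add bcs_cmult QQ_bcs)

lemma nX_bound_E:
  assumes A: "bcs N A" and E: "ip wE A A \<le> mu / 2 * x\<^sup>2" and x: "0 \<le> x"
  shows "nX A \<le> x"
proof -
  have "mu / 2 * (nX A)\<^sup>2 \<le> mu / 2 * x\<^sup>2" using nX_le_E[OF A] E by linarith
  then have "(nX A)\<^sup>2 \<le> x\<^sup>2" using mu by (simp add: mult_le_cancel_left)
  then show ?thesis using x by (rule power2_le_imp_le)
qed

text \<open>One step changes the energy by a linear term of at most \<open>12 * x ^ 3 * h\<close>
  and a quadratic one of at most \<open>h\<close>, the latter because
  \<open>h * CR N x \<le> 1\<close>. As long as the accumulated growth is at most 1, the energy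
  stays below \<open>M0 + 1\<close>, which keeps \<open>nX\<close> below \<open>x\<close> and closes
  the induction.\<close>

lemma eul_energy:
  assumes a: "bcs N a" and N: "0 \<le> N" and h: "0 \<le> h" "h * CR N x \<le> 1" and x: "0 \<le> x"
    and M: "ip wE a a \<le> M0" "M0 + 1 \<le> mu / 2 * x\<^sup>2" and n: "real n * h * (12 * x ^ 3 + 1) \<le> 1"
  shows "ip wE (eul N h a n) (eul N h a n) \<le> M0 + real n * h * (12 * x ^ 3 + 1)"
  using n
proof (induction n)
  case 0 then show ?case using M by simp
next
  case (Suc n)
  let ?A = "eul N h a n"
  have A: "bcs N ?A" by (rule eul_bcs[OF a])
  have hh: "0 \<le> h * (12 * x ^ 3 + 1)" using h x by simp
  have "real n * h * (12 * x ^ 3 + 1) \<le> 1" using Suc.prems hh by (simp add: algebra_simps)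
  with Suc.IH have E: "ip wE ?A ?A \<le> M0 + real n * h * (12 * x ^ 3 + 1)" by simp
  also have "\<dots> \<le> M0 + 1" using \<open>real n * h * (12 * x ^ 3 + 1) \<le> 1\<close> by simp
  finally have xA: "nX ?A \<le> x" using M(2) by (intro nX_bound_E[OF A _ x]) linarith
  have d: "ip wE ?A (QQ N ?A) \<le> 6 * x ^ 3"
  proof -
    have "6 * (nX ?A) ^ 3 \<le> 6 * x ^ 3" using xA by (intro mult_left_mono power_mono) auto
    then show ?thesis using E_deriv[OF A N] by linarith
  qed
  have "h\<^sup>2 * ip wE (QQ N ?A) (QQ N ?A) \<le> h * (h * CR N x)"
    using mult_left_mono[OF E_QQ[OF A N xA], of "h\<^sup>2"] by (simp add: power2_eq_square mult.assoc)
  also have "\<dots> \<le> h * 1" using h by (intro mult_left_mono)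
  finally have q: "h\<^sup>2 * ip wE (QQ N ?A) (QQ N ?A) \<le> h" by simp
  have "ip wE (eul N h a (Suc n)) (eul N h a (Suc n)) = ip wE ?A ?A + 2 * h * ip wE ?A (QQ N ?A) + h\<^sup>2 * ip wE (QQ N ?A) (QQ N ?A)"
    unfolding eul.simps by (rule ip_add_sq[OF A QQ_bcs[OF A] wE_cont])
  also have "\<dots> \<le> (M0 + real n * h * (12 * x ^ 3 + 1)) + 2 * h * (6 * x ^ 3) + h"
    using h by (intro add_mono E q mult_left_mono d) auto
  also have "\<dots> = M0 + real (Suc n) * h * (12 * x ^ 3 + 1)" by (simp add: algebra_simps)
  finally show ?case .
qed

lemma eul_nX:
  assumes a: "bcs N a" and N: "0 \<le> N" and h: "0 \<le> h" "h * CR N x \<le> 1" and x: "0 \<le> x"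
    and M: "ip wE a a \<le> M0" "M0 + 1 \<le> mu / 2 * x\<^sup>2" and n: "real n * h * (12 * x ^ 3 + 1) \<le> 1"
  shows "nX (eul N h a n) \<le> x"
  using eul_energy[OF assms] n M(2) by (intro nX_bound_E[OF eul_bcs[OF a] _ x]) linarith

text \<open>The two velocities are truncated at different frequencies. Up to \<open>N\<close> their
  difference is that of the untruncated right sides; above \<open>N\<close> the coarse profile
  vanishes while its quadratic term need not, and this leftover meets only the high-frequency tail
  of \<open>d\<close>.\<close>

lemma pairing_difference:
  assumes d: "bcs M d" and a: "bcs N a" and N: "0 \<le> N" "N \<le> M" and x: "nX d \<le> x" "nX a \<le> x"
  defines "v \<equiv> \<lambda>k. d k - a k"
  shows "\<bar>ip wt v (\<lambda>k. QQ M d k - QQ N a k)\<bar> \<le> 4 * x * sqrt (ln (1 + M)) / mu * ip wt v v + 5 * x ^ 3 / (1 + N)"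
proof -
  have a': "bcs M a" by (rule bcs_mono[OF a N(2)])
  have v: "bcs M v" unfolding v_def by (rule bcs_diff[OF d a'])
  have x0: "0 \<le> x" using x(1) nX_nonneg[of d] by linarith
  \<comment> \<open>The part of \<open>d\<close> above the coarse cutoff. Adding and subtracting
    \<open>NL a\<close> there restores the full difference \<open>NL d k - NL a k\<close>.\<close>
  define t where "t k = complex_of_real (indicat_real {N<..} k) * d k" for k
  have t: "bcs M t" unfolding t_def[abs_def]
    by (rule bcs_mult[OF d, where K=1]) (auto simp: indicator_def)
  have pt: "wt k * Re (cnj (v k) * (QQ M d k - QQ N a k)) = Re (cnj (v k) * (NL d k - NL a k)) + Re (cnj (t k) * NL a k)" for k
  proof (cases "0 < k \<and> k \<le> M")
    case False
    then have "v k = 0" "t k = 0" using bcs_0[OF v False] bcs_0[OF t False] by auto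
    then show ?thesis by simp
  next
    case True
    have w: "wt k \<noteq> 0" using wt_pos[of k] by simp
    have Q: "wt k * Re (z * (RR b k / complex_of_real (wt k))) = Re (z * RR b k)" for z b
      using w by (simp add: Re_divide_of_real)
    show ?thesis
    proof (cases "k \<le> N")
      case le: True
      have "t k = 0" using le by (simp add: t_def)
      moreover have "wt k * Re (cnj (v k) * (QQ M d k - QQ N a k)) = Re (cnj (v k) * RR d k) - Re (cnj (v k) * RR a k)"
        using True le Q[of "cnj (v k)" d] Q[of "cnj (v k)" a] by (simp add: QQ_def right_diff_distrib)
      moreover have "Re (cnj (v k) * RR d k) - Re (cnj (v k) * RR a k) = Re (cnj (v k) * (NL d k - NL a k))"
        using True by (simp add: RR_def v_def algebra_simps)
      ultimately show ?thesis by simp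
    next
      case gt: False
      have ak: "a k = 0" using gt bcs_0[OF a] by auto
      have "t k = d k" "v k = d k" using gt ak by (auto simp: t_def v_def)
      moreover have "wt k * Re (cnj (d k) * (QQ M d k - QQ N a k)) = Re (cnj (d k) * RR d k)"
        using True gt Q[of "cnj (d k)" d] by (simp add: QQ_def)
      moreover have "Re (cnj (d k) * RR d k) = Re (cnj (d k) * NL d k)"
        using True by (simp add: RR_def algebra_simps)
      ultimately show ?thesis by (simp add: algebra_simps)
    qed
  qed
  have i1: "integrable lborel (\<lambda>k. cnj (v k) * (NL d k - NL a k))"
    unfolding right_diff_distrib
    by (rule Bochner_Integration.integrable_diff[OF NL_pair(1)[OF v d] NL_pair(1)[OF v a']])
  have i2: "integrable lborel (\<lambda>k. cnj (t k) * NL a k)"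
    by (rule NL_pair(1)[OF t a'])
  have "ip wt v (\<lambda>k. QQ M d k - QQ N a k) = Re (LINT k|lborel. cnj (v k) * (NL d k - NL a k)) + Re (LINT k|lborel. cnj (t k) * NL a k)"
    unfolding ip_def pt by (simp only: Bochner_Integration.integral_add[OF integrable_Re[OF i1] integrable_Re[OF i2]] integral_Re[OF i1] integral_Re[OF i2])
  then have "\<bar>ip wt v (\<lambda>k. QQ M d k - QQ N a k)\<bar> \<le> \<bar>Re (LINT k|lborel. cnj (v k) * (NL d k - NL a k))\<bar> + \<bar>Re (LINT k|lborel. cnj (t k) * NL a k)\<bar>"
    by linarith
  moreover have "\<bar>Re (LINT k|lborel. cnj (v k) * (NL d k - NL a k))\<bar> \<le> 4 * x * sqrt (ln (1 + M)) / mu * ip wt v v"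
  proof -
    have L: "0 \<le> sqrt (ln (1 + M))" using N by simp
    have "\<bar>Re (LINT k|lborel. cnj (v k) * (NL d k - NL a k))\<bar> \<le> 2 * nW v * nX (\<lambda>k. d k + a k) * n1 v"
      unfolding v_def by (rule difference_estimate[OF d a'])
    also have "\<dots> \<le> 2 * nW v * (2 * x) * (sqrt (ln (1 + M)) * nW v)"
    proof (intro mult_mono mult_left_mono)
      show "nX (\<lambda>k. d k + a k) \<le> 2 * x"
        using nX_triangle[OF bcs_Xc[OF d] bcs_Xc[OF a]] x by linarith
      show "n1 v \<le> sqrt (ln (1 + M)) * nW v" using N by (intro n1_le_nW[OF v]) linarith
    qed (use x0 in auto)
    also have "\<dots> = 4 * x * sqrt (ln (1 + M)) / mu * (mu * (nW v)\<^sup>2)"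
      using mu by (simp add: power2_eq_square)
    also have "\<dots> \<le> 4 * x * sqrt (ln (1 + M)) / mu * ip wt v v"
      using x0 L mu by (intro mult_left_mono nW_le_e[OF v]) auto
    finally show ?thesis .
  qed
  moreover have "\<bar>Re (LINT k|lborel. cnj (t k) * NL a k)\<bar> \<le> 5 * x ^ 3 / (1 + N)"
  proof -
    have x2: "(nX a)\<^sup>2 \<le> x\<^sup>2" using x(2) by (intro power_mono) auto
    have "\<bar>Re (LINT k|lborel. cnj (t k) * NL a k)\<bar> \<le> cmod (LINT k|lborel. cnj (t k) * NL a k)"
      by (rule abs_Re_le_cmod)
    also have "\<dots> \<le> (LINT k|lborel. cmod (cnj (t k) * NL a k))" by (rule integral_norm_bound)
    also have "\<dots> \<le> (LINT k|lborel. (5 * x\<^sup>2) * cmod (t k))"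
    proof (rule integral_mono)
      show "cmod (cnj (t k) * NL a k) \<le> (5 * x\<^sup>2) * cmod (t k)" for k
        unfolding norm_mult complex_mod_cnj mult.commute[of "cmod (t k)"]
        using NL_bound[OF bcs_Xc[OF a], of k] x2 by (intro mult_right_mono) auto
    qed (use i2 bcs_integrable[OF t] in auto)
    also have "\<dots> = (5 * x\<^sup>2) * n1 t" by (simp add: n1_def)
    also have "n1 t \<le> x / (1 + N)"
    proof -
      have "nX t \<le> nX d"
        unfolding nX_def
      proof (rule L2n_mono[OF bcs_sqi[OF bcs_s3[OF d]] bcs_measurable[OF bcs_s3[OF t]]])
        show "AE k in lborel. cmod (s3 k * t k) \<le> cmod (s3 k * d k)"
          by (auto simp: t_def indicator_def)
      qed
      then have "nX t / (1 + N) \<le> x / (1 + N)" using x(1) N by (intro divide_right_mono) auto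
      moreover have "n1 t \<le> nX t / (1 + N)"
        by (rule n1_le_nX_tail[OF t _ N]) (simp add: t_def)
      ultimately show ?thesis by linarith
    qed
    finally have "\<bar>Re (LINT k|lborel. cnj (t k) * NL a k)\<bar> \<le> (5 * x\<^sup>2) * (x / (1 + N))"
      by (simp add: mult_left_mono)
    then show ?thesis by (simp add: power2_eq_square power3_eq_cube)
  qed
  ultimately show ?thesis by linarith
qed

end

section \<open>Gronwall argument between two levels\<close>

lemma ip_scale: "ip \<omega> (\<lambda>k. complex_of_real c * A k) (\<lambda>k. complex_of_real c * A k) = c\<^sup>2 * ip \<omega> A A"
proof -
  have e: "cnj (complex_of_real c * A k) * (complex_of_real c * A k) = complex_of_real (c\<^sup>2) * (cnj (A k) * A k)" for k
    by (simp add: power2_eq_square)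
  have R: "Re (complex_of_real r * z) = r * Re z" for r z by simp
  show ?thesis unfolding ip_def
    by (simp only: e R mult.left_commute[of "\<omega> _" "c\<^sup>2"] integral_mult_right_zero)
qed

lemma discrete_Gronwall:
  fixes e :: "nat \<Rightarrow> real"
  assumes e: "\<And>i. i < n \<Longrightarrow> e (Suc i) \<le> (1 + a) * e i + b" and a: "0 \<le> a" and b: "0 \<le> b" and e0: "0 \<le> e 0"
  shows "e n \<le> exp (real n * a) * (e 0 + real n * b)"
  using e
proof (induction n)
  case (Suc n)
  have IH: "e n \<le> exp (real n * a) * (e 0 + real n * b)" using Suc by simp
  have "e (Suc n) \<le> (1 + a) * e n + b" using Suc.prems by simp
  also have "\<dots> \<le> (1 + a) * (exp (real n * a) * (e 0 + real n * b)) + b"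
    using a by (intro add_right_mono mult_left_mono IH) auto
  also have "\<dots> \<le> exp a * (exp (real n * a) * (e 0 + real n * b)) + exp (real (Suc n) * a) * b"
  proof (intro add_mono mult_right_mono)
    show "1 + a \<le> exp a" by (rule exp_ge_add_one_self)
    show "b \<le> exp (real (Suc n) * a) * b" using b a mult_right_mono[of 1 "exp (real (Suc n) * a)" b] by simp
  qed (use e0 b in auto)
  also have "\<dots> = exp (real (Suc n) * a) * (e 0 + real (Suc n) * b)"
    by (simp add: algebra_simps exp_add)
  finally show ?case .
qed simp

context evol
begin

text \<open>One fine step of length \<open>h'\<close> is compared with the linear motion inside one
  coarse step, \<open>\<theta>\<close> being the time since the coarse node. The coarse velocity is
  evaluated at the node, so the pairing estimate controls the distance of \<open>d\<close> to
  \<open>a\<close> rather than \<open>w\<close>; the second claim bridges the two at a cost of order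
  \<open>h\<^sup>2\<close>.\<close>

lemma step_difference:
  assumes d: "bcs M d" and a: "bcs N a" and N: "0 \<le> N" "N \<le> M" and x: "nX d \<le> x" "nX a \<le> x"
    and h: "0 \<le> \<theta>" "\<theta> \<le> h" "0 \<le> h'" "h' \<le> h"
  defines "w \<equiv> \<lambda>k. d k - (a k + complex_of_real \<theta> * QQ N a k)"
    and "w' \<equiv> \<lambda>k. (d k + complex_of_real h' * QQ M d k) - (a k + complex_of_real (\<theta> + h') * QQ N a k)"
    and "L \<equiv> 16 * x * sqrt (ln (1 + M)) / mu"
  shows "ip wt w' w' \<le> (1 + h' * L) * ip wt w w + h' * (L * h\<^sup>2 * CR M x + 10 * x ^ 3 / (1 + N) + 10 * h * CR M x)"
    and "ip wt (\<lambda>k. d k - a k) (\<lambda>k. d k - a k) \<le> 2 * ip wt w w + 2 * h\<^sup>2 * CR M x"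
proof -
  note wc = wt_cont and wn = wt_nonneg
  have M0: "0 \<le> M" using N by linarith
  have x0: "0 \<le> x" using x(1) nX_nonneg[of d] by linarith
  have a': "bcs M a" by (rule bcs_mono[OF a N(2)])
  have qa: "bcs M (QQ N a)" by (rule bcs_mono[OF QQ_bcs[OF a] N(2)])
  have qd: "bcs M (QQ M d)" by (rule QQ_bcs[OF d])
  define v where "v k = d k - a k" for k
  define q where "q k = QQ M d k - QQ N a k" for k
  have v: "bcs M v" unfolding v_def[abs_def] by (rule bcs_diff[OF d a'])
  have q: "bcs M q" unfolding q_def[abs_def] by (rule bcs_diff[OF qd qa])
  have w: "bcs M w" unfolding w_def by (intro bcs_diff bcs_add bcs_cmult d a' qa)
  have Qa: "ip wt (QQ N a) (QQ N a) \<le> CR M x"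
    using e_le_E[OF QQ_bcs[OF a]] E_QQ[OF a N(1) x(2)] CR_mono[OF N, of x] by linarith
  have Qd: "ip wt (QQ M d) (QQ M d) \<le> CR M x"
    using e_le_E[OF qd] E_QQ[OF d M0 x(1)] by linarith
  have Qq: "ip wt q q \<le> 4 * CR M x"
    using ip_diff_sq[OF qd qa wc wn] Qa Qd unfolding q_def[symmetric, abs_def] by linarith
  have C: "0 \<le> CR M x" by (rule CR_nonneg[OF M0])
  have hh: "0 \<le> h" using h by linarith
  have th: "\<theta>\<^sup>2 * ip wt (QQ N a) (QQ N a) \<le> h\<^sup>2 * CR M x"
    using h Qa C by (intro mult_mono power_mono) (auto intro: ip_nonneg wn)
  show ev: "ip wt (\<lambda>k. d k - a k) (\<lambda>k. d k - a k) \<le> 2 * ip wt w w + 2 * h\<^sup>2 * CR M x"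
  proof -
    have "(\<lambda>k. d k - a k) = (\<lambda>k. w k - complex_of_real (- \<theta>) * QQ N a k)"
      by (auto simp: w_def)
    then have "ip wt (\<lambda>k. d k - a k) (\<lambda>k. d k - a k) \<le> 2 * ip wt w w + 2 * ((- \<theta>)\<^sup>2 * ip wt (QQ N a) (QQ N a))"
      using ip_diff_sq[OF w bcs_cmult[OF qa] wc wn, of "complex_of_real (- \<theta>)"] unfolding ip_scale by simp
    then show ?thesis using th by simp
  qed
  have wv: "w = (\<lambda>k. v k - complex_of_real \<theta> * QQ N a k)"
    by (auto simp: w_def v_def)
  have wq: "ip wt w q = ip wt v q - \<theta> * ip wt (QQ N a) q"
    unfolding wv by (rule ip_diff_right[OF q v qa wc])
  have 1: "\<bar>ip wt v q\<bar> \<le> L / 4 * ip wt v v + 5 * x ^ 3 / (1 + N)"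
    using pairing_difference[OF d a N x] unfolding v_def[symmetric] q_def[symmetric, abs_def] L_def by simp
  have 2: "\<bar>\<theta> * ip wt (QQ N a) q\<bar> \<le> h * (5 / 2 * CR M x)"
    unfolding abs_mult using h ip_AMGM[OF qa q wc wn] Qa Qq by (intro mult_mono) auto
  have L: "0 \<le> L" using x0 mu M0 by (simp add: L_def)
  have 3: "ip wt w q \<le> L / 4 * (2 * ip wt w w + 2 * h\<^sup>2 * CR M x) + 5 * x ^ 3 / (1 + N) + h * (5 / 2 * CR M x)"
  proof -
    have "L / 4 * ip wt v v \<le> L / 4 * (2 * ip wt w w + 2 * h\<^sup>2 * CR M x)"
      using L ev unfolding v_def[symmetric] by (intro mult_left_mono) auto
    with 1 2 show ?thesis unfolding wq by linarith
  qed
  have w'eq: "w' = (\<lambda>k. w k + complex_of_real h' * q k)"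
    by (auto simp: w'_def w_def q_def algebra_simps)
  have "ip wt w' w' = ip wt w w + 2 * h' * ip wt w q + h'\<^sup>2 * ip wt q q"
    unfolding w'eq by (rule ip_add_sq[OF w q wc])
  also have "\<dots> \<le> ip wt w w + 2 * h' * (L / 4 * (2 * ip wt w w + 2 * h\<^sup>2 * CR M x) + 5 * x ^ 3 / (1 + N) + h * (5 / 2 * CR M x))
      + h' * (h * (4 * CR M x))"
  proof (intro add_mono order_refl mult_left_mono 3)
    have "h' * (h' * ip wt q q) \<le> h' * (h * (4 * CR M x))"
      using h hh Qq C by (intro mult_left_mono mult_mono) (auto intro: ip_nonneg wn)
    then show "h'\<^sup>2 * ip wt q q \<le> h' * (h * (4 * CR M x))" by (simp add: power2_eq_square mult.assoc)
  qed (use h in auto)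
  also have "\<dots> = (1 + h' * L) * ip wt w w + h' * (L * h\<^sup>2 * CR M x + 10 * x ^ 3 / (1 + N) + 9 * h * CR M x)"
    by (simp add: algebra_simps)
  also have "\<dots> \<le> (1 + h' * L) * ip wt w w + h' * (L * h\<^sup>2 * CR M x + 10 * x ^ 3 / (1 + N) + 10 * h * CR M x)"
    using h hh C by (intro add_left_mono mult_left_mono add_left_mono mult_right_mono) auto
  finally show "ip wt w' w' \<le> (1 + h' * L) * ip wt w w + h' * (L * h\<^sup>2 * CR M x + 10 * x ^ 3 / (1 + N) + 10 * h * CR M x)" .
qed

text \<open>Gronwall over the fine steps. After \<open>i\<close> fine steps the coarse scheme has
  completed \<open>i div r\<close> steps and is \<open>i mod r\<close> fine steps into the next one;
  the last terms account for this fraction of a coarse step.\<close>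

lemma eul_comparison:
  assumes a: "bcs N a" and d: "bcs M d" and N: "0 \<le> N" "N \<le> M" and h': "0 \<le> h'" and r: "0 < r"
    and xa: "\<And>n. real n * (real r * h') \<le> T \<Longrightarrow> nX (eul N (real r * h') a n) \<le> x"
    and xd: "\<And>n. real n * h' \<le> T \<Longrightarrow> nX (eul M h' d n) \<le> x"
    and i: "real i * h' \<le> T"
  defines "h \<equiv> real r * h'" and "L \<equiv> 16 * x * sqrt (ln (1 + M)) / mu"
  defines "v \<equiv> \<lambda>k. eul M h' d i k - eul N h a (i div r) k"
  shows "ip wt v v \<le> 2 * (exp (T * L) * (ip wt (\<lambda>k. d k - a k) (\<lambda>k. d k - a k)
     + T * (L * h\<^sup>2 * CR M x + 10 * x ^ 3 / (1 + N) + 10 * h * CR M x))) + 2 * h\<^sup>2 * CR M x"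
proof -
  define w where "w i k = eul M h' d i k - (eul N h a (i div r) k + complex_of_real (real (i mod r) * h') * QQ N (eul N h a (i div r)) k)" for i k
  let ?D = "L * h\<^sup>2 * CR M x + 10 * x ^ 3 / (1 + N) + 10 * h * CR M x"
  have T0: "0 \<le> T" using order_trans[OF _ i] h' by simp
  have x0: "0 \<le> x" using order_trans[OF nX_nonneg xa[of 0]] T0 by simp
  have M0: "0 \<le> M" using N by linarith
  have L: "0 \<le> L" using x0 mu M0 by (simp add: L_def)
  have hh: "0 \<le> h" "h' \<le> h" using h' r by (auto simp: h_def mult_le_cancel_right1)
  have D: "0 \<le> ?D" using L hh CR_nonneg[OF M0, of x] x0 N by (intro add_nonneg_nonneg mult_nonneg_nonneg divide_nonneg_nonneg) auto
  have th: "real (m mod r) * h' \<le> h" for m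
    unfolding h_def using r h' by (intro mult_right_mono) (auto simp: less_imp_le)
  have nh: "real (m div r) * (real r * h') \<le> T" if "m \<le> i" for m
  proof -
    have "real (m div r) * real r \<le> real m"
      unfolding of_nat_mult[symmetric] of_nat_le_iff by (rule div_times_less_eq_dividend)
    then have "real (m div r) * real r * h' \<le> real i * h'"
      using that h' by (intro mult_right_mono) auto
    then show ?thesis using i by (simp add: mult.assoc)
  qed
  have dm: "real m * h' \<le> T" if "m \<le> i" for m
    using order_trans[OF mult_right_mono[of "real m" "real i" h'] i] that h' by simp
  have step: "ip wt (w (Suc m)) (w (Suc m)) \<le> (1 + h' * L) * ip wt (w m) (w m) + h' * ?D" if "m < i" for m
  proof -
    have mi: "m \<le> i" using that by simp
    have "w (Suc m) = (\<lambda>k. (eul M h' d m k + complex_of_real h' * QQ M (eul M h' d m) k)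
       - (eul N h a (m div r) k + complex_of_real (real (m mod r) * h' + h') * QQ N (eul N h a (m div r)) k))"
    \<comment> \<open>At the end of a coarse step the linear motion has reached the next coarse
      iterate exactly, so the comparison continues without a jump.\<close>
    proof (cases "Suc (m mod r) = r")
      case True
      then have e: "Suc m div r = Suc (m div r)" "Suc m mod r = 0" by (auto simp: div_Suc mod_Suc)
      have "real (m mod r) * h' + h' = real (Suc (m mod r)) * h'" by (simp add: algebra_simps)
      then have "real (m mod r) * h' + h' = h" unfolding True h_def .
      then show ?thesis by (simp add: w_def e fun_eq_iff)
    next
      case False
      then have e: "Suc m div r = m div r" "Suc m mod r = Suc (m mod r)" by (auto simp: div_Suc mod_Suc)
      have "real (Suc (m mod r)) * h' = real (m mod r) * h' + h'" by (simp add: algebra_simps)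
      then show ?thesis unfolding w_def e by simp
    qed
    then show ?thesis
      using step_difference(1)[OF eul_bcs[OF d, of h' m] eul_bcs[OF a, of h "m div r"] N xd[OF dm[OF mi]] xa[OF nh[OF mi], folded h_def]
          _ th[of m] h' hh(2)] h' unfolding L_def w_def[of m, abs_def] by simp
  qed
  have "ip wt (w i) (w i) \<le> exp (real i * (h' * L)) * (ip wt (w 0) (w 0) + real i * (h' * ?D))"
    by (rule discrete_Gronwall[where e="\<lambda>m. ip wt (w m) (w m)" and a="h' * L" and b="h' * ?D", OF step]) (use h' L D in \<open>auto intro: ip_nonneg wt_nonneg\<close>)
  also have "\<dots> \<le> exp (T * L) * (ip wt (w 0) (w 0) + T * ?D)"
  proof (rule mult_mono)
    have "real i * h' * L \<le> T * L" using i L by (intro mult_right_mono)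
    then show "exp (real i * (h' * L)) \<le> exp (T * L)" by (simp add: mult.assoc)
    have "real i * h' * ?D \<le> T * ?D" using i D by (intro mult_right_mono)
    then show "ip wt (w 0) (w 0) + real i * (h' * ?D) \<le> ip wt (w 0) (w 0) + T * ?D" by (simp add: mult.assoc)
  qed (use h' D in \<open>auto intro!: add_nonneg_nonneg ip_nonneg wt_nonneg\<close>)
  also have "w 0 = (\<lambda>k. d k - a k)" by (simp add: w_def fun_eq_iff)
  finally have 1: "ip wt (w i) (w i) \<le> exp (T * L) * (ip wt (\<lambda>k. d k - a k) (\<lambda>k. d k - a k) + T * ?D)" .
  have "ip wt v v \<le> 2 * ip wt (w i) (w i) + 2 * h\<^sup>2 * CR M x"
    using step_difference(2)[OF eul_bcs[OF d, of h' i] eul_bcs[OF a, of h "i div r"] N xd[OF i] xa[OF nh[OF order_refl], folded h_def]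
          _ th[of i] h' hh(2)] h' unfolding v_def w_def[of i, abs_def] by simp
  with 1 show ?thesis by linarith
qed

end

section \<open>Initial data and choice of parameters\<close>

lemma nW_triangle3: "Xc A \<Longrightarrow> Xc B \<Longrightarrow> Xc C \<Longrightarrow> nW (\<lambda>k. A k - C k) \<le> nW (\<lambda>k. A k - B k) + nW (\<lambda>k. B k - C k)"
  unfolding nW_def right_diff_distrib by (rule L2n_triangle3[OF Xc_s1(1) Xc_s1(1) Xc_s1(1)])

lemma nW_minus_commute: "nW (\<lambda>k. A k - B k) = nW (\<lambda>k. B k - A k)"
  unfolding nW_def right_diff_distrib by (rule L2n_minus_commute)

lemma s1_le_s3_over: "cmod (s1 k) * (1 + \<bar>k\<bar>) = cmod (s3 k)"
proof -
  have "sqrt ((1 + \<bar>k\<bar>) ^ 3) = sqrt ((1 + \<bar>k\<bar>) * (1 + \<bar>k\<bar>)\<^sup>2)"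
    by (simp add: power2_eq_square power3_eq_cube)
  then show ?thesis unfolding cmod_s1 cmod_s3 by (simp add: real_sqrt_mult)
qed

lemma Xc_restrict:
  assumes A: "Xc A" and S: "S \<in> sets borel"
  shows "Xc (\<lambda>k. if k \<in> S then A k else 0)" "nX (\<lambda>k. if k \<in> S then A k else 0) \<le> nX A"
proof -
  have s: "sqi lborel (\<lambda>k. s3 k * A k)" using A by (simp add: Xc_def)
  have [measurable]: "A \<in> borel_measurable borel" using Xc_measurable[OF A] by simp
  note [measurable] = S
  have m: "(\<lambda>k. if k \<in> S then A k else 0) \<in> borel_measurable borel" by measurable
  then have m': "(\<lambda>k. s3 k * (if k \<in> S then A k else 0)) \<in> borel_measurable lborel" by simp
  have ae: "AE k in lborel. cmod (s3 k * (if k \<in> S then A k else 0)) \<le> cmod (s3 k * A k)" by auto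
  show "Xc (\<lambda>k. if k \<in> S then A k else 0)"
    unfolding Xc_def using m sqi_bound[OF s m' ae] A by (auto simp: Xc_def)
  show "nX (\<lambda>k. if k \<in> S then A k else 0) \<le> nX A"
    unfolding nX_def by (rule L2n_mono[OF s m' ae])
qed

text \<open>Two cutoffs are combined. In frequency, at \<open>2 ^ j\<close>, the weights differ by
  one power of \<open>1 + \<bar>k\<bar>\<close>, which gives the rate \<open>(1/2) ^ j\<close>; in
  amplitude, the level \<open>K j\<close> is taken so large that it adds at most
  \<open>(1/2) ^ j\<close>, and it makes the data bounded.\<close>

lemma data_approximation:
  assumes A: "Xc A"
  obtains b where "\<And>j::nat. bcs (2 ^ j) (b j)" "\<And>j. nX (b j) \<le> nX A" "\<And>j. nW (\<lambda>k. b j k - A k) \<le> (1 + nX A) * (1/2) ^ j"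
proof -
  have Am: "A \<in> borel_measurable borel" using Xc_measurable[OF A] by simp
  define f where "f j K k = (if k \<in> {k. k \<le> 2 ^ j \<and> cmod (A k) \<le> real K} then A k else 0)" for j K :: nat and k
  define g where "g j k = (if k \<in> {..2 ^ j} then A k else 0)" for j :: nat and k :: real
  have S: "{k. k \<le> 2 ^ j \<and> cmod (A k) \<le> real K} \<in> sets borel" for j K :: nat
    using Am by measurable
  have fX: "Xc (f j K)" "nX (f j K) \<le> nX A" for j K
    unfolding f_def[abs_def] by (rule Xc_restrict[OF A S])+
  have gX: "Xc (g j)" for j
    unfolding g_def[abs_def] by (rule Xc_restrict[OF A]) simp
  have lim: "(\<lambda>K. L2n lborel (\<lambda>k. s1 k * f j K k - s1 k * g j k)) \<longlonglongrightarrow> 0" for j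
  proof (rule L2_dominated)
    show "(\<lambda>k. s1 k * f j K k) \<in> borel_measurable lborel" for K by (rule sqi_measurable[OF Xc_s1(1)[OF fX(1)]])
    show "(\<lambda>k. s1 k * g j k) \<in> borel_measurable lborel" by (rule sqi_measurable[OF Xc_s1(1)[OF gX]])
    show "integrable lborel (\<lambda>k. (cmod (s1 k * A k))\<^sup>2)" by (rule sqi_integrable[OF Xc_s1(1)[OF A]])
    show "AE k in lborel. cmod (s1 k * f j K k - s1 k * g j k) \<le> cmod (s1 k * A k)" for K
      by (auto simp: f_def g_def)
    have "(\<lambda>K. s1 k * f j K k) \<longlonglongrightarrow> s1 k * g j k" for k
    proof (rule tendsto_eventually)
      obtain n0 :: nat where n0: "cmod (A k) \<le> real n0" using real_arch_simple by blast
      have "s1 k * f j K k = s1 k * g j k" if "K \<ge> n0" for K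
        using that n0 by (auto simp: f_def g_def)
      then show "\<forall>\<^sub>F K in sequentially. s1 k * f j K k = s1 k * g j k"
        unfolding eventually_sequentially by blast
    qed
    then show "AE k in lborel. (\<lambda>K. s1 k * f j K k) \<longlonglongrightarrow> s1 k * g j k" by simp
  qed
  have "\<exists>K. nW (\<lambda>k. f j K k - g j k) \<le> (1/2) ^ j" for j
  proof -
    have "eventually (\<lambda>K. L2n lborel (\<lambda>k. s1 k * f j K k - s1 k * g j k) < (1/2) ^ j) sequentially"
      by (rule order_tendstoD(2)[OF lim]) simp
    then obtain K where "L2n lborel (\<lambda>k. s1 k * f j K k - s1 k * g j k) < (1/2) ^ j"
      by (auto simp: eventually_sequentially)
    then show ?thesis unfolding nW_def right_diff_distrib by (intro exI[of _ K]) simp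
  qed
  then obtain K where K: "\<And>j. nW (\<lambda>k. f j (K j) k - g j k) \<le> (1/2) ^ j" by metis
  have tail: "nW (\<lambda>k. g j k - A k) \<le> nX A * (1/2) ^ j" for j
  proof -
    have "nW (\<lambda>k. g j k - A k) \<le> L2n lborel (\<lambda>k. complex_of_real ((1/2) ^ j) * (s3 k * A k))"
      unfolding nW_def
    proof (rule L2n_mono)
      show "sqi lborel (\<lambda>k. complex_of_real ((1/2) ^ j) * (s3 k * A k))"
        using A by (intro sqi_cmult) (auto simp: Xc_def)
      show "(\<lambda>k. s1 k * (g j k - A k)) \<in> borel_measurable lborel"
        by (rule sqi_measurable[OF Xc_s1(1)[OF Xc_diff[OF gX A]]])
      show "AE k in lborel. cmod (s1 k * (g j k - A k)) \<le> cmod (complex_of_real ((1/2) ^ j) * (s3 k * A k))"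
      proof (rule AE_I2)
        fix k
        show "cmod (s1 k * (g j k - A k)) \<le> cmod (complex_of_real ((1/2) ^ j) * (s3 k * A k))"
        proof (cases "k \<le> 2 ^ j")
          case False
          have "cmod (s1 k) * 2 ^ j \<le> cmod (s1 k) * (1 + \<bar>k\<bar>)"
            using False by (intro mult_left_mono) auto
          then have "cmod (s1 k) \<le> (1/2) ^ j * cmod (s3 k)"
            unfolding s1_le_s3_over by (simp add: power_one_over field_simps)
          then have "cmod (s1 k) * cmod (A k) \<le> (1/2) ^ j * cmod (s3 k) * cmod (A k)"
            by (rule mult_right_mono) simp
          then show ?thesis using False by (simp add: g_def norm_mult norm_power mult.assoc)
        qed (simp add: g_def)
      qed
    qed
    also have "\<dots> = nX A * (1/2) ^ j" unfolding L2n_cmult nX_def by (simp add: norm_power)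
    finally show ?thesis .
  qed
  show thesis
  proof (rule that[of "\<lambda>j. f j (K j)"])
    fix j
    show "bcs (2 ^ j) (f j (K j))"
      unfolding bcs_def
    proof (intro conjI)
      show "f j (K j) \<in> borel_measurable lborel" by (rule Xc_measurable[OF fX(1)])
      show "\<exists>B. \<forall>k. cmod (f j (K j) k) \<le> B" by (rule exI[of _ "real (K j)"]) (auto simp: f_def)
      have "A k = 0" if "k \<le> 0" for k using A that by (auto simp: Xc_def)
      then show "\<forall>k. f j (K j) k \<noteq> 0 \<longrightarrow> 0 < k \<and> k \<le> 2 ^ j"
        unfolding f_def using not_le by (auto split: if_splits)
    qed
    show "nX (f j (K j)) \<le> nX A" by (rule fX)
    show "nW (\<lambda>k. f j (K j) k - A k) \<le> (1 + nX A) * (1/2) ^ j"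
      using nW_triangle3[OF fX(1)[of j "K j"] gX[of j] A] K[of j] tail[of j] by (simp add: distrib_right)
  qed
qed

context evol
begin

text \<open>The parameters depend on each other in one direction only: \<open>x\<close> on the
  energy of the data, \<open>T\<close> on \<open>x\<close>, and the steps \<open>h j\<close> on
  both.\<close>

lemma approximations:
  assumes A: "Xc A0"
  obtains T x C h r b where "0 < T" "0 \<le> x" "\<And>j::nat. 0 < h j" "\<And>j. bcs (2 ^ j) (b j)"
    "\<And>j. \<exists>n::nat. T = real n * h j" "\<And>j. h j = real (r j) * h (Suc j)" "\<And>j. 0 < (r j :: nat)"
    "\<And>j. h j \<le> (1/2) ^ j"
    "\<And>j. nW (\<lambda>k. b j k - A0 k) \<le> C * (4/5) ^ j"
    "\<And>j n. real n * h j \<le> T \<Longrightarrow> nX (eul (2 ^ j) (h j) (b j) n) \<le> x"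
    "\<And>j i. real i * h (Suc j) \<le> T \<Longrightarrow>
       nW (\<lambda>k. eul (2 ^ Suc j) (h (Suc j)) (b (Suc j)) i k - eul (2 ^ j) (h j) (b j) (i div r j) k) \<le> C * (4/5) ^ j"
proof -
  obtain b where b: "\<And>j::nat. bcs (2 ^ j) (b j)" "\<And>j. nX (b j) \<le> nX A0" "\<And>j. nW (\<lambda>k. b j k - A0 k) \<le> (1 + nX A0) * (1/2) ^ j"
    by (rule data_approximation[OF A], rule that)
  define M0 where "M0 = nu * (nX A0)\<^sup>2"
  \<comment> \<open>The solution of \<open>mu / 2 * x\<^sup>2 = M0 + 1\<close>: the energy may grow
    by 1 before the bound \<open>x\<close> is lost.\<close>
  define x where "x = sqrt (2 / mu * (M0 + 1))"
  have M0: "0 \<le> M0" using nu by (simp add: M0_def)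
  have x0: "0 \<le> x" using M0 mu by (simp add: x_def)
  have xM: "M0 + 1 \<le> mu / 2 * x\<^sup>2" using M0 mu by (simp add: x_def)
  \<comment> \<open>The three summands give \<open>T \<le> 1\<close>, an energy growth of at most 1,
    and a Gronwall exponent of at most \<open>(real j + 2) / 8\<close>. As \<open>L\<close> is at
    most \<open>16 * x / mu * (real j + 2)\<close>, the last needs the constant
    \<open>128 = 8 * 16\<close>.\<close>
  define T where "T = 1 / (1 + (12 * x ^ 3 + 1) + 128 * x / mu)"
  have den: "0 \<le> 12 * x ^ 3 + 1" "0 \<le> 128 * x / mu" using x0 mu by auto
  have T: "0 < T" using den by (simp add: T_def)
  have Tb: "T \<le> 1" "T * (12 * x ^ 3 + 1) \<le> 1" "T * (128 * x / mu) \<le> 1"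
  proof -
    have *: "1 / (1 + y + z) \<le> 1 \<and> 1 / (1 + y + z) * y \<le> 1 \<and> 1 / (1 + y + z) * z \<le> 1"
      if "0 \<le> y" "0 \<le> z" for y z :: real using that by (auto simp: divide_le_eq_1)
    show "T \<le> 1" "T * (12 * x ^ 3 + 1) \<le> 1" "T * (128 * x / mu) \<le> 1"
      using *[OF den] unfolding T_def by blast+
  qed
  have eb: "ip wE (b j) (b j) \<le> M0" for j
  proof -
    have "nu * (nX (b j))\<^sup>2 \<le> M0" unfolding M0_def using b(2)[of j] nu by (intro mult_left_mono power_mono) auto
    then show ?thesis using E_le_nX[OF b(1)[of j]] by linarith
  qed
  \<comment> \<open>All steps are \<open>T\<close> divided by powers of 2, so that they nest. The
    cumulative sum makes \<open>q\<close> monotone, and \<open>q j < 2 ^ q j\<close> turns the lower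
    bound for \<open>q j\<close> into \<open>h j * CR (2 ^ Suc j) x \<le> (1/4) ^ j\<close>; the
    added \<open>j\<close> gives \<open>h j \<le> (1/2) ^ j\<close>.\<close>
  define q where "q j = (\<Sum>i\<le>j. nat \<lceil>T * CR (2 ^ Suc i) x * 4 ^ i\<rceil>) + j" for j :: nat
  have qS: "q j \<le> q (Suc j)" for j by (simp add: q_def)
  define h where "h j = T / 2 ^ q j" for j
  define r where "r j = (2 :: nat) ^ (q (Suc j) - q j)" for j
  have h0: "0 < h j" for j using T by (simp add: h_def)
  have hr: "h j = real (r j) * h (Suc j)" for j
  proof -
    have "(2::real) ^ q (Suc j) = 2 ^ (q (Suc j) - q j) * 2 ^ q j"
      using qS[of j] by (simp flip: power_add)
    then show ?thesis by (simp add: h_def r_def)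
  qed
  have hC: "h j * CR (2 ^ Suc j) x \<le> (1/4) ^ j" for j
  proof -
    have "T * CR (2 ^ Suc j) x * 4 ^ j \<le> real (nat \<lceil>T * CR (2 ^ Suc j) x * 4 ^ j\<rceil>)" by (rule real_nat_ceiling_ge)
    also have "nat \<lceil>T * CR (2 ^ Suc j) x * 4 ^ j\<rceil> \<le> (\<Sum>i\<le>j. nat \<lceil>T * CR (2 ^ Suc i) x * 4 ^ i\<rceil>)"
      by (rule member_le_sum) auto
    also have "\<dots> \<le> q j" by (simp add: q_def)
    also have "q j \<le> 2 ^ q j" by (rule less_imp_le[OF less_exp])
    finally have "T * CR (2 ^ Suc j) x * 4 ^ j \<le> 2 ^ q j" by simp
    then show ?thesis by (simp add: h_def power_one_over field_simps)
  qed
  have hC': "h j * CR (2 ^ j) x \<le> 1" for j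
  proof -
    have "h j * CR (2 ^ j) x \<le> h j * CR (2 ^ Suc j) x"
      using h0[of j] by (intro mult_left_mono CR_mono) auto
    also have "\<dots> \<le> 1" by (rule order_trans[OF hC]) (simp add: power_le_one)
    finally show ?thesis .
  qed
  have hj: "h j \<le> (1/2) ^ j" for j
  proof -
    have "(2::real) ^ j \<le> 2 ^ q j" by (rule power_increasing) (auto simp: q_def)
    then have "T / 2 ^ q j \<le> 1 / 2 ^ j" using Tb(1) T by (intro frac_le) auto
    then show ?thesis by (simp add: h_def power_one_over)
  qed
  have h1: "h j \<le> 1" for j using order_trans[OF hj[of j]] by (simp add: power_le_one)
  have nXb: "nX (eul (2 ^ j) (h j) (b j) n) \<le> x" if "real n * h j \<le> T" for j n
  proof (rule eul_nX[OF b(1) _ _ hC' x0 eb xM])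
    have "real n * h j * (12 * x ^ 3 + 1) \<le> T * (12 * x ^ 3 + 1)" using that den by (intro mult_right_mono)
    then show "real n * h j * (12 * x ^ 3 + 1) \<le> 1" using Tb by linarith
  qed (use h0[of j] in auto)
  \<comment> \<open>\<open>CD\<close> bounds the step and truncation errors and \<open>Ce\<close>
    the squared distance of consecutive data, both relative to \<open>(1/2) ^ j\<close>;
    \<open>C1\<close> collects what remains of them after Gronwall.\<close>
  define CD where "CD = 32 * x / mu + 10 * x ^ 3 + 10"
  define Ce where "Ce = 4 * nu * (1 + nX A0)\<^sup>2"
  have CD0: "0 \<le> CD" using x0 mu by (simp add: CD_def)
  have Ce0: "0 \<le> Ce" using nu by (simp add: Ce_def)
  define C1 where "C1 = 4 * (Ce + CD) + 2"
  have C10: "0 \<le> C1" using CD0 Ce0 by (simp add: C1_def)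
  \<comment> \<open>The Gronwall factor grows by at most 5/4 per level. Against the error
    \<open>(1/2) ^ j\<close> this leaves \<open>(5/8) ^ j\<close>, enlarged to
    \<open>(16/25) ^ j\<close>, whose root is \<open>(4/5) ^ j\<close>.\<close>
  have e8: "exp (1/8) \<le> (5/4 :: real)" using exp_bound[of "1/8"] by (simp add: power2_eq_square)
  have e4: "exp (1/4) \<le> (2 :: real)" using exp_bound[of "1/4"] by (simp add: power2_eq_square)
  have main: "nW (\<lambda>k. eul (2 ^ Suc j) (h (Suc j)) (b (Suc j)) i k - eul (2 ^ j) (h j) (b j) (i div r j) k) \<le> sqrt (C1 / mu) * (4/5) ^ j"
    if i: "real i * h (Suc j) \<le> T" for i j
  proof -
    let ?M = "2 ^ Suc j :: real" and ?N = "2 ^ j :: real"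
    let ?v = "\<lambda>k. eul ?M (h (Suc j)) (b (Suc j)) i k - eul ?N (h j) (b j) (i div r j) k"
    let ?d = "\<lambda>k. b (Suc j) k - b j k"
    define L where "L = 16 * x * sqrt (ln (1 + ?M)) / mu"
    let ?D = "L * (h j)\<^sup>2 * CR ?M x + 10 * x ^ 3 / (1 + ?N) + 10 * h j * CR ?M x"
    have NM: "(0::real) \<le> ?N" "?N \<le> ?M" by auto
    have cmp: "ip wt ?v ?v \<le> 2 * (exp (T * L) * (ip wt ?d ?d + T * ?D)) + 2 * (h j)\<^sup>2 * CR ?M x"
      using eul_comparison[OF b(1)[of j] b(1)[of "Suc j"] NM less_imp_le[OF h0[of "Suc j"]] _
          nXb[where j=j, unfolded hr[of j]] nXb[where j="Suc j"] i]
      unfolding hr[of j, symmetric] L_def by (simp add: r_def)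
    \<comment> \<open>The square root is bounded crudely by a linear function of \<open>j\<close>; a
      linear Gronwall exponent is still absorbed by a small \<open>T\<close>.\<close>
    have lnM: "sqrt (ln (1 + ?M)) \<le> real j + 2"
    proof -
      have "1 + ?M \<le> ?M + ?M" using one_le_power[of "2::real" "Suc j"] by simp
      then have "1 + ?M \<le> 2 ^ (j + 2)" by simp
      then have "ln (1 + ?M) \<le> ln (2 ^ (j + 2))" by (subst ln_le_cancel_iff) auto
      also have "\<dots> = real (j + 2) * ln 2" by (rule ln_realpow)
      also have "\<dots> \<le> real (j + 2) * 1" using ln_le_minus_one[of "2::real"] by (intro mult_left_mono) auto
      also have "\<dots> \<le> (real j + 2)\<^sup>2" by (simp add: power2_eq_square algebra_simps)
      finally show ?thesis by (intro real_le_lsqrt) auto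
    qed
    have L: "0 \<le> L" "L \<le> 16 * x / mu * (real j + 2)"
    proof -
      show "0 \<le> L" using x0 mu by (simp add: L_def)
      have "16 * x / mu * sqrt (ln (1 + ?M)) \<le> 16 * x / mu * (real j + 2)"
        using x0 mu by (intro mult_left_mono lnM) auto
      then show "L \<le> 16 * x / mu * (real j + 2)" by (simp add: L_def)
    qed
    have j2: "(real j + 2) * (1/4) ^ j \<le> 2 * (1/2) ^ j"
    proof -
      have "real j + 2 \<le> 2 * 2 ^ j"
      proof (induction j)
        case (Suc j)
        have "(1::real) \<le> 2 ^ j" by (rule one_le_power) simp
        then show ?case using Suc by simp
      qed simp
      then have "(real j + 2) * (1/4) ^ j \<le> 2 * 2 ^ j * (1/4) ^ j" by (intro mult_right_mono) auto
      also have "\<dots> = 2 * (2 * (1/4)) ^ j" unfolding power_mult_distrib by simp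
      finally show ?thesis by simp
    qed
    have CRM: "0 \<le> CR ?M x" by (rule CR_nonneg) simp
    have hC2: "(h j)\<^sup>2 * CR ?M x \<le> (1/4) ^ j"
    proof -
      have "h j * (h j * CR ?M x) \<le> 1 * (1/4) ^ j" using h0[of j] h1[of j] hC[of j] CRM by (intro mult_mono) auto
      then show ?thesis by (simp add: power2_eq_square mult.assoc)
    qed
    have q4: "(1/4::real) ^ j \<le> (1/2) ^ j" by (rule power_mono) auto
    have D: "?D \<le> CD * (1/2) ^ j"
    proof -
      have "L * ((h j)\<^sup>2 * CR ?M x) \<le> (16 * x / mu * (real j + 2)) * (1/4) ^ j"
        using L hC2 CRM x0 mu by (intro mult_mono) auto
      also have "\<dots> = 16 * x / mu * ((real j + 2) * (1/4) ^ j)" by simp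
      also have "\<dots> \<le> 16 * x / mu * (2 * (1/2) ^ j)" using x0 mu by (intro mult_left_mono j2) auto
      finally have 1: "L * (h j)\<^sup>2 * CR ?M x \<le> 32 * x / mu * (1/2) ^ j" by (simp add: mult.assoc)
      have "10 * x ^ 3 / (1 + ?N) \<le> 10 * x ^ 3 / ?N" by (rule frac_le) (use x0 in auto)
      then have 2: "10 * x ^ 3 / (1 + ?N) \<le> 10 * x ^ 3 * (1/2) ^ j" by (simp add: power_one_over)
      have 3: "10 * h j * CR ?M x \<le> 10 * (1/2) ^ j" using hC[of j] q4 by simp
      show ?thesis unfolding CD_def distrib_right using 1 2 3 by linarith
    qed
    have D0: "0 \<le> ?D" using L CRM x0 h0[of j] by (intro add_nonneg_nonneg mult_nonneg_nonneg divide_nonneg_nonneg) auto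
    have e0: "ip wt ?d ?d \<le> Ce * (1/2) ^ j"
    proof -
      have dd: "bcs ?M ?d" by (rule bcs_diff[OF b(1) bcs_mono[OF b(1) NM(2)]])
      have "nW ?d \<le> nW (\<lambda>k. b (Suc j) k - A0 k) + nW (\<lambda>k. A0 k - b j k)"
        by (rule nW_triangle3[OF bcs_Xc[OF b(1)] A bcs_Xc[OF b(1)]])
      also have "\<dots> \<le> (1 + nX A0) * (1/2) ^ Suc j + (1 + nX A0) * (1/2) ^ j"
        using b(3)[of "Suc j"] b(3)[of j] nW_minus_commute[of A0 "b j"] by linarith
      also have "\<dots> \<le> 2 * (1 + nX A0) * (1/2) ^ j"
      proof -
        have "0 \<le> (1 + nX A0) * (1/2) ^ j" by (intro mult_nonneg_nonneg add_nonneg_nonneg) auto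
        then show ?thesis by simp
      qed
      finally have "(nW ?d)\<^sup>2 \<le> (2 * (1 + nX A0) * (1/2) ^ j)\<^sup>2" by (rule power_mono) simp
      also have "\<dots> = 4 * (1 + nX A0)\<^sup>2 * (1/4) ^ j"
      proof -
        have "((1/2::real) ^ j)\<^sup>2 = (1/4) ^ j" by (simp add: power2_eq_square flip: power_mult_distrib)
        then show ?thesis unfolding power_mult_distrib by simp
      qed
      also have "\<dots> \<le> 4 * (1 + nX A0)\<^sup>2 * (1/2) ^ j" by (intro mult_left_mono q4) auto
      finally have "nu * (nW ?d)\<^sup>2 \<le> nu * (4 * (1 + nX A0)\<^sup>2 * (1/2) ^ j)" using nu by (intro mult_left_mono) auto
      then show ?thesis using e_le_nW[OF dd] by (simp add: Ce_def mult_ac)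
    qed
    have ex: "exp (T * L) \<le> 2 * (5/4) ^ j"
    proof -
      have "T * L \<le> T * (16 * x / mu * (real j + 2))" using L T by (intro mult_left_mono) auto
      also have "\<dots> = T * (128 * x / mu) * ((real j + 2) / 8)" by simp
      also have "\<dots> \<le> 1 * ((real j + 2) / 8)" by (rule mult_right_mono[OF Tb(3)]) simp
      finally have "exp (T * L) \<le> exp (1/4 + real j * (1/8))" by simp
      also have "\<dots> = exp (1/4) * exp (1/8) ^ j" unfolding exp_add exp_of_nat_mult ..
      also have "\<dots> \<le> 2 * (5/4) ^ j" by (intro mult_mono power_mono e4 e8) auto
      finally show ?thesis .
    qed
    have "exp (T * L) * (ip wt ?d ?d + T * ?D) \<le> (2 * (5/4) ^ j) * (Ce * (1/2) ^ j + CD * (1/2) ^ j)"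
    proof -
      have "T * ?D \<le> 1 * ?D" using Tb(1) D0 by (intro mult_right_mono)
      then have TD: "T * ?D \<le> CD * (1/2) ^ j" unfolding mult_1 by (rule order_trans[OF _ D])
      show ?thesis
        by (rule mult_mono[OF ex add_mono[OF e0 TD]])
           (use D0 T in \<open>auto intro!: add_nonneg_nonneg ip_nonneg wt_nonneg\<close>)
    qed
    also have "\<dots> = 2 * (Ce + CD) * ((5/4) ^ j * (1/2) ^ j)" by (simp add: algebra_simps)
    also have "(5/4 :: real) ^ j * (1/2) ^ j = (5/8) ^ j" by (simp flip: power_mult_distrib)
    finally have E1: "exp (T * L) * (ip wt ?d ?d + T * ?D) \<le> 2 * (Ce + CD) * (5/8) ^ j" .
    have E2: "2 * (h j)\<^sup>2 * CR ?M x \<le> 2 * (5/8) ^ j"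
      using hC2 power_mono[of "1/4::real" "5/8" j] by simp
    have "2 * (exp (T * L) * (ip wt ?d ?d + T * ?D)) \<le> 2 * (2 * (Ce + CD) * (5/8) ^ j)"
      by (rule mult_left_mono[OF E1]) simp
    from order_trans[OF cmp add_mono[OF this E2]]
    have "ip wt ?v ?v \<le> 2 * (2 * (Ce + CD) * (5/8) ^ j) + 2 * (5/8) ^ j" .
    also have "\<dots> = C1 * (5/8) ^ j" by (simp add: C1_def algebra_simps)
    finally have "ip wt ?v ?v \<le> C1 * (5/8) ^ j" .
    also have "\<dots> \<le> C1 * (16/25) ^ j" using C10 by (intro mult_left_mono power_mono) auto
    finally have "mu * (nW ?v)\<^sup>2 \<le> C1 * (16/25) ^ j"
      using nW_le_e[OF bcs_diff[OF eul_bcs[OF b(1)] bcs_mono[OF eul_bcs[OF b(1)] NM(2)]]] by (rule order_trans[rotated])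
    then have "(nW ?v)\<^sup>2 \<le> C1 / mu * (16/25) ^ j" using mu by (simp add: field_simps)
    also have "(16/25::real) ^ j = ((4/5) ^ j)\<^sup>2" by (simp add: power2_eq_square flip: power_mult_distrib)
    also have "C1 / mu * ((4/5) ^ j)\<^sup>2 = (sqrt (C1 / mu) * (4/5) ^ j)\<^sup>2"
      using C10 mu by (simp add: power_mult_distrib)
    finally show ?thesis by (rule power2_le_imp_le) (use C10 mu in auto)
  qed
  define C where "C = max (sqrt (C1 / mu)) (1 + nX A0)"
  show thesis
  proof (rule that[of T x h b r C])
    show "0 < T" by (rule T)
    show "0 \<le> x" by (rule x0)
    show "0 < h j" for j by (rule h0)
    show "bcs (2 ^ j) (b j)" for j by (rule b)
    show "\<exists>n::nat. T = real n * h j" for j by (rule exI[of _ "2 ^ q j"]) (simp add: h_def)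
    show "h j = real (r j) * h (Suc j)" for j by (rule hr)
    show "0 < r j" for j by (simp add: r_def)
    show "h j \<le> (1/2) ^ j" for j by (rule hj)
    show "nX (eul (2 ^ j) (h j) (b j) n) \<le> x" if "real n * h j \<le> T" for j n by (rule nXb[OF that])
    show "nW (\<lambda>k. b j k - A0 k) \<le> C * (4/5) ^ j" for j
    proof -
      have "(1 + nX A0) * (1/2) ^ j \<le> C * (4/5) ^ j"
        by (intro mult_mono power_mono) (auto simp: C_def le_max_iff_disj add_nonneg_nonneg)
      then show ?thesis using b(3)[of j] by linarith
    qed
    show "nW (\<lambda>k. eul (2 ^ Suc j) (h (Suc j)) (b (Suc j)) i k - eul (2 ^ j) (h j) (b j) (i div r j) k) \<le> C * (4/5) ^ j"
      if "real i * h (Suc j) \<le> T" for i j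
    proof -
      have "sqrt (C1 / mu) * (4/5) ^ j \<le> C * (4/5) ^ j" by (intro mult_right_mono) (auto simp: C_def)
      then show ?thesis using main[OF that] by linarith
    qed
  qed
qed

end

section \<open>Passage to the limit\<close>

text \<open>Profiles of H^1 test functions: the weight makes them integrable, for pairing with
  bounded quadratic terms, and absorbs the factor \<open>1 + \<bar>k\<bar>\<close> of the linear
  terms.\<close>

definition Tc :: "(real \<Rightarrow> complex) \<Rightarrow> bool" where
  "Tc \<eta> \<longleftrightarrow> \<eta> \<in> borel_measurable lborel \<and> sqi lborel (\<lambda>k. complex_of_real (1 + \<bar>k\<bar>) * \<eta> k) \<and> (\<forall>k\<le>0. \<eta> k = 0)"

lemma sqi_inverse_weight: "sqi lborel (\<lambda>k. complex_of_real (1 / (1 + \<bar>k\<bar>)))"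
  unfolding sqi_def
proof
  show "integrable lborel (\<lambda>k. (cmod (complex_of_real (1 / (1 + \<bar>k\<bar>))))\<^sup>2)"
  proof (rule Bochner_Integration.integrable_bound)
    show "integrable lborel (\<lambda>k::real. inverse (1 + k\<^sup>2))"
      using integrable_inverse_1_plus_square by (simp add: set_integrable_def)
    have "norm ((cmod (complex_of_real (1 / (1 + \<bar>k\<bar>))))\<^sup>2) \<le> norm (inverse (1 + k\<^sup>2))" for k
    proof -
      have "1 / (1 + \<bar>k\<bar>)\<^sup>2 \<le> 1 / (1 + k\<^sup>2)"
        by (rule divide_left_mono) (auto simp: power2_sum intro!: mult_pos_pos add_pos_nonneg)
      then show ?thesis by (simp add: norm_divide power_divide inverse_eq_divide del: of_real_add)
    qed
    then show "AE k in lborel. norm ((cmod (complex_of_real (1 / (1 + \<bar>k\<bar>))))\<^sup>2) \<le> norm (inverse (1 + k\<^sup>2))" by simp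
  qed measurable
qed measurable

lemma Tc_measurable: "Tc \<eta> \<Longrightarrow> \<eta> \<in> borel_measurable lborel" by (simp add: Tc_def)

lemma Tc_integrable:
  assumes "Tc \<eta>" shows "integrable lborel \<eta>"
proof -
  have "complex_of_real (1 / (1 + \<bar>k\<bar>)) * (complex_of_real (1 + \<bar>k\<bar>) * \<eta> k) = \<eta> k" for k
    unfolding mult.assoc[symmetric] of_real_mult[symmetric] by simp
  then show ?thesis
    using sqi_mult_integrable(1)[OF sqi_inverse_weight, of "\<lambda>k. complex_of_real (1 + \<bar>k\<bar>) * \<eta> k"] assms
    by (simp add: Tc_def)
qed

lemma Tc_weight_pair:
  assumes \<eta>: "Tc \<eta>" and U: "sqi lborel U"
  shows "integrable lborel (\<lambda>k. (1 + \<bar>k\<bar>) * (cmod (\<eta> k) * cmod (U k)))"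
    and "(LINT k|lborel. (1 + \<bar>k\<bar>) * (cmod (\<eta> k) * cmod (U k))) \<le> n2 \<eta> * L2n lborel U"
proof -
  have s: "sqi lborel (\<lambda>k. complex_of_real (1 + \<bar>k\<bar>) * \<eta> k)" using \<eta> by (simp add: Tc_def)
  have eq: "cmod (complex_of_real (1 + \<bar>k\<bar>) * \<eta> k) * cmod (U k) = (1 + \<bar>k\<bar>) * (cmod (\<eta> k) * cmod (U k))" for k
    unfolding norm_mult norm_of_real by simp
  show "integrable lborel (\<lambda>k. (1 + \<bar>k\<bar>) * (cmod (\<eta> k) * cmod (U k)))"
    using integrable_norm[OF sqi_mult_integrable(1)[OF s U]] unfolding norm_mult[of _ "U _"] eq .
  show "(LINT k|lborel. (1 + \<bar>k\<bar>) * (cmod (\<eta> k) * cmod (U k))) \<le> n2 \<eta> * L2n lborel U"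
    using sqi_mult_integrable(2)[OF s U] unfolding eq n2_def .
qed

section \<open>Continuity of the tested equation\<close>

context evol
begin

lemma RR_diff:
  assumes U: "Xc U" and V: "Xc V"
  shows "cmod (RR U k - RR V k) \<le> (1 + \<bar>k\<bar>) / \<epsilon> * cmod (U k - V k) + 5 * (n2 (\<lambda>k. U k - V k) * (nX U + nX V))"
proof (cases "0 < k")
  case True
  have "RR U k - RR V k = \<i> * complex_of_real ((k - 1) / \<epsilon>) * (U k - V k) + (NL U k - NL V k)"
  proof -
    have "c * u + p - (c * v + q) = c * (u - v) + (p - q)" for c u v p q :: complex by (simp add: algebra_simps)
    then show ?thesis using True by (simp only: RR_def if_True)
  qed
  then have "cmod (RR U k - RR V k) \<le> cmod (\<i> * complex_of_real ((k - 1) / \<epsilon>) * (U k - V k)) + cmod (NL U k - NL V k)"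
    by (simp add: norm_triangle_ineq)
  moreover have "cmod (\<i> * complex_of_real ((k - 1) / \<epsilon>) * (U k - V k)) \<le> (1 + \<bar>k\<bar>) / \<epsilon> * cmod (U k - V k)"
    unfolding norm_mult norm_of_real using eps True
    by (intro mult_right_mono) (auto simp: abs_divide intro!: divide_right_mono)
  ultimately show ?thesis using NL_diff[OF U V, of k] by linarith
next
  case False
  have "0 \<le> (1 + \<bar>k\<bar>) / \<epsilon> * cmod (U k - V k) + 5 * (n2 (\<lambda>k. U k - V k) * (nX U + nX V))"
    using eps by (intro add_nonneg_nonneg mult_nonneg_nonneg) (auto simp: n2_def)
  then show ?thesis using False by (simp add: RR_def)
qed

text \<open>The hypothesis has the shape of the right side: a linear part of size
  \<open>1 + \<bar>k\<bar>\<close> times an L2 function and a bounded quadratic part. The former is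
  paired by Cauchy-Schwarz with the weighted test profile, the latter with its L1 norm.\<close>

lemma pair_bound:
  assumes \<eta>: "Tc \<eta>" and F: "F \<in> borel_measurable lborel" and U: "sqi lborel U"
    and b: "\<And>k. cmod (F k) \<le> (1 + \<bar>k\<bar>) / \<epsilon> * cmod (U k) + D"
  shows "integrable lborel (\<lambda>k. cnj (\<eta> k) * F k)"
    and "cmod (LINT k|lborel. cnj (\<eta> k) * F k) \<le> n2 \<eta> * L2n lborel U / \<epsilon> + D * n1 \<eta>"
proof -
  note w = Tc_weight_pair[OF \<eta> U] and i = Tc_integrable[OF \<eta>]
  let ?b = "\<lambda>k. (1 / \<epsilon>) * ((1 + \<bar>k\<bar>) * (cmod (\<eta> k) * cmod (U k))) + D * cmod (\<eta> k)"
  have bi: "integrable lborel ?b"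
    by (intro Bochner_Integration.integrable_add integrable_mult_right w(1) integrable_norm[OF i])
  have pt: "norm (cnj (\<eta> k) * F k) \<le> ?b k" for k
  proof -
    have "cmod (\<eta> k) * cmod (F k) \<le> cmod (\<eta> k) * ((1 + \<bar>k\<bar>) / \<epsilon> * cmod (U k) + D)"
      by (rule mult_left_mono[OF b]) simp
    moreover have "a * (w / e * u + D) = (1 / e) * (w * (a * u)) + D * a" for a w e u :: real
      by (simp add: distrib_left)
    ultimately show ?thesis unfolding norm_mult complex_mod_cnj by simp
  qed
  show ii: "integrable lborel (\<lambda>k. cnj (\<eta> k) * F k)"
  proof (rule Bochner_Integration.integrable_bound[OF bi])
    show "(\<lambda>k. cnj (\<eta> k) * F k) \<in> borel_measurable lborel"
      by (intro borel_measurable_times borel_measurable_cnj Tc_measurable[OF \<eta>] F)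
    show "AE k in lborel. norm (cnj (\<eta> k) * F k) \<le> norm (?b k)"
      by (intro AE_I2 order_trans[OF pt]) simp
  qed
  have "cmod (LINT k|lborel. cnj (\<eta> k) * F k) \<le> (LINT k|lborel. ?b k)"
    by (rule Bochner_Integration.integral_norm_bound_integral[OF ii bi pt])
  also have "\<dots> = (1 / \<epsilon>) * (LINT k|lborel. (1 + \<bar>k\<bar>) * (cmod (\<eta> k) * cmod (U k))) + D * n1 \<eta>"
    unfolding n1_def by (simp only: Bochner_Integration.integral_add[OF integrable_mult_right[OF w(1)] integrable_mult_right[OF integrable_norm[OF i]]] integral_mult_right_zero)
  also have "\<dots> \<le> (1 / \<epsilon>) * (n2 \<eta> * L2n lborel U) + D * n1 \<eta>"
    using eps by (intro add_right_mono mult_left_mono w(2)) auto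
  finally show "cmod (LINT k|lborel. cnj (\<eta> k) * F k) \<le> n2 \<eta> * L2n lborel U / \<epsilon> + D * n1 \<eta>" by simp
qed

text \<open>\<open>BB\<close> tests the right side and \<open>PP\<close> the left side before time
  differentiation: on the positive half-line the equation says that the time derivative of
  \<open>PP \<eta>\<close> along the solution is \<open>BB \<eta>\<close>.\<close>

definition BB :: "(real \<Rightarrow> complex) \<Rightarrow> (real \<Rightarrow> complex) \<Rightarrow> real" where
  "BB \<eta> U = Re (LINT k|lborel. cnj (\<eta> k) * RR U k)"

definition PP :: "(real \<Rightarrow> complex) \<Rightarrow> (real \<Rightarrow> complex) \<Rightarrow> real" where
  "PP \<eta> U = Re (LINT k|lborel. complex_of_real (wt k) * (cnj (\<eta> k) * U k))"

lemma BB_integrable: "Tc \<eta> \<Longrightarrow> Xc U \<Longrightarrow> integrable lborel (\<lambda>k. cnj (\<eta> k) * RR U k)"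
  by (rule pair_bound(1)[OF _ RR_measurable[OF Xc_measurable] Xc_self(1) RR_bound])

lemma BB_bound:
  assumes \<eta>: "Tc \<eta>" and U: "Xc U" and x: "nX U \<le> x"
  shows "\<bar>BB \<eta> U\<bar> \<le> n2 \<eta> * x / \<epsilon> + 5 * x\<^sup>2 * n1 \<eta>"
proof -
  have "\<bar>BB \<eta> U\<bar> \<le> cmod (LINT k|lborel. cnj (\<eta> k) * RR U k)" unfolding BB_def by (rule abs_Re_le_cmod)
  also have "\<dots> \<le> n2 \<eta> * L2n lborel U / \<epsilon> + (5 * (nX U)\<^sup>2) * n1 \<eta>"
    by (rule pair_bound(2)[OF \<eta> RR_measurable[OF Xc_measurable[OF U]] Xc_self(1)[OF U] RR_bound[OF U]])
  also have "\<dots> \<le> n2 \<eta> * x / \<epsilon> + 5 * x\<^sup>2 * n1 \<eta>"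
    using order_trans[OF Xc_self(2)[OF U] x] x eps
    by (intro add_mono divide_right_mono mult_left_mono mult_right_mono power_mono) (auto simp: n2_def)
  finally show ?thesis .
qed

lemma BB_diff:
  assumes \<eta>: "Tc \<eta>" and U: "Xc U" "nX U \<le> x" and V: "Xc V" "nX V \<le> x"
  shows "\<bar>BB \<eta> U - BB \<eta> V\<bar> \<le> n2 \<eta> * L2n lborel (\<lambda>k. U k - V k) / \<epsilon> + 10 * x * n2 (\<lambda>k. U k - V k) * n1 \<eta>"
proof -
  let ?n = "n2 (\<lambda>k. U k - V k)"
  have n: "0 \<le> ?n" by (simp add: n2_def)
  have "BB \<eta> U - BB \<eta> V = Re (LINT k|lborel. cnj (\<eta> k) * (RR U k - RR V k))"
    unfolding BB_def right_diff_distrib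
      Bochner_Integration.integral_diff[OF BB_integrable[OF \<eta> U(1)] BB_integrable[OF \<eta> V(1)]] by simp
  then have "\<bar>BB \<eta> U - BB \<eta> V\<bar> \<le> cmod (LINT k|lborel. cnj (\<eta> k) * (RR U k - RR V k))"
    by (simp add: abs_Re_le_cmod)
  also have "\<dots> \<le> n2 \<eta> * L2n lborel (\<lambda>k. U k - V k) / \<epsilon> + (5 * (?n * (nX U + nX V))) * n1 \<eta>"
    by (rule pair_bound(2)[OF \<eta> borel_measurable_diff[OF RR_measurable RR_measurable] Xc_self(1)[OF Xc_diff[OF U(1) V(1)]] RR_diff[OF U(1) V(1)]])
       (rule Xc_measurable U V)+
  also have "\<dots> \<le> n2 \<eta> * L2n lborel (\<lambda>k. U k - V k) / \<epsilon> + (5 * (?n * (2 * x))) * n1 \<eta>"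
    using U V n by (intro add_left_mono mult_right_mono mult_left_mono) auto
  finally show ?thesis by (simp add: mult_ac)
qed

lemma PP_integrable:
  assumes \<eta>: "Tc \<eta>" and U: "sqi lborel U"
  shows "integrable lborel (\<lambda>k. complex_of_real (wt k) * (cnj (\<eta> k) * U k))"
    and "\<bar>PP \<eta> U\<bar> \<le> nu * (n2 \<eta> * L2n lborel U)"
proof -
  note w = Tc_weight_pair[OF \<eta> U]
  have pt: "norm (complex_of_real (wt k) * (cnj (\<eta> k) * U k)) \<le> nu * ((1 + \<bar>k\<bar>) * (cmod (\<eta> k) * cmod (U k)))" for k
  proof -
    have "wt k * (cmod (\<eta> k) * cmod (U k)) \<le> nu * (1 + \<bar>k\<bar>) * (cmod (\<eta> k) * cmod (U k))"
      by (rule mult_right_mono[OF wt_upper]) simp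
    then show ?thesis using wt_nonneg[of k] by (simp add: norm_mult mult.assoc)
  qed
  have "continuous_on UNIV (\<lambda>k. complex_of_real (wt k))" by (intro continuous_intros wt_cont)
  from borel_measurable_continuous_onI[OF this]
  have wm: "(\<lambda>k. complex_of_real (wt k)) \<in> borel_measurable lborel" by simp
  show i: "integrable lborel (\<lambda>k. complex_of_real (wt k) * (cnj (\<eta> k) * U k))"
  proof (rule Bochner_Integration.integrable_bound[OF integrable_mult_right[OF w(1), of nu]])
    show "(\<lambda>k. complex_of_real (wt k) * (cnj (\<eta> k) * U k)) \<in> borel_measurable lborel"
      by (intro borel_measurable_times borel_measurable_cnj Tc_measurable[OF \<eta>] sqi_measurable[OF U] wm)
    show "AE k in lborel. norm (complex_of_real (wt k) * (cnj (\<eta> k) * U k)) \<le> norm (nu * ((1 + \<bar>k\<bar>) * (cmod (\<eta> k) * cmod (U k))))"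
      by (intro AE_I2 order_trans[OF pt]) simp
  qed
  have "\<bar>PP \<eta> U\<bar> \<le> cmod (LINT k|lborel. complex_of_real (wt k) * (cnj (\<eta> k) * U k))"
    unfolding PP_def by (rule abs_Re_le_cmod)
  also have "\<dots> \<le> (LINT k|lborel. nu * ((1 + \<bar>k\<bar>) * (cmod (\<eta> k) * cmod (U k))))"
    by (rule Bochner_Integration.integral_norm_bound_integral[OF i integrable_mult_right[OF w(1)] pt])
  also have "\<dots> \<le> nu * (n2 \<eta> * L2n lborel U)"
    unfolding integral_mult_right_zero using nu by (intro mult_left_mono w(2)) auto
  finally show "\<bar>PP \<eta> U\<bar> \<le> nu * (n2 \<eta> * L2n lborel U)" .
qed

lemma PP_diff:
  assumes \<eta>: "Tc \<eta>" and U: "sqi lborel U" and V: "sqi lborel V"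
  shows "PP \<eta> U - PP \<eta> V = PP \<eta> (\<lambda>k. U k - V k)"
  unfolding PP_def right_diff_distrib
    Bochner_Integration.integral_diff[OF PP_integrable(1)[OF \<eta> U] PP_integrable(1)[OF \<eta> V]] by simp

text \<open>Transfers the frequency truncation of the velocity to the test profile.\<close>

definition cutoff :: "real \<Rightarrow> (real \<Rightarrow> complex) \<Rightarrow> real \<Rightarrow> complex" where
  "cutoff N \<eta> k = (if k \<le> N then \<eta> k else 0)"

lemma Tc_cutoff:
  assumes \<eta>: "Tc \<eta>" shows "Tc (cutoff N \<eta>)" "n2 (cutoff N \<eta>) \<le> n2 \<eta>" "n1 (cutoff N \<eta>) \<le> n1 \<eta>"
proof -
  have [measurable]: "\<eta> \<in> borel_measurable borel" using Tc_measurable[OF \<eta>] by simp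
  have s: "sqi lborel (\<lambda>k. complex_of_real (1 + \<bar>k\<bar>) * \<eta> k)" using \<eta> by (simp add: Tc_def)
  have "cutoff N \<eta> \<in> borel_measurable borel" unfolding cutoff_def[abs_def] by measurable
  then have m: "cutoff N \<eta> \<in> borel_measurable lborel" by simp
  have m': "(\<lambda>k. complex_of_real (1 + \<bar>k\<bar>) * cutoff N \<eta> k) \<in> borel_measurable lborel"
    by (rule borel_measurable_times[OF _ m]) simp
  have ae: "AE k in lborel. cmod (complex_of_real (1 + \<bar>k\<bar>) * cutoff N \<eta> k) \<le> cmod (complex_of_real (1 + \<bar>k\<bar>) * \<eta> k)"
    by (auto simp: cutoff_def)
  show T: "Tc (cutoff N \<eta>)" unfolding Tc_def
    using m sqi_bound[OF s m' ae] \<eta> by (auto simp: Tc_def cutoff_def)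
  show "n2 (cutoff N \<eta>) \<le> n2 \<eta>" unfolding n2_def by (rule L2n_mono[OF s m' ae])
  show "n1 (cutoff N \<eta>) \<le> n1 \<eta>" unfolding n1_def
    by (rule integral_mono[OF integrable_norm[OF Tc_integrable[OF T]] integrable_norm[OF Tc_integrable[OF \<eta>]]]) (simp add: cutoff_def)
qed

text \<open>The weight in \<open>PP\<close> cancels the division in \<open>QQ\<close>, and the
  truncation moves to the test profile; the iterates thus satisfy a discrete form of the tested
  equation exactly.\<close>

lemma eul_PP:
  assumes \<eta>: "Tc \<eta>" and b: "bcs N b"
  shows "PP \<eta> (eul N h b (Suc n)) = PP \<eta> (eul N h b n) + h * BB (cutoff N \<eta>) (eul N h b n)"
proof -
  let ?A = "eul N h b n"
  have A: "bcs N ?A" by (rule eul_bcs[OF b])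
  have Q: "bcs N (QQ N ?A)" by (rule QQ_bcs[OF A])
  have eq: "complex_of_real (wt k) * (cnj (\<eta> k) * QQ N ?A k) = cnj (cutoff N \<eta> k) * RR ?A k" for k
  proof -
    have w: "complex_of_real (wt k) \<noteq> 0" using wt_pos[of k] by simp
    show ?thesis
    proof (cases "0 < k \<and> k \<le> N")
      case True
      then have "QQ N ?A k = RR ?A k / complex_of_real (wt k)" by (simp add: QQ_def)
      then show ?thesis using True w by (simp add: cutoff_def)
    next
      case False
      then have "QQ N ?A k = 0" unfolding QQ_def by (rule if_not_P)
      moreover have "cutoff N \<eta> k = 0" using False \<eta> by (auto simp: cutoff_def Tc_def)
      ultimately show ?thesis by simp
    qed
  qed
  have "complex_of_real (wt k) * (cnj (\<eta> k) * eul N h b (Suc n) k)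
     = complex_of_real (wt k) * (cnj (\<eta> k) * ?A k) + complex_of_real h * (cnj (cutoff N \<eta> k) * RR ?A k)" for k
    unfolding eq[symmetric] by (simp add: algebra_simps)
  then have "(LINT k|lborel. complex_of_real (wt k) * (cnj (\<eta> k) * eul N h b (Suc n) k))
     = (LINT k|lborel. complex_of_real (wt k) * (cnj (\<eta> k) * ?A k)) + complex_of_real h * (LINT k|lborel. cnj (cutoff N \<eta> k) * RR ?A k)"
    by (simp only: Bochner_Integration.integral_add[OF PP_integrable(1)[OF \<eta> bcs_sqi[OF A]]
          integrable_mult_right[OF BB_integrable[OF Tc_cutoff(1)[OF \<eta>] bcs_Xc[OF A]]]] integral_mult_right_zero)
  then show ?thesis unfolding PP_def BB_def by simp
qed

lemma eul_PP_sum: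
  assumes \<eta>: "Tc \<eta>" and b: "bcs N b"
  shows "PP \<eta> (eul N h b n) = PP \<eta> b + h * (\<Sum>i<n. BB (cutoff N \<eta>) (eul N h b i))"
  by (induction n) (use eul_PP[OF assms] in \<open>auto simp: algebra_simps simp del: eul.simps(2)\<close>)

end

text \<open>Presents the Euler sum as the integral of a step function in time, so that the passage
  to the limit becomes dominated convergence.\<close>

lemma step_integral:
  fixes G :: "nat \<Rightarrow> real" and h :: real
  assumes h: "0 < h"
  shows "has_bochner_integral lborel (\<lambda>s. indicat_real {0..<real n * h} s * G (nat \<lfloor>s / h\<rfloor>)) (h * (\<Sum>i<n. G i))"
proof (induction n)
  case (Suc n)
  have 1: "has_bochner_integral lborel (\<lambda>s. G n * indicat_real {real n * h..<real (Suc n) * h} s) (G n * h)"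
  proof -
    have "has_bochner_integral lborel (indicat_real {real n * h..<real (Suc n) * h}) (measure lborel {real n * h..<real (Suc n) * h})"
      by (rule has_bochner_integral_real_indicator) (use h in \<open>auto simp: emeasure_lborel_Ico\<close>)
    moreover have "measure lborel {real n * h..<real (Suc n) * h} = h"
      using h by (simp add: algebra_simps)
    ultimately show ?thesis by (intro has_bochner_integral_mult_right) auto
  qed
  have "indicat_real {0..<real (Suc n) * h} s * G (nat \<lfloor>s / h\<rfloor>)
      = indicat_real {0..<real n * h} s * G (nat \<lfloor>s / h\<rfloor>) + G n * indicat_real {real n * h..<real (Suc n) * h} s" for s
  proof -
    consider "s < 0" | "0 \<le> s" "s < real n * h" | "real n * h \<le> s" "s < real (Suc n) * h" | "real (Suc n) * h \<le> s"
      by linarith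
    then show ?thesis
    proof cases
      case 1
      have "0 \<le> real n * h" using h by simp
      then show ?thesis using 1 by (auto simp: indicator_def)
    next
      case 2
      have "real n * h \<le> real (Suc n) * h" using h by simp
      then show ?thesis using 2 by (auto simp: indicator_def)
    next
      case 3
      have "real n \<le> s / h" "s / h < real n + 1" using 3 h by (auto simp: field_simps)
      then have "\<lfloor>s / h\<rfloor> = int n" by linarith
      moreover have "0 \<le> real n * h" using h by simp
      ultimately show ?thesis using 3 by (auto simp: indicator_def)
    next
      case 4
      have "real n * h \<le> real (Suc n) * h" using h by simp
      then show ?thesis using 4 by (auto simp: indicator_def)
    qed
  qed
  then show ?case
    using has_bochner_integral_add[OF Suc 1] by (simp add: algebra_simps)
qed (simp add: has_bochner_integral_zero)

text \<open>Level \<open>j\<close> consists of Euler iterates with step \<open>h j\<close> and frequencies up to \<open>2 ^ j\<close>; one step of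
  level \<open>j\<close> is \<open>r j\<close> steps of the next level.\<close>

locale evol_seq = evol +
  fixes A0 :: "real \<Rightarrow> complex" and T x C :: real and h :: "nat \<Rightarrow> real" and r :: "nat \<Rightarrow> nat" and b :: "nat \<Rightarrow> real \<Rightarrow> complex"
  assumes A0: "Xc A0" and T: "0 < T" and x: "0 \<le> x" and h: "\<And>j. 0 < h j" and b: "\<And>j. bcs (2 ^ j) (b j)"
    and hr: "\<And>j. h j = real (r j) * h (Suc j)" and h_small: "\<And>j. h j \<le> (1/2) ^ j"
    and data: "\<And>j. nW (\<lambda>k. b j k - A0 k) \<le> C * (4/5) ^ j"
    and bd: "\<And>j n. real n * h j \<le> T \<Longrightarrow> nX (eul (2 ^ j) (h j) (b j) n) \<le> x"
    and cmp: "\<And>j i. real i * h (Suc j) \<le> T \<Longrightarrow>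
       nW (\<lambda>k. eul (2 ^ Suc j) (h (Suc j)) (b (Suc j)) i k - eul (2 ^ j) (h j) (b j) (i div r j) k) \<le> C * (4/5) ^ j"
begin

section \<open>The limit profile and its equation\<close>

definition u :: "nat \<Rightarrow> nat \<Rightarrow> real \<Rightarrow> complex" where "u j n = eul (2 ^ j) (h j) (b j) n"
definition tn :: "nat \<Rightarrow> real \<Rightarrow> nat" where "tn j t = nat \<lfloor>t / h j\<rfloor>"
text \<open>The limit is pointwise, which makes \<open>AA\<close> jointly measurable in time and
  frequency. The factor \<open>s1\<close> matches the weighted sequence to which
  \<open>L2_fast_Cauchy\<close> applies; where it diverges, a null set for each \<open>t\<close> in
  \<open>[0, T]\<close>, the default value of \<open>lim\<close> is immaterial.\<close>

definition AA :: "real \<Rightarrow> real \<Rightarrow> complex" where "AA t k = lim (\<lambda>j. s1 k * u j (tn j t) k) / s1 k"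

lemma u_bcs: "bcs (2 ^ j) (u j n)" unfolding u_def by (rule eul_bcs[OF b])
lemma u_Xc: "Xc (u j n)" by (rule bcs_Xc[OF u_bcs])

lemma C0: "0 \<le> C" using order_trans[OF nW_nonneg data[of 0]] by simp

lemma tn_le: "0 \<le> t \<Longrightarrow> real (tn j t) * h j \<le> t"
  using h[of j] by (simp add: tn_def pos_le_divide_eq[symmetric])

lemma tn_gt: "0 \<le> t \<Longrightarrow> t - h j < real (tn j t) * h j"
proof -
  assume t: "0 \<le> t"
  have "0 \<le> t / h j" using t h[of j] by simp
  then have "real (tn j t) = of_int \<lfloor>t / h j\<rfloor>" unfolding tn_def by simp
  then have "t / h j - 1 < real (tn j t)" by linarith
  then have "(t / h j - 1) * h j < real (tn j t) * h j" using h[of j] by (intro mult_strict_right_mono)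
  then show ?thesis using h[of j] by (simp add: left_diff_distrib)
qed

text \<open>Nested floors: the coarse node before \<open>t\<close> is also the coarse node before
  the fine node of \<open>t\<close>. Consecutive levels can therefore be compared at the same
  time.\<close>

lemma tn_div: "0 \<le> t \<Longrightarrow> tn j t = tn (Suc j) t div r j"
proof -
  assume t: "0 \<le> t"
  have rj: "0 < r j" using hr[of j] h[of j] by (cases "r j = 0") auto
  have "t / h j = (t / h (Suc j)) / real_of_int (int (r j))" by (simp add: hr[of j] mult.commute)
  then have "\<lfloor>t / h j\<rfloor> = \<lfloor>t / h (Suc j)\<rfloor> div int (r j)"
    by (simp only: floor_divide_real_eq_div of_nat_0_le_iff)
  then show ?thesis using t h[of "Suc j"] by (simp add: tn_def nat_div_distrib)
qed

lemma u_nX: "0 \<le> t \<Longrightarrow> t \<le> T \<Longrightarrow> nX (u j (tn j t)) \<le> x"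
  unfolding u_def by (rule bd) (rule order_trans[OF tn_le])

lemma u_step:
  assumes "0 \<le> t" "t \<le> T"
  shows "nW (\<lambda>k. u (Suc j) (tn (Suc j) t) k - u j (tn j t) k) \<le> C * (4/5) ^ j"
  unfolding u_def tn_div[OF assms(1), of j] by (rule cmp) (rule order_trans[OF tn_le[OF assms(1)] assms(2)])

lemma s1_nz: "s1 k \<noteq> 0" using one_le_s1[of k] by auto

text \<open>The factor 5 is the geometric sum \<open>1 / (1 - 4/5)\<close> over the distances of
  consecutive levels.\<close>

lemma AA_lim:
  assumes t: "0 \<le> t" "t \<le> T"
  shows "sqi lborel (\<lambda>k. s1 k * AA t k)"
    and "nW (\<lambda>k. u j (tn j t) k - AA t k) \<le> 5 * C * (4/5) ^ j"
    and "AE k in lborel. (\<lambda>j. u j (tn j t) k) \<longlonglongrightarrow> AA t k"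
proof -
  have s: "sqi lborel (\<lambda>k. s1 k * u j (tn j t) k)" for j by (rule Xc_s1(1)[OF u_Xc])
  have d: "L2n lborel (\<lambda>k. s1 k * u (Suc j) (tn (Suc j) t) k - s1 k * u j (tn j t) k) \<le> C * (4/5) ^ j" for j
    using u_step[OF t, of j] unfolding nW_def right_diff_distrib .
  have e: "s1 k * AA t k = lim (\<lambda>j. s1 k * u j (tn j t) k)" for k
    using s1_nz[of k] by (simp add: AA_def)
  note F = L2_fast_Cauchy[of lborel "\<lambda>j k. s1 k * u j (tn j t) k" C "4/5", OF s d, folded e]
  show "sqi lborel (\<lambda>k. s1 k * AA t k)" by (rule F(2)) auto
  show "nW (\<lambda>k. u j (tn j t) k - AA t k) \<le> 5 * C * (4/5) ^ j"
    unfolding nW_def right_diff_distrib using F(3)[of j] by simp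
  have "AE k in lborel. (\<lambda>j. s1 k * u j (tn j t) k) \<longlonglongrightarrow> s1 k * AA t k" by (rule F(1)) auto
  then show "AE k in lborel. (\<lambda>j. u j (tn j t) k) \<longlonglongrightarrow> AA t k"
  proof eventually_elim
    case (elim k)
    from tendsto_divide[OF elim tendsto_const s1_nz[of k]] show ?case using s1_nz[of k] by simp
  qed
qed

lemma AA_0: "k \<le> 0 \<Longrightarrow> AA t k = 0"
proof -
  assume "k \<le> 0"
  then have "u j n k = 0" for j n by (intro bcs_0[OF u_bcs]) auto
  then show ?thesis by (simp add: AA_def)
qed

text \<open>The known rate of convergence is in H^(1/2), but convergence also holds almost
  everywhere in frequency, so Fatou carries the uniform H^(3/2) bound of the iterates over to the
  limit.\<close>

lemma AA_Xc:
  assumes t: "0 \<le> t" "t \<le> T"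
  shows "Xc (AA t)" "nX (AA t) \<le> x"
proof -
  have "(\<lambda>k. s1 k * AA t k / s1 k) \<in> borel_measurable lborel"
    by (rule borel_measurable_divide[OF sqi_measurable[OF AA_lim(1)[OF t]]]) simp
  then have m: "AA t \<in> borel_measurable lborel" using s1_nz by simp
  have m3: "(\<lambda>k. s3 k * AA t k) \<in> borel_measurable lborel"
    by (rule borel_measurable_times[OF _ m]) simp
  have ae: "AE k in lborel. (\<lambda>j. s3 k * u j (tn j t) k) \<longlonglongrightarrow> s3 k * AA t k"
    using AA_lim(3)[OF t] by eventually_elim (intro tendsto_mult tendsto_const)
  have s: "sqi lborel (\<lambda>k. s3 k * u j (tn j t) k)" for j using u_Xc by (simp add: Xc_def)
  have bb: "\<forall>\<^sub>F j in sequentially. L2n lborel (\<lambda>k. s3 k * u j (tn j t) k) \<le> x"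
    using u_nX[OF t] unfolding nX_def by (intro always_eventually allI)
  note F = L2_Fatou[where f="\<lambda>j k. s3 k * u j (tn j t) k", OF s m3 ae x bb]
  show "Xc (AA t)" using m F(1) AA_0 by (simp add: Xc_def)
  show "nX (AA t) \<le> x" unfolding nX_def by (rule F(2))
qed

lemma tn_measurable: "tn j \<in> borel \<rightarrow>\<^sub>M count_space UNIV"
  unfolding tn_def[abs_def] by measurable

lemma u_joint_measurable: "(\<lambda>p. u j (tn j (fst p)) (snd p)) \<in> borel_measurable (borel \<Otimes>\<^sub>M borel)"
proof (rule measurable_compose_countable[where f="\<lambda>n p. u j n (snd p)" and g="\<lambda>p. tn j (fst p)"])
  show "(\<lambda>p. tn j (fst p)) \<in> borel \<Otimes>\<^sub>M borel \<rightarrow>\<^sub>M count_space UNIV"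
    by (rule measurable_compose[OF measurable_fst tn_measurable])
  have "u j n \<in> borel_measurable borel" for n using bcs_measurable[OF u_bcs[of j n]] by simp
  then show "(\<lambda>p. u j n (snd p)) \<in> borel_measurable (borel \<Otimes>\<^sub>M borel)" for n
    by (rule measurable_compose[OF measurable_snd])
qed

lemma AA_joint_measurable: "(\<lambda>p. AA (fst p) (snd p)) \<in> borel_measurable (borel \<Otimes>\<^sub>M borel)"
proof -
  have "(\<lambda>p. s1 (snd p)) \<in> borel_measurable (borel \<Otimes>\<^sub>M borel)"
    by (rule measurable_compose[OF measurable_snd s1_measurable])
  note m = this u_joint_measurable
  show ?thesis unfolding AA_def
    by (intro borel_measurable_divide borel_measurable_lim_metric borel_measurable_times m)
qed

lemma u_AA_L2:
  assumes t: "0 \<le> t" "t \<le> T"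
  shows "L2n lborel (\<lambda>k. u j (tn j t) k - AA t k) \<le> 5 * C * (4/5) ^ j"
    and "n2 (\<lambda>k. u j (tn j t) k - AA t k) \<le> sqrt (5 * C * (4/5) ^ j * (2 * x))"
proof -
  note X = Xc_diff[OF u_Xc[of j "tn j t"] AA_Xc(1)[OF t]]
  have "L2n lborel (\<lambda>k. u j (tn j t) k - AA t k) \<le> nW (\<lambda>k. u j (tn j t) k - AA t k)"
    unfolding nW_def
  proof (rule L2n_mono[OF Xc_s1(1)[OF X] Xc_measurable[OF X]])
    show "AE k in lborel. cmod (u j (tn j t) k - AA t k) \<le> cmod (s1 k * (u j (tn j t) k - AA t k))"
      unfolding norm_mult by (intro AE_I2) (rule mult_le_cancel_right1[THEN iffD2], use one_le_s1 in auto)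
  qed
  then show "L2n lborel (\<lambda>k. u j (tn j t) k - AA t k) \<le> 5 * C * (4/5) ^ j"
    using AA_lim(2)[OF t, of j] by linarith
  have "(n2 (\<lambda>k. u j (tn j t) k - AA t k))\<^sup>2 \<le> nW (\<lambda>k. u j (tn j t) k - AA t k) * nX (\<lambda>k. u j (tn j t) k - AA t k)"
    by (rule n2_interpolation[OF X])
  also have "\<dots> \<le> (5 * C * (4/5) ^ j) * (2 * x)"
  proof (rule mult_mono[OF AA_lim(2)[OF t]])
    show "nX (\<lambda>k. u j (tn j t) k - AA t k) \<le> 2 * x"
      using nX_triangle_diff[OF u_Xc[of j "tn j t"] AA_Xc(1)[OF t]] u_nX[OF t, of j] AA_Xc(2)[OF t] by linarith
  qed (use C0 in auto)
  finally show "n2 (\<lambda>k. u j (tn j t) k - AA t k) \<le> sqrt (5 * C * (4/5) ^ j * (2 * x))" by (rule real_le_rsqrt)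
qed

lemma rate_tendsto: "(\<lambda>j. c * (4/5) ^ j) \<longlonglongrightarrow> (0::real)"
proof -
  have "(\<lambda>j. c * (4/5) ^ j) \<longlonglongrightarrow> c * 0"
    by (intro tendsto_mult tendsto_const LIMSEQ_power_zero) auto
  then show ?thesis by simp
qed

lemma PP_lim:
  assumes \<eta>: "Tc \<eta>" and t: "0 \<le> t" "t \<le> T"
  shows "(\<lambda>j. PP \<eta> (u j (tn j t))) \<longlonglongrightarrow> PP \<eta> (AA t)"
proof (rule LIM_zero_cancel, rule Lim_null_comparison)
  show "\<forall>\<^sub>F j in sequentially. norm (PP \<eta> (u j (tn j t)) - PP \<eta> (AA t)) \<le> (nu * n2 \<eta> * (5 * C)) * (4/5) ^ j"
  proof (intro always_eventually allI)
    fix j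
    note s = Xc_self(1)[OF u_Xc[of j "tn j t"]] Xc_self(1)[OF AA_Xc(1)[OF t]]
    have "\<bar>PP \<eta> (\<lambda>k. u j (tn j t) k - AA t k)\<bar> \<le> nu * (n2 \<eta> * L2n lborel (\<lambda>k. u j (tn j t) k - AA t k))"
      by (rule PP_integrable(2)[OF \<eta> sqi_diff[OF s]])
    also have "\<dots> \<le> nu * (n2 \<eta> * (5 * C * (4/5) ^ j))"
      using nu by (intro mult_left_mono u_AA_L2(1)[OF t]) (auto simp: n2_def)
    finally show "norm (PP \<eta> (u j (tn j t)) - PP \<eta> (AA t)) \<le> (nu * n2 \<eta> * (5 * C)) * (4/5) ^ j"
      unfolding PP_diff[OF \<eta> s] by (simp add: mult_ac)
  qed
qed (rule rate_tendsto)

lemma PP_data_lim: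
  assumes \<eta>: "Tc \<eta>"
  shows "(\<lambda>j. PP \<eta> (b j)) \<longlonglongrightarrow> PP \<eta> A0"
proof (rule LIM_zero_cancel, rule Lim_null_comparison)
  show "\<forall>\<^sub>F j in sequentially. norm (PP \<eta> (b j) - PP \<eta> A0) \<le> (nu * n2 \<eta> * C) * (4/5) ^ j"
  proof (intro always_eventually allI)
    fix j
    note X = Xc_diff[OF bcs_Xc[OF b[of j]] A0]
    note s = bcs_sqi[OF b[of j]] Xc_self(1)[OF A0]
    have l: "L2n lborel (\<lambda>k. b j k - A0 k) \<le> nW (\<lambda>k. b j k - A0 k)"
      unfolding nW_def
    proof (rule L2n_mono[OF Xc_s1(1)[OF X] Xc_measurable[OF X]])
      show "AE k in lborel. cmod (b j k - A0 k) \<le> cmod (s1 k * (b j k - A0 k))"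
        unfolding norm_mult by (intro AE_I2) (rule mult_le_cancel_right1[THEN iffD2], use one_le_s1 in auto)
    qed
    have "\<bar>PP \<eta> (\<lambda>k. b j k - A0 k)\<bar> \<le> nu * (n2 \<eta> * L2n lborel (\<lambda>k. b j k - A0 k))"
      by (rule PP_integrable(2)[OF \<eta> sqi_diff[OF s]])
    also have "\<dots> \<le> nu * (n2 \<eta> * (C * (4/5) ^ j))"
      using nu by (intro mult_left_mono order_trans[OF l data]) (auto simp: n2_def)
    finally show "norm (PP \<eta> (b j) - PP \<eta> A0) \<le> (nu * n2 \<eta> * C) * (4/5) ^ j"
      unfolding PP_diff[OF \<eta> s] by (simp add: mult_ac)
  qed
qed (rule rate_tendsto)

lemma BB_cutoff_lim:
  assumes \<eta>: "Tc \<eta>" and U: "Xc U"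
  shows "(\<lambda>j. BB (cutoff (2 ^ j) \<eta>) U) \<longlonglongrightarrow> BB \<eta> U"
proof -
  have "(\<lambda>j. LINT k|lborel. cnj (cutoff (2 ^ j) \<eta> k) * RR U k) \<longlonglongrightarrow> (LINT k|lborel. cnj (\<eta> k) * RR U k)"
  proof (rule integral_dominated_convergence)
    show "(\<lambda>k. cnj (\<eta> k) * RR U k) \<in> borel_measurable lborel"
      by (rule borel_measurable_integrable[OF BB_integrable[OF \<eta> U]])
    show "(\<lambda>k. cnj (cutoff (2 ^ j) \<eta> k) * RR U k) \<in> borel_measurable lborel" for j
      by (rule borel_measurable_integrable[OF BB_integrable[OF Tc_cutoff(1)[OF \<eta>] U]])
    show "integrable lborel (\<lambda>k. cmod (cnj (\<eta> k) * RR U k))" by (rule integrable_norm[OF BB_integrable[OF \<eta> U]])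
    show "AE k in lborel. norm (cnj (cutoff (2 ^ j) \<eta> k) * RR U k) \<le> cmod (cnj (\<eta> k) * RR U k)" for j
      by (intro AE_I2) (simp add: cutoff_def)
    show "AE k in lborel. (\<lambda>j. cnj (cutoff (2 ^ j) \<eta> k) * RR U k) \<longlonglongrightarrow> cnj (\<eta> k) * RR U k"
    proof (intro AE_I2 tendsto_eventually)
      fix k :: real
      obtain n0 :: nat where n0: "k \<le> real n0" using real_arch_simple by blast
      have "cnj (cutoff (2 ^ j) \<eta> k) * RR U k = cnj (\<eta> k) * RR U k" if "n0 \<le> j" for j
      proof -
        have "real n0 \<le> real j" using that by simp
        also have "real j \<le> 2 ^ j" using of_nat_less_two_power[of j, where 'a=real] by simp
        finally have "k \<le> 2 ^ j" using n0 by linarith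
        then show ?thesis by (simp add: cutoff_def)
      qed
      then show "\<forall>\<^sub>F j in sequentially. cnj (cutoff (2 ^ j) \<eta> k) * RR U k = cnj (\<eta> k) * RR U k"
        unfolding eventually_sequentially by blast
    qed
  qed
  then show ?thesis unfolding BB_def by (rule tendsto_Re)
qed

text \<open>Two limits at once: the iterates converge in H^1 by interpolation, uniformly over the
  cut off test profiles, and for the fixed profile \<open>AA t\<close> the cutoff disappears by
  dominated convergence.\<close>

lemma BB_lim:
  assumes \<eta>: "Tc \<eta>" and t: "0 \<le> t" "t \<le> T"
  shows "(\<lambda>j. BB (cutoff (2 ^ j) \<eta>) (u j (tn j t))) \<longlonglongrightarrow> BB \<eta> (AA t)"
proof -
  have n: "0 \<le> n2 \<eta>" by (simp add: n2_def)
  have z: "(\<lambda>j. BB (cutoff (2 ^ j) \<eta>) (u j (tn j t)) - BB (cutoff (2 ^ j) \<eta>) (AA t)) \<longlonglongrightarrow> 0"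
  proof (rule Lim_null_comparison)
    show "\<forall>\<^sub>F j in sequentially. norm (BB (cutoff (2 ^ j) \<eta>) (u j (tn j t)) - BB (cutoff (2 ^ j) \<eta>) (AA t))
       \<le> n2 \<eta> * (5 * C * (4/5) ^ j) / \<epsilon> + 10 * x * sqrt ((5 * C * (2 * x)) * (4/5) ^ j) * n1 \<eta>"
    proof (intro always_eventually allI)
      fix j
      note c = Tc_cutoff[OF \<eta>, of "2 ^ j"]
      let ?d = "\<lambda>k. u j (tn j t) k - AA t k"
      have s: "n2 ?d \<le> sqrt ((5 * C * (2 * x)) * (4/5) ^ j)" using u_AA_L2(2)[OF t, of j] by (simp add: mult_ac)
      have "\<bar>BB (cutoff (2 ^ j) \<eta>) (u j (tn j t)) - BB (cutoff (2 ^ j) \<eta>) (AA t)\<bar>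
         \<le> n2 (cutoff (2 ^ j) \<eta>) * L2n lborel ?d / \<epsilon> + 10 * x * n2 ?d * n1 (cutoff (2 ^ j) \<eta>)"
        by (rule BB_diff[OF c(1) u_Xc u_nX[OF t] AA_Xc[OF t]])
      also have "\<dots> \<le> n2 \<eta> * (5 * C * (4/5) ^ j) / \<epsilon> + 10 * x * sqrt ((5 * C * (2 * x)) * (4/5) ^ j) * n1 \<eta>"
        using eps x n C0 by (intro add_mono divide_right_mono mult_mono c mult_left_mono s u_AA_L2(1)[OF t])
          (auto simp: n2_def)
      finally show "norm (BB (cutoff (2 ^ j) \<eta>) (u j (tn j t)) - BB (cutoff (2 ^ j) \<eta>) (AA t))
       \<le> n2 \<eta> * (5 * C * (4/5) ^ j) / \<epsilon> + 10 * x * sqrt ((5 * C * (2 * x)) * (4/5) ^ j) * n1 \<eta>" by simp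
    qed
    have "(\<lambda>j. n2 \<eta> * (5 * C * (4/5) ^ j) / \<epsilon> + 10 * x * sqrt ((5 * C * (2 * x)) * (4/5) ^ j) * n1 \<eta>)
       \<longlonglongrightarrow> n2 \<eta> * 0 / \<epsilon> + 10 * x * sqrt 0 * n1 \<eta>"
      using eps by (intro tendsto_add tendsto_divide tendsto_mult tendsto_const tendsto_real_sqrt rate_tendsto) auto
    then show "(\<lambda>j. n2 \<eta> * (5 * C * (4/5) ^ j) / \<epsilon> + 10 * x * sqrt ((5 * C * (2 * x)) * (4/5) ^ j) * n1 \<eta>) \<longlonglongrightarrow> 0"
      by simp
  qed
  show ?thesis
    using tendsto_add[OF z BB_cutoff_lim[OF \<eta> AA_Xc(1)[OF t]]] by simp
qed

lemma AA_KM_joint: "(\<lambda>p. KM (AA (fst p)) (snd p)) \<in> borel_measurable (borel \<Otimes>\<^sub>M borel)"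
  unfolding KM_def by (intro borel_measurable_times AA_joint_measurable) simp

lemma convol_joint:
  assumes U: "(\<lambda>p. U (fst p) (snd p)) \<in> borel_measurable (borel \<Otimes>\<^sub>M (borel :: real measure))"
    and V: "(\<lambda>p. V (fst p) (snd p)) \<in> borel_measurable (borel \<Otimes>\<^sub>M (borel :: real measure))"
  shows "(\<lambda>p. convol (U (fst p)) (V (fst p)) (snd p)) \<in> borel_measurable ((borel :: real measure) \<Otimes>\<^sub>M borel)"
    and "(\<lambda>p. correl (U (fst p)) (V (fst p)) (snd p)) \<in> borel_measurable ((borel :: real measure) \<Otimes>\<^sub>M borel)"
proof -
  let ?B = "((borel :: real measure) \<Otimes>\<^sub>M (borel :: real measure)) \<Otimes>\<^sub>M (lborel :: real measure)"
  have pr: "(\<lambda>q. (fst (fst q), f q)) \<in> ?B \<rightarrow>\<^sub>M borel \<Otimes>\<^sub>M borel" if "f \<in> borel_measurable ?B" for f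
    using that by measurable
  have c: "(\<lambda>q. W (fst (fst q)) (f q)) \<in> borel_measurable ?B"
    if "(\<lambda>p. W (fst p) (snd p)) \<in> borel_measurable (borel \<Otimes>\<^sub>M borel)" "f \<in> borel_measurable ?B" for W and f :: "(real \<times> real) \<times> real \<Rightarrow> real"
    using measurable_compose[OF pr[OF that(2)] that(1)] by simp
  have m: "(\<lambda>q. snd q) \<in> borel_measurable ?B" "(\<lambda>q. snd (fst q) - snd q) \<in> borel_measurable ?B"
    "(\<lambda>q. snd (fst q) + snd q) \<in> borel_measurable ?B" by measurable
  show "(\<lambda>p. convol (U (fst p)) (V (fst p)) (snd p)) \<in> borel_measurable (borel \<Otimes>\<^sub>M borel)"
    unfolding convol_def
    by (rule lborel.borel_measurable_lebesgue_integral)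
       (simp add: case_prod_beta' borel_measurable_times[OF c[OF U m(1)] c[OF V m(2)]])
  show "(\<lambda>p. correl (U (fst p)) (V (fst p)) (snd p)) \<in> borel_measurable (borel \<Otimes>\<^sub>M borel)"
    unfolding correl_def
    by (rule lborel.borel_measurable_lebesgue_integral)
       (simp add: case_prod_beta' borel_measurable_times[OF c[OF U m(3)] borel_measurable_cnj[OF c[OF V m(1)]]])
qed

lemma NL_joint_measurable: "(\<lambda>p. NL (AA (fst p)) (snd p)) \<in> borel_measurable (borel \<Otimes>\<^sub>M borel)"
proof -
  note K = AA_KM_joint and A = AA_joint_measurable
  show ?thesis unfolding NL_def
    by (intro borel_measurable_times borel_measurable_add borel_measurable_diff borel_measurable_const
        convol_joint(1)[OF K K] convol_joint(2)[OF K K] convol_joint(2)[OF A K])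
qed

lemma RR_joint_measurable: "(\<lambda>p. RR (AA (fst p)) (snd p)) \<in> borel_measurable (borel \<Otimes>\<^sub>M borel)"
proof -
  have l: "(\<lambda>p. \<i> * complex_of_real ((snd p - 1) / \<epsilon>) * AA (fst p) (snd p) + NL (AA (fst p)) (snd p)) \<in> borel_measurable ((borel :: real measure) \<Otimes>\<^sub>M borel)"
    by (intro borel_measurable_add borel_measurable_times NL_joint_measurable AA_joint_measurable) simp_all
  show ?thesis unfolding RR_def
    by (rule measurable_If[OF l]) simp_all
qed

text \<open>The limit of the summed Euler identity, by dominated convergence in time. The last node
  lies less than \<open>h j\<close> below \<open>t\<close>, so the indicator of the step function
  converges for every \<open>s\<close> other than \<open>t\<close>.\<close>

lemma weak_equation:
  assumes \<eta>: "Tc \<eta>" and t: "0 \<le> t" "t < T"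
  shows "PP \<eta> (AA t) = PP \<eta> A0 + (LINT s|lborel. indicat_real {0..<t} s * BB \<eta> (AA s))"
proof -
  define K where "K = n2 \<eta> * x / \<epsilon> + 5 * x\<^sup>2 * n1 \<eta>"
  have tT: "t \<le> T" using t by simp
  let ?f = "\<lambda>j s. indicat_real {0..<real (tn j t) * h j} s * BB (cutoff (2 ^ j) \<eta>) (u j (tn j s))"
  have st: "has_bochner_integral lborel (?f j) (h j * (\<Sum>i<tn j t. BB (cutoff (2 ^ j) \<eta>) (u j i)))" for j
    using step_integral[OF h[of j], of "tn j t" "\<lambda>i. BB (cutoff (2 ^ j) \<eta>) (u j i)"] unfolding tn_def .
  have P: "PP \<eta> (u j (tn j t)) = PP \<eta> (b j) + (LINT s|lborel. ?f j s)" for j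
    unfolding has_bochner_integral_integral_eq[OF st] using eul_PP_sum[OF \<eta> b, of j "h j" "tn j t"] by (simp add: u_def)
  have Tt: "real (tn j t) * h j \<le> T" for j using tn_le[OF t(1), of j] tT by linarith
  have bdd: "norm (?f j s) \<le> indicat_real {0..T} s * K" for j s
  proof (cases "0 \<le> s \<and> s < real (tn j t) * h j")
    case True
    then have s: "0 \<le> s" "s \<le> T" using Tt[of j] by auto
    have "\<bar>BB (cutoff (2 ^ j) \<eta>) (u j (tn j s))\<bar> \<le> n2 (cutoff (2 ^ j) \<eta>) * x / \<epsilon> + 5 * x\<^sup>2 * n1 (cutoff (2 ^ j) \<eta>)"
      by (rule BB_bound[OF Tc_cutoff(1)[OF \<eta>] u_Xc u_nX[OF s]])
    also have "\<dots> \<le> K" unfolding K_def using x eps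
      by (intro add_mono divide_right_mono mult_right_mono mult_left_mono Tc_cutoff[OF \<eta>]) auto
    finally show ?thesis using True s by simp
  next
    case False
    have "0 \<le> K" using x eps by (auto simp: K_def n2_def intro!: add_nonneg_nonneg mult_nonneg_nonneg divide_nonneg_nonneg)
    then show ?thesis using False by (auto simp: indicator_def)
  qed
  have lim: "(\<lambda>j. LINT s|lborel. ?f j s) \<longlonglongrightarrow> (LINT s|lborel. indicat_real {0..<t} s * BB \<eta> (AA s))"
  proof (rule integral_dominated_convergence)
    have "(\<lambda>p. cnj (\<eta> (snd p)) * RR (AA (fst p)) (snd p)) \<in> borel_measurable (borel \<Otimes>\<^sub>M lborel)"
    proof -
      have "\<eta> \<in> borel_measurable borel" using Tc_measurable[OF \<eta>] by simp
      then have "(\<lambda>p. cnj (\<eta> (snd p)) * RR (AA (fst p)) (snd p)) \<in> borel_measurable ((borel :: real measure) \<Otimes>\<^sub>M borel)"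
        by (intro borel_measurable_times borel_measurable_cnj RR_joint_measurable measurable_compose[OF measurable_snd])
      then show ?thesis by (simp cong: measurable_cong_sets sets_pair_measure_cong)
    qed
    then have "(\<lambda>s. LINT k|lborel. cnj (\<eta> k) * RR (AA s) k) \<in> borel_measurable borel"
      by (intro lborel.borel_measurable_lebesgue_integral) (simp add: case_prod_beta')
    then have [measurable]: "(\<lambda>s. BB \<eta> (AA s)) \<in> borel_measurable borel"
      unfolding BB_def by measurable
    show "(\<lambda>s. indicat_real {0..<t} s * BB \<eta> (AA s)) \<in> borel_measurable lborel" by measurable
    show "?f j \<in> borel_measurable lborel" for j
      using st[of j] by (auto dest: has_bochner_integral_iff[THEN iffD1] borel_measurable_integrable)
    show "integrable lborel (\<lambda>s. indicat_real {0..T} s * K)"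
      by (intro integrable_mult_left integrable_real_indicator) (auto simp: emeasure_lborel_Icc_eq)
    show "AE s in lborel. norm (?f j s) \<le> indicat_real {0..T} s * K" for j using bdd by simp
    have "AE s in lborel. s \<noteq> t" by (rule AE_lborel_singleton)
    then show "AE s in lborel. (\<lambda>j. ?f j s) \<longlonglongrightarrow> indicat_real {0..<t} s * BB \<eta> (AA s)"
    proof eventually_elim
      case (elim s)
      show ?case
      proof (cases "0 \<le> s \<and> s < t")
        case False
        then have "s < 0 \<or> t < s" using elim by auto
        then have f0: "?f j s = 0" for j using tn_le[OF t(1), of j] by (auto simp: indicator_def)
        have e: "indicat_real {0..<t} s = 0" using False by simp
        show ?thesis unfolding f0 e by simp
      next
        case True
        then have s: "0 \<le> s" "s \<le> T" using tT by auto
        have "(\<lambda>j. (1/2::real) ^ j) \<longlonglongrightarrow> 0" by (rule LIMSEQ_power_zero) simp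
        from order_tendstoD(2)[OF this, of "t - s"] True
        have "\<forall>\<^sub>F j in sequentially. (1/2::real) ^ j < t - s" by simp
        then have "\<forall>\<^sub>F j in sequentially. BB (cutoff (2 ^ j) \<eta>) (u j (tn j s)) = ?f j s"
        proof eventually_elim
          case (elim j)
          have "s < real (tn j t) * h j" using tn_gt[OF t(1), of j] h_small[of j] elim by linarith
          then show ?case using s by simp
        qed
        from tendsto_cong[THEN iffD1, OF this BB_lim[OF \<eta> s]]
        show ?thesis using True by simp
      qed
    qed
  qed
  have "(\<lambda>j. PP \<eta> (u j (tn j t))) \<longlonglongrightarrow> PP \<eta> A0 + (LINT s|lborel. indicat_real {0..<t} s * BB \<eta> (AA s))"
    unfolding P by (rule tendsto_add[OF PP_data_lim[OF \<eta>] lim])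
  from LIMSEQ_unique[OF PP_lim[OF \<eta> t(1) tT] this] show ?thesis .
qed

end

lemma (in evol) evol_seq_ex:
  assumes A: "Xc A0"
  obtains T x C h r b where "evol_seq \<epsilon> \<alpha> A0 T x C h r b"
proof -
  obtain T x C h r b where *: "0 < T" "0 \<le> x" "\<And>j::nat. 0 < h j" "\<And>j. bcs (2 ^ j) (b j)"
    "\<And>j. \<exists>n::nat. T = real n * h j" "\<And>j. h j = real (r j) * h (Suc j)" "\<And>j. 0 < (r j :: nat)"
    "\<And>j. h j \<le> (1/2) ^ j"
    "\<And>j. nW (\<lambda>k. b j k - A0 k) \<le> C * (4/5) ^ j"
    "\<And>j n. real n * h j \<le> T \<Longrightarrow> nX (eul (2 ^ j) (h j) (b j) n) \<le> x"
    "\<And>j i. real i * h (Suc j) \<le> T \<Longrightarrow>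
       nW (\<lambda>k. eul (2 ^ Suc j) (h (Suc j)) (b (Suc j)) i k - eul (2 ^ j) (h j) (b j) (i div r j) k) \<le> C * (4/5) ^ j"
    by (rule approximations[OF A], rule that)
  have "evol_seq \<epsilon> \<alpha> A0 T x C h r b"
    by unfold_locales (fact A *)+
  then show thesis by (rule that)
qed

section \<open>Test profiles depending on time\<close>

lemma Tc_cmod:
  assumes \<eta>: "Tc \<eta>"
  shows "Tc (\<lambda>k. complex_of_real (cmod (\<eta> k)))" "n2 (\<lambda>k. complex_of_real (cmod (\<eta> k))) = n2 \<eta>"
    "n1 (\<lambda>k. complex_of_real (cmod (\<eta> k))) = n1 \<eta>"
proof -
  have m: "(\<lambda>k. complex_of_real (cmod (\<eta> k))) \<in> borel_measurable lborel"
    using Tc_measurable[OF \<eta>] by measurable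
  have s: "sqi lborel (\<lambda>k. complex_of_real (1 + \<bar>k\<bar>) * \<eta> k)" using \<eta> by (simp add: Tc_def)
  have "(\<lambda>k. complex_of_real (1 + \<bar>k\<bar>) * complex_of_real (cmod (\<eta> k))) \<in> borel_measurable lborel"
    by (rule borel_measurable_times[OF _ m]) simp
  then have "sqi lborel (\<lambda>k. complex_of_real (1 + \<bar>k\<bar>) * complex_of_real (cmod (\<eta> k)))"
    by (rule sqi_bound[OF s]) (auto simp: norm_mult)
  then show "Tc (\<lambda>k. complex_of_real (cmod (\<eta> k)))" using m \<eta> by (auto simp: Tc_def)
  show "n2 (\<lambda>k. complex_of_real (cmod (\<eta> k))) = n2 \<eta>" unfolding n2_def
    by (rule L2n_cong) (simp add: norm_mult)
  show "n1 (\<lambda>k. complex_of_real (cmod (\<eta> k))) = n1 \<eta>" by (simp add: n1_def)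
qed

text \<open>The uniform bound \<open>B\<close> for the absolute pairings and the bounded set of
  times give joint integrability, so the time integral may be moved into the pairing with the fixed
  function \<open>F\<close>.\<close>

lemma time_Fubini:
  fixes \<eta> :: "real \<Rightarrow> real \<Rightarrow> complex"
  assumes m: "(\<lambda>p. \<eta> (fst p) (snd p)) \<in> borel_measurable (borel \<Otimes>\<^sub>M borel)"
    and F: "F \<in> borel_measurable borel" and S: "S \<in> sets borel" "S \<subseteq> {a..c}"
    and i: "\<And>t. integrable lborel (\<lambda>k. cnj (\<eta> t k) * F k)" and b: "\<And>t. (LINT k|lborel. cmod (\<eta> t k) * cmod (F k)) \<le> B"
  shows "(LINT t|lborel. indicat_real S t * Re (LINT k|lborel. cnj (\<eta> t k) * F k))
    = Re (LINT k|lborel. cnj (LINT t|lborel. complex_of_real (indicat_real S t) * \<eta> t k) * F k)"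
    and "integrable lborel (\<lambda>t. indicat_real S t * Re (LINT k|lborel. cnj (\<eta> t k) * F k))"
proof -
  let ?g = "\<lambda>t k. complex_of_real (indicat_real S t) * (cnj (\<eta> t k) * F k)"
  have gm: "(\<lambda>(t, k). ?g t k) \<in> borel_measurable (lborel \<Otimes>\<^sub>M lborel)"
  proof -
    have "(\<lambda>p. complex_of_real (indicat_real S (fst p)) * (cnj (\<eta> (fst p) (snd p)) * F (snd p))) \<in> borel_measurable ((borel :: real measure) \<Otimes>\<^sub>M borel)"
    proof (intro borel_measurable_times borel_measurable_cnj m)
      have "(\<lambda>t. complex_of_real (indicat_real S t)) \<in> borel_measurable borel" using S(1) by measurable
      then show "(\<lambda>p. complex_of_real (indicat_real S (fst p))) \<in> borel_measurable ((borel :: real measure) \<Otimes>\<^sub>M (borel :: real measure))"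
        by (rule measurable_compose[OF measurable_fst])
      show "(\<lambda>p. F (snd p)) \<in> borel_measurable ((borel :: real measure) \<Otimes>\<^sub>M borel)"
        by (rule measurable_compose[OF measurable_snd F])
    qed
    then show ?thesis by (simp add: case_prod_beta' cong: measurable_cong_sets sets_pair_measure_cong)
  qed
  have B: "0 \<le> B" by (rule order_trans[OF _ b[of 0]]) simp
  have n: "(LINT k|lborel. norm (?g t k)) = indicat_real S t * (LINT k|lborel. cmod (\<eta> t k) * cmod (F k))" for t
    by (simp add: norm_mult)
  have gi: "integrable (lborel \<Otimes>\<^sub>M lborel) (\<lambda>(t, k). ?g t k)"
  proof (rule lborel_pair.Fubini_integrable[OF gm])
    have "integrable lborel (\<lambda>t. B * indicat_real {a..c} t)"
      by (intro integrable_mult_right integrable_real_indicator) (auto simp: emeasure_lborel_Icc_eq)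
    then show "integrable lborel (\<lambda>t. LINT k|lborel. norm (case (t, k) of (t, k) \<Rightarrow> ?g t k))"
    proof (rule Bochner_Integration.integrable_bound)
      have "(\<lambda>(t, k). norm (?g t k)) \<in> borel_measurable (lborel \<Otimes>\<^sub>M lborel)"
        using measurable_compose[OF gm borel_measurable_norm] by (simp add: case_prod_beta')
      then show "(\<lambda>t. LINT k|lborel. norm (case (t, k) of (t, k) \<Rightarrow> ?g t k)) \<in> borel_measurable lborel"
        using lborel.borel_measurable_lebesgue_integral[of "\<lambda>t k. norm (?g t k)" lborel] by simp
      show "AE t in lborel. norm (LINT k|lborel. norm (case (t, k) of (t, k) \<Rightarrow> ?g t k)) \<le> norm (B * indicat_real {a..c} t)"
      proof (rule AE_I2)
        fix t
        have nn: "0 \<le> (LINT k|lborel. cmod (\<eta> t k) * cmod (F k))" by simp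
        have "indicat_real S t * (LINT k|lborel. cmod (\<eta> t k) * cmod (F k)) \<le> B * indicat_real {a..c} t"
        proof (cases "t \<in> S")
          case True
          then show ?thesis using S(2) b[of t] by auto
        next
          case False
          then show ?thesis using B by simp
        qed
        then show "norm (LINT k|lborel. norm (case (t, k) of (t, k) \<Rightarrow> ?g t k)) \<le> norm (B * indicat_real {a..c} t)"
          using B nn by (simp add: n del: norm_mult)
      qed
    qed
    show "AE t in lborel. integrable lborel (\<lambda>k. case (t, k) of (t, k) \<Rightarrow> ?g t k)"
      using i by simp
  qed
  have eq: "indicat_real S t * Re (LINT k|lborel. cnj (\<eta> t k) * F k) = Re (LINT k|lborel. ?g t k)" for t
    by simp
  have ti: "integrable lborel (\<lambda>t. LINT k|lborel. ?g t k)"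
    using lborel_pair.integrable_fst[OF gi] by simp
  then show "integrable lborel (\<lambda>t. indicat_real S t * Re (LINT k|lborel. cnj (\<eta> t k) * F k))"
    unfolding eq by (rule integrable_Re)
  have "(LINT t|lborel. indicat_real S t * Re (LINT k|lborel. cnj (\<eta> t k) * F k)) = Re (LINT t|lborel. LINT k|lborel. ?g t k)"
    unfolding eq by (rule integral_Re[OF ti])
  also have "(LINT t|lborel. LINT k|lborel. ?g t k) = (LINT k|lborel. LINT t|lborel. ?g t k)"
    using lborel_pair.Fubini_integral[OF gi] by simp
  also have "\<dots> = (LINT k|lborel. cnj (LINT t|lborel. complex_of_real (indicat_real S t) * \<eta> t k) * F k)"
  proof (rule Bochner_Integration.integral_cong[OF refl])
    fix k
    have "?g t k = cnj (complex_of_real (indicat_real S t) * \<eta> t k) * F k" for t by simp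
    then show "(LINT t|lborel. ?g t k) = cnj (LINT t|lborel. complex_of_real (indicat_real S t) * \<eta> t k) * F k"
      by (simp only: integral_mult_left_zero Bochner_Integration.integral_cnj)
  qed
  finally show "(LINT t|lborel. indicat_real S t * Re (LINT k|lborel. cnj (\<eta> t k) * F k))
    = Re (LINT k|lborel. cnj (LINT t|lborel. complex_of_real (indicat_real S t) * \<eta> t k) * F k)" .
qed

context evol
begin

lemma pair_bound_norm:
  assumes \<eta>: "Tc \<eta>" and F: "F \<in> borel_measurable lborel" and U: "sqi lborel U"
    and b: "\<And>k. cmod (F k) \<le> (1 + \<bar>k\<bar>) / \<epsilon> * cmod (U k) + D"
  shows "(LINT k|lborel. cmod (\<eta> k) * cmod (F k)) \<le> n2 \<eta> * L2n lborel U / \<epsilon> + D * n1 \<eta>"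
proof -
  have Fm: "(\<lambda>k. complex_of_real (cmod (F k))) \<in> borel_measurable lborel" using F by measurable
  have "cmod (LINT k|lborel. cnj (complex_of_real (cmod (\<eta> k))) * complex_of_real (cmod (F k)))
      \<le> n2 (\<lambda>k. complex_of_real (cmod (\<eta> k))) * L2n lborel U / \<epsilon> + D * n1 (\<lambda>k. complex_of_real (cmod (\<eta> k)))"
    by (rule pair_bound(2)[OF Tc_cmod(1)[OF \<eta>] Fm U]) (use b in simp)
  also have "(LINT k|lborel. cnj (complex_of_real (cmod (\<eta> k))) * complex_of_real (cmod (F k)))
      = complex_of_real (LINT k|lborel. cmod (\<eta> k) * cmod (F k))"
    by (simp flip: of_real_mult)
  finally show ?thesis unfolding Tc_cmod(2,3)[OF \<eta>] by simp
qed

end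

context evol_seq
begin

text \<open>\<open>weak_equation\<close> at time \<open>t\<close> is tested with
  \<open>\<eta> t\<close> and integrated over \<open>t\<close>. Exchanging the order on the triangle
  \<open>0 \<le> s < t < T\<close> leaves the integral of \<open>\<eta>\<close> over
  \<open>(s, T)\<close>, which is \<open>- \<zeta> s\<close>. Fubini thus takes the place of
  integration by parts in time, and the datum enters through \<open>\<zeta> 0\<close>.\<close>

lemma time_identity:
  assumes m: "(\<lambda>p. \<eta> (fst p) (snd p)) \<in> borel_measurable (borel \<Otimes>\<^sub>M borel)"
    and \<eta>: "\<And>t. Tc (\<eta> t)" and D: "\<And>t. n2 (\<eta> t) \<le> D" "\<And>t. n1 (\<eta> t) \<le> D"
    and \<zeta>: "\<And>s. Tc (\<zeta> s)" "\<And>s k. 0 \<le> s \<Longrightarrow> s < T \<Longrightarrow> \<zeta> s k = - (LINT t|lborel. complex_of_real (indicat_real {s<..<T} t) * \<eta> t k)"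
  shows "- PP (\<zeta> 0) A0 - (LINT s|lborel. indicat_real {0<..<T} s * PP (\<eta> s) (AA s))
    = (LINT s|lborel. indicat_real {0<..<T} s * BB (\<zeta> s) (AA s))"
proof -
  define K where "K = D * x / \<epsilon> + 5 * x\<^sup>2 * D"
  have D0: "0 \<le> D" using order_trans[OF _ D(1)[of 0]] by (simp add: n2_def)
  have K0: "0 \<le> K" using D0 x eps by (simp add: K_def)
  have B: "\<bar>BB (\<eta> t) (AA s)\<bar> \<le> K" if "0 \<le> s" "s \<le> T" for s t
  proof -
    have "\<bar>BB (\<eta> t) (AA s)\<bar> \<le> n2 (\<eta> t) * x / \<epsilon> + 5 * x\<^sup>2 * n1 (\<eta> t)"
      by (rule BB_bound[OF \<eta> AA_Xc[OF that]])
    also have "\<dots> \<le> K" unfolding K_def using x eps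
      by (intro add_mono divide_right_mono mult_right_mono mult_left_mono D) auto
    finally show ?thesis .
  qed
  define Q where "Q t s = indicat_real {0<..<T} t * (indicat_real {0..<t} s * BB (\<eta> t) (AA s))" for t s
  have Qm: "(\<lambda>p. Q (fst p) (snd p)) \<in> borel_measurable (lborel \<Otimes>\<^sub>M lborel)"
  proof -
    let ?B = "((borel :: real measure) \<Otimes>\<^sub>M (borel :: real measure)) \<Otimes>\<^sub>M (lborel :: real measure)"
    have p1: "(\<lambda>q. (fst (fst q), snd q)) \<in> ?B \<rightarrow>\<^sub>M borel \<Otimes>\<^sub>M borel" by measurable
    have p2: "(\<lambda>q. (snd (fst q), snd q)) \<in> ?B \<rightarrow>\<^sub>M borel \<Otimes>\<^sub>M borel" by measurable
    have "(\<lambda>q. cnj (\<eta> (fst (fst q)) (snd q)) * RR (AA (snd (fst q))) (snd q)) \<in> borel_measurable ?B"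
      using borel_measurable_times[OF borel_measurable_cnj[OF measurable_compose[OF p1 m]] measurable_compose[OF p2 RR_joint_measurable]]
      by simp
    then have "(\<lambda>p. LINT k|lborel. cnj (\<eta> (fst p) k) * RR (AA (snd p)) k) \<in> borel_measurable ((borel :: real measure) \<Otimes>\<^sub>M (borel :: real measure))"
      by (intro lborel.borel_measurable_lebesgue_integral) (simp add: case_prod_beta')
    then have [measurable]: "(\<lambda>p. BB (\<eta> (fst p)) (AA (snd p))) \<in> borel_measurable ((borel :: real measure) \<Otimes>\<^sub>M (borel :: real measure))"
      unfolding BB_def by measurable
    have e: "Q (fst p) (snd p) = (if 0 < fst p \<and> fst p < T \<and> 0 \<le> snd p \<and> snd p < fst p then BB (\<eta> (fst p)) (AA (snd p)) else 0)" for p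
      by (auto simp: Q_def indicator_def)
    have "(\<lambda>p. Q (fst p) (snd p)) \<in> borel_measurable ((borel :: real measure) \<Otimes>\<^sub>M (borel :: real measure))"
      unfolding e by measurable
    then show ?thesis by (simp cong: measurable_cong_sets sets_pair_measure_cong)
  qed
  have Qi: "integrable (lborel \<Otimes>\<^sub>M lborel) (\<lambda>p. Q (fst p) (snd p))"
  proof (rule box_integrable[OF Qm])
    show "norm (Q (fst p) (snd p)) \<le> K" for p
      using B[of "snd p" "fst p"] K0 by (auto simp: Q_def indicator_def)
    show "\<bar>x\<bar> > T \<or> \<bar>y\<bar> > T \<Longrightarrow> Q (fst (x, y)) (snd (x, y)) = 0" for x y
      by (auto simp: Q_def indicator_def)
  qed
  have Qi': "integrable (lborel \<Otimes>\<^sub>M lborel) (\<lambda>(t, s). Q t s)" using Qi by (simp add: case_prod_beta')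
  have A0s: "sqi lborel A0" by (rule Xc_self(1)[OF A0])
  define F0 where "F0 k = complex_of_real (wt k) * A0 k" for k
  have F0m: "F0 \<in> borel_measurable lborel"
  proof -
    have "continuous_on UNIV (\<lambda>k. complex_of_real (wt k))" by (intro continuous_intros wt_cont)
    from borel_measurable_continuous_onI[OF this] Xc_measurable[OF A0]
    show ?thesis unfolding F0_def[abs_def] by (intro borel_measurable_times) auto
  qed
  \<comment> \<open>The factor \<open>\<epsilon> * nu\<close> brings the weighted datum into the
    form required by \<open>pair_bound\<close>, with zero bounded part.\<close>
  define U0 where "U0 k = complex_of_real (\<epsilon> * nu) * A0 k" for k
  have U0: "sqi lborel U0" unfolding U0_def[abs_def] by (rule sqi_cmult[OF A0s])
  have F0b: "cmod (F0 k) \<le> (1 + \<bar>k\<bar>) / \<epsilon> * cmod (U0 k) + 0" for k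
  proof -
    have "wt k * cmod (A0 k) \<le> nu * (1 + \<bar>k\<bar>) * cmod (A0 k)" by (rule mult_right_mono[OF wt_upper]) simp
    then show ?thesis using eps nu wt_nonneg[of k] by (simp add: F0_def U0_def norm_mult mult_ac)
  qed
  have PPF: "PP e A0 = Re (LINT k|lborel. cnj (e k) * F0 k)" for e
    unfolding PP_def F0_def by (simp add: mult_ac)
  have F0i: "integrable lborel (\<lambda>k. cnj (\<eta> t k) * F0 k)" for t
    by (rule pair_bound(1)[OF \<eta> F0m U0 F0b])
  have F0B: "(LINT k|lborel. cmod (\<eta> t k) * cmod (F0 k)) \<le> D * L2n lborel U0 / \<epsilon>" for t
  proof -
    have "(LINT k|lborel. cmod (\<eta> t k) * cmod (F0 k)) \<le> n2 (\<eta> t) * L2n lborel U0 / \<epsilon> + 0 * n1 (\<eta> t)"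
      by (rule pair_bound_norm[OF \<eta> F0m U0 F0b])
    also have "\<dots> \<le> D * L2n lborel U0 / \<epsilon> + 0 * n1 (\<eta> t)"
      using eps by (intro add_right_mono divide_right_mono mult_right_mono D) auto
    finally show ?thesis by simp
  qed
  have F0m': "F0 \<in> borel_measurable borel" using F0m by simp
  have SI: "{s<..<T} \<in> sets borel" "{s<..<T} \<subseteq> {s..T}" for s by auto
  note TF0 = time_Fubini[OF m F0m' SI F0i F0B]
  have data: "(LINT t|lborel. indicat_real {0<..<T} t * PP (\<eta> t) A0) = - PP (\<zeta> 0) A0"
  proof -
    have "\<zeta> 0 k = - (LINT t|lborel. complex_of_real (indicat_real {0<..<T} t) * \<eta> t k)" for k
      using \<zeta>(2)[of 0 k] T by simp
    then show ?thesis unfolding PPF TF0(1)[of 0] by simp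
  qed
  have "indicat_real {0<..<T} t * PP (\<eta> t) (AA t) = indicat_real {0<..<T} t * PP (\<eta> t) A0 + (LINT s|lborel. Q t s)" for t
  proof (cases "0 < t \<and> t < T")
    case True
    then show ?thesis using weak_equation[OF \<eta>[of t], of t] by (simp add: Q_def)
  qed (auto simp: Q_def)
  then have "(LINT t|lborel. indicat_real {0<..<T} t * PP (\<eta> t) (AA t))
      = (LINT t|lborel. indicat_real {0<..<T} t * PP (\<eta> t) A0 + (LINT s|lborel. Q t s))" by presburger
  also have "\<dots> = (LINT t|lborel. indicat_real {0<..<T} t * PP (\<eta> t) A0) + (LINT t|lborel. LINT s|lborel. Q t s)"
  proof (rule Bochner_Integration.integral_add)
    show "integrable lborel (\<lambda>t. indicat_real {0<..<T} t * PP (\<eta> t) A0)" unfolding PPF by (rule TF0(2))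
    show "integrable lborel (\<lambda>t. LINT s|lborel. Q t s)" using lborel_pair.integrable_fst[OF Qi'] by simp
  qed
  also have "(LINT t|lborel. LINT s|lborel. Q t s) = (LINT s|lborel. LINT t|lborel. Q t s)"
    using lborel_pair.Fubini_integral[OF Qi'] by simp
  also have "\<dots> = (LINT s|lborel. - (indicat_real {0<..<T} s * BB (\<zeta> s) (AA s)))"
  proof (rule integral_cong_AE)
    have Ae: "AE s in lborel. (LINT t|lborel. Q t s) = - (indicat_real {0<..<T} s * BB (\<zeta> s) (AA s))"
      using AE_lborel_singleton[of "0::real"]
    proof eventually_elim
      case (elim s)
      show ?case
      proof (cases "0 < s \<and> s < T")
        case False
        then have "Q t s = 0" for t using elim by (auto simp: Q_def indicator_def)
        then show ?thesis using False by (auto simp: indicator_def)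
      next
        case True
        then have s: "0 \<le> s" "s \<le> T" by auto
        note X = AA_Xc(1)[OF s]
        have Rm: "RR (AA s) \<in> borel_measurable borel" using RR_measurable[OF Xc_measurable[OF X]] by simp
        have Rb: "(LINT k|lborel. cmod (\<eta> t k) * cmod (RR (AA s) k)) \<le> D * L2n lborel (AA s) / \<epsilon> + (5 * (nX (AA s))\<^sup>2) * D" for t
        proof -
          have "(LINT k|lborel. cmod (\<eta> t k) * cmod (RR (AA s) k)) \<le> n2 (\<eta> t) * L2n lborel (AA s) / \<epsilon> + (5 * (nX (AA s))\<^sup>2) * n1 (\<eta> t)"
            by (rule pair_bound_norm[OF \<eta> RR_measurable[OF Xc_measurable[OF X]] Xc_self(1)[OF X] RR_bound[OF X]])
          also have "\<dots> \<le> D * L2n lborel (AA s) / \<epsilon> + (5 * (nX (AA s))\<^sup>2) * D"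
            using eps by (intro add_mono divide_right_mono mult_right_mono mult_left_mono D) auto
          finally show ?thesis .
        qed
        have "Q t s = indicat_real {s<..<T} t * Re (LINT k|lborel. cnj (\<eta> t k) * RR (AA s) k)" for t
          using True by (auto simp: Q_def BB_def indicator_def)
        then have "(LINT t|lborel. Q t s) = (LINT t|lborel. indicat_real {s<..<T} t * Re (LINT k|lborel. cnj (\<eta> t k) * RR (AA s) k))" by presburger
        also have "\<dots> = Re (LINT k|lborel. cnj (LINT t|lborel. complex_of_real (indicat_real {s<..<T} t) * \<eta> t k) * RR (AA s) k)"
          by (rule time_Fubini(1)[OF m Rm SI BB_integrable[OF \<eta> X] Rb])
        also have "\<dots> = Re (LINT k|lborel. - (cnj (\<zeta> s k) * RR (AA s) k))"
          using True by (simp add: \<zeta>(2))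
        also have "\<dots> = - BB (\<zeta> s) (AA s)" by (simp add: BB_def)
        finally show ?thesis using True by simp
      qed
    qed
    show "AE s in lborel. (LINT t|lborel. Q t s) = - (indicat_real {0<..<T} s * BB (\<zeta> s) (AA s))" by (rule Ae)
    show "(\<lambda>s. LINT t|lborel. Q t s) \<in> borel_measurable lborel"
      by (rule borel_measurable_integrable) (use lborel_pair.integrable_snd[OF Qi'] in simp)
    have zm: "\<zeta> s k = - (LINT t|lborel. complex_of_real (indicat_real {s<..<T} t) * \<eta> t k)" if "s \<in> {0<..<T}" for s k
      using \<zeta>(2)[of s k] that by simp
    let ?B = "((borel :: real measure) \<Otimes>\<^sub>M (borel :: real measure)) \<Otimes>\<^sub>M (lborel :: real measure)"
    \<comment> \<open>The integral formula for \<open>\<zeta>\<close> is assumed only for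
      \<open>0 \<le> s < T\<close>; \<open>?z\<close> extends it to all \<open>s\<close>, and
      measurability of the integrand on the interval is obtained through this version.\<close>
    let ?z = "\<lambda>s k. - (LINT t|lborel. (if s < t \<and> t < T then \<eta> t k else 0))"
    have p1: "(\<lambda>q. (snd q, snd (fst q))) \<in> ?B \<rightarrow>\<^sub>M borel \<Otimes>\<^sub>M borel" by measurable
    have [measurable]: "(\<lambda>q. \<eta> (snd q) (snd (fst q))) \<in> borel_measurable ?B"
      using measurable_compose[OF p1 m] by simp
    have "(\<lambda>q. if fst (fst q) < snd q \<and> snd q < T then \<eta> (snd q) (snd (fst q)) else 0) \<in> borel_measurable ?B"
      by measurable
    then have zmm: "(\<lambda>p. ?z (fst p) (snd p)) \<in> borel_measurable ((borel :: real measure) \<Otimes>\<^sub>M (borel :: real measure))"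
      by (intro borel_measurable_uminus lborel.borel_measurable_lebesgue_integral) (simp add: case_prod_beta')
    have "(\<lambda>p. cnj (?z (fst p) (snd p)) * RR (AA (fst p)) (snd p)) \<in> borel_measurable ((borel :: real measure) \<Otimes>\<^sub>M (borel :: real measure))"
      by (intro borel_measurable_times borel_measurable_cnj zmm RR_joint_measurable)
    then have "(\<lambda>p. cnj (?z (fst p) (snd p)) * RR (AA (fst p)) (snd p)) \<in> borel_measurable ((borel :: real measure) \<Otimes>\<^sub>M lborel)"
      by (simp cong: measurable_cong_sets sets_pair_measure_cong)
    then have "(\<lambda>s. LINT k|lborel. cnj (?z s k) * RR (AA s) k) \<in> borel_measurable borel"
      by (intro lborel.borel_measurable_lebesgue_integral) (simp add: case_prod_beta')
    then have bm: "(\<lambda>s. - (indicat_real {0<..<T} s * Re (LINT k|lborel. cnj (?z s k) * RR (AA s) k))) \<in> borel_measurable borel"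
      by measurable
    have "- (indicat_real {0<..<T} s * BB (\<zeta> s) (AA s)) = - (indicat_real {0<..<T} s * Re (LINT k|lborel. cnj (?z s k) * RR (AA s) k))" for s
    proof (cases "s \<in> {0<..<T}")
      case True
      have "\<zeta> s k = ?z s k" for k
        unfolding zm[OF True] by (intro arg_cong[where f=uminus] Bochner_Integration.integral_cong refl) (auto simp: indicator_def)
      then show ?thesis unfolding BB_def by presburger
    qed simp
    then show "(\<lambda>s. - (indicat_real {0<..<T} s * BB (\<zeta> s) (AA s))) \<in> borel_measurable lborel"
      using bm by simp
  qed
  also have "\<dots> = - (LINT s|lborel. indicat_real {0<..<T} s * BB (\<zeta> s) (AA s))" by simp
  finally show ?thesis unfolding data by linarith
qed

end

section \<open>Return to physical space\<close>

text \<open>A hermitian function on the line corresponds to its profile on the positive half-line; the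
  factor \<open>\<i>\<close> makes the coefficients of the quadratic terms real.\<close>

definition herm :: "(real \<Rightarrow> complex) \<Rightarrow> real \<Rightarrow> complex" where
  "herm A k = \<i> * A k + cnj (\<i> * A (- k))"

definition half :: "(real \<Rightarrow> complex) \<Rightarrow> real \<Rightarrow> complex" where
  "half G k = (if 0 < k then - \<i> * G k else 0)"

lemma herm_uminus: "herm A (- k) = cnj (herm A k)"
  by (simp add: herm_def)

lemma herm_sqi:
  assumes s: "sqi lborel (\<lambda>k. w k * A k)" and e: "\<And>k. w (- k) = w k" "\<And>k. cnj (w k) = w k"
  shows "sqi lborel (\<lambda>k. w k * herm A k)"
proof -
  have "sqi lborel (\<lambda>k. \<i> * (w k * A k) + cnj (\<i> * (w (- k) * A (- k))))"
    by (intro sqi_add sqi_cnj sqi_cmult s sqi_uminus_arg[OF s])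
  then show ?thesis by (simp add: e herm_def algebra_simps)
qed

lemma half_measurable:
  assumes "G \<in> borel_measurable borel" shows "half G \<in> borel_measurable borel"
  unfolding half_def[abs_def] using assms by measurable

lemma half_Tc:
  assumes G: "G \<in> borel_measurable borel" "sqi lborel (\<lambda>k. complex_of_real (1 + \<bar>k\<bar>) * G k)"
  shows "Tc (half G)" "n2 (half G) \<le> n2 G"
proof -
  have m: "half G \<in> borel_measurable borel" by (rule half_measurable[OF G(1)])
  then have m': "(\<lambda>k. complex_of_real (1 + \<bar>k\<bar>) * half G k) \<in> borel_measurable lborel"
    by (intro borel_measurable_times) auto
  have ae: "AE k in lborel. cmod (complex_of_real (1 + \<bar>k\<bar>) * half G k) \<le> cmod (complex_of_real (1 + \<bar>k\<bar>) * G k)"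
    by (auto simp: half_def norm_mult)
  show "Tc (half G)" unfolding Tc_def using m sqi_bound[OF G(2) m' ae] by (auto simp: half_def)
  show "n2 (half G) \<le> n2 G" unfolding n2_def by (rule L2n_mono[OF G(2) m' ae])
qed

lemma n1_le_n2:
  assumes "Tc \<eta>"
  shows "n1 \<eta> \<le> L2n lborel (\<lambda>k. complex_of_real (1 / (1 + \<bar>k\<bar>))) * n2 \<eta>"
proof -
  have "cmod (complex_of_real (1 / (1 + \<bar>k\<bar>))) * cmod (complex_of_real (1 + \<bar>k\<bar>) * \<eta> k) = cmod (\<eta> k)" for k
    unfolding norm_mult[symmetric] mult.assoc[symmetric] of_real_mult[symmetric] by simp
  then show ?thesis
    using sqi_mult_integrable(2)[OF sqi_inverse_weight, of "\<lambda>k. complex_of_real (1 + \<bar>k\<bar>) * \<eta> k"] assms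
    by (simp add: Tc_def n1_def n2_def)
qed

text \<open>The negative frequencies contribute the conjugate of the positive ones, hence the factor
  2 and the real part.\<close>

lemma herm_pair:
  assumes A: "sqi lborel A" "\<And>k. k \<le> 0 \<Longrightarrow> A k = 0" and G: "sqi lborel G" "AE k in lborel. G (- k) = cnj (G k)"
  shows "Re (LINT k|lborel. herm A k * cnj (G k)) = 2 * Re (LINT k|lborel. cnj (half G k) * A k)"
proof -
  have 1: "integrable lborel (\<lambda>k. \<i> * A k * cnj (G k))"
    by (rule sqi_mult_integrable(1)[OF sqi_cmult[OF A(1)] sqi_cnj[OF G(1)]])
  have 2: "integrable lborel (\<lambda>k. cnj (\<i> * A (- k)) * cnj (G k))"
    by (rule sqi_mult_integrable(1)[OF sqi_cnj[OF sqi_cmult[OF sqi_uminus_arg[OF A(1)]]] sqi_cnj[OF G(1)]])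
  have "(LINT k|lborel. cnj (\<i> * A (- k)) * cnj (G k)) = (LINT k|lborel. cnj (\<i> * A (- (- k))) * cnj (G (- k)))"
    by (rule integral_lborel_uminus[symmetric])
  also have "\<dots> = (LINT k|lborel. cnj (\<i> * A k * cnj (G k)))"
  proof (rule integral_cong_AE)
    show "AE k in lborel. cnj (\<i> * A (- (- k))) * cnj (G (- k)) = cnj (\<i> * A k * cnj (G k))"
      using G(2) by eventually_elim simp
    show "(\<lambda>k. cnj (\<i> * A (- (- k))) * cnj (G (- k))) \<in> borel_measurable lborel"
      by (intro borel_measurable_times borel_measurable_cnj sqi_measurable[OF sqi_uminus_arg[OF G(1)]])
         (use sqi_measurable[OF A(1)] in simp_all)
    show "(\<lambda>k. cnj (\<i> * A k * cnj (G k))) \<in> borel_measurable lborel"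
      by (intro borel_measurable_cnj borel_measurable_integrable[OF 1])
  qed
  also have "\<dots> = cnj (LINT k|lborel. \<i> * A k * cnj (G k))" by (rule Bochner_Integration.integral_cnj)
  finally have 3: "(LINT k|lborel. cnj (\<i> * A (- k)) * cnj (G k)) = cnj (LINT k|lborel. \<i> * A k * cnj (G k))" .
  have "(LINT k|lborel. herm A k * cnj (G k)) = (LINT k|lborel. \<i> * A k * cnj (G k)) + (LINT k|lborel. cnj (\<i> * A (- k)) * cnj (G k))"
    unfolding herm_def distrib_right by (rule Bochner_Integration.integral_add[OF 1 2])
  moreover have "\<i> * A k * cnj (G k) = cnj (half G k) * A k" for k
    using A(2)[of k] by (auto simp: half_def)
  ultimately show ?thesis unfolding 3 by simp
qed

section \<open>Products in L2 and the symbol of the quadratic terms\<close>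

lemma nn_integral_shift_minus:
  fixes f :: "real \<Rightarrow> ennreal"
  assumes "f \<in> borel_measurable borel"
  shows "(\<integral>\<^sup>+k. f (k - l) \<partial>lborel) = (\<integral>\<^sup>+k. f k \<partial>lborel)"
  using nn_integral_real_affine[OF assms, of 1 "- l"] by simp

text \<open>With \<open>W\<close> split into two square roots, Cauchy-Schwarz bounds the square of
  the convolution by the L1 norm of \<open>W\<close> times the convolution of the square of
  \<open>X\<close> with the modulus of \<open>W\<close>; Tonelli evaluates the integral of the
  latter.\<close>

lemma Young_L2_L1:
  fixes X W :: "real \<Rightarrow> complex"
  assumes X: "sqi lborel X" and W: "sqi lborel W" "integrable lborel W"
  shows "sqi lborel (\<lambda>k. complex_of_real (LINT l|lborel. cmod (X l) * cmod (W (k - l))))"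
proof -
  have [measurable]: "X \<in> borel_measurable borel" "W \<in> borel_measurable borel"
    using sqi_measurable[OF X] sqi_measurable[OF W(1)] by auto
  define w where "w = (\<integral>\<^sup>+l. ennreal (cmod (W l)) \<partial>lborel)"
  have wfin: "w = ennreal (n1 W)" unfolding w_def n1_def
    by (rule nn_integral_eq_integral[OF integrable_norm[OF W(2)]]) simp
  have i: "integrable lborel (\<lambda>l. cmod (X l) * cmod (W (k - l)))" for k
    using integrable_norm[OF conv_integrable[OF X W(1), of k]] by (simp add: norm_mult)
  have wk: "(\<integral>\<^sup>+l. ennreal (cmod (W (k - l))) \<partial>lborel) = w" for k
    unfolding w_def using nn_integral_real_affine[of "\<lambda>l. ennreal (cmod (W l))" "-1" k] by simp
  have pt: "ennreal ((LINT l|lborel. cmod (X l) * cmod (W (k - l)))\<^sup>2)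
      \<le> (\<integral>\<^sup>+l. ennreal ((cmod (X l))\<^sup>2) * ennreal (cmod (W (k - l))) \<partial>lborel) * w" for k
  proof -
    have "ennreal (LINT l|lborel. cmod (X l) * cmod (W (k - l)))
        = (\<integral>\<^sup>+l. ennreal (cmod (X l) * cmod (W (k - l))) \<partial>lborel)"
      by (rule nn_integral_eq_integral[OF i, symmetric]) simp
    also have "\<dots> = (\<integral>\<^sup>+l. ennreal (cmod (X l) * sqrt (cmod (W (k - l)))) * ennreal (sqrt (cmod (W (k - l)))) \<partial>lborel)"
      by (intro nn_integral_cong) (simp flip: ennreal_mult add: mult.assoc)
    finally have "(ennreal (LINT l|lborel. cmod (X l) * cmod (W (k - l))))\<^sup>2
        \<le> (\<integral>\<^sup>+l. (ennreal (cmod (X l) * sqrt (cmod (W (k - l)))))\<^sup>2 \<partial>lborel) * (\<integral>\<^sup>+l. (ennreal (sqrt (cmod (W (k - l)))))\<^sup>2 \<partial>lborel)"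
      by (simp only:) (rule Cauchy_Schwarz_nn_integral, measurable)
    also have "(\<integral>\<^sup>+l. (ennreal (sqrt (cmod (W (k - l)))))\<^sup>2 \<partial>lborel) = w"
      unfolding wk[of k, symmetric] by (intro nn_integral_cong) (simp add: ennreal_power)
    also have "(\<integral>\<^sup>+l. (ennreal (cmod (X l) * sqrt (cmod (W (k - l)))))\<^sup>2 \<partial>lborel)
        = (\<integral>\<^sup>+l. ennreal ((cmod (X l))\<^sup>2) * ennreal (cmod (W (k - l))) \<partial>lborel)"
      by (intro nn_integral_cong) (simp add: ennreal_power power_mult_distrib ennreal_mult)
    finally show ?thesis by (simp add: ennreal_power)
  qed
  have "(\<integral>\<^sup>+k. ennreal ((cmod (complex_of_real (LINT l|lborel. cmod (X l) * cmod (W (k - l)))))\<^sup>2) \<partial>lborel)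
      \<le> (\<integral>\<^sup>+k. (\<integral>\<^sup>+l. ennreal ((cmod (X l))\<^sup>2) * ennreal (cmod (W (k - l))) \<partial>lborel) * w \<partial>lborel)"
    by (intro nn_integral_mono) (use pt in simp)
  also have "\<dots> = (\<integral>\<^sup>+k. (\<integral>\<^sup>+l. ennreal ((cmod (X l))\<^sup>2) * ennreal (cmod (W (k - l))) \<partial>lborel) \<partial>lborel) * w"
    by (rule nn_integral_multc) measurable
  also have "(\<integral>\<^sup>+k. (\<integral>\<^sup>+l. ennreal ((cmod (X l))\<^sup>2) * ennreal (cmod (W (k - l))) \<partial>lborel) \<partial>lborel)
      = (\<integral>\<^sup>+l. (\<integral>\<^sup>+k. ennreal ((cmod (X l))\<^sup>2) * ennreal (cmod (W (k - l))) \<partial>lborel) \<partial>lborel)"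
    by (rule lborel_pair.Fubini') measurable
  also have "\<dots> = (\<integral>\<^sup>+l. ennreal ((cmod (X l))\<^sup>2) * w \<partial>lborel)"
  proof (rule nn_integral_cong)
    fix l :: real
    have "(\<integral>\<^sup>+k. ennreal ((cmod (X l))\<^sup>2) * ennreal (cmod (W (k - l))) \<partial>lborel)
       = ennreal ((cmod (X l))\<^sup>2) * (\<integral>\<^sup>+k. ennreal (cmod (W (k - l))) \<partial>lborel)"
      by (rule nn_integral_cmult) measurable
    also have "(\<integral>\<^sup>+k. ennreal (cmod (W (k - l))) \<partial>lborel) = w"
      unfolding w_def by (rule nn_integral_shift_minus[of "\<lambda>k. ennreal (cmod (W k))"]) measurable
    finally show "(\<integral>\<^sup>+k. ennreal ((cmod (X l))\<^sup>2) * ennreal (cmod (W (k - l))) \<partial>lborel) = ennreal ((cmod (X l))\<^sup>2) * w" .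
  qed
  also have "\<dots> = (\<integral>\<^sup>+l. ennreal ((cmod (X l))\<^sup>2) \<partial>lborel) * w"
    by (rule nn_integral_multc) measurable
  also have "\<dots> * w = ennreal ((L2n lborel X * n1 W)\<^sup>2)"
    unfolding nn_integral_sqi[OF X] wfin by (simp add: power_mult_distrib power2_eq_square ennreal_mult mult_ac)
  finally have *: "(\<integral>\<^sup>+k. ennreal ((cmod (complex_of_real (LINT l|lborel. cmod (X l) * cmod (W (k - l)))))\<^sup>2) \<partial>lborel) \<le> ennreal ((L2n lborel X * n1 W)\<^sup>2)" .
  show ?thesis
    by (rule sqi_nn_integral(1)[OF _ *]) (auto intro!: mult_nonneg_nonneg)
qed

text \<open>The larger frequency takes the weight 3/2 and the smaller one 1/2. The factor with
  weight 1/2 is integrable because it has the modulus of the one with weight 3/2 divided by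
  \<open>1 + \<bar>k\<bar>\<close>, so Young's inequality applies. This provides the hypothesis of
  \<open>fhat_prod\<close> for all products of the equation.\<close>

lemma Xc_conv_sqi:
  assumes F3: "sqi lborel (\<lambda>k. s3 k * F k)" and F: "F \<in> borel_measurable lborel"
    and U: "sqi lborel U" "\<And>k. cmod (U k) \<le> (1 + \<bar>k\<bar>) * cmod (F k)"
    and V: "sqi lborel V" "\<And>k. cmod (V k) \<le> (1 + \<bar>k\<bar>) * cmod (F k)"
  shows "sqi lborel (\<lambda>k. complex_of_real (LINT l|lborel. cmod (U l) * cmod (V (k - l))))"
proof -
  define X where "X k = s3 k * F k" for k
  define W where "W k = s1 k * F k" for k
  have X: "sqi lborel X" unfolding X_def[abs_def] by (rule F3)
  have Wm: "W \<in> borel_measurable lborel" unfolding W_def[abs_def] using F by (intro borel_measurable_times) auto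
  have W: "sqi lborel W"
    by (rule sqi_bound[OF X Wm]) (auto simp: X_def W_def norm_mult intro!: mult_right_mono s1_le_s3)
  have Wi: "integrable lborel W"
  proof (rule Bochner_Integration.integrable_bound[OF sqi_mult_integrable(1)[OF sqi_inverse_weight X] Wm])
    have "cmod (W k) = cmod (complex_of_real (1 / (1 + \<bar>k\<bar>)) * X k)" for k
      unfolding W_def X_def norm_mult s1_le_s3_over[of k, symmetric] norm_of_real by simp
    then show "AE k in lborel. norm (W k) \<le> norm (complex_of_real (1 / (1 + \<bar>k\<bar>)) * X k)" by simp
  qed
  have wt: "(1 + \<bar>l\<bar>) * (1 + \<bar>m\<bar>) \<le> cmod (s3 l) * cmod (s1 m)" if "\<bar>m\<bar> \<le> \<bar>l\<bar>" for l m
  proof -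
    have "cmod (s1 m) * cmod (s1 m) \<le> cmod (s1 l) * cmod (s1 m)"
      using that by (intro mult_right_mono) (auto simp: cmod_s1)
    then have "1 + \<bar>m\<bar> \<le> cmod (s1 l) * cmod (s1 m)" by (simp add: cmod_s1)
    then have "(1 + \<bar>l\<bar>) * (1 + \<bar>m\<bar>) \<le> (1 + \<bar>l\<bar>) * (cmod (s1 l) * cmod (s1 m))" by (intro mult_left_mono) auto
    then show ?thesis unfolding s1_le_s3_over[of l, symmetric] by (simp add: mult_ac)
  qed
  have pt: "cmod (U l) * cmod (V m) \<le> cmod (X l) * cmod (W m) + cmod (W l) * cmod (X m)" for l m
  proof -
    have "cmod (U l) * cmod (V m) \<le> ((1 + \<bar>l\<bar>) * cmod (F l)) * ((1 + \<bar>m\<bar>) * cmod (F m))"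
      by (intro mult_mono U V) auto
    also have "\<dots> = ((1 + \<bar>l\<bar>) * (1 + \<bar>m\<bar>)) * (cmod (F l) * cmod (F m))" by simp
    also have "\<dots> \<le> (cmod (s3 l) * cmod (s1 m) + cmod (s1 l) * cmod (s3 m)) * (cmod (F l) * cmod (F m))"
    proof (rule mult_right_mono)
      show "(1 + \<bar>l\<bar>) * (1 + \<bar>m\<bar>) \<le> cmod (s3 l) * cmod (s1 m) + cmod (s1 l) * cmod (s3 m)"
      proof (cases "\<bar>m\<bar> \<le> \<bar>l\<bar>")
        case True
        then show ?thesis using wt[OF True] by (simp add: add_increasing2)
      next
        case False
        then have "\<bar>l\<bar> \<le> \<bar>m\<bar>" by simp
        from wt[OF this] have "(1 + \<bar>l\<bar>) * (1 + \<bar>m\<bar>) \<le> cmod (s1 l) * cmod (s3 m)" by (simp add: mult.commute)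
        then show ?thesis by (simp add: add_increasing)
      qed
    qed simp
    also have "\<dots> = cmod (X l) * cmod (W m) + cmod (W l) * cmod (X m)"
      by (simp add: X_def W_def norm_mult algebra_simps)
    finally show ?thesis .
  qed
  have i: "integrable lborel (\<lambda>l. cmod (P l) * cmod (Q (k - l)))" if "sqi lborel P" "sqi lborel Q" for P Q :: "real \<Rightarrow> complex" and k
    using integrable_norm[OF conv_integrable[OF that, of k]] by (simp add: norm_mult)
  have sym: "(LINT l|lborel. cmod (W l) * cmod (X (k - l))) = (LINT l|lborel. cmod (X l) * cmod (W (k - l)))" for k
    using lborel_integral_real_affine[of "-1" "\<lambda>l. cmod (X l) * cmod (W (k - l))" k] by (simp add: mult.commute)
  have le: "(LINT l|lborel. cmod (U l) * cmod (V (k - l))) \<le> 2 * (LINT l|lborel. cmod (X l) * cmod (W (k - l)))" for k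
  proof -
    have "(LINT l|lborel. cmod (U l) * cmod (V (k - l))) \<le> (LINT l|lborel. cmod (X l) * cmod (W (k - l)) + cmod (W l) * cmod (X (k - l)))"
      by (rule integral_mono[OF i[OF U(1) V(1)] Bochner_Integration.integrable_add[OF i[OF X W] i[OF W X]] pt])
    also have "\<dots> = 2 * (LINT l|lborel. cmod (X l) * cmod (W (k - l)))"
      unfolding Bochner_Integration.integral_add[OF i[OF X W] i[OF W X]] sym by simp
    finally show ?thesis .
  qed
  note [measurable] = sqi_measurable[OF U(1)] sqi_measurable[OF V(1)]
  show ?thesis
  proof (rule sqi_bound[OF sqi_cmult[OF Young_L2_L1[OF X W Wi], of 2]])
    show "(\<lambda>k. complex_of_real (LINT l|lborel. cmod (U l) * cmod (V (k - l)))) \<in> borel_measurable lborel" by measurable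
    show "AE k in lborel. cmod (complex_of_real (LINT l|lborel. cmod (U l) * cmod (V (k - l))))
       \<le> cmod (2 * complex_of_real (LINT l|lborel. cmod (X l) * cmod (W (k - l))))"
      using le by (intro AE_I2) (simp add: norm_mult)
  qed
qed

text \<open>The two halves of the commutator cancel unless the frequency \<open>k - l\<close> of the
  factor with \<open>Lambda\<close> is negative, where they add up; hence the coefficient 2 of
  \<open>correl A (KM A) k\<close>. The squared term gives the convolution for \<open>l\<close>
  between 0 and \<open>k\<close>, and the same correlation once for \<open>l > k\<close> and once
  for \<open>l < 0\<close>.\<close>

lemma NL_symbol:
  assumes A: "Xc A" and k: "0 < k"
  defines "F \<equiv> herm A"
  defines "G1 \<equiv> \<lambda>k. complex_of_real \<bar>k\<bar> * F k"
  shows "complex_of_real c0 * (- \<i> * convol G1 G1 k + \<i> * convol F G1 k + convol F (\<lambda>k. - \<i> * complex_of_real (sgn k) * G1 k) k) = \<i> * NL A k"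
proof -
  have A0: "A k = 0" if "k \<le> 0" for k using A that by (simp add: Xc_def)
  have s: "sqi lborel A" "sqi lborel (KM A)" by (rule Xc_self(1)[OF A], rule Xc_KM(1)[OF A])
  have Fs: "sqi lborel F" using herm_sqi[of "\<lambda>k. 1" A] s(1) by (simp add: F_def)
  have G1s: "sqi lborel G1" unfolding G1_def F_def
  proof (rule herm_sqi)
    have "complex_of_real \<bar>k\<bar> * A k = KM A k" for k using A0[of k] by (cases "0 < k") (auto simp: KM_def)
    then show "sqi lborel (\<lambda>k. complex_of_real \<bar>k\<bar> * A k)" using s(2) by simp
  qed auto
  have Hs: "sqi lborel (\<lambda>k. - \<i> * complex_of_real (sgn k) * G1 k)"
    by (rule sqi_mult_bounded[OF G1s, where K=1]) (auto simp: norm_mult sgn_real_def)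
  have pt: "- \<i> * (G1 l * G1 (k - l)) + \<i> * (F l * G1 (k - l)) + F l * (- \<i> * complex_of_real (sgn (k - l)) * G1 (k - l))
     = \<i> * (KM A l * KM A (k - l)) + (- \<i> * (KM A l * cnj (KM A (- k + l))) + 2 * \<i> * (A l * cnj (KM A (- k + l)))) - \<i> * (KM A (k - l) * cnj (KM A (- l)))" for l
  proof -
    consider "l < 0" | "l = 0" | "0 < l" "l < k" | "l = k" | "k < l" using k by linarith
    then show ?thesis
    proof cases
      case 1
      then show ?thesis using k A0[of l] A0[of "- (k - l)"] A0[of "- k + l"]
        by (simp add: G1_def F_def herm_def KM_def algebra_simps)
    next
      case 2
      then show ?thesis using k A0[of 0] A0[of "- k"] by (simp add: G1_def F_def herm_def KM_def)
    next
      case 3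
      then show ?thesis using k A0[of "- l"] A0[of "- (k - l)"] A0[of "- k + l"]
        by (simp add: G1_def F_def herm_def KM_def algebra_simps)
    next
      case 4
      then show ?thesis using k A0[of "- l"] A0[of 0] by (simp add: G1_def F_def herm_def KM_def)
    next
      case 5
      then show ?thesis using k A0[of "- l"] A0[of "k - l"]
        by (simp add: G1_def F_def herm_def KM_def algebra_simps)
    qed
  qed
  note i1 = conv_integrable[OF G1s G1s, of k] and i2 = conv_integrable[OF Fs G1s, of k] and i3 = conv_integrable[OF Fs Hs, of k]
  note j1 = conv_integrable[OF s(2) s(2), of k]
  have ci: "integrable lborel (\<lambda>l. U l * cnj (V (- k + l)))" if "sqi lborel U" "sqi lborel V" for U V :: "real \<Rightarrow> complex"
    by (rule sqi_mult_integrable(1)[OF that(1) sqi_cnj[OF sqi_shift[OF that(2)]]])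
  have ce: "(LINT l|lborel. U l * cnj (V (- k + l))) = correl U V k" for U V :: "real \<Rightarrow> complex"
    unfolding correl_def using lborel_integral_real_affine[of 1 "\<lambda>l. U l * cnj (V (- k + l))" k] by simp
  have j4: "integrable lborel (\<lambda>l. KM A (k - l) * cnj (KM A (- l)))"
    using integrable_lborel_uminus[OF correl_integrable[OF s(2) s(2), of k]] by simp
  have e4: "(LINT l|lborel. KM A (k - l) * cnj (KM A (- l))) = correl (KM A) (KM A) k"
    unfolding correl_def using integral_lborel_uminus[of "\<lambda>l. KM A (k + l) * cnj (KM A l)"] by simp
  have "- \<i> * convol G1 G1 k + \<i> * convol F G1 k + convol F (\<lambda>k. - \<i> * complex_of_real (sgn k) * G1 k) k
     = (LINT l|lborel. - \<i> * (G1 l * G1 (k - l)) + \<i> * (F l * G1 (k - l)) + F l * (- \<i> * complex_of_real (sgn (k - l)) * G1 (k - l)))"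
    unfolding convol_def
    by (subst Bochner_Integration.integral_add[OF Bochner_Integration.integrable_add[OF integrable_mult_right[OF i1] integrable_mult_right[OF i2]] i3],
        subst Bochner_Integration.integral_add[OF integrable_mult_right[OF i1] integrable_mult_right[OF i2]])
       (simp only: integral_mult_right_zero)
  also have "\<dots> = \<i> * convol (KM A) (KM A) k + (- \<i> * correl (KM A) (KM A) k + 2 * \<i> * correl A (KM A) k) - \<i> * correl (KM A) (KM A) k"
    unfolding pt
    by (subst Bochner_Integration.integral_diff[OF Bochner_Integration.integrable_add[OF integrable_mult_right[OF j1]
          Bochner_Integration.integrable_add[OF integrable_mult_right[OF ci[OF s(2) s(2)]] integrable_mult_right[OF ci[OF s(1) s(2)]]]] integrable_mult_right[OF j4]],
        subst Bochner_Integration.integral_add[OF integrable_mult_right[OF j1]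
          Bochner_Integration.integrable_add[OF integrable_mult_right[OF ci[OF s(2) s(2)]] integrable_mult_right[OF ci[OF s(1) s(2)]]]],
        subst Bochner_Integration.integral_add[OF integrable_mult_right[OF ci[OF s(2) s(2)]] integrable_mult_right[OF ci[OF s(1) s(2)]]])
       (simp only: integral_mult_right_zero ce e4 convol_def)
  finally have E: "- \<i> * convol G1 G1 k + \<i> * convol F G1 k + convol F (\<lambda>k. - \<i> * complex_of_real (sgn k) * G1 k) k
     = \<i> * convol (KM A) (KM A) k + (- \<i> * correl (KM A) (KM A) k + 2 * \<i> * correl A (KM A) k) - \<i> * correl (KM A) (KM A) k" .
  show ?thesis unfolding E by (simp add: NL_def algebra_simps)
qed

section \<open>Pairing of the equation with test functions\<close>

lemma herm_half:
  assumes "AE k in lborel. G (- k) = cnj (G k)"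
  shows "AE k in lborel. herm (half G) k = G k"
  using assms AE_lborel_uminus[OF assms] AE_lborel_singleton[of "0::real"]
proof eventually_elim
  case (elim k)
  then show ?case by (cases "0 < k") (auto simp: herm_def half_def)
qed

lemma half_0: "k \<le> 0 \<Longrightarrow> half G k = 0"
  by (simp add: half_def)

lemma half_sqi: "sqi lborel G \<Longrightarrow> sqi lborel (half G)"
proof (rule sqi_bound)
  assume G: "sqi lborel G"
  show "half G \<in> borel_measurable lborel" using half_measurable[of G] sqi_measurable[OF G] by simp
  show "AE k in lborel. cmod (half G k) \<le> cmod (G k)" by (auto simp: half_def norm_mult)
qed

lemma hermitian_pair:
  assumes H: "sqi lborel H" "AE k in lborel. H (- k) = cnj (H k)"
    and G: "sqi lborel G" "AE k in lborel. G (- k) = cnj (G k)"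
  shows "Re (LINT k|lborel. H k * cnj (G k)) = 2 * Re (LINT k|lborel. cnj (half G k) * half H k)"
proof -
  have s: "sqi lborel (\<lambda>k. 1 * herm (half H) k)" by (rule herm_sqi) (use half_sqi[OF H(1)] in auto)
  have "(LINT k|lborel. H k * cnj (G k)) = (LINT k|lborel. herm (half H) k * cnj (G k))"
  proof (rule integral_cong_AE)
    show "AE k in lborel. H k * cnj (G k) = herm (half H) k * cnj (G k)"
      using herm_half[OF H(2)] by eventually_elim simp
    show "(\<lambda>k. H k * cnj (G k)) \<in> borel_measurable lborel"
      by (intro borel_measurable_times borel_measurable_cnj sqi_measurable[OF H(1)] sqi_measurable[OF G(1)])
    show "(\<lambda>k. herm (half H) k * cnj (G k)) \<in> borel_measurable lborel"
      using sqi_measurable[OF s] by (intro borel_measurable_times borel_measurable_cnj sqi_measurable[OF G(1)]) simp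
  qed
  then show ?thesis using herm_pair[OF half_sqi[OF H(1)] half_0 G] by simp
qed

lemma fhat_pair_half:
  assumes f: "fhat f H" and g: "fhat \<psi> G"
  shows "(LINT x|lebesgue. f x * \<psi> x) = 2 * Re (LINT k|lborel. cnj (half G k) * half H k)"
  unfolding fhat_Parseval(2)[OF f g]
  by (rule hermitian_pair[OF fhat_sqi[OF f] fhat_hermitian[OF f] fhat_sqi[OF g] fhat_hermitian[OF g]])

lemma half_herm_eq: "(\<And>k. k \<le> 0 \<Longrightarrow> A k = 0) \<Longrightarrow> half (herm A) = A"
  by (rule ext) (auto simp: half_def herm_def not_less)

lemma Xc_0: "Xc A \<Longrightarrow> k \<le> 0 \<Longrightarrow> A k = 0"
  by (simp add: Xc_def)

lemma Xc_herm:
  assumes A: "Xc A"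
  shows "sqi lborel (\<lambda>k. s3 k * herm A k)" "sqi lborel (herm A)" "sqi lborel (\<lambda>k. complex_of_real \<bar>k\<bar> * herm A k)"
proof -
  show s: "sqi lborel (\<lambda>k. s3 k * herm A k)"
    by (rule herm_sqi) (use A in \<open>auto simp: Xc_def s3_def\<close>)
  have "sqi lborel (\<lambda>k. 1 * herm A k)" by (rule herm_sqi) (use Xc_self(1)[OF A] in auto)
  then show h: "sqi lborel (herm A)" by simp
  have "(\<lambda>k. complex_of_real \<bar>k\<bar> * herm A k) \<in> borel_measurable lborel"
    by (rule borel_measurable_times[OF _ sqi_measurable[OF h]]) simp
  then show "sqi lborel (\<lambda>k. complex_of_real \<bar>k\<bar> * herm A k)"
  proof (rule sqi_bound[OF s])
    have "\<bar>k\<bar> \<le> cmod (s3 k)" for k using le_s3[of k] by linarith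
    then show "AE k in lborel. cmod (complex_of_real \<bar>k\<bar> * herm A k) \<le> cmod (s3 k * herm A k)"
      by (auto simp: norm_mult intro!: mult_right_mono)
  qed
qed

lemma quadratic_pair:
  assumes A: "Xc A" and f: "fhat f (herm A)" and \<psi>: "fhat \<psi> G"
  shows "(LINT x|lebesgue. (Hilbert (\<lambda>y. (Lambda f y)\<^sup>2) x - commutator Hilbert f (Lambda f) x) * \<psi> x)
    = 2 * Re (LINT k|lborel. cnj (half G k) * NL A k)"
proof -
  define F where "F = herm A"
  define G1 where "G1 k = complex_of_real \<bar>k\<bar> * F k" for k
  define G2 where "G2 k = - \<i> * complex_of_real (sgn k) * G1 k" for k
  note H = Xc_herm[OF A, folded F_def]
  have f': "fhat f F" using f by (simp add: F_def)
  have L: "fhat (Lambda f) G1" unfolding G1_def[abs_def] by (rule fhat_Lambda[OF f' H(3)])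
  have HL: "fhat (Hilbert (Lambda f)) G2" unfolding G2_def[abs_def] by (rule fhat_Hilbert[OF L])
  note Fm = sqi_measurable[OF H(2)]
  have bF: "cmod (F k) \<le> (1 + \<bar>k\<bar>) * cmod (F k)" for k by (simp add: distrib_right)
  have bG1: "cmod (G1 k) \<le> (1 + \<bar>k\<bar>) * cmod (F k)" for k by (simp add: G1_def norm_mult distrib_right)
  have "cmod (G2 k) \<le> cmod (G1 k)" for k by (simp add: G2_def norm_mult sgn_real_def)
  then have bG2: "cmod (G2 k) \<le> (1 + \<bar>k\<bar>) * cmod (F k)" for k using bG1[of k] by (rule order_trans)
  note s1 = fhat_sqi[OF L] and s2 = fhat_sqi[OF HL]
  have sq: "fhat (\<lambda>y. Lambda f y * Lambda f y) (\<lambda>k. complex_of_real c0 * convol G1 G1 k)"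
    unfolding convol_def c0_def by (rule fhat_prod[OF L L Xc_conv_sqi[OF H(1) Fm s1 bG1 s1 bG1]])
  have fL: "fhat (\<lambda>y. f y * Lambda f y) (\<lambda>k. complex_of_real c0 * convol F G1 k)"
    unfolding convol_def c0_def by (rule fhat_prod[OF f' L Xc_conv_sqi[OF H(1) Fm H(2) bF s1 bG1]])
  have fHL: "fhat (\<lambda>y. f y * Hilbert (Lambda f) y) (\<lambda>k. complex_of_real c0 * convol F G2 k)"
    unfolding convol_def c0_def by (rule fhat_prod[OF f' HL Xc_conv_sqi[OF H(1) Fm H(2) bF s2 bG2]])
  note h1 = fhat_lincomb[OF fhat_Hilbert[OF sq] fhat_Hilbert[OF fL], of 1 "-1"]
  note h2 = fhat_lincomb[OF h1 fHL, of 1 1]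
  let ?X = "\<lambda>k. complex_of_real 1 * (complex_of_real 1 * (- \<i> * complex_of_real (sgn k) * (complex_of_real c0 * convol G1 G1 k))
      + complex_of_real (- 1) * (- \<i> * complex_of_real (sgn k) * (complex_of_real c0 * convol F G1 k))) + complex_of_real 1 * (complex_of_real c0 * convol F G2 k)"
  have X: "fhat (\<lambda>x. Hilbert (\<lambda>y. (Lambda f y)\<^sup>2) x - commutator Hilbert f (Lambda f) x) ?X"
  proof -
    have "(\<lambda>x. Hilbert (\<lambda>y. (Lambda f y)\<^sup>2) x - commutator Hilbert f (Lambda f) x)
      = (\<lambda>x. 1 * (1 * Hilbert (\<lambda>y. Lambda f y * Lambda f y) x + (- 1) * Hilbert (\<lambda>y. f y * Lambda f y) x) + 1 * (f x * Hilbert (Lambda f) x))"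
      by (rule ext) (simp add: commutator_def power2_eq_square)
    then show ?thesis using h2 by argo
  qed
  have "?X k = \<i> * NL A k" if "0 < k" for k
    using NL_symbol[OF A that, folded F_def] that unfolding G1_def[abs_def] G2_def[abs_def] by (simp add: algebra_simps)
  then have "cnj (half G k) * half ?X k = cnj (half G k) * NL A k" for k
    by (cases "0 < k") (simp_all only: half_def if_True if_False, simp_all)
  then show ?thesis unfolding fhat_pair_half[OF X \<psi>] by presburger
qed

text \<open>On positive frequencies the symbols of the derivative and the Hilbert transform of the
  test function add up to \<open>\<i>\<close> times \<open>k - 1\<close>, and the conjugation in the
  pairing changes the sign.\<close>

lemma linear_pair:
  assumes A: "Xc A" and f: "fhat f (herm A)" and \<psi>: "fhat \<psi> G" and \<psi>': "fhat \<psi>' (\<lambda>k. \<i> * complex_of_real k * G k)"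
  shows "(LINT x|lebesgue. f x * \<psi>' x + Hilbert \<psi> x * f x)
    = 2 * Re (LINT k|lborel. cnj (half G k) * (- \<i> * complex_of_real (k - 1) * A k))"
proof -
  note h = fhat_lincomb[OF \<psi>' fhat_Hilbert[OF \<psi>], of 1 1]
  let ?G = "\<lambda>k. complex_of_real 1 * (\<i> * complex_of_real k * G k) + complex_of_real 1 * (- \<i> * complex_of_real (sgn k) * G k)"
  have "(LINT x|lebesgue. f x * \<psi>' x + Hilbert \<psi> x * f x) = (LINT x|lebesgue. f x * (1 * \<psi>' x + 1 * Hilbert \<psi> x))"
    by (simp add: algebra_simps)
  also have "\<dots> = 2 * Re (LINT k|lborel. cnj (half ?G k) * half (herm A) k)"
    by (rule fhat_pair_half[OF f h])
  also have "half (herm A) = A" by (rule half_herm_eq[OF Xc_0[OF A]])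
  also have "(\<lambda>k. cnj (half ?G k) * A k) = (\<lambda>k. cnj (half G k) * (- \<i> * complex_of_real (k - 1) * A k))"
    by (rule ext) (auto simp: half_def algebra_simps)
  finally show ?thesis .
qed

context evol
begin

lemma evolution_pair:
  assumes A: "Xc A" and f: "fhat f (herm A)" and \<psi>: "fhat \<psi> G" and s: "sqi lborel (\<lambda>k. complex_of_real \<bar>k\<bar> * G k)"
  shows "(LINT x|lebesgue. (2 * \<psi> x + \<alpha> * Lambda \<psi> x) * f x) = 2 * PP (half G) A"
proof -
  note h = fhat_lincomb[OF \<psi> fhat_Lambda[OF \<psi> s], of 2 \<alpha>]
  let ?G = "\<lambda>k. complex_of_real 2 * G k + complex_of_real \<alpha> * (complex_of_real \<bar>k\<bar> * G k)"
  have "(LINT x|lebesgue. (2 * \<psi> x + \<alpha> * Lambda \<psi> x) * f x) = (LINT x|lebesgue. f x * (2 * \<psi> x + \<alpha> * Lambda \<psi> x))"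
    by (simp add: mult.commute)
  also have "\<dots> = 2 * Re (LINT k|lborel. cnj (half ?G k) * half (herm A) k)"
    by (rule fhat_pair_half[OF f h])
  also have "half (herm A) = A" by (rule half_herm_eq[OF Xc_0[OF A]])
  also have "(\<lambda>k. cnj (half ?G k) * A k) = (\<lambda>k. complex_of_real (wt k) * (cnj (half G k) * A k))"
    by (rule ext) (auto simp: half_def wt_def algebra_simps)
  finally show ?thesis by (simp add: PP_def)
qed

text \<open>The weak formulation integrates linear and quadratic terms separately, so
  \<open>BB\<close> has to be split; \<open>NB\<close> is the quadratic share and \<open>LB\<close>
  the linear one, including its factor in front of the integral.\<close>

definition NB :: "(real \<Rightarrow> complex) \<Rightarrow> (real \<Rightarrow> complex) \<Rightarrow> real" where
  "NB \<eta> A = Re (LINT k|lborel. cnj (\<eta> k) * NL A k)"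

definition LB :: "(real \<Rightarrow> complex) \<Rightarrow> (real \<Rightarrow> complex) \<Rightarrow> real" where
  "LB \<eta> A = - (1 / \<epsilon>) * Re (LINT k|lborel. cnj (\<eta> k) * (- \<i> * complex_of_real (k - 1) * A k))"

lemma NB_integrable:
  assumes \<eta>: "Tc \<eta>" and A: "Xc A"
  shows "integrable lborel (\<lambda>k. cnj (\<eta> k) * NL A k)" "\<bar>NB \<eta> A\<bar> \<le> 5 * (nX A)\<^sup>2 * n1 \<eta>"
proof -
  have b: "cmod (NL A k) \<le> (1 + \<bar>k\<bar>) / \<epsilon> * cmod (0::complex) + 5 * (nX A)\<^sup>2" for k using NL_bound[OF A, of k] by simp
  note p = pair_bound[OF \<eta> NL_measurable[OF Xc_measurable[OF A]] sqi_zero b]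
  show "integrable lborel (\<lambda>k. cnj (\<eta> k) * NL A k)" by (rule p(1))
  have "L2n lborel (\<lambda>x::real. 0) = 0" by (simp add: L2n_def)
  then show "\<bar>NB \<eta> A\<bar> \<le> 5 * (nX A)\<^sup>2 * n1 \<eta>"
    unfolding NB_def using order_trans[OF abs_Re_le_cmod p(2)] by simp
qed

lemma BB_split:
  assumes \<eta>: "Tc \<eta>" and A: "Xc A"
  shows "BB \<eta> A = LB \<eta> A + NB \<eta> A"
proof -
  have e0: "\<eta> k = 0" if "k \<le> 0" for k using \<eta> that by (simp add: Tc_def)
  have pt: "cnj (\<eta> k) * RR A k = complex_of_real (- (1 / \<epsilon>)) * (cnj (\<eta> k) * (- \<i> * complex_of_real (k - 1) * A k)) + cnj (\<eta> k) * NL A k" for k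
    using e0[of k] by (cases "0 < k") (auto simp: RR_def algebra_simps diff_divide_distrib)
  have i: "integrable lborel (\<lambda>k. complex_of_real (- (1 / \<epsilon>)) * (cnj (\<eta> k) * (- \<i> * complex_of_real (k - 1) * A k)))"
    using Bochner_Integration.integrable_diff[OF BB_integrable[OF \<eta> A] NB_integrable(1)[OF \<eta> A]] unfolding pt by simp
  have "(LINT k|lborel. cnj (\<eta> k) * RR A k) = complex_of_real (- (1 / \<epsilon>)) * (LINT k|lborel. cnj (\<eta> k) * (- \<i> * complex_of_real (k - 1) * A k)) + (LINT k|lborel. cnj (\<eta> k) * NL A k)"
    unfolding pt Bochner_Integration.integral_add[OF i NB_integrable(1)[OF \<eta> A]] integral_mult_right_zero ..
  then show ?thesis unfolding BB_def LB_def NB_def by simp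
qed

end

section \<open>Test functions\<close>

lemma test_continuous:
  assumes "test_function T \<phi>"
  shows "continuous_on UNIV (\<lambda>p. \<phi> (fst p) (snd p))"
proof -
  have "Ck 0 \<phi>" using assms unfolding test_function_def by blast
  then show ?thesis unfolding Ck.simps case_prod_beta' .
qed

lemma test_partial_x:
  assumes "test_function T \<phi>"
  shows "((\<lambda>y. \<phi> y t) has_real_derivative partial_x \<phi> x t) (at x)"
proof -
  have "Ck (Suc 0) \<phi>" using assms unfolding test_function_def by blast
  then have "(\<lambda>y. \<phi> y t) field_differentiable at x" unfolding Ck.simps by blast
  then show ?thesis unfolding partial_x_def by (rule field_differentiable_derivI)
qed

lemma test_partial_t:
  assumes "test_function T \<phi>"
  shows "((\<lambda>r. \<phi> x r) has_real_derivative partial_t \<phi> x t) (at t)"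
proof -
  have "Ck (Suc 0) \<phi>" using assms unfolding test_function_def by blast
  then have "(\<lambda>r. \<phi> x r) field_differentiable at t" unfolding Ck.simps by blast
  then show ?thesis unfolding partial_t_def by (rule field_differentiable_derivI)
qed

lemma derivative_outside_support:
  assumes "(x, t) \<notin> closure {(x, t). \<phi> x t \<noteq> 0}"
  shows "partial_x \<phi> x t = 0" "partial_t \<phi> x t = 0"
proof -
  let ?S = "closure {(x, t). \<phi> x t \<noteq> (0::real)}"
  have o: "open (- ?S)" by (rule open_Compl[OF closed_closure])
  have m: "(x, t) \<in> - ?S" by (rule ComplI) (rule notE[OF assms])
  obtain A B where AB: "open A" "open B" "(x, t) \<in> A \<times> B" "A \<times> B \<subseteq> - ?S"
    by (rule open_prod_elim[OF o m]) (rule that)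
  have xt: "x \<in> A" "t \<in> B" using AB(3) by blast+
  have z: "\<phi> y r = 0" if "y \<in> A" "r \<in> B" for y r
  proof -
    have "(y, r) \<in> - ?S" by (rule subsetD[OF AB(4)]) (rule SigmaI[OF that])
    then have "(y, r) \<notin> ?S" by (rule ComplD)
    then have "(y, r) \<notin> {(x, t). \<phi> x t \<noteq> 0}" using subsetD[OF closure_subset[of "{(x, t). \<phi> x t \<noteq> 0}"], of "(y, r)"] by argo
    then show ?thesis by simp
  qed
  have "((\<lambda>y. \<phi> y t) has_real_derivative 0) (at x)"
  proof (rule has_field_derivative_transform_within_open[of "\<lambda>y. 0" 0 x A])
    show "0 = \<phi> y t" if "y \<in> A" for y using z[OF that xt(2)] by (rule sym)
  qed (simp_all add: AB(1) xt)
  then show "partial_x \<phi> x t = 0" unfolding partial_x_def by (rule DERIV_imp_deriv)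
  have "((\<lambda>r. \<phi> x r) has_real_derivative 0) (at t)"
  proof (rule has_field_derivative_transform_within_open[of "\<lambda>y. 0" 0 t B])
    show "0 = \<phi> x r" if "r \<in> B" for r using z[OF xt(1) that] by (rule sym)
  qed (simp_all add: AB(2) xt)
  then show "partial_t \<phi> x t = 0" unfolding partial_t_def by (rule DERIV_imp_deriv)
qed

lemma test_function_partials:
  assumes \<phi>: "test_function T \<phi>"
  shows "test_function T (partial_x \<phi>)" "test_function T (partial_t \<phi>)"
proof -
  let ?S = "closure {(x, t). \<phi> x t \<noteq> 0}"
  have c: "Ck n (partial_x \<phi>)" "Ck n (partial_t \<phi>)" for n
  proof -
    have "Ck (Suc n) \<phi>" using \<phi> unfolding test_function_def by blast
    then show "Ck n (partial_x \<phi>)" "Ck n (partial_t \<phi>)" unfolding Ck.simps by blast+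
  qed
  have sub: "closure {(x, t). partial_x \<phi> x t \<noteq> 0} \<subseteq> ?S" "closure {(x, t). partial_t \<phi> x t \<noteq> 0} \<subseteq> ?S"
  proof -
    have "(x, t) \<in> ?S" if "partial_x \<phi> x t \<noteq> 0" for x t using derivative_outside_support(1)[of x t \<phi>] that by argo
    then show "closure {(x, t). partial_x \<phi> x t \<noteq> 0} \<subseteq> ?S" by (intro closure_minimal closed_closure) blast
    have "(x, t) \<in> ?S" if "partial_t \<phi> x t \<noteq> 0" for x t using derivative_outside_support(2)[of x t \<phi>] that by argo
    then show "closure {(x, t). partial_t \<phi> x t \<noteq> 0} \<subseteq> ?S" by (intro closure_minimal closed_closure) blast
  qed
  have k: "compact ?S" "?S \<subseteq> UNIV \<times> {..<T}" using \<phi> unfolding test_function_def by blast+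
  have k': "compact (closure Y)" if "closure Y \<subseteq> ?S" for Y :: "(real \<times> real) set"
    using compact_Int_closed[OF k(1) closed_closure[of Y]] that by (simp add: inf_absorb2)
  show "test_function T (partial_x \<phi>)" "test_function T (partial_t \<phi>)"
    unfolding test_function_def using c k'[OF sub(1)] k'[OF sub(2)] order_trans[OF sub(1) k(2)] order_trans[OF sub(2) k(2)] by blast+
qed

lemma test_support:
  assumes \<phi>: "test_function T \<phi>"
  shows "\<exists>R B. 0 < R \<and> 0 \<le> B \<and> (\<forall>x t. \<bar>x\<bar> > R \<longrightarrow> \<phi> x t = 0) \<and> (\<forall>x t. \<bar>\<phi> x t\<bar> \<le> B)"
proof -
  let ?S = "closure {(x, t). \<phi> x t \<noteq> 0}"
  have k: "compact ?S" using \<phi> unfolding test_function_def by blast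
  from compact_imp_bounded[OF k] obtain R where R: "0 < R" "\<forall>p\<in>?S. norm p \<le> R"
    unfolding bounded_pos by (elim exE conjE)
  have out: "\<phi> x t = 0" if "(x, t) \<notin> ?S" for x t
    using that subsetD[OF closure_subset[of "{(x, t). \<phi> x t \<noteq> 0}"], of "(x, t)"] by fast
  have "compact ((\<lambda>p. \<phi> (fst p) (snd p)) ` ?S)"
    by (intro compact_continuous_image k continuous_on_subset[OF test_continuous[OF \<phi>]]) auto
  from compact_imp_bounded[OF this] obtain B where B: "0 < B" "\<forall>y\<in>(\<lambda>p. \<phi> (fst p) (snd p)) ` ?S. norm y \<le> B"
    unfolding bounded_pos by (elim exE conjE)
  have 1: "\<phi> x t = 0" if "\<bar>x\<bar> > R" for x t
  proof (rule out, rule notI)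
    assume "(x, t) \<in> ?S"
    with R(2) have "norm (x, t) \<le> R" by (rule bspec)
    then show False using norm_fst_le[of x t] that by simp
  qed
  have 2: "\<bar>\<phi> x t\<bar> \<le> B" for x t
  proof (cases "(x, t) \<in> ?S")
    case True
    from bspec[OF B(2) imageI[OF this]] show ?thesis by simp
  next
    case False then show ?thesis using out[OF False] B(1) by simp
  qed
  show ?thesis by (intro exI[of _ R] exI[of _ B] conjI allI impI 1 2 R(1) less_imp_le[OF B(1)])
qed

lemma test_vanish:
  assumes "test_function T \<phi>" "T \<le> t"
  shows "\<phi> x t = 0"
proof (rule ccontr)
  assume "\<phi> x t \<noteq> 0"
  then have "(x, t) \<in> {(x, t). \<phi> x t \<noteq> 0}" by simp
  then have "(x, t) \<in> UNIV \<times> {..<T}"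
    using assms(1) closure_subset[of "{(x, t). \<phi> x t \<noteq> 0}"] unfolding test_function_def by blast
  then show False using assms(2) by simp
qed

lemma test_joint_measurable:
  assumes "test_function T \<phi>"
  shows "(\<lambda>p. \<phi> (fst p) (snd p)) \<in> borel_measurable (borel \<Otimes>\<^sub>M borel)"
  using borel_measurable_continuous_onI[OF test_continuous[OF assms]] by (simp add: borel_prod)

lemma test_section_continuous:
  assumes \<phi>: "test_function T \<phi>"
  shows "continuous_on UNIV (\<lambda>x. \<phi> x t)" "continuous_on UNIV (\<lambda>t. \<phi> x t)"
proof -
  have c: "continuous_on UNIV (\<lambda>x::real. (x, t))" "continuous_on UNIV (\<lambda>t::real. (x, t))"
    by (simp_all add: continuous_on_Pair)
  have U: "continuous_on A (\<lambda>p. \<phi> (fst p) (snd p))" for A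
    by (rule continuous_on_subset[OF test_continuous[OF \<phi>] subset_UNIV])
  show "continuous_on UNIV (\<lambda>x. \<phi> x t)" using continuous_on_compose[OF c(1) U] by (simp add: o_def)
  show "continuous_on UNIV (\<lambda>t. \<phi> x t)" using continuous_on_compose[OF c(2) U] by (simp add: o_def)
qed

lemma test_section:
  assumes \<phi>: "test_function T \<phi>"
  shows "(\<lambda>x. complex_of_real (\<phi> x t)) \<in> borel_measurable lborel" "sqi lborel (\<lambda>x. complex_of_real (\<phi> x t))"
    "integrable lborel (\<lambda>x. complex_of_real (\<phi> x t))" "(\<lambda>x. \<phi> x t) \<in> borel_measurable lborel"
proof -
  obtain R B where RB: "0 < R" "0 \<le> B" "\<forall>x t. \<bar>x\<bar> > R \<longrightarrow> \<phi> x t = 0" "\<forall>x t. \<bar>\<phi> x t\<bar> \<le> B"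
    using test_support[OF \<phi>] by blast
  note RB = RB[rule_format]
  have "continuous_on UNIV (\<lambda>x. \<phi> x t)" by (rule test_section_continuous(1)[OF \<phi>])
  from borel_measurable_continuous_onI[OF this]
  show m: "(\<lambda>x. \<phi> x t) \<in> borel_measurable lborel" by simp
  then show cm: "(\<lambda>x. complex_of_real (\<phi> x t)) \<in> borel_measurable lborel"
    by (intro measurable_compose[OF m]) simp
  show "sqi lborel (\<lambda>x. complex_of_real (\<phi> x t))"
  proof (rule sqi_compact_bounded[OF cm])
    show "cmod (complex_of_real (\<phi> x t)) \<le> B" for x using RB(4)[of x t] by simp
    show "complex_of_real (\<phi> x t) = 0" if "\<bar>x\<bar> > R" for x using RB(3)[OF that, of t] by simp
  qed
  show "integrable lborel (\<lambda>x. complex_of_real (\<phi> x t))"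
  proof (rule integrable_compact_bounded[OF cm])
    show "cmod (complex_of_real (\<phi> x t)) \<le> B" for x using RB(4)[of x t] by simp
    show "complex_of_real (\<phi> x t) = 0" if "\<bar>x\<bar> > R" for x using RB(3)[OF that, of t] by simp
  qed
qed

text \<open>The absolutely convergent integral is used instead of \<open>FT\<close> or
  \<open>fourier\<close> because its values are determined for every \<open>t\<close> and
  \<open>k\<close>, as joint measurability and the identity \<open>tft_time\<close> require.\<close>

definition tft :: "(real \<Rightarrow> real \<Rightarrow> real) \<Rightarrow> real \<Rightarrow> real \<Rightarrow> complex" where
  "tft \<phi> t = ft (\<lambda>x. complex_of_real (\<phi> x t))"

lemma tft_fhat:
  assumes \<phi>: "test_function T \<phi>"
  shows "fhat (\<lambda>x. \<phi> x t) (tft \<phi> t)"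
proof -
  note s = test_section[OF \<phi>, of t]
  have t: "sqi lborel (tft \<phi> t)"
  proof (rule sqi_bound[OF FT_sqi[OF s(2)]])
    show "tft \<phi> t \<in> borel_measurable lborel" unfolding tft_def by (rule borel_measurable_ft[OF s(1)])
    show "AE k in lborel. cmod (tft \<phi> t k) \<le> cmod (FT (\<lambda>x. complex_of_real (\<phi> x t)) k)"
      using FT_ft[OF s(2,3)] unfolding tft_def by eventually_elim simp
  qed
  show ?thesis
    by (rule fhat_cong_AE[OF fhat_FT[OF s(4,2)] t]) (use FT_ft[OF s(2,3)] in \<open>simp add: tft_def\<close>)
qed

lemma tft_L2n:
  assumes \<phi>: "test_function T \<phi>"
  obtains D where "\<And>t. L2n lborel (tft \<phi> t) \<le> D"
proof -
  obtain R B where RB: "0 < R" "0 \<le> B" "\<forall>x t. \<bar>x\<bar> > R \<longrightarrow> \<phi> x t = 0" "\<forall>x t. \<bar>\<phi> x t\<bar> \<le> B"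
    using test_support[OF \<phi>] by blast
  note RB = RB[rule_format]
  have i: "sqi lborel (\<lambda>x. complex_of_real (B * indicat_real {-R..R} x))"
    by (rule sqi_compact_bounded[where K=B and R=R]) (use RB in \<open>auto simp: indicator_def\<close>)
  have "L2n lborel (tft \<phi> t) \<le> L2n lborel (\<lambda>x. complex_of_real (B * indicat_real {-R..R} x))" for t
  proof -
    note s = test_section[OF \<phi>, of t]
    have "L2n lborel (tft \<phi> t) = L2n lborel (FT (\<lambda>x. complex_of_real (\<phi> x t)))"
    proof (rule L2n_cong_AE)
      show "tft \<phi> t \<in> borel_measurable lborel" unfolding tft_def by (rule borel_measurable_ft[OF s(1)])
      show "FT (\<lambda>x. complex_of_real (\<phi> x t)) \<in> borel_measurable lborel" by (rule sqi_measurable[OF FT_sqi[OF s(2)]])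
      show "AE k in lborel. cmod (tft \<phi> t k) = cmod (FT (\<lambda>x. complex_of_real (\<phi> x t)) k)"
        using FT_ft[OF s(2,3)] unfolding tft_def by eventually_elim simp
    qed
    also have "\<dots> = L2n lborel (\<lambda>x. complex_of_real (\<phi> x t))" by (rule FT_norm[OF s(2)])
    also have "\<dots> \<le> L2n lborel (\<lambda>x. complex_of_real (B * indicat_real {-R..R} x))"
    proof (rule L2n_mono[OF i s(1)])
      show "AE x in lborel. cmod (complex_of_real (\<phi> x t)) \<le> cmod (complex_of_real (B * indicat_real {-R..R} x))"
      proof (rule AE_I2)
        fix x
        show "cmod (complex_of_real (\<phi> x t)) \<le> cmod (complex_of_real (B * indicat_real {-R..R} x))"
        proof (cases "\<bar>x\<bar> > R")
          case False
          then have "x \<in> {-R..R}" by auto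
          then show ?thesis using RB(2) RB(4)[of x t] by simp
        qed (use RB(3)[of x t] in simp)
      qed
    qed
    finally show ?thesis .
  qed
  then show thesis by (rule that)
qed

text \<open>The fundamental theorem of calculus for \<open>\<phi>\<close> times the exponential, on
  an interval whose end points lie outside the support.\<close>

lemma tft_partial_x:
  assumes \<phi>: "test_function T \<phi>"
  shows "tft (partial_x \<phi>) t k = \<i> * complex_of_real k * tft \<phi> t k"
proof -
  obtain R B where RB: "0 < R" "0 \<le> B" "\<forall>x t. \<bar>x\<bar> > R \<longrightarrow> \<phi> x t = 0" "\<forall>x t. \<bar>\<phi> x t\<bar> \<le> B"
    using test_support[OF \<phi>] by blast
  note RB = RB[rule_format]
  obtain R' B' where RB': "0 < R'" "0 \<le> B'" "\<forall>x t. \<bar>x\<bar> > R' \<longrightarrow> partial_x \<phi> x t = 0" "\<forall>x t. \<bar>partial_x \<phi> x t\<bar> \<le> B'"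
    using test_support[OF test_function_partials(1)[OF \<phi>]] by blast
  note RB' = RB'[rule_format]
  define Q where "Q = max R R' + 1"
  let ?e = "\<lambda>x. exp (- (\<i> * complex_of_real (k * x)))"
  let ?F = "\<lambda>x. complex_of_real (\<phi> x t) * ?e x"
  let ?f = "\<lambda>x. complex_of_real (partial_x \<phi> x t) * ?e x - \<i> * complex_of_real k * (complex_of_real (\<phi> x t) * ?e x)"
  note cont = test_section_continuous(1)
  have hb: "has_bochner_integral lborel (\<lambda>x. indicator {-Q..Q} x *\<^sub>R ?f x) (?F Q - ?F (-Q))"
  proof (rule has_bochner_integral_FTC_Icc)
    show "-Q \<le> Q" using RB by (simp add: Q_def)
    show "(?F has_vector_derivative ?f x) (at x within {-Q..Q})" for x
    proof -
      have 1: "((\<lambda>x. complex_of_real (\<phi> x t)) has_vector_derivative complex_of_real (partial_x \<phi> x t)) (at x within {-Q..Q})"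
        by (rule has_vector_derivative_of_real[OF has_field_derivative_at_within[OF test_partial_x[OF \<phi>]]])
      have "((\<lambda>z. exp (- (\<i> * complex_of_real k) * z)) has_field_derivative exp (- (\<i> * complex_of_real k) * complex_of_real x) * (- (\<i> * complex_of_real k))) (at (complex_of_real x))"
        by (rule DERIV_chain2[OF DERIV_exp DERIV_cmult_Id])
      from has_vector_derivative_real_field[OF this, of "{-Q..Q}"]
      have 2: "(?e has_vector_derivative ?e x * (- (\<i> * complex_of_real k))) (at x within {-Q..Q})"
        by (simp only: of_real_mult minus_mult_left mult.assoc)
      show ?thesis using has_vector_derivative_mult[OF 1 2] by (simp add: algebra_simps)
    qed
    have e: "continuous_on {-Q..Q} ?e" by (intro continuous_intros)
    have c: "continuous_on {-Q..Q} (\<lambda>x. complex_of_real (\<psi> x t))" if "test_function T \<psi>" for \<psi>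
      by (rule continuous_on_of_real[OF continuous_on_subset[OF cont[OF that] subset_UNIV]])
    show "continuous_on {-Q..Q} ?f"
      by (rule continuous_on_diff[OF continuous_on_mult[OF c[OF test_function_partials(1)[OF \<phi>]] e]
        continuous_on_mult[OF continuous_on_const continuous_on_mult[OF c[OF \<phi>] e]]])
  qed
  have z: "\<phi> Q t = 0" "\<phi> (- Q) t = 0" using RB by (auto simp: Q_def)
  have "indicator {-Q..Q} x *\<^sub>R ?f x = ?f x" for x
  proof (cases "x \<in> {-Q..Q}")
    case False
    then have "\<bar>x\<bar> > R" "\<bar>x\<bar> > R'" by (auto simp: Q_def)
    then show ?thesis using RB(3)[of x t] RB'(3)[of x t] by simp
  qed simp
  then have "(LINT x|lborel. ?f x) = 0"
    using has_bochner_integral_integral_eq[OF hb] z by simp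
  then have "(LINT x|lborel. complex_of_real (partial_x \<phi> x t) * ?e x) = \<i> * complex_of_real k * (LINT x|lborel. complex_of_real (\<phi> x t) * ?e x)"
    by (subst (asm) Bochner_Integration.integral_diff[OF ft_integrable[OF test_section(3)[OF test_function_partials(1)[OF \<phi>]]]
        integrable_mult_right[OF ft_integrable[OF test_section(3)[OF \<phi>]]]]) (simp only: integral_mult_right_zero, simp)
  then show ?thesis unfolding tft_def ft_def by (simp only: mult.left_commute)
qed

lemma tft_Tc:
  assumes \<phi>: "test_function T \<phi>"
  shows "sqi lborel (\<lambda>k. complex_of_real (1 + \<bar>k\<bar>) * tft \<phi> t k)" "sqi lborel (\<lambda>k. complex_of_real \<bar>k\<bar> * tft \<phi> t k)"
    "n2 (tft \<phi> t) \<le> L2n lborel (tft \<phi> t) + L2n lborel (tft (partial_x \<phi>) t)"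
proof -
  note a = fhat_sqi[OF tft_fhat[OF \<phi>, of t]] and b = fhat_sqi[OF tft_fhat[OF test_function_partials(1)[OF \<phi>], of t]]
  have n: "cmod (complex_of_real \<bar>k\<bar> * tft \<phi> t k) = cmod (tft (partial_x \<phi>) t k)" for k
    unfolding tft_partial_x[OF \<phi>] by (simp add: norm_mult)
  have m: "(\<lambda>k. complex_of_real \<bar>k\<bar> * tft \<phi> t k) \<in> borel_measurable lborel"
    by (rule borel_measurable_times[OF _ sqi_measurable[OF a]]) simp
  show s: "sqi lborel (\<lambda>k. complex_of_real \<bar>k\<bar> * tft \<phi> t k)"
    by (rule sqi_bound[OF b m]) (use n in simp)
  have e: "complex_of_real (1 + \<bar>k\<bar>) * tft \<phi> t k = tft \<phi> t k + complex_of_real \<bar>k\<bar> * tft \<phi> t k" for k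
    by (simp add: distrib_right)
  show "sqi lborel (\<lambda>k. complex_of_real (1 + \<bar>k\<bar>) * tft \<phi> t k)" unfolding e by (rule sqi_add[OF a s])
  have "L2n lborel (\<lambda>k. complex_of_real \<bar>k\<bar> * tft \<phi> t k) = L2n lborel (tft (partial_x \<phi>) t)"
    by (rule L2n_cong) (rule n)
  then show "n2 (tft \<phi> t) \<le> L2n lborel (tft \<phi> t) + L2n lborel (tft (partial_x \<phi>) t)"
    unfolding n2_def e using L2n_triangle[OF a s] by simp
qed

lemma tft_joint_measurable:
  assumes \<phi>: "test_function T \<phi>"
  shows "(\<lambda>p. tft \<phi> (fst p) (snd p)) \<in> borel_measurable (borel \<Otimes>\<^sub>M borel)"
proof -
  let ?B = "((borel :: real measure) \<Otimes>\<^sub>M (borel :: real measure)) \<Otimes>\<^sub>M (lborel :: real measure)"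
  have p: "(\<lambda>q. (snd q, fst (fst q))) \<in> ?B \<rightarrow>\<^sub>M borel \<Otimes>\<^sub>M borel" by measurable
  have [measurable]: "(\<lambda>q. \<phi> (snd q) (fst (fst q))) \<in> borel_measurable ?B"
    using measurable_compose[OF p test_joint_measurable[OF \<phi>]] by simp
  have "(\<lambda>q. complex_of_real (\<phi> (snd q) (fst (fst q))) * exp (- (\<i> * complex_of_real (snd (fst q) * snd q)))) \<in> borel_measurable ?B"
    by measurable
  then have "(\<lambda>p. LINT x|lborel. complex_of_real (\<phi> x (fst p)) * exp (- (\<i> * complex_of_real (snd p * x)))) \<in> borel_measurable ((borel :: real measure) \<Otimes>\<^sub>M (borel :: real measure))"
    by (intro lborel.borel_measurable_lebesgue_integral) (simp add: case_prod_beta')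
  then show ?thesis unfolding tft_def ft_def by measurable
qed

text \<open>The support lies in times below \<open>T\<close>, so only the lower end point
  contributes.\<close>

lemma test_time_FTC:
  assumes \<phi>: "test_function T \<phi>" and s: "s < T"
  shows "(LINT t|lborel. indicat_real {s<..<T} t * partial_t \<phi> x t) = - \<phi> x s"
proof -
  have cont: "continuous_on UNIV (\<lambda>t. partial_t \<phi> x t)" by (rule test_section_continuous(2)[OF test_function_partials(2)[OF \<phi>]])
  have "has_bochner_integral lborel (\<lambda>t. indicator {s..T} t *\<^sub>R partial_t \<phi> x t) (\<phi> x T - \<phi> x s)"
  proof (rule has_bochner_integral_FTC_Icc)
    show "s \<le> T" using s by simp
    show "((\<lambda>t. \<phi> x t) has_vector_derivative partial_t \<phi> x t) (at t within {s..T})" for t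
      using has_field_derivative_at_within[OF test_partial_t[OF \<phi>]] by (simp add: has_real_derivative_iff_has_vector_derivative)
    show "continuous_on {s..T} (partial_t \<phi> x)" by (rule continuous_on_subset[OF cont]) simp
  qed
  from has_bochner_integral_integral_eq[OF this]
  have e: "(LINT t|lborel. indicator {s..T} t *\<^sub>R partial_t \<phi> x t) = - \<phi> x s"
    using test_vanish[OF \<phi>, of T x] by simp
  have "(LINT t|lborel. indicat_real {s<..<T} t * partial_t \<phi> x t) = (LINT t|lborel. indicator {s..T} t *\<^sub>R partial_t \<phi> x t)"
  proof (rule integral_cong_AE)
    have m: "(\<lambda>t. partial_t \<phi> x t) \<in> borel_measurable borel" by (rule borel_measurable_continuous_onI[OF cont])
    show "(\<lambda>t. indicat_real {s<..<T} t * partial_t \<phi> x t) \<in> borel_measurable lborel" using m by measurable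
    show "(\<lambda>t. indicator {s..T} t *\<^sub>R partial_t \<phi> x t) \<in> borel_measurable lborel" using m by measurable
    show "AE t in lborel. indicat_real {s<..<T} t * partial_t \<phi> x t = indicator {s..T} t *\<^sub>R partial_t \<phi> x t"
      using AE_lborel_singleton[of s] AE_lborel_singleton[of T] by eventually_elim (auto simp: indicator_def)
  qed
  with e show ?thesis by simp
qed

text \<open>The fundamental theorem in time under the Fourier integral, by Fubini; it supplies the
  relation between \<open>\<zeta>\<close> and \<open>\<eta>\<close> assumed in
  \<open>time_identity\<close>.\<close>

lemma tft_time:
  assumes \<phi>: "test_function T \<phi>" and s: "s < T"
  shows "tft \<phi> s k = - (LINT t|lborel. complex_of_real (indicat_real {s<..<T} t) * tft (partial_t \<phi>) t k)"
proof -
  note \<phi>t = test_function_partials(2)[OF \<phi>]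
  obtain R B where RB: "0 < R" "0 \<le> B" "\<forall>x t. \<bar>x\<bar> > R \<longrightarrow> partial_t \<phi> x t = 0" "\<forall>x t. \<bar>partial_t \<phi> x t\<bar> \<le> B"
    using test_support[OF \<phi>t] by blast
  note RB = RB[rule_format]
  let ?e = "\<lambda>x. exp (- (\<i> * complex_of_real (k * x)))"
  let ?g = "\<lambda>t x. complex_of_real (indicat_real {s<..<T} t * partial_t \<phi> x t) * ?e x"
  define Q where "Q = max R (max \<bar>s\<bar> \<bar>T\<bar>)"
  have p: "(\<lambda>p. (snd p, fst p)) \<in> (borel :: real measure) \<Otimes>\<^sub>M (borel :: real measure) \<rightarrow>\<^sub>M borel \<Otimes>\<^sub>M borel" by measurable
  have [measurable]: "(\<lambda>p. partial_t \<phi> (snd p) (fst p)) \<in> borel_measurable (borel \<Otimes>\<^sub>M borel)"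
    using measurable_compose[OF p test_joint_measurable[OF \<phi>t]] by simp
  have "(\<lambda>p. complex_of_real (indicat_real {s<..<T} (fst p) * partial_t \<phi> (snd p) (fst p)) * ?e (snd p)) \<in> borel_measurable ((borel :: real measure) \<Otimes>\<^sub>M (borel :: real measure))"
    by measurable
  then have m: "(\<lambda>(t, x). ?g t x) \<in> borel_measurable (lborel \<Otimes>\<^sub>M lborel)"
    by (simp add: case_prod_beta' cong: measurable_cong_sets sets_pair_measure_cong)
  have i: "integrable (lborel \<Otimes>\<^sub>M lborel) (\<lambda>(t, x). ?g t x)"
  proof (rule box_integrable[OF m])
    show "norm (case p of (t, x) \<Rightarrow> ?g t x) \<le> B" for p
      using RB by (auto simp: norm_mult indicator_def split: prod.split)
    show "\<bar>t\<bar> > Q \<or> \<bar>x\<bar> > Q \<Longrightarrow> (case (t, x) of (t, x) \<Rightarrow> ?g t x) = 0" for t x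
      using RB(3)[of x t] by (auto simp: indicator_def Q_def)
  qed
  have "complex_of_real (indicat_real {s<..<T} t) * tft (partial_t \<phi>) t k = complex_of_real (1 / sqrt (2 * pi)) * (LINT x|lborel. ?g t x)" for t
    unfolding tft_def ft_def by (simp add: mult.assoc)
  then have "(LINT t|lborel. complex_of_real (indicat_real {s<..<T} t) * tft (partial_t \<phi>) t k)
      = complex_of_real (1 / sqrt (2 * pi)) * (LINT t|lborel. LINT x|lborel. ?g t x)"
    by (simp only: integral_mult_right_zero)
  also have "(LINT t|lborel. LINT x|lborel. ?g t x) = (LINT x|lborel. LINT t|lborel. ?g t x)"
    using lborel_pair.Fubini_integral[OF i] by simp
  also have "\<dots> = (LINT x|lborel. - (complex_of_real (\<phi> x s) * ?e x))"
  proof (rule Bochner_Integration.integral_cong[OF refl])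
    fix x
    have "(LINT t|lborel. ?g t x) = complex_of_real (LINT t|lborel. indicat_real {s<..<T} t * partial_t \<phi> x t) * ?e x"
      unfolding integral_mult_left_zero integral_complex_of_real ..
    then show "(LINT t|lborel. ?g t x) = - (complex_of_real (\<phi> x s) * ?e x)"
      unfolding test_time_FTC[OF \<phi> s] by simp
  qed
  finally show ?thesis unfolding tft_def[of \<phi>] ft_def by simp
qed

section \<open>The solution\<close>

lemma sobolev_weight: "(1 + \<bar>n\<bar> powr (2 * (3/2))) = 1 + \<bar>n::real\<bar> ^ 3"
  by simp

lemma cmod_s3_sq: "(cmod (s3 k))\<^sup>2 = (1 + \<bar>k\<bar>) ^ 3"
  by (simp add: s3_def)

text \<open>In the second inequality the right side exceeds the left by
  \<open>3 * (a - 1)\<^sup>2 * (a + 1)\<close>.\<close>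

lemma cube_weight:
  fixes a :: real
  assumes "0 \<le> a"
  shows "1 + a ^ 3 \<le> (1 + a) ^ 3" "(1 + a) ^ 3 \<le> 4 * (1 + a ^ 3)"
proof -
  have e: "(1 + a) ^ 3 = 1 + 3 * a + 3 * a\<^sup>2 + a ^ 3" by (simp add: power3_eq_cube power2_eq_square algebra_simps)
  show "1 + a ^ 3 \<le> (1 + a) ^ 3" unfolding e using assms by simp
  have "0 \<le> (a - 1)\<^sup>2 * (a + 1)" using assms by simp
  also have "(a - 1)\<^sup>2 * (a + 1) = a ^ 3 - a\<^sup>2 - a + 1" by (simp add: power3_eq_cube power2_eq_square algebra_simps)
  finally have "0 \<le> 3 * (a ^ 3 - a\<^sup>2 - a + 1)" by simp
  also have "\<dots> = 4 * (1 + a ^ 3) - (1 + 3 * a + 3 * a\<^sup>2 + a ^ 3)" by (simp add: algebra_simps)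
  finally show "(1 + a) ^ 3 \<le> 4 * (1 + a ^ 3)" unfolding e by (simp only: diff_ge_0_iff_ge)
qed

lemma fhat_sobolev:
  assumes f: "fhat h F"
  shows "h \<in> sobolev (3/2) \<longleftrightarrow> sqi lborel (\<lambda>k. s3 k * F k)"
    and "sqi lborel (\<lambda>k. s3 k * F k) \<Longrightarrow> sobolev_norm (3/2) h \<le> L2n lborel (\<lambda>k. s3 k * F k)"
proof -
  obtain h' where h': "h' \<in> borel_measurable lborel" "AE x in lborel. h x = h' x" "sqi lborel (cr h')"
    "AE k in lborel. FT (cr h') k = F k"
    by (rule fhat_Borel[OF f])
  have "fourier h \<in> L2" by (rule fourier_FT(2)[OF fhat_L2[OF f] h'(1-3)])
  then have hm: "fourier h \<in> borel_measurable lebesgue" by (simp add: L2_def)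
  have ae: "AE k in lebesgue. fourier h k = F k" using f by (intro AE_completion) (simp add: fhat_def)
  let ?f = "\<lambda>n. (1 + \<bar>n\<bar> ^ 3) * (cmod (fourier h n))\<^sup>2" and ?g = "\<lambda>n. (1 + \<bar>n\<bar> ^ 3) * (cmod (F n))\<^sup>2"
  have Fm: "F \<in> borel_measurable borel" using sqi_measurable[OF fhat_sqi[OF f]] by simp
  have sm: "(\<lambda>k. s3 k * F k) \<in> borel_measurable lborel"
    using Fm s3_measurable by (intro borel_measurable_times) simp_all
  have gm: "?g \<in> borel_measurable lborel" using Fm by measurable
  have wm: "(\<lambda>n::real. 1 + \<bar>n\<bar> ^ 3) \<in> borel_measurable lebesgue" by (intro measurable_completion) measurable
  have fm: "?f \<in> borel_measurable lebesgue"
    by (intro borel_measurable_times wm borel_measurable_power measurable_compose[OF hm borel_measurable_norm])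
  have ae': "AE n in lebesgue. ?f n = ?g n" using ae by eventually_elim simp
  have sg: "(cmod (s3 n * F n))\<^sup>2 = (1 + \<bar>n\<bar>) ^ 3 * (cmod (F n))\<^sup>2" for n
    by (simp add: norm_mult power_mult_distrib cmod_s3_sq)
  have lo: "?g n \<le> (cmod (s3 n * F n))\<^sup>2" for n
    unfolding sg by (rule mult_right_mono[OF cube_weight(1)]) simp_all
  have up: "(cmod (s3 n * F n))\<^sup>2 \<le> 4 * ?g n" for n
    unfolding sg mult.assoc[symmetric] by (rule mult_right_mono[OF cube_weight(2)]) simp_all
  have g0: "0 \<le> ?g n" for n by simp
  have "integrable lebesgue ?f \<longleftrightarrow> integrable lebesgue ?g"
    by (rule integrable_cong_AE[OF fm measurable_completion[OF gm] ae'])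
  also have "\<dots> \<longleftrightarrow> integrable lborel ?g" by (rule integrable_completion[OF gm])
  also have "\<dots> \<longleftrightarrow> sqi lborel (\<lambda>k. s3 k * F k)"
  proof
    assume i: "integrable lborel ?g"
    have "integrable lborel (\<lambda>n. (cmod (s3 n * F n))\<^sup>2)"
    proof (rule Bochner_Integration.integrable_bound[OF integrable_mult_right[OF i, of 4]])
      show "(\<lambda>n. (cmod (s3 n * F n))\<^sup>2) \<in> borel_measurable lborel"
        by (intro borel_measurable_power measurable_compose[OF sm borel_measurable_norm])
      have "norm ((cmod (s3 n * F n))\<^sup>2) \<le> norm (4 * ?g n)" for n
        using order_trans[OF up[of n] abs_ge_self] by (simp only: real_norm_def abs_of_nonneg[OF zero_le_power2])
      then show "AE n in lborel. norm ((cmod (s3 n * F n))\<^sup>2) \<le> norm (4 * ?g n)" by (rule AE_I2)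
    qed
    with sm show "sqi lborel (\<lambda>k. s3 k * F k)" by (simp add: sqi_def)
  next
    assume s: "sqi lborel (\<lambda>k. s3 k * F k)"
    show "integrable lborel ?g"
      by (rule Bochner_Integration.integrable_bound[OF sqi_integrable[OF s] gm])
         (use lo in \<open>simp add: abs_mult\<close>)
  qed
  finally have iff: "integrable lebesgue ?f \<longleftrightarrow> sqi lborel (\<lambda>k. s3 k * F k)" .
  show "h \<in> sobolev (3/2) \<longleftrightarrow> sqi lborel (\<lambda>k. s3 k * F k)"
    using iff fhat_L2[OF f] unfolding sobolev_def sobolev_weight by simp
  assume s: "sqi lborel (\<lambda>k. s3 k * F k)"
  have gi: "integrable lborel ?g"
    using s iff integrable_cong_AE[OF fm measurable_completion[OF gm] ae'] integrable_completion[OF gm] by blast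
  have "(LINT n|lebesgue. ?f n) = (LINT n|lebesgue. ?g n)"
    by (rule integral_cong_AE[OF fm measurable_completion[OF gm] ae'])
  also have "\<dots> = (LINT n|lborel. ?g n)" by (rule integral_completion[OF gm])
  also have "\<dots> \<le> (LINT n|lborel. (cmod (s3 n * F n))\<^sup>2)"
    by (rule integral_mono[OF gi sqi_integrable[OF s]]) (rule lo)
  finally show "sobolev_norm (3/2) h \<le> L2n lborel (\<lambda>k. s3 k * F k)"
    unfolding sobolev_norm_def sobolev_weight L2n_def by (rule real_sqrt_le_mono)
qed

lemma herm_nX:
  assumes A: "Xc A"
  shows "L2n lborel (\<lambda>k. s3 k * herm A k) \<le> 2 * nX A"
proof -
  have s: "sqi lborel (\<lambda>k. s3 k * A k)" using A by (simp add: Xc_def)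
  have s': "sqi lborel (\<lambda>k. s3 (- k) * A (- k))" using sqi_uminus_arg[OF s] by simp
  have e: "s3 k * herm A k = \<i> * (s3 k * A k) + cnj (\<i> * (s3 (- k) * A (- k)))" for k
    by (simp add: herm_def s3_def algebra_simps)
  have "L2n lborel (\<lambda>k. s3 k * herm A k) \<le> L2n lborel (\<lambda>k. \<i> * (s3 k * A k)) + L2n lborel (\<lambda>k. cnj (\<i> * (s3 (- k) * A (- k))))"
    unfolding e by (rule L2n_triangle[OF sqi_cmult[OF s] sqi_cnj[OF sqi_cmult[OF s']]])
  also have "L2n lborel (\<lambda>k. \<i> * (s3 k * A k)) = nX A" unfolding nX_def L2n_cmult by simp
  also have "L2n lborel (\<lambda>k. cnj (\<i> * (s3 (- k) * A (- k)))) = L2n lborel (\<lambda>k. s3 (- k) * A (- k))"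
    by (rule L2n_cong) (simp add: norm_mult)
  also have "\<dots> = nX A" unfolding nX_def by (rule L2n_uminus_arg[of "\<lambda>k. s3 k * A k"])
  finally show ?thesis by simp
qed

text \<open>One fixed choice for each transform. A profile taking finitely many values in time
  therefore yields a function of time with finitely many values, as simple functions
  require.\<close>

definition ift :: "(real \<Rightarrow> complex) \<Rightarrow> real \<Rightarrow> real" where
  "ift F = (SOME h. fhat h F)"

lemma fhat_ift:
  assumes "Xc A"
  shows "fhat (ift (herm A)) (herm A)"
proof -
  obtain h where "fhat h (herm A)"
    by (rule fhat_surj[OF Xc_herm(2)[OF assms]]) (simp_all add: herm_uminus)
  then show ?thesis unfolding ift_def by (rule someI[of "\<lambda>h. fhat h (herm A)"])
qed

lemma ift_sobolev:
  assumes "Xc A"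
  shows "ift (herm A) \<in> sobolev (3/2)" "sobolev_norm (3/2) (ift (herm A)) \<le> 2 * nX A"
  using fhat_sobolev[OF fhat_ift[OF assms]] Xc_herm(1)[OF assms] herm_nX[OF assms] by auto

lemma ift_diff_sobolev:
  assumes A: "Xc A" and B: "Xc B"
  shows "sobolev_norm (3/2) (\<lambda>x. ift (herm A) x - ift (herm B) x) \<le> 2 * nX (\<lambda>k. A k - B k)"
proof -
  note d = Xc_diff[OF A B]
  have e: "(\<lambda>k. complex_of_real 1 * herm A k + complex_of_real (- 1) * herm B k) = herm (\<lambda>k. A k - B k)"
    by (rule ext) (simp add: herm_def algebra_simps)
  have "fhat (\<lambda>x. 1 * ift (herm A) x + (- 1) * ift (herm B) x) (herm (\<lambda>k. A k - B k))"
    using fhat_lincomb[OF fhat_ift[OF A] fhat_ift[OF B], of 1 "- 1"] unfolding e .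
  then have "fhat (\<lambda>x. ift (herm A) x - ift (herm B) x) (herm (\<lambda>k. A k - B k))" by simp
  from fhat_sobolev(2)[OF this Xc_herm(1)[OF d]] herm_nX[OF d] show ?thesis by simp
qed

section \<open>Strong measurability in time\<close>

context evol
begin

lemma cutoff_Xc:
  assumes A: "Xc A"
  shows "Xc (cutoff N A)"
proof -
  have Am: "A \<in> borel_measurable borel" using Xc_measurable[OF A] by simp
  have m: "cutoff N A \<in> borel_measurable borel"
    unfolding cutoff_def[abs_def] using Am by measurable
  have s: "sqi lborel (\<lambda>k. s3 k * A k)" using A by (simp add: Xc_def)
  have "sqi lborel (\<lambda>k. s3 k * cutoff N A k)"
  proof (rule sqi_bound[OF s])
    show "(\<lambda>k. s3 k * cutoff N A k) \<in> borel_measurable lborel"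
      using m s3_measurable by (intro borel_measurable_times) simp_all
    show "AE k in lborel. cmod (s3 k * cutoff N A k) \<le> cmod (s3 k * A k)"
      by (auto simp: cutoff_def)
  qed
  with m Xc_0[OF A] show ?thesis by (auto simp: Xc_def cutoff_def)
qed

text \<open>Below the frequency \<open>N\<close> the weight 3/2 exceeds the weight 1/2 by a factor
  of at most \<open>1 + N\<close>.\<close>

lemma cutoff_nX:
  assumes A: "Xc A" and N: "0 \<le> N"
  shows "nX (cutoff N A) \<le> (1 + N) * nW A"
proof -
  have s: "sqi lborel (\<lambda>k. complex_of_real (1 + N) * (s1 k * A k))" by (rule sqi_cmult[OF Xc_s1(1)[OF A]])
  have "nX (cutoff N A) \<le> L2n lborel (\<lambda>k. complex_of_real (1 + N) * (s1 k * A k))"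
    unfolding nX_def
  proof (rule L2n_mono[OF s])
    show "(\<lambda>k. s3 k * cutoff N A k) \<in> borel_measurable lborel"
      using cutoff_Xc[OF A, of N] by (intro sqi_measurable) (simp add: Xc_def)
    have "cmod (s3 k * cutoff N A k) \<le> cmod (complex_of_real (1 + N) * (s1 k * A k))" for k
    proof (cases "0 < k \<and> k \<le> N")
      case True
      have "sqrt ((1 + \<bar>k\<bar>) ^ 3) = (1 + \<bar>k\<bar>) * sqrt (1 + \<bar>k\<bar>)"
        by (simp add: power3_eq_cube real_sqrt_mult)
      then have e: "cmod (s3 k) = (1 + \<bar>k\<bar>) * cmod (s1 k)"
        unfolding s3_def s1_def norm_of_real by (simp add: abs_mult)
      have "(1 + \<bar>k\<bar>) * (cmod (s1 k) * cmod (A k)) \<le> (1 + N) * (cmod (s1 k) * cmod (A k))"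
        using True by (intro mult_right_mono) auto
      moreover have "cmod (complex_of_real (1 + N)) = 1 + N" unfolding norm_of_real using N by simp
      moreover have "cutoff N A k = A k" using True by (simp add: cutoff_def)
      ultimately show ?thesis by (simp only: norm_mult e mult.assoc)
    next
      case False
      then show ?thesis using Xc_0[OF A, of k] by (cases "k \<le> 0") (auto simp: cutoff_def)
    qed
    then show "AE k in lborel. cmod (s3 k * cutoff N A k) \<le> cmod (complex_of_real (1 + N) * (s1 k * A k))" by simp
  qed
  also have "\<dots> = (1 + N) * nW A" unfolding L2n_cmult nW_def norm_of_real using N by simp
  finally show ?thesis .
qed

lemma cutoff_tendsto:
  assumes A: "Xc A"
  shows "(\<lambda>n. nX (\<lambda>k. cutoff (real n) A k - A k)) \<longlonglongrightarrow> 0"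
proof -
  have s: "sqi lborel (\<lambda>k. s3 k * A k)" using A by (simp add: Xc_def)
  have "(\<lambda>n. L2n lborel (\<lambda>k. s3 k * cutoff (real n) A k - s3 k * A k)) \<longlonglongrightarrow> 0"
  proof (rule L2_dominated[where w="\<lambda>k. cmod (s3 k * A k)"])
    show "(\<lambda>k. s3 k * cutoff (real n) A k) \<in> borel_measurable lborel" for n
      using cutoff_Xc[OF A, of "real n"] by (intro sqi_measurable) (simp add: Xc_def)
    show "(\<lambda>k. s3 k * A k) \<in> borel_measurable lborel" by (rule sqi_measurable[OF s])
    show "integrable lborel (\<lambda>k. (cmod (s3 k * A k))\<^sup>2)" by (rule sqi_integrable[OF s])
    show "AE k in lborel. cmod (s3 k * cutoff (real n) A k - s3 k * A k) \<le> cmod (s3 k * A k)" for n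
      by (auto simp: cutoff_def)
    have "(\<lambda>n. s3 k * cutoff (real n) A k) \<longlonglongrightarrow> s3 k * A k" for k
    proof (rule tendsto_eventually)
      show "\<forall>\<^sub>F n in sequentially. s3 k * cutoff (real n) A k = s3 k * A k"
        using eventually_ge_at_top[of "nat \<lceil>k\<rceil>"]
      proof eventually_elim
        case (elim n)
        then have "k \<le> real n" by linarith
        then show ?case by (simp add: cutoff_def)
      qed
    qed
    then show "AE k in lborel. (\<lambda>n. s3 k * cutoff (real n) A k) \<longlonglongrightarrow> s3 k * A k" by simp
  qed
  then show ?thesis by (simp add: nX_def right_diff_distrib)
qed

end

context evol_seq
begin

lemma tn_simple: "simple_function (lebesgue_on {0<..<T}) (tn n)"
  unfolding simple_function_def
proof (intro conjI ballI)
  have "tn n t \<le> nat \<lceil>T / h n\<rceil>" if "t \<in> {0<..<T}" for t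
  proof -
    have "t / h n \<le> T / h n" using that h[of n] by (intro divide_right_mono) auto
    then show ?thesis unfolding tn_def by linarith
  qed
  then have "tn n ` space (lebesgue_on {0<..<T}) \<subseteq> {..nat \<lceil>T / h n\<rceil>}" by auto
  then show "finite (tn n ` space (lebesgue_on {0<..<T}))" by (rule finite_subset) simp
  show "tn n -` {m} \<inter> space (lebesgue_on {0<..<T}) \<in> sets (lebesgue_on {0<..<T})" for m
  proof -
    have "tn n -` {m} \<inter> space borel \<in> sets borel" by (rule measurable_sets[OF tn_measurable]) simp
    then have "tn n -` {m} \<in> sets lebesgue" by (simp add: sets_completionI_sets)
    moreover have "{0<..<T} \<in> sets lebesgue" by simp
    ultimately have "tn n -` {m} \<inter> {0<..<T} \<in> sets lebesgue" by (rule sets.Int)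
    then show ?thesis by (subst sets_restrict_space_iff) auto
  qed
qed

text \<open>The iterates are step functions in time, but their known rate of convergence is in
  H^(1/2). Cutting level \<open>n\<close> off at frequency \<open>n\<close> costs a factor
  \<open>1 + n\<close>, which the rate \<open>(4/5) ^ n\<close> outweighs, and the cut off limit
  tends to the limit in H^(3/2). This gives simple functions converging in H^(3/2).\<close>

lemma Linfty_ift: "(\<lambda>t. ift (herm (AA t))) \<in> Linfty_sobolev T (3/2)"
proof -
  have X: "Xc (AA t)" "nX (AA t) \<le> x" if "t \<in> {0<..<T}" for t using AA_Xc[of t] that by auto
  \<comment> \<open>The iterate itself has frequencies up to \<open>2 ^ n\<close>, for which the
    cost \<open>1 + 2 ^ n\<close> would exceed the rate; hence the second, much lower
    cutoff.\<close>
  define S where "S n t = ift (herm (cutoff (real n) (u n (tn n t))))" for n t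
  have S_simple: "simple_function (lebesgue_on {0<..<T}) (S n)" for n
    using simple_function_compose[OF tn_simple[of n], of "\<lambda>m. ift (herm (cutoff (real n) (u n m)))"]
    by (simp add: S_def[abs_def] o_def)
  have S_mem: "S n t \<in> sobolev (3/2)" for n t
    unfolding S_def by (rule ift_sobolev(1)[OF cutoff_Xc[OF u_Xc]])
  have lim: "(\<lambda>n. sobolev_norm (3/2) (\<lambda>x. S n t x - ift (herm (AA t)) x)) \<longlonglongrightarrow> 0" if t: "t \<in> {0<..<T}" for t
  proof -
    note A = X(1)[OF t]
    define e where "e n = (1 + real n) * (5 * C * (4/5) ^ n) + nX (\<lambda>k. cutoff (real n) (AA t) k - AA t k)" for n
    have le: "sobolev_norm (3/2) (\<lambda>x. S n t x - ift (herm (AA t)) x) \<le> 2 * e n" for n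
    proof -
      let ?v = "u n (tn n t)"
      note d = Xc_diff[OF u_Xc[of n "tn n t"] A]
      have sp: "(\<lambda>k. cutoff (real n) ?v k - AA t k) = (\<lambda>k. cutoff (real n) (\<lambda>k. ?v k - AA t k) k + (cutoff (real n) (AA t) k - AA t k))"
        by (rule ext) (simp add: cutoff_def)
      have "nX (\<lambda>k. cutoff (real n) ?v k - AA t k)
          \<le> nX (cutoff (real n) (\<lambda>k. ?v k - AA t k)) + nX (\<lambda>k. cutoff (real n) (AA t) k - AA t k)"
        unfolding sp by (rule nX_triangle[OF cutoff_Xc[OF d] Xc_diff[OF cutoff_Xc[OF A] A]])
      also have "nX (cutoff (real n) (\<lambda>k. ?v k - AA t k)) \<le> (1 + real n) * nW (\<lambda>k. ?v k - AA t k)"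
        by (rule cutoff_nX[OF d]) simp
      also have "\<dots> \<le> (1 + real n) * (5 * C * (4/5) ^ n)"
        using AA_lim(2)[of t n] t by (intro mult_left_mono) auto
      finally have "nX (\<lambda>k. cutoff (real n) ?v k - AA t k) \<le> e n" by (simp add: e_def)
      then show ?thesis
        using ift_diff_sobolev[OF cutoff_Xc[OF u_Xc] A, of "real n" n "tn n t"] by (simp add: S_def)
    qed
    have "(\<lambda>n. 5 * C * (4/5) ^ n + 5 * C * (real n * (4/5) ^ n) + nX (\<lambda>k. cutoff (real n) (AA t) k - AA t k)) \<longlonglongrightarrow> 0 + 5 * C * 0 + 0"
      by (intro tendsto_add tendsto_mult_left rate_tendsto powser_times_n_limit_0 cutoff_tendsto[OF A]) simp
    then have "e \<longlonglongrightarrow> 0" unfolding e_def[abs_def] by (simp add: algebra_simps)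
    from tendsto_mult_left[OF this, of 2] have "(\<lambda>n. 2 * e n) \<longlonglongrightarrow> 0" by simp
    then show ?thesis
      by (rule tendsto_sandwich[rotated 3]) (use le in \<open>auto simp: sobolev_norm_def\<close>)
  qed
  have "strongly_measurable_sobolev T (3/2) (\<lambda>t. ift (herm (AA t)))"
    unfolding strongly_measurable_sobolev_def
  proof (intro exI[of _ S] conjI allI ballI)
    show "AE t in lebesgue_on {0<..<T}. (\<lambda>n. sobolev_norm (3/2) (\<lambda>x. S n t x - ift (herm (AA t)) x)) \<longlonglongrightarrow> 0"
      by (rule AE_I2) (rule lim, simp)
  qed (rule S_simple, rule S_mem)
  moreover have "AE t in lebesgue_on {0<..<T}. ift (herm (AA t)) \<in> sobolev (3/2)"
    by (rule AE_I2) (rule ift_sobolev(1)[OF X(1)], simp)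
  moreover have "AE t in lebesgue_on {0<..<T}. sobolev_norm (3/2) (ift (herm (AA t))) \<le> 2 * x"
  proof (rule AE_I2)
    fix t assume "t \<in> space (lebesgue_on {0<..<T})"
    then have t: "t \<in> {0<..<T}" by simp
    show "sobolev_norm (3/2) (ift (herm (AA t))) \<le> 2 * x"
      using ift_sobolev(2)[OF X(1)[OF t]] X(2)[OF t] by linarith
  qed
  ultimately show ?thesis unfolding Linfty_sobolev_def by blast
qed

end

section \<open>The weak formulation\<close>

lemma set_lebesgue_integral_Ioo:
  fixes g G :: "real \<Rightarrow> real"
  assumes e: "\<And>s. s \<in> {0<..<T} \<Longrightarrow> g s = G s" and m: "(\<lambda>s. indicat_real {0<..<T} s * G s) \<in> borel_measurable borel"
  shows "(LINT s:{0<..<T}|lebesgue. g s) = (LINT s|lborel. indicat_real {0<..<T} s * G s)"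
proof -
  have pt: "indicat_real {0<..<T} s *\<^sub>R g s = indicat_real {0<..<T} s * G s" for s
    by (auto simp: indicator_def e)
  have "(LINT s:{0<..<T}|lebesgue. g s) = (LINT s|lebesgue. indicat_real {0<..<T} s * G s)"
    unfolding set_lebesgue_integral_def pt ..
  also have "\<dots> = (LINT s|lborel. indicat_real {0<..<T} s * G s)"
    by (rule integral_completion) (use m in simp)
  finally show ?thesis .
qed

lemma integrable_Ioo:
  fixes G :: "real \<Rightarrow> real"
  assumes m: "G \<in> borel_measurable borel" and b: "\<And>s. s \<in> {0<..<T} \<Longrightarrow> \<bar>G s\<bar> \<le> K"
  shows "integrable lborel (\<lambda>s. indicat_real {0<..<T} s * G s)"
proof (rule Bochner_Integration.integrable_bound)
  show "integrable lborel (\<lambda>s. K * indicat_real {0<..<T} s)"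
    by (intro integrable_mult_right integrable_real_indicator emeasure_bounded_finite
        bounded_subset[OF compact_imp_bounded[OF compact_Icc[of 0 T]]]) auto
  have "(\<lambda>s. indicat_real {0<..<T} s * G s) \<in> borel_measurable borel" using m by measurable
  then show "(\<lambda>s. indicat_real {0<..<T} s * G s) \<in> borel_measurable lborel" by simp
  show "AE s in lborel. norm (indicat_real {0<..<T} s * G s) \<le> norm (K * indicat_real {0<..<T} s)"
  proof (rule AE_I2)
    fix s
    show "norm (indicat_real {0<..<T} s * G s) \<le> norm (K * indicat_real {0<..<T} s)"
    proof (cases "s \<in> {0<..<T}")
      case True
      then show ?thesis using order_trans[OF b[OF True] abs_ge_self] by simp
    qed simp
  qed
qed

lemma pairing_measurable:
  fixes \<eta> F :: "real \<Rightarrow> real \<Rightarrow> complex"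
  assumes \<eta>: "(\<lambda>p. \<eta> (fst p) (snd p)) \<in> borel_measurable (borel \<Otimes>\<^sub>M borel)"
    and F: "(\<lambda>p. F (fst p) (snd p)) \<in> borel_measurable (borel \<Otimes>\<^sub>M borel)"
  shows "(\<lambda>s. Re (LINT k|lborel. cnj (\<eta> s k) * F s k)) \<in> borel_measurable borel"
proof -
  have "(\<lambda>p. cnj (\<eta> (fst p) (snd p)) * F (fst p) (snd p)) \<in> borel_measurable ((borel :: real measure) \<Otimes>\<^sub>M (borel :: real measure))"
    by (intro borel_measurable_times borel_measurable_cnj \<eta> F)
  then have "(\<lambda>p. cnj (\<eta> (fst p) (snd p)) * F (fst p) (snd p)) \<in> borel_measurable ((borel :: real measure) \<Otimes>\<^sub>M lborel)"
    by (simp cong: measurable_cong_sets sets_pair_measure_cong)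
  then have "(\<lambda>s. LINT k|lborel. cnj (\<eta> s k) * F s k) \<in> borel_measurable borel"
    by (intro lborel.borel_measurable_lebesgue_integral) (simp add: case_prod_beta')
  then show ?thesis by measurable
qed

lemma half_tft_joint_measurable:
  assumes \<phi>: "test_function T \<phi>"
  shows "(\<lambda>p. half (tft \<phi> (fst p)) (snd p)) \<in> borel_measurable (borel \<Otimes>\<^sub>M borel)"
proof -
  have m: "(\<lambda>p. - \<i> * tft \<phi> (fst p) (snd p)) \<in> borel_measurable (borel \<Otimes>\<^sub>M borel)"
    by (intro borel_measurable_times tft_joint_measurable[OF \<phi>]) simp
  show ?thesis unfolding half_def by (rule measurable_If[OF m]) simp_all
qed

lemma half_tft_Tc:
  assumes \<phi>: "test_function T \<phi>"
  shows "Tc (half (tft \<phi> s))" "n2 (half (tft \<phi> s)) \<le> n2 (tft \<phi> s)"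
proof -
  have "tft \<phi> s \<in> borel_measurable borel" using sqi_measurable[OF fhat_sqi[OF tft_fhat[OF \<phi>]]] by simp
  from half_Tc[OF this tft_Tc(1)[OF \<phi>]] show "Tc (half (tft \<phi> s))" "n2 (half (tft \<phi> s)) \<le> n2 (tft \<phi> s)" .
qed

lemma half_tft_bounded:
  assumes \<phi>: "test_function T \<phi>"
  obtains D where "\<And>s. n2 (half (tft \<phi> s)) \<le> D" "\<And>s. n1 (half (tft \<phi> s)) \<le> D"
proof -
  obtain D1 where D1: "\<And>s. L2n lborel (tft \<phi> s) \<le> D1" by (rule tft_L2n[OF \<phi>], rule that)
  obtain D2 where D2: "\<And>s. L2n lborel (tft (partial_x \<phi>) s) \<le> D2"
    by (rule tft_L2n[OF test_function_partials(1)[OF \<phi>]], rule that)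
  let ?c = "L2n lborel (\<lambda>k. complex_of_real (1 / (1 + \<bar>k\<bar>)))"
  have b2: "n2 (half (tft \<phi> s)) \<le> D1 + D2" for s
    using half_tft_Tc(2)[OF \<phi>, of s] tft_Tc(3)[OF \<phi>, of s] D1[of s] D2[of s] by linarith
  have b1: "n1 (half (tft \<phi> s)) \<le> ?c * (D1 + D2)" for s
    by (rule order_trans[OF n1_le_n2[OF half_tft_Tc(1)[OF \<phi>]] mult_left_mono[OF b2 L2n_nonneg]])
  show thesis
  proof (rule that[of "max (D1 + D2) (?c * (D1 + D2))"])
    show "n2 (half (tft \<phi> s)) \<le> max (D1 + D2) (?c * (D1 + D2))" for s by (rule order_trans[OF b2 max.cobounded1])
    show "n1 (half (tft \<phi> s)) \<le> max (D1 + D2) (?c * (D1 + D2))" for s by (rule order_trans[OF b1 max.cobounded2])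
  qed
qed

lemma half_tft_time:
  assumes \<phi>: "test_function T \<phi>" and s: "s < T"
  shows "half (tft \<phi> s) k = - (LINT t|lborel. complex_of_real (indicat_real {s<..<T} t) * half (tft (partial_t \<phi>) t) k)"
proof (cases "0 < k")
  case True
  have "(LINT t|lborel. complex_of_real (indicat_real {s<..<T} t) * half (tft (partial_t \<phi>) t) k)
      = (LINT t|lborel. - \<i> * (complex_of_real (indicat_real {s<..<T} t) * tft (partial_t \<phi>) t k))"
    using True by (simp add: half_def mult_ac)
  also have "\<dots> = - \<i> * (LINT t|lborel. complex_of_real (indicat_real {s<..<T} t) * tft (partial_t \<phi>) t k)"
    by (rule integral_mult_right_zero)
  finally show ?thesis using True by (simp add: half_def tft_time[OF \<phi> s])
qed (simp add: half_def)

context evol_seq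
begin

text \<open>Each of the four integrals over space is twice a pairing of profiles, up to the factor
  \<open>- \<epsilon>\<close> in the linear one. What remains is \<open>time_identity\<close> for
  the profiles of \<open>\<phi>\<close> and its time derivative, with \<open>BB\<close> split into
  its linear and quadratic parts.\<close>

lemma weak_form:
  assumes f0: "fhat f0 (herm A0)"
  shows "distributional_solution \<epsilon> \<alpha> T f0 (\<lambda>y t. ift (herm (AA t)) y)"
  unfolding distributional_solution_def
proof (intro allI impI)
  fix \<phi> assume \<phi>: "test_function T \<phi>"
  note \<phi>x = test_function_partials(1)[OF \<phi>] and \<phi>t = test_function_partials(2)[OF \<phi>]
  let ?f = "\<lambda>s. ift (herm (AA s))" and ?I = "indicat_real {0<..<T}"
  define \<zeta> where "\<zeta> s = half (tft \<phi> s)" for s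
  define \<eta> where "\<eta> s = half (tft (partial_t \<phi>) s)" for s
  have \<zeta>T: "Tc (\<zeta> s)" and \<eta>T: "Tc (\<eta> s)" for s
    unfolding \<zeta>_def \<eta>_def by (rule half_tft_Tc(1)[OF \<phi>], rule half_tft_Tc(1)[OF \<phi>t])
  have \<zeta>m: "(\<lambda>p. \<zeta> (fst p) (snd p)) \<in> borel_measurable (borel \<Otimes>\<^sub>M borel)"
    and \<eta>m: "(\<lambda>p. \<eta> (fst p) (snd p)) \<in> borel_measurable (borel \<Otimes>\<^sub>M borel)"
    unfolding \<zeta>_def \<eta>_def by (rule half_tft_joint_measurable[OF \<phi>], rule half_tft_joint_measurable[OF \<phi>t])
  obtain D where D: "\<And>s. n2 (\<zeta> s) \<le> D" "\<And>s. n1 (\<zeta> s) \<le> D"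
    by (rule half_tft_bounded[OF \<phi>, folded \<zeta>_def], rule that)
  obtain E where E: "\<And>s. n2 (\<eta> s) \<le> E" "\<And>s. n1 (\<eta> s) \<le> E"
    by (rule half_tft_bounded[OF \<phi>t, folded \<eta>_def], rule that)
  have \<zeta>\<eta>: "\<zeta> s k = - (LINT t|lborel. complex_of_real (indicat_real {s<..<T} t) * \<eta> t k)" if "0 \<le> s" "s < T" for s k
    unfolding \<zeta>_def \<eta>_def by (rule half_tft_time[OF \<phi> that(2)])
  note ID = time_identity[OF \<eta>m \<eta>T E \<zeta>T \<zeta>\<eta>]
  have X: "Xc (AA s)" "nX (AA s) \<le> x" if "s \<in> {0<..<T}" for s using AA_Xc[of s] that by auto
  have fs: "fhat (?f s) (herm (AA s))" if "s \<in> {0<..<T}" for s by (rule fhat_ift[OF X(1)[OF that]])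
  have Im: "(\<lambda>s. ?I s * G s) \<in> borel_measurable borel" if "G \<in> borel_measurable borel" for G :: "real \<Rightarrow> real"
    using that by measurable

  have mB: "(\<lambda>s. BB (\<zeta> s) (AA s)) \<in> borel_measurable borel"
    unfolding BB_def by (rule pairing_measurable[OF \<zeta>m RR_joint_measurable])
  have mN: "(\<lambda>s. NB (\<zeta> s) (AA s)) \<in> borel_measurable borel"
    unfolding NB_def by (rule pairing_measurable[OF \<zeta>m NL_joint_measurable])
  have mL: "(\<lambda>s. LB (\<zeta> s) (AA s)) \<in> borel_measurable borel"
  proof -
    have "(\<lambda>p. - \<i> * complex_of_real (snd p - 1) * AA (fst p) (snd p)) \<in> borel_measurable ((borel :: real measure) \<Otimes>\<^sub>M borel)"
      by (intro borel_measurable_times AA_joint_measurable) simp_all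
    from pairing_measurable[OF \<zeta>m this] show ?thesis unfolding LB_def by (intro borel_measurable_times) simp_all
  qed
  have mP: "(\<lambda>s. PP (\<eta> s) (AA s)) \<in> borel_measurable borel"
  proof -
    have "(\<lambda>k. complex_of_real (wt k)) \<in> borel_measurable borel"
      by (rule borel_measurable_continuous_onI) (intro continuous_intros wt_cont)
    from measurable_compose[OF measurable_snd this]
    have "(\<lambda>p. complex_of_real (wt (snd p)) * AA (fst p) (snd p)) \<in> borel_measurable ((borel :: real measure) \<Otimes>\<^sub>M borel)"
      by (intro borel_measurable_times AA_joint_measurable)
    from pairing_measurable[OF \<eta>m this] show ?thesis unfolding PP_def by (simp add: mult_ac)
  qed

  have t1: "(LINT y|lebesgue. (2 * \<phi> y 0 + \<alpha> * Lambda (\<lambda>y. \<phi> y 0) y) * f0 y) = 2 * PP (\<zeta> 0) A0"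
    unfolding \<zeta>_def by (rule evolution_pair[OF A0 f0 tft_fhat[OF \<phi>] tft_Tc(2)[OF \<phi>]])
  have t2: "(LINT s:{0<..<T}|lebesgue. LINT y|lebesgue. (2 * partial_t \<phi> y s + \<alpha> * Lambda (\<lambda>y. partial_t \<phi> y s) y) * ?f s y)
      = (LINT s|lborel. ?I s * (2 * PP (\<eta> s) (AA s)))"
  proof (rule set_lebesgue_integral_Ioo)
    show "(LINT y|lebesgue. (2 * partial_t \<phi> y s + \<alpha> * Lambda (\<lambda>y. partial_t \<phi> y s) y) * ?f s y) = 2 * PP (\<eta> s) (AA s)"
      if "s \<in> {0<..<T}" for s
      unfolding \<eta>_def by (rule evolution_pair[OF X(1)[OF that] fs[OF that] tft_fhat[OF \<phi>t] tft_Tc(2)[OF \<phi>t]])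
    show "(\<lambda>s. ?I s * (2 * PP (\<eta> s) (AA s))) \<in> borel_measurable borel" using mP by (intro Im borel_measurable_times) simp_all
  qed
  have t3: "(LINT s:{0<..<T}|lebesgue. LINT y|lebesgue. ?f s y * partial_x \<phi> y s + Hilbert (\<lambda>y. \<phi> y s) y * ?f s y)
      = (LINT s|lborel. ?I s * (- (2 * \<epsilon>) * LB (\<zeta> s) (AA s)))"
  proof (rule set_lebesgue_integral_Ioo)
    show "(LINT y|lebesgue. ?f s y * partial_x \<phi> y s + Hilbert (\<lambda>y. \<phi> y s) y * ?f s y) = - (2 * \<epsilon>) * LB (\<zeta> s) (AA s)"
      if "s \<in> {0<..<T}" for s
    proof -
      have "tft (partial_x \<phi>) s = (\<lambda>k. \<i> * complex_of_real k * tft \<phi> s k)" by (rule ext) (rule tft_partial_x[OF \<phi>])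
      with tft_fhat[OF \<phi>x, of s] have px: "fhat (\<lambda>y. partial_x \<phi> y s) (\<lambda>k. \<i> * complex_of_real k * tft \<phi> s k)" by argo
      show ?thesis unfolding LB_def \<zeta>_def linear_pair[OF X(1)[OF that] fs[OF that] tft_fhat[OF \<phi>] px]
        using eps by simp
    qed
    show "(\<lambda>s. ?I s * (- (2 * \<epsilon>) * LB (\<zeta> s) (AA s))) \<in> borel_measurable borel" using mL by (intro Im borel_measurable_times) simp_all
  qed
  have t4: "(LINT s:{0<..<T}|lebesgue. LINT y|lebesgue. (Hilbert (\<lambda>y. (Lambda (\<lambda>z. ?f s z) y)\<^sup>2) y
        - commutator Hilbert (\<lambda>y. ?f s y) (Lambda (\<lambda>y. ?f s y)) y) * \<phi> y s)
      = (LINT s|lborel. ?I s * (2 * NB (\<zeta> s) (AA s)))"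
  proof (rule set_lebesgue_integral_Ioo)
    show "(LINT y|lebesgue. (Hilbert (\<lambda>y. (Lambda (\<lambda>z. ?f s z) y)\<^sup>2) y
        - commutator Hilbert (\<lambda>y. ?f s y) (Lambda (\<lambda>y. ?f s y)) y) * \<phi> y s) = 2 * NB (\<zeta> s) (AA s)"
      if "s \<in> {0<..<T}" for s
      unfolding NB_def \<zeta>_def by (rule quadratic_pair[OF X(1)[OF that] fs[OF that] tft_fhat[OF \<phi>]])
    show "(\<lambda>s. ?I s * (2 * NB (\<zeta> s) (AA s))) \<in> borel_measurable borel" using mN by (intro Im borel_measurable_times) simp_all
  qed

  have iN: "integrable lborel (\<lambda>s. ?I s * NB (\<zeta> s) (AA s))"
  proof (rule integrable_Ioo[OF mN])
    fix s assume s: "s \<in> {0<..<T}"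
    have "\<bar>NB (\<zeta> s) (AA s)\<bar> \<le> 5 * (nX (AA s))\<^sup>2 * n1 (\<zeta> s)" by (rule NB_integrable(2)[OF \<zeta>T X(1)[OF s]])
    also have "\<dots> \<le> 5 * x\<^sup>2 * n1 (\<zeta> s)"
      using X(2)[OF s] by (intro mult_right_mono mult_left_mono power_mono) simp_all
    also have "\<dots> \<le> 5 * x\<^sup>2 * D" by (rule mult_left_mono[OF D(2)]) simp
    finally show "\<bar>NB (\<zeta> s) (AA s)\<bar> \<le> 5 * x\<^sup>2 * D" .
  qed
  have iB: "integrable lborel (\<lambda>s. ?I s * BB (\<zeta> s) (AA s))"
  proof (rule integrable_Ioo[OF mB])
    fix s assume s: "s \<in> {0<..<T}"
    have "\<bar>BB (\<zeta> s) (AA s)\<bar> \<le> n2 (\<zeta> s) * x / \<epsilon> + 5 * x\<^sup>2 * n1 (\<zeta> s)" by (rule BB_bound[OF \<zeta>T X[OF s]])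
    also have "\<dots> \<le> D * x / \<epsilon> + 5 * x\<^sup>2 * D"
      using x eps by (intro add_mono divide_right_mono mult_right_mono mult_left_mono D) auto
    finally show "\<bar>BB (\<zeta> s) (AA s)\<bar> \<le> D * x / \<epsilon> + 5 * x\<^sup>2 * D" .
  qed
  have "?I s * LB (\<zeta> s) (AA s) = ?I s * BB (\<zeta> s) (AA s) - ?I s * NB (\<zeta> s) (AA s)" for s
  proof (cases "s \<in> {0<..<T}")
    case True
    show ?thesis unfolding BB_split[OF \<zeta>T X(1)[OF True]] by (simp add: algebra_simps)
  qed simp
  then have L: "(LINT s|lborel. ?I s * LB (\<zeta> s) (AA s)) = (LINT s|lborel. ?I s * BB (\<zeta> s) (AA s)) - (LINT s|lborel. ?I s * NB (\<zeta> s) (AA s))"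
    using Bochner_Integration.integral_diff[OF iB iN] by presburger
  have c: "(LINT s|lborel. ?I s * (a * G s)) = a * (LINT s|lborel. ?I s * G s)" for a :: real and G
    unfolding mult.left_commute[of _ a] by (rule integral_mult_right_zero)
  have "- (1 / \<epsilon>) * (- (2 * \<epsilon>) * z) = 2 * z" for z :: real using eps by simp
  then show "- (LINT y|lebesgue. (2 * \<phi> y 0 + \<alpha> * Lambda (\<lambda>y. \<phi> y 0) y) * f0 y)
      - (LINT s:{0<..<T}|lebesgue. LINT y|lebesgue. (2 * partial_t \<phi> y s + \<alpha> * Lambda (\<lambda>y. partial_t \<phi> y s) y) * ?f s y)
      = - (1 / \<epsilon>) * (LINT s:{0<..<T}|lebesgue. LINT y|lebesgue. ?f s y * partial_x \<phi> y s + Hilbert (\<lambda>y. \<phi> y s) y * ?f s y)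
      + (LINT s:{0<..<T}|lebesgue. LINT y|lebesgue. (Hilbert (\<lambda>y. (Lambda (\<lambda>z. ?f s z) y)\<^sup>2) y
        - commutator Hilbert (\<lambda>y. ?f s y) (Lambda (\<lambda>y. ?f s y)) y) * \<phi> y s)"
    unfolding t1 t2 t3 t4 c L using ID by simp
qed

end

theorem theorem4:
  fixes \<epsilon> \<alpha>\<^sub>o \<beta> :: real and f0 :: "real \<Rightarrow> real"
  assumes "\<epsilon> > 0" and "\<alpha>\<^sub>o > 0" and "\<beta> = \<alpha>\<^sub>o"
    and "f0 \<in> sobolev (3/2)"
  shows "\<exists>T>0. \<exists>f :: real \<Rightarrow> real \<Rightarrow> real.
           (\<lambda>t x. f x t) \<in> Linfty_sobolev T (3/2) \<and>
           distributional_solution \<epsilon> \<alpha>\<^sub>o T f0 f"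
proof -
  interpret evol \<epsilon> \<alpha>\<^sub>o by unfold_locales (use assms in auto)
  have "f0 \<in> L2" using assms(4) by (simp add: sobolev_def)
  from fhat_ex[OF this] obtain F0 where F0: "fhat f0 F0" ..
  have s3: "sqi lborel (\<lambda>k. s3 k * F0 k)" using fhat_sobolev(1)[OF F0] assms(4) by simp
  \<comment> \<open>Restriction to positive frequencies does not increase the modulus, so the
    weighted square integrability of the transform passes to \<open>A0\<close>; the symmetry of
    \<open>F0\<close> lets \<open>herm\<close> recover it almost everywhere.\<close>
  define A0 where "A0 = half F0"
  have Am: "A0 \<in> borel_measurable borel" unfolding A0_def
    by (rule half_measurable) (use sqi_measurable[OF fhat_sqi[OF F0]] in simp)
  have "sqi lborel (\<lambda>k. s3 k * A0 k)"
  proof (rule sqi_bound[OF s3])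
    show "(\<lambda>k. s3 k * A0 k) \<in> borel_measurable lborel" using Am s3_measurable by (intro borel_measurable_times) simp_all
    show "AE k in lborel. cmod (s3 k * A0 k) \<le> cmod (s3 k * F0 k)" by (auto simp: A0_def half_def norm_mult)
  qed
  with Am have A0: "Xc A0" by (auto simp: Xc_def A0_def half_0)
  have "AE k in lborel. F0 k = herm A0 k"
    using herm_half[OF fhat_hermitian[OF F0]] unfolding A0_def by eventually_elim (rule sym)
  then have f0: "fhat f0 (herm A0)" by (rule fhat_cong_AE[OF F0 Xc_herm(2)[OF A0]])
  obtain T x C h r b where "evol_seq \<epsilon> \<alpha>\<^sub>o A0 T x C h r b" by (rule evol_seq_ex[OF A0])
  then interpret evol_seq \<epsilon> \<alpha>\<^sub>o A0 T x C h r b .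
  show ?thesis
    by (intro exI[of _ T] conjI T exI[of _ "\<lambda>y t. ift (herm (AA t)) y"] Linfty_ift weak_form[OF f0])
qed

end
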